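(* Let $R$ be a commutative Noetherian ring with non-zero identity, let $\mathcal{S}$ be a Serre subcategory of the category of $R$-modules, and let $\mathfrak{a}=(x_1,\dots,x_s)$ be an ideal of $R$. For an $R$-module $M$ the following conditions are equivalent: (i) $\operatorname{Ext}^i_R(R/\mathfrak{a},M)$ belongs to $\mathcal{S}$ for all $i$. (ii) $\operatorname{Tor}_i^R(R/\mathfrak{a},M)$ belongs to $\mathcal{S}$ for all $i$. (iii) The Koszul cohomology module $H^i(x_1,\dots,x_s;M)$ belongs to $\mathcal{S}$ for all $i$. (iv) The Koszul homology module $H_i(x_1,\dots,x_s;M)$ belongs to $\mathcal{S}$ for all $i$.
   Context: A Serre subcategory of the category of $R$-modules is a class of $R$-modules (as usual, nonempty and closed under isomorphism) that is closed under taking submodules, quotients and extensions. $H_i(x_1,\dots,x_s;M)$ and $H^i(x_1,\dots,x_s;M)$ are the homology of $K_\bullet\otimes_R M$ and the cohomology of $\operatorname{Hom}_R(K_\bullet,M)$, where $K_\bullet=K_\bullet(x_1,\dots,x_s)$ is the Koszul complex over $R$ on $x_1,\dots,x_s$. *)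

theory Defs
  imports "HOL-Algebra.Algebra"
begin

section \<open>Homomorphisms, quotients and Hom modules\<close>

text \<open>
  The record type of modules extends that of rings; the multiplicative fields carry no
  meaning for a module and are left undefined below.
\<close>

definition mod_hom ::
    "('a,'r) ring_scheme \<Rightarrow> ('a,'m) module \<Rightarrow> ('a,'n) module \<Rightarrow> ('m \<Rightarrow> 'n) set" where
  "mod_hom R M N = {f. f \<in> carrier M \<rightarrow> carrier N
     \<and> (\<forall>x\<in>carrier M. \<forall>y\<in>carrier M. f (x \<oplus>\<^bsub>M\<^esub> y) = f x \<oplus>\<^bsub>N\<^esub> f y)
     \<and> (\<forall>a\<in>carrier R. \<forall>x\<in>carrier M. f (a \<odot>\<^bsub>M\<^esub> x) = a \<odot>\<^bsub>N\<^esub> f x)}"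

definition mod_iso ::
    "('a,'r) ring_scheme \<Rightarrow> ('a,'m) module \<Rightarrow> ('a,'n) module \<Rightarrow> bool" where
  "mod_iso R M N \<longleftrightarrow> (\<exists>f\<in>mod_hom R M N. bij_betw f (carrier M) (carrier N))"

definition self_mod :: "('a,'r) ring_scheme \<Rightarrow> ('a,'a) module" where
  "self_mod R = \<lparr>carrier = carrier R, monoid.mult = undefined, one = undefined,
     ring.zero = \<zero>\<^bsub>R\<^esub>, ring.add = (\<oplus>\<^bsub>R\<^esub>), smult = (\<otimes>\<^bsub>R\<^esub>)\<rparr>"

definition quot_mod :: "('a,'m) module \<Rightarrow> 'm set \<Rightarrow> ('a,'m set) module" where
  "quot_mod M N = \<lparr>carrier = a_rcosets\<^bsub>M\<^esub> N, monoid.mult = undefined, one = undefined,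
     ring.zero = N, ring.add = (<+>\<^bsub>M\<^esub>),
     smult = (\<lambda>a C. \<Union>x\<in>C. N +>\<^bsub>M\<^esub> (a \<odot>\<^bsub>M\<^esub> x))\<rparr>"

text \<open>Functions are made extensional so that equal homomorphisms are equal elements.\<close>

definition hom_mod ::
    "('a,'r) ring_scheme \<Rightarrow> ('a,'p) module \<Rightarrow> ('a,'m) module \<Rightarrow> ('a,'p \<Rightarrow> 'm) module" where
  "hom_mod R P M = \<lparr>carrier = mod_hom R P M \<inter> extensional (carrier P),
     monoid.mult = undefined, one = undefined,
     ring.zero = (\<lambda>x\<in>carrier P. \<zero>\<^bsub>M\<^esub>),
     ring.add = (\<lambda>f g. \<lambda>x\<in>carrier P. f x \<oplus>\<^bsub>M\<^esub> g x),
     smult = (\<lambda>a f. \<lambda>x\<in>carrier P. a \<odot>\<^bsub>M\<^esub> f x)\<rparr>"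

section \<open>Free modules and tensor products\<close>

text \<open>The free module on a set \<open>B\<close>: finitely supported functions from \<open>B\<close> to \<open>R\<close>, extended by zero.\<close>

definition free_mod :: "('a,'r) ring_scheme \<Rightarrow> 'b set \<Rightarrow> ('a,'b \<Rightarrow> 'a) module" where
  "free_mod R B = \<lparr>carrier = {u. (\<forall>b\<in>B. u b \<in> carrier R) \<and> (\<forall>b. b \<notin> B \<longrightarrow> u b = \<zero>\<^bsub>R\<^esub>)
                              \<and> finite {b. u b \<noteq> \<zero>\<^bsub>R\<^esub>}},
     monoid.mult = undefined, one = undefined,
     ring.zero = (\<lambda>b. \<zero>\<^bsub>R\<^esub>),
     ring.add = (\<lambda>u v b. u b \<oplus>\<^bsub>R\<^esub> v b),
     smult = (\<lambda>a u b. a \<otimes>\<^bsub>R\<^esub> u b)\<rparr>"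

definition basis_vec :: "('a,'r) ring_scheme \<Rightarrow> 'b \<Rightarrow> 'b \<Rightarrow> 'a" where
  "basis_vec R b = (\<lambda>c. if c = b then \<one>\<^bsub>R\<^esub> else \<zero>\<^bsub>R\<^esub>)"

text \<open>The linear extension of a map \<open>g\<close> of bases, into the free module on \<open>B'\<close>.\<close>

definition free_map ::
    "('a,'r) ring_scheme \<Rightarrow> 'c set \<Rightarrow> ('b \<Rightarrow> 'c) \<Rightarrow> ('b \<Rightarrow> 'a) \<Rightarrow> 'c \<Rightarrow> 'a" where
  "free_map R B' g u = (\<lambda>c. if c \<in> B'
     then (\<Oplus>\<^bsub>R\<^esub>b\<in>{b. u b \<noteq> \<zero>\<^bsub>R\<^esub> \<and> g b = c}. u b) else \<zero>\<^bsub>R\<^esub>)"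

definition generated_submodule ::
    "('a,'r) ring_scheme \<Rightarrow> ('a,'m) module \<Rightarrow> 'm set \<Rightarrow> 'm set" where
  "generated_submodule R M A = \<Inter>{N. submodule N R M \<and> A \<subseteq> N}"

definition tensor_free ::
    "('a,'r) ring_scheme \<Rightarrow> ('a,'p) module \<Rightarrow> ('a,'m) module \<Rightarrow> ('a,'p \<times> 'm \<Rightarrow> 'a) module" where
  "tensor_free R P M = free_mod R (carrier P \<times> carrier M)"

definition tensor_relations ::
    "('a,'r) ring_scheme \<Rightarrow> ('a,'p) module \<Rightarrow> ('a,'m) module \<Rightarrow> ('p \<times> 'm \<Rightarrow> 'a) set" where
  "tensor_relations R P M =
     (let F = tensor_free R P M; e = (\<lambda>p m. basis_vec R (p, m)) in
       {e (p \<oplus>\<^bsub>P\<^esub> p') m \<ominus>\<^bsub>F\<^esub> (e p m \<oplus>\<^bsub>F\<^esub> e p' m) | p p' m.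
          p \<in> carrier P \<and> p' \<in> carrier P \<and> m \<in> carrier M} \<union>
       {e p (m \<oplus>\<^bsub>M\<^esub> m') \<ominus>\<^bsub>F\<^esub> (e p m \<oplus>\<^bsub>F\<^esub> e p m') | p m m'.
          p \<in> carrier P \<and> m \<in> carrier M \<and> m' \<in> carrier M} \<union>
       {e (a \<odot>\<^bsub>P\<^esub> p) m \<ominus>\<^bsub>F\<^esub> a \<odot>\<^bsub>F\<^esub> e p m | a p m.
          a \<in> carrier R \<and> p \<in> carrier P \<and> m \<in> carrier M} \<union>
       {e p (a \<odot>\<^bsub>M\<^esub> m) \<ominus>\<^bsub>F\<^esub> a \<odot>\<^bsub>F\<^esub> e p m | a p m.
          a \<in> carrier R \<and> p \<in> carrier P \<and> m \<in> carrier M})"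

definition tensor_null ::
    "('a,'r) ring_scheme \<Rightarrow> ('a,'p) module \<Rightarrow> ('a,'m) module \<Rightarrow> ('p \<times> 'm \<Rightarrow> 'a) set" where
  "tensor_null R P M = generated_submodule R (tensor_free R P M) (tensor_relations R P M)"

definition tensor_mod ::
    "('a,'r) ring_scheme \<Rightarrow> ('a,'p) module \<Rightarrow> ('a,'m) module \<Rightarrow> ('a,('p \<times> 'm \<Rightarrow> 'a) set) module" where
  "tensor_mod R P M = quot_mod (tensor_free R P M) (tensor_null R P M)"

text \<open>
  The map \<open>f \<otimes> id\<close> from \<open>P \<otimes> M\<close> to \<open>P' \<otimes> M\<close>, where \<open>f\<close> is a homomorphism into \<open>P'\<close>. All
  representatives \<open>u\<close> of a class \<open>C\<close> contribute the same coset to the union.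
\<close>

definition tensor_map ::
    "('a,'r) ring_scheme \<Rightarrow> ('a,'q) module \<Rightarrow> ('a,'m) module \<Rightarrow> ('p \<Rightarrow> 'q)
      \<Rightarrow> ('p \<times> 'm \<Rightarrow> 'a) set \<Rightarrow> ('q \<times> 'm \<Rightarrow> 'a) set" where
  "tensor_map R P' M f C =
     (\<Union>u\<in>C. tensor_null R P' M +>\<^bsub>tensor_free R P' M\<^esub>
        free_map R (carrier P' \<times> carrier M) (map_prod f id) u)"

section \<open>Homology of complexes\<close>

text \<open>
  A complex indexed by the natural numbers is given by its modules \<open>C n\<close> and differentials \<open>d n\<close>,
  where \<open>d n\<close> goes from \<open>C (Suc n)\<close> to \<open>C n\<close> for chain complexes and from \<open>C n\<close> to
  \<open>C (Suc n)\<close> for cochain complexes; the terms of negative degree are zero.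
\<close>

definition chain_homology ::
    "(nat \<Rightarrow> ('a,'c) module) \<Rightarrow> (nat \<Rightarrow> 'c \<Rightarrow> 'c) \<Rightarrow> nat \<Rightarrow> ('a,'c set) module" where
  "chain_homology C d i =
     quot_mod ((C i)\<lparr>carrier :=
         (case i of 0 \<Rightarrow> carrier (C 0) | Suc n \<Rightarrow> a_kernel (C (Suc n)) (C n) (d n))\<rparr>)
       (d i ` carrier (C (Suc i)))"

definition cochain_cohomology ::
    "(nat \<Rightarrow> ('a,'c) module) \<Rightarrow> (nat \<Rightarrow> 'c \<Rightarrow> 'c) \<Rightarrow> nat \<Rightarrow> ('a,'c set) module" where
  "cochain_cohomology C d i =
     quot_mod ((C i)\<lparr>carrier := a_kernel (C i) (C (Suc i)) (d i)\<rparr>)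
       (case i of 0 \<Rightarrow> {\<zero>\<^bsub>C 0\<^esub>} | Suc n \<Rightarrow> d n ` carrier (C n))"

text \<open>For a chain complex \<open>(C, d)\<close>, the homology of \<open>C \<otimes> M\<close> and the cohomology of \<open>Hom(C, M)\<close>.\<close>

definition tensor_homology ::
    "('a,'r) ring_scheme \<Rightarrow> (nat \<Rightarrow> ('a,'c) module) \<Rightarrow> (nat \<Rightarrow> 'c \<Rightarrow> 'c) \<Rightarrow> ('a,'m) module
      \<Rightarrow> nat \<Rightarrow> ('a,('c \<times> 'm \<Rightarrow> 'a) set set) module" where
  "tensor_homology R C d M =
     chain_homology (\<lambda>n. tensor_mod R (C n) M) (\<lambda>n. tensor_map R (C n) M (d n))"

definition hom_cohomology ::
    "('a,'r) ring_scheme \<Rightarrow> (nat \<Rightarrow> ('a,'c) module) \<Rightarrow> (nat \<Rightarrow> 'c \<Rightarrow> 'c) \<Rightarrow> ('a,'m) module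
      \<Rightarrow> nat \<Rightarrow> ('a,('c \<Rightarrow> 'm) set) module" where
  "hom_cohomology R C d M =
     cochain_cohomology (\<lambda>n. hom_mod R (C n) M)
       (\<lambda>n f. \<lambda>x\<in>carrier (C (Suc n)). f (d n x))"

section \<open>Ext and Tor\<close>

text \<open>
  A free resolution of \<open>N\<close>: the degree \<open>n\<close> term is the free module on \<open>B n\<close>, the differential
  \<open>d n\<close> goes from degree \<open>Suc n\<close> to degree \<open>n\<close>, and \<open>\<epsilon>\<close> is the augmentation onto \<open>N\<close>.
\<close>

definition is_free_resolution ::
    "('a,'r) ring_scheme \<Rightarrow> ('a,'n) module \<Rightarrow> (nat \<Rightarrow> 'b set) \<Rightarrow> (nat \<Rightarrow> ('b \<Rightarrow> 'a) \<Rightarrow> ('b \<Rightarrow> 'a))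
      \<Rightarrow> (('b \<Rightarrow> 'a) \<Rightarrow> 'n) \<Rightarrow> bool" where
  "is_free_resolution R N B d \<epsilon> \<longleftrightarrow>
     \<epsilon> \<in> mod_hom R (free_mod R (B 0)) N
   \<and> \<epsilon> ` carrier (free_mod R (B 0)) = carrier N
   \<and> (\<forall>n. d n \<in> mod_hom R (free_mod R (B (Suc n))) (free_mod R (B n)))
   \<and> d 0 ` carrier (free_mod R (B 1)) = a_kernel (free_mod R (B 0)) N \<epsilon>
   \<and> (\<forall>n. d (Suc n) ` carrier (free_mod R (B (Suc (Suc n))))
          = a_kernel (free_mod R (B (Suc n))) (free_mod R (B n)) (d n))"

text \<open>
  A chosen free resolution. Its bases are subsets of the type \<open>('a + 'n) list\<close>, which is infinite
  and has cardinality at least that of \<open>R\<close> and of \<open>N\<close>. This is large enough for every module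
  \<open>N\<close>: if a basis \<open>B n\<close> lies in this type, then the free module on it, hence also the kernel to be
  covered in the next step, has at most the cardinality of the type.
\<close>

definition free_resolution ::
    "('a,'r) ring_scheme \<Rightarrow> ('a,'n) module
      \<Rightarrow> (nat \<Rightarrow> ('a + 'n) list set)
         \<times> (nat \<Rightarrow> (('a + 'n) list \<Rightarrow> 'a) \<Rightarrow> (('a + 'n) list \<Rightarrow> 'a))" where
  "free_resolution R N = (SOME (B, d). \<exists>\<epsilon>. is_free_resolution R N B d \<epsilon>)"

definition Ext_mod ::
    "('a,'r) ring_scheme \<Rightarrow> nat \<Rightarrow> ('a,'n) module \<Rightarrow> ('a,'m) module
      \<Rightarrow> ('a,((('a + 'n) list \<Rightarrow> 'a) \<Rightarrow> 'm) set) module" where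
  "Ext_mod R i N M = (case free_resolution R N of
     (B, d) \<Rightarrow> hom_cohomology R (\<lambda>n. free_mod R (B n)) d M i)"

definition Tor_mod ::
    "('a,'r) ring_scheme \<Rightarrow> nat \<Rightarrow> ('a,'n) module \<Rightarrow> ('a,'m) module
      \<Rightarrow> ('a,((('a + 'n) list \<Rightarrow> 'a) \<times> 'm \<Rightarrow> 'a) set set) module" where
  "Tor_mod R i N M = (case free_resolution R N of
     (B, d) \<Rightarrow> tensor_homology R (\<lambda>n. free_mod R (B n)) d M i)"

section \<open>The Koszul complex\<close>

text \<open>
  For \<open>xs = [x\<^sub>0, \<dots>, x\<^bsub>s-1\<^esub>]\<close> the degree \<open>n\<close> term is the \<open>n\<close>-th exterior power of \<open>R\<^sup>s\<close>, free on the
  elements \<open>e\<^sub>I\<close> for the \<open>n\<close>-element subsets \<open>I\<close> of the index set. The differential sends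
  \<open>e\<^sub>I\<close>, for \<open>I = {i\<^sub>0 < \<dots> < i\<^sub>n}\<close>, to the sum over \<open>k\<close> of \<open>(-1)\<^sup>k x\<^bsub>i\<^sub>k\<^esub> e\<^bsub>I - {i\<^sub>k}\<^esub>\<close>.
  Below, this is expressed on coordinates: the coefficient at \<open>J\<close> of the image of \<open>u\<close> collects
  the contributions of all \<open>I = J \<union> {j}\<close>, where \<open>j\<close> has position \<open>card {i \<in> J. i < j}\<close> in \<open>I\<close>.
\<close>

definition koszul_basis :: "'a list \<Rightarrow> nat \<Rightarrow> nat set set" where
  "koszul_basis xs n = {I. I \<subseteq> {..<length xs} \<and> card I = n}"

definition koszul_mod :: "('a,'r) ring_scheme \<Rightarrow> 'a list \<Rightarrow> nat \<Rightarrow> ('a,nat set \<Rightarrow> 'a) module" where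
  "koszul_mod R xs n = free_mod R (koszul_basis xs n)"

definition koszul_diff ::
    "('a,'r) ring_scheme \<Rightarrow> 'a list \<Rightarrow> nat \<Rightarrow> (nat set \<Rightarrow> 'a) \<Rightarrow> (nat set \<Rightarrow> 'a)" where
  "koszul_diff R xs n u = (\<lambda>J. if J \<in> koszul_basis xs n
     then (\<Oplus>\<^bsub>R\<^esub>j\<in>{..<length xs} - J.
             (\<ominus>\<^bsub>R\<^esub> \<one>\<^bsub>R\<^esub>) [^]\<^bsub>R\<^esub> card {i \<in> J. i < j} \<otimes>\<^bsub>R\<^esub> (xs ! j) \<otimes>\<^bsub>R\<^esub> u (insert j J))
     else \<zero>\<^bsub>R\<^esub>)"

definition koszul_homology ::
    "('a,'r) ring_scheme \<Rightarrow> nat \<Rightarrow> 'a list \<Rightarrow> ('a,'m) module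
      \<Rightarrow> ('a,((nat set \<Rightarrow> 'a) \<times> 'm \<Rightarrow> 'a) set set) module" where
  "koszul_homology R i xs M = tensor_homology R (koszul_mod R xs) (koszul_diff R xs) M i"

definition koszul_cohomology ::
    "('a,'r) ring_scheme \<Rightarrow> nat \<Rightarrow> 'a list \<Rightarrow> ('a,'m) module
      \<Rightarrow> ('a,((nat set \<Rightarrow> 'a) \<Rightarrow> 'm) set) module" where
  "koszul_cohomology R i xs M = hom_cohomology R (koszul_mod R xs) (koszul_diff R xs) M i"

section \<open>Serre subcategories\<close>

text \<open>
  The category of \<open>R\<close>-modules is represented by the \<open>R\<close>-modules whose elements lie in a type \<open>'u\<close>
  (the universe). A module with elements in some other type belongs to a class of modules in
  \<open>'u\<close> if it is isomorphic to a member of it; for a class closed under isomorphism and a module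
  in \<open>'u\<close> this is just membership.

  For infinite \<open>'u\<close>, finite direct sums of modules in \<open>'u\<close> and their subquotients have
  isomorphic copies in \<open>'u\<close>; for finite \<open>'u\<close> this fails and the notion is not meaningful.
\<close>

definition belongs_to ::
    "('a,'r) ring_scheme \<Rightarrow> ('a,'m) module \<Rightarrow> ('a,'u) module set \<Rightarrow> bool" where
  "belongs_to R N S \<longleftrightarrow> (\<exists>L\<in>S. mod_iso R N L)"

definition serre_subcategory :: "('a,'r) ring_scheme \<Rightarrow> ('a,'u) module set \<Rightarrow> bool" where
  "serre_subcategory R S \<longleftrightarrow>
     S \<noteq> {} \<and> (\<forall>M\<in>S. module R M)
   \<and> (\<forall>M\<in>S. \<forall>L. module R L \<and> mod_iso R M L \<longrightarrow> L \<in> S)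
   \<and> (\<forall>M\<in>S. \<forall>N. submodule N R M \<longrightarrow> M\<lparr>carrier := N\<rparr> \<in> S)
   \<and> (\<forall>M\<in>S. \<forall>N. submodule N R M \<longrightarrow> belongs_to R (quot_mod M N) S)
   \<and> (\<forall>M N. module R M \<and> submodule N R M \<and> M\<lparr>carrier := N\<rparr> \<in> S
          \<and> belongs_to R (quot_mod M N) S \<longrightarrow> M \<in> S)"

end

theory Submission
  imports Defs
begin

text \<open>
  Let \<open>P\<close> be a complex of finite free modules with \<open>H\<^sub>0(P) = R / \<aa>\<close>, and write \<open>G\<^sub>i(N)\<close> for the homology
  of \<open>P \<otimes> N\<close>. Let \<open>C\<close> be a chain complex in degrees \<open>\<ge> 0\<close>, with cycles \<open>Z\<^sub>j\<close> and boundaries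
  \<open>B\<^sub>j\<close>, whose terms are finite powers of \<open>M\<close> and whose homology is killed by \<open>\<aa>\<close>. If all \<open>G\<^sub>i(M)\<close>
  belong to \<open>S\<close>, then so does all homology of \<open>C\<close>. Indeed, if all \<open>G\<^sub>i(Z\<^sub>j)\<close> belong to \<open>S\<close>, then so does
  \<open>H\<^sub>j(C)\<close>, as a quotient of \<open>Z\<^sub>j / \<aa> Z\<^sub>j = G\<^sub>0(Z\<^sub>j)\<close>. Hence so do all \<open>G\<^sub>i(H\<^sub>j(C))\<close>, and by the long exact
  sequences of \<open>B\<^sub>j \<rightarrow> Z\<^sub>j \<rightarrow> H\<^sub>j(C)\<close> and \<open>Z\<^sub>j\<^sub>+\<^sub>1 \<rightarrow> C\<^sub>j\<^sub>+\<^sub>1 \<rightarrow> B\<^sub>j\<close> all \<open>G\<^sub>i(B\<^sub>j)\<close> and \<open>G\<^sub>i(Z\<^sub>j\<^sub>+\<^sub>1)\<close>. The dual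
  argument applies to \<open>Hom(P, N)\<close> and cochain complexes.

  Taking for \<open>P\<close> and \<open>C\<close> the Koszul complex and a finite free resolution of \<open>R / \<aa>\<close>, in either order,
  compares (ii) with (iv) and (i) with (iii). Taking for \<open>C\<close> the dual of the Koszul complex, with the
  degrees reversed, compares (iii) with (iv). The homology of \<open>C\<close> is killed by \<open>\<aa>\<close> because the
  multiplications by the generators are null-homotopic. The resolution that defines Ext and Tor
  may have infinite rank, but it is homotopy equivalent to a finite one.

  All modules that occur are subquotients of finite powers of \<open>M\<close>, so they are represented by pairs of
  submodules.
\<close>

section \<open>Homomorphisms and quotients\<close>

text \<open>The class \<open>S\<close> lives in one type \<open>'u\<close>, while kernels, images,
  powers and tensor products have other types. Membership of \<open>U / V\<close> is therefore
  expressed by a surjection from \<open>U\<close> onto a member of \<open>S\<close> with kernel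
  \<open>V\<close>. Only closure under extensions forces the construction of a new module in
  \<open>'u\<close>; the infinity of \<open>'u\<close> makes room for it. Finite rank of
  \<open>P\<close> matters twice. Tensor product with \<open>N\<close> and Hom into \<open>N\<close>
  become finite powers of \<open>N\<close> with a matrix, or its transpose, as differential, so one
  calculus of matrices serves homology and cohomology. Moreover the homology of such powers is a
  subquotient of a finite power of \<open>N\<close>, which is why \<open>N\<close> in
  \<open>S\<close> puts every \<open>G_i(N)\<close> in \<open>S\<close>. The Noetherian hypothesis
  supplies a resolution of finite rank. The induction on \<open>j\<close> treats all
  \<open>G_i\<close> at once, because the connecting map from \<open>G_{i+1}(H_j)\<close> to
  \<open>G_i(B_j)\<close> asks for one degree more at every step. The roles differ: \<open>P\<close>
  must recover a module modulo the ideal in degree zero, while the homology of \<open>C\<close> must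
  be killed by the ideal; the reversed dual of the Koszul complex qualifies as
  \<open>C\<close>.\<close>

lemma mod_homI:
  assumes "\<And>x. x \<in> carrier M \<Longrightarrow> f x \<in> carrier N"
    and "\<And>x y. x \<in> carrier M \<Longrightarrow> y \<in> carrier M \<Longrightarrow> f (x \<oplus>\<^bsub>M\<^esub> y) = f x \<oplus>\<^bsub>N\<^esub> f y"
    and "\<And>a x. a \<in> carrier R \<Longrightarrow> x \<in> carrier M \<Longrightarrow> f (a \<odot>\<^bsub>M\<^esub> x) = a \<odot>\<^bsub>N\<^esub> f x"
  shows "f \<in> mod_hom R M N"
  using assms by (auto simp: mod_hom_def)

lemma mod_homD:
  assumes "f \<in> mod_hom R M N"
  shows "\<And>x. x \<in> carrier M \<Longrightarrow> f x \<in> carrier N"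
    and "\<And>x y. x \<in> carrier M \<Longrightarrow> y \<in> carrier M \<Longrightarrow> f (x \<oplus>\<^bsub>M\<^esub> y) = f x \<oplus>\<^bsub>N\<^esub> f y"
    and "\<And>a x. a \<in> carrier R \<Longrightarrow> x \<in> carrier M \<Longrightarrow> f (a \<odot>\<^bsub>M\<^esub> x) = a \<odot>\<^bsub>N\<^esub> f x"
  using assms by (auto simp: mod_hom_def)

lemma mod_hom_zero:
  assumes "module R M" "module R N" "f \<in> mod_hom R M N"
  shows "f \<zero>\<^bsub>M\<^esub> = \<zero>\<^bsub>N\<^esub>"
proof -
  interpret M: module R M by fact
  interpret N: module R N by fact
  have "f (\<zero>\<^bsub>R\<^esub> \<odot>\<^bsub>M\<^esub> \<zero>\<^bsub>M\<^esub>) = \<zero>\<^bsub>R\<^esub> \<odot>\<^bsub>N\<^esub> f \<zero>\<^bsub>M\<^esub>"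
    using mod_homD(3)[OF assms(3)] by blast
  then show ?thesis using mod_homD(1)[OF assms(3)] by simp
qed

lemma mod_hom_neg:
  assumes "module R M" "module R N" "f \<in> mod_hom R M N" "x \<in> carrier M"
  shows "f (\<ominus>\<^bsub>M\<^esub> x) = \<ominus>\<^bsub>N\<^esub> f x"
proof -
  interpret M: module R M by fact
  interpret N: module R N by fact
  have "f (\<ominus>\<^bsub>M\<^esub> x) \<oplus>\<^bsub>N\<^esub> f x = f (\<ominus>\<^bsub>M\<^esub> x \<oplus>\<^bsub>M\<^esub> x)"
    using assms mod_homD(2)[OF assms(3), of "\<ominus>\<^bsub>M\<^esub> x" x] by simp
  then have "f (\<ominus>\<^bsub>M\<^esub> x) \<oplus>\<^bsub>N\<^esub> f x = \<zero>\<^bsub>N\<^esub>"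
    using assms mod_hom_zero[OF assms(1-3)] by (simp add: M.l_neg)
  then show ?thesis using mod_homD(1)[OF assms(3)] assms
    by (simp add: N.minus_equality)
qed

lemma mod_hom_minus:
  assumes "module R M" "module R N" "f \<in> mod_hom R M N" "x \<in> carrier M" "y \<in> carrier M"
  shows "f (x \<ominus>\<^bsub>M\<^esub> y) = f x \<ominus>\<^bsub>N\<^esub> f y"
proof -
  interpret M: module R M by fact
  show ?thesis using assms
    by (simp add: a_minus_def mod_homD(2)[OF assms(3)] mod_hom_neg)
qed

lemma mod_hom_comp:
  assumes "f \<in> mod_hom R M N" "g \<in> mod_hom R N P"
  shows "(\<lambda>x. g (f x)) \<in> mod_hom R M P"
  using assms by (auto simp: mod_hom_def Pi_iff)

lemma mod_hom_restrict:
  assumes "f \<in> mod_hom R M N" "U \<subseteq> carrier M" "\<And>x. x \<in> U \<Longrightarrow> f x \<in> U'"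
  shows "f \<in> mod_hom R (M\<lparr>carrier := U\<rparr>) (N\<lparr>carrier := U'\<rparr>)"
proof -
  have U: "x \<in> carrier M" if "x \<in> U" for x using assms(2) that by blast
  show ?thesis by (rule mod_homI) (simp_all add: U assms(3) mod_homD[OF assms(1)])
qed

lemma (in module) minus_zero_iff:
  "x \<in> carrier M \<Longrightarrow> y \<in> carrier M \<Longrightarrow> x \<ominus>\<^bsub>M\<^esub> y = \<zero>\<^bsub>M\<^esub> \<longleftrightarrow> x = y"
  by (metis M.add.inv_solve_right M.l_zero M.zero_closed a_minus_def)

lemma (in module) minus_r_zero: "x \<in> carrier M \<Longrightarrow> x \<ominus>\<^bsub>M\<^esub> \<zero>\<^bsub>M\<^esub> = x"
  by (simp add: a_minus_def)

lemma (in module) submodule_zero: "submodule N R M \<Longrightarrow> \<zero>\<^bsub>M\<^esub> \<in> N"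
  using subgroup.one_closed[OF submodule.axioms(1)] by fastforce

lemma (in module) submodule_minus:
  "submodule N R M \<Longrightarrow> x \<in> N \<Longrightarrow> y \<in> N \<Longrightarrow> x \<ominus>\<^bsub>M\<^esub> y \<in> N"
  by (simp add: a_minus_def submoduleE)

lemma (in module) submodule_Int:
  "submodule N R M \<Longrightarrow> submodule N' R M \<Longrightarrow> submodule (N \<inter> N') R M"
  by (rule submoduleI) (auto simp: submodule_zero submoduleE dest: submoduleE(1))

text \<open>Negatives are multiples by \<open>\<ominus> \<one>\<close>, so closure under scalars
  provides them.\<close>

lemma (in module) submoduleI':
  assumes "H \<subseteq> carrier M" "\<zero>\<^bsub>M\<^esub> \<in> H"
    and "\<And>a b. a \<in> H \<Longrightarrow> b \<in> H \<Longrightarrow> a \<oplus>\<^bsub>M\<^esub> b \<in> H"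
    and "\<And>a x. a \<in> carrier R \<Longrightarrow> x \<in> H \<Longrightarrow> a \<odot>\<^bsub>M\<^esub> x \<in> H"
  shows "submodule H R M"
proof (rule submoduleI)
  fix x assume x: "x \<in> H"
  then have "\<ominus>\<^bsub>M\<^esub> x = (\<ominus>\<^bsub>R\<^esub> \<one>\<^bsub>R\<^esub>) \<odot>\<^bsub>M\<^esub> x"
    using assms(1) by (subst smult_l_minus) auto
  then show "\<ominus>\<^bsub>M\<^esub> x \<in> H" using assms(4) x by simp
qed (use assms in auto)

lemma (in module) submodule_trivial: "submodule {\<zero>\<^bsub>M\<^esub>} R M"
  by (rule submoduleI') auto

lemma module_restrict: "module R M \<Longrightarrow> submodule U R M \<Longrightarrow> module R (M\<lparr>carrier := U\<rparr>)"
  by (rule submodule.submodule_is_module)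

lemma submodule_restrict:
  assumes M: "module R M" and U: "submodule U R M" and V: "submodule V R M" "V \<subseteq> U"
  shows "submodule V R (M\<lparr>carrier := U\<rparr>)"
proof -
  interpret M: module R M by fact
  interpret MU: module R "M\<lparr>carrier := U\<rparr>" by (rule module_restrict[OF M U])
  show ?thesis
    by (rule MU.submoduleI') (use V M.submodule_zero M.submoduleE[OF V(1)] in auto)
qed

lemma submodule_vimage:
  assumes M: "module R M" and N: "module R N" and f: "f \<in> mod_hom R M N"
    and U: "submodule U R M" and V: "submodule V R N"
  shows "submodule {u \<in> U. f u \<in> V} R M"
proof -
  interpret M: module R M by fact
  interpret N: module R N by fact
  note U' = M.submoduleE[OF U] and V' = N.submoduleE[OF V]
  show ?thesis
    by (rule M.submoduleI')
      (use U' V' M.submodule_zero[OF U] N.submodule_zero[OF V] mod_hom_zero[OF M N f]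
         mod_homD[OF f] subsetD[OF U'(1)] in auto)
qed

lemma submodule_image:
  assumes M: "module R M" and N: "module R N" and f: "f \<in> mod_hom R M N"
    and U: "submodule U R M"
  shows "submodule (f ` U) R N"
proof -
  interpret M: module R M by fact
  interpret N: module R N by fact
  note U' = M.submoduleE[OF U]
  show ?thesis
  proof (rule N.submoduleI')
    show "\<zero>\<^bsub>N\<^esub> \<in> f ` U"
      using mod_hom_zero[OF M N f, symmetric] M.submodule_zero[OF U] by (rule image_eqI)
    show "a \<oplus>\<^bsub>N\<^esub> b \<in> f ` U" if "a \<in> f ` U" "b \<in> f ` U" for a b
    proof -
      from that obtain u v where u: "u \<in> U" "v \<in> U" "a = f u" "b = f v" by auto
      then have "a \<oplus>\<^bsub>N\<^esub> b = f (u \<oplus>\<^bsub>M\<^esub> v)" using mod_homD(2)[OF f] subsetD[OF U'(1)] by simp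
      then show ?thesis using u U'(5) by blast
    qed
    show "a \<odot>\<^bsub>N\<^esub> b \<in> f ` U" if "a \<in> carrier R" "b \<in> f ` U" for a b
    proof -
      from that obtain u where u: "u \<in> U" "b = f u" by auto
      then have "a \<odot>\<^bsub>N\<^esub> b = f (a \<odot>\<^bsub>M\<^esub> u)" using that mod_homD(3)[OF f] subsetD[OF U'(1)] by simp
      then show ?thesis using u that U'(4) by blast
    qed
  qed (use U'(1) mod_homD(1)[OF f] in auto)
qed

text \<open>\<open>Q\<close> is only known as a set with operations; every axiom is the image under
  \<open>h\<close> of the same axiom in \<open>M\<close>. Sets of cosets, and copies of quotients in
  other types, become modules in this way.\<close>

lemma module_image:
  assumes M: "module R M" and onto: "h ` carrier M = carrier Q"
    and add: "\<And>x y. x \<in> carrier M \<Longrightarrow> y \<in> carrier M \<Longrightarrow> h (x \<oplus>\<^bsub>M\<^esub> y) = h x \<oplus>\<^bsub>Q\<^esub> h y"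
    and smult: "\<And>a x. a \<in> carrier R \<Longrightarrow> x \<in> carrier M \<Longrightarrow> h (a \<odot>\<^bsub>M\<^esub> x) = a \<odot>\<^bsub>Q\<^esub> h x"
    and zero: "h \<zero>\<^bsub>M\<^esub> = \<zero>\<^bsub>Q\<^esub>"
  shows "module R Q"
proof -
  interpret M: module R M by fact
  have [simp]: "h x \<in> carrier Q" if "x \<in> carrier M" for x using onto that by auto
  have ex: "\<exists>x\<in>carrier M. q = h x" if "q \<in> carrier Q" for q using onto that by blast
  note simps = add[symmetric] smult[symmetric] zero[symmetric]
  have "abelian_group Q"
  proof (rule abelian_groupI)
    fix x y z assume "x \<in> carrier Q" "y \<in> carrier Q" "z \<in> carrier Q"
    then obtain x' y' z' where *: "x = h x'" "y = h y'" "z = h z'"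
      "x' \<in> carrier M" "y' \<in> carrier M" "z' \<in> carrier M" using ex by metis
    show "x \<oplus>\<^bsub>Q\<^esub> y \<oplus>\<^bsub>Q\<^esub> z = x \<oplus>\<^bsub>Q\<^esub> (y \<oplus>\<^bsub>Q\<^esub> z)"
      using * by (simp add: M.a_assoc simps)
  next
    fix x y assume "x \<in> carrier Q" "y \<in> carrier Q"
    then obtain x' y' where *: "x = h x'" "y = h y'" "x' \<in> carrier M" "y' \<in> carrier M" using ex by metis
    show "x \<oplus>\<^bsub>Q\<^esub> y \<in> carrier Q" using * by (simp add: simps)
    show "x \<oplus>\<^bsub>Q\<^esub> y = y \<oplus>\<^bsub>Q\<^esub> x" using * by (simp add: M.a_comm simps)
  next
    fix x assume "x \<in> carrier Q"
    then obtain x' where *: "x = h x'" "x' \<in> carrier M" using ex by metis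
    have "\<zero>\<^bsub>Q\<^esub> \<oplus>\<^bsub>Q\<^esub> x = h (\<zero>\<^bsub>M\<^esub> \<oplus>\<^bsub>M\<^esub> x')"
      using * zero add[of "\<zero>\<^bsub>M\<^esub>" x'] by (simp del: M.l_zero)
    then show "\<zero>\<^bsub>Q\<^esub> \<oplus>\<^bsub>Q\<^esub> x = x" using * by simp
    show "\<exists>y\<in>carrier Q. y \<oplus>\<^bsub>Q\<^esub> x = \<zero>\<^bsub>Q\<^esub>"
      by (rule bexI[of _ "h (\<ominus>\<^bsub>M\<^esub> x')"]) (use * in \<open>simp_all add: M.l_neg simps\<close>)
  qed (simp add: zero[symmetric])
  then show ?thesis
  proof (rule moduleI[OF M.R.cring_axioms])
    fix a b x y assume "a \<in> carrier R" "b \<in> carrier R" and xy: "x \<in> carrier Q" "y \<in> carrier Q"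
    moreover obtain x' y' where "x = h x'" "y = h y'" "x' \<in> carrier M" "y' \<in> carrier M" using ex xy by metis
    ultimately show "(a \<oplus>\<^bsub>R\<^esub> b) \<odot>\<^bsub>Q\<^esub> x = a \<odot>\<^bsub>Q\<^esub> x \<oplus>\<^bsub>Q\<^esub> b \<odot>\<^bsub>Q\<^esub> x"
      "a \<odot>\<^bsub>Q\<^esub> (x \<oplus>\<^bsub>Q\<^esub> y) = a \<odot>\<^bsub>Q\<^esub> x \<oplus>\<^bsub>Q\<^esub> a \<odot>\<^bsub>Q\<^esub> y" "a \<otimes>\<^bsub>R\<^esub> b \<odot>\<^bsub>Q\<^esub> x = a \<odot>\<^bsub>Q\<^esub> (b \<odot>\<^bsub>Q\<^esub> x)"
      by (simp_all add: M.smult_l_distr M.smult_r_distr M.smult_assoc1 simps)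
  next
    fix a x assume "a \<in> carrier R" "x \<in> carrier Q"
    then show "a \<odot>\<^bsub>Q\<^esub> x \<in> carrier Q" using ex[of x] by (auto simp: simps)
  next
    fix x assume "x \<in> carrier Q"
    then show "\<one>\<^bsub>R\<^esub> \<odot>\<^bsub>Q\<^esub> x = x" using ex[of x] by (auto simp: simps)
  qed
qed

lemma quot_mod_simps:
  "carrier (quot_mod M N) = a_rcosets\<^bsub>M\<^esub> N" "\<zero>\<^bsub>quot_mod M N\<^esub> = N"
  "x \<oplus>\<^bsub>quot_mod M N\<^esub> y = x <+>\<^bsub>M\<^esub> y"
  "a \<odot>\<^bsub>quot_mod M N\<^esub> C = (\<Union>x\<in>C. N +>\<^bsub>M\<^esub> (a \<odot>\<^bsub>M\<^esub> x))"
  by (simp_all add: quot_mod_def)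

lemma quot_mod_facts:
  assumes M: "module R M" and N: "submodule N R M"
  shows quot_carrier: "carrier (quot_mod M N) = (\<lambda>x. N +>\<^bsub>M\<^esub> x) ` carrier M"
    and coset_eq_iff: "\<And>x y. x \<in> carrier M \<Longrightarrow> y \<in> carrier M \<Longrightarrow>
      N +>\<^bsub>M\<^esub> x = N +>\<^bsub>M\<^esub> y \<longleftrightarrow> x \<ominus>\<^bsub>M\<^esub> y \<in> N"
    and coset_hom: "(\<lambda>x. N +>\<^bsub>M\<^esub> x) \<in> mod_hom R M (quot_mod M N)"
    and quot_module: "module R (quot_mod M N)"
    and coset_self: "\<And>x. x \<in> carrier M \<Longrightarrow> x \<in> N +>\<^bsub>M\<^esub> x"
    and coset_zero: "N +>\<^bsub>M\<^esub> \<zero>\<^bsub>M\<^esub> = N"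
    and coset_mem: "\<And>x y. x \<in> carrier M \<Longrightarrow> y \<in> N +>\<^bsub>M\<^esub> x \<Longrightarrow> y \<in> carrier M \<and> N +>\<^bsub>M\<^esub> y = N +>\<^bsub>M\<^esub> x"
proof -
  interpret M: module R M by fact
  have "additive_subgroup N M" using submodule.axioms(1)[OF N] by (rule additive_subgroup.intro)
  then interpret N: abelian_subgroup N M by (rule abelian_subgroupI3) (rule M.abelian_group_axioms)
  note N' = M.submoduleE[OF N]
  show car: "carrier (quot_mod M N) = (\<lambda>x. N +>\<^bsub>M\<^esub> x) ` carrier M"
    by (auto simp: quot_mod_simps A_RCOSETS_def')
  show eq: "N +>\<^bsub>M\<^esub> x = N +>\<^bsub>M\<^esub> y \<longleftrightarrow> x \<ominus>\<^bsub>M\<^esub> y \<in> N"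
    if "x \<in> carrier M" "y \<in> carrier M" for x y
    using that N.a_rcos_module N.a_rcos_self N.a_repr_independence'
    by (metis a_minus_def)
  show self: "x \<in> N +>\<^bsub>M\<^esub> x" if "x \<in> carrier M" for x
    using that by (rule N.a_rcos_self)
  show mem: "y \<in> carrier M \<and> N +>\<^bsub>M\<^esub> y = N +>\<^bsub>M\<^esub> x" if "x \<in> carrier M" "y \<in> N +>\<^bsub>M\<^esub> x" for x y
    using that by (metis N.a_elemrcos_carrier N.a_repr_independence')
  show z: "N +>\<^bsub>M\<^esub> \<zero>\<^bsub>M\<^esub> = N"
    using N'(1) by (rule M.a_coset_add_zero)
  have add: "N +>\<^bsub>M\<^esub> (x \<oplus>\<^bsub>M\<^esub> y) = (N +>\<^bsub>M\<^esub> x) \<oplus>\<^bsub>quot_mod M N\<^esub> (N +>\<^bsub>M\<^esub> y)"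
    if "x \<in> carrier M" "y \<in> carrier M" for x y
    using that by (simp add: quot_mod_simps N.a_rcos_sum)
  have sm: "N +>\<^bsub>M\<^esub> (a \<odot>\<^bsub>M\<^esub> x) = a \<odot>\<^bsub>quot_mod M N\<^esub> (N +>\<^bsub>M\<^esub> x)"
    if "a \<in> carrier R" "x \<in> carrier M" for a x
  proof -
    \<comment> \<open>The scalar multiple of a coset is defined as a union over its representatives.
      The union collapses because all representatives contribute the same coset.\<close>
    have "N +>\<^bsub>M\<^esub> (a \<odot>\<^bsub>M\<^esub> y) = N +>\<^bsub>M\<^esub> (a \<odot>\<^bsub>M\<^esub> x)" if y: "y \<in> N +>\<^bsub>M\<^esub> x" for y
    proof -
      have "y \<ominus>\<^bsub>M\<^esub> x \<in> N" "y \<in> carrier M" using mem[OF \<open>x \<in> carrier M\<close> y] eq \<open>x \<in> carrier M\<close> by auto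
      then have "a \<odot>\<^bsub>M\<^esub> (y \<ominus>\<^bsub>M\<^esub> x) \<in> N" using N'(4) \<open>a \<in> carrier R\<close> by blast
      then have "a \<odot>\<^bsub>M\<^esub> y \<ominus>\<^bsub>M\<^esub> a \<odot>\<^bsub>M\<^esub> x \<in> N"
        using \<open>y \<in> carrier M\<close> \<open>a \<in> carrier R\<close> \<open>x \<in> carrier M\<close>
        by (simp add: a_minus_def M.smult_r_distr M.smult_r_minus)
      then show ?thesis using eq \<open>y \<in> carrier M\<close> \<open>a \<in> carrier R\<close> \<open>x \<in> carrier M\<close> by simp
    qed
    moreover have "x \<in> N +>\<^bsub>M\<^esub> x" by (rule self) fact
    ultimately show ?thesis unfolding quot_mod_simps by blast
  qed
  show "(\<lambda>x. N +>\<^bsub>M\<^esub> x) \<in> mod_hom R M (quot_mod M N)"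
    by (rule mod_homI) (use add sm car in auto)
  show "module R (quot_mod M N)"
    by (rule module_image[OF M car[symmetric] add sm]) (simp_all add: z quot_mod_simps)
qed

text \<open>The first isomorphism theorem in a symmetric form: \<open>f\<close> and \<open>g\<close>
  identify the same pairs of elements, so \<open>g\<close> composed with any section of
  \<open>f\<close> is independent of the section and inherits its linearity from
  \<open>g\<close>.\<close>

lemma hom_onto_iso:
  assumes M: "module R M" and L: "module R L" and L': "module R L'"
    and f: "f \<in> mod_hom R M L" "f ` carrier M = carrier L"
    and g: "g \<in> mod_hom R M L'" "g ` carrier M = carrier L'"
    and ker: "\<And>x. x \<in> carrier M \<Longrightarrow> f x = \<zero>\<^bsub>L\<^esub> \<longleftrightarrow> g x = \<zero>\<^bsub>L'\<^esub>"
  shows "mod_iso R L L'"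
proof -
  interpret M: module R M by fact
  interpret L: module R L by fact
  interpret L': module R L' by fact
  have eq: "f x = f y \<longleftrightarrow> g x = g y" if "x \<in> carrier M" "y \<in> carrier M" for x y
  proof -
    have "f x = f y \<longleftrightarrow> f (x \<ominus>\<^bsub>M\<^esub> y) = \<zero>\<^bsub>L\<^esub>"
      using that by (simp add: mod_hom_minus[OF M L f(1)] L.minus_zero_iff mod_homD(1)[OF f(1)])
    moreover have "g x = g y \<longleftrightarrow> g (x \<ominus>\<^bsub>M\<^esub> y) = \<zero>\<^bsub>L'\<^esub>"
      using that by (simp add: mod_hom_minus[OF M L' g(1)] L'.minus_zero_iff mod_homD(1)[OF g(1)])
    ultimately show ?thesis using ker that by simp
  qed
  define s where "s = inv_into (carrier M) f"
  have s: "s l \<in> carrier M" "f (s l) = l" if "l \<in> carrier L" for l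
    using that f(2) by (auto simp: s_def inv_into_into f_inv_into_f)
  have gs: "g (s (f x)) = g x" if "x \<in> carrier M" for x
    using eq s that mod_homD(1)[OF f(1)] by metis
  have "(\<lambda>l. g (s l)) \<in> mod_hom R L L'"
  proof (rule mod_homI)
    fix x y assume "x \<in> carrier L" "y \<in> carrier L"
    then have "g (s (x \<oplus>\<^bsub>L\<^esub> y)) = g (s x \<oplus>\<^bsub>M\<^esub> s y)"
      by (subst eq[symmetric]) (simp_all add: s mod_homD(2)[OF f(1)])
    then show "g (s (x \<oplus>\<^bsub>L\<^esub> y)) = g (s x) \<oplus>\<^bsub>L'\<^esub> g (s y)"
      using s \<open>x \<in> carrier L\<close> \<open>y \<in> carrier L\<close> mod_homD(2)[OF g(1)] by simp
  next
    fix a x assume "a \<in> carrier R" "x \<in> carrier L"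
    then have "g (s (a \<odot>\<^bsub>L\<^esub> x)) = g (a \<odot>\<^bsub>M\<^esub> s x)"
      by (subst eq[symmetric]) (simp_all add: s mod_homD(3)[OF f(1)])
    then show "g (s (a \<odot>\<^bsub>L\<^esub> x)) = a \<odot>\<^bsub>L'\<^esub> g (s x)"
      using s \<open>x \<in> carrier L\<close> \<open>a \<in> carrier R\<close> mod_homD(3)[OF g(1)] by simp
  qed (use s mod_homD(1)[OF g(1)] in auto)
  moreover have "bij_betw (\<lambda>l. g (s l)) (carrier L) (carrier L')"
  proof (rule bij_betw_imageI)
    show "inj_on (\<lambda>l. g (s l)) (carrier L)"
    proof (rule inj_onI)
      fix x y assume *: "x \<in> carrier L" "y \<in> carrier L" "g (s x) = g (s y)"
      then have "f (s x) = f (s y)" using eq[of "s x" "s y"] s(1) by simp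
      then show "x = y" using * s(2) by simp
    qed
    show "(\<lambda>l. g (s l)) ` carrier L = carrier L'"
    proof
      show "carrier L' \<subseteq> (\<lambda>l. g (s l)) ` carrier L"
      proof
        fix y assume "y \<in> carrier L'"
        then obtain x where "x \<in> carrier M" "y = g x" using g(2) by blast
        then have "y = g (s (f x))" "f x \<in> carrier L" using gs mod_homD(1)[OF f(1)] by auto
        then show "y \<in> (\<lambda>l. g (s l)) ` carrier L" by blast
      qed
    qed (use s mod_homD(1)[OF g(1)] in auto)
  qed
  ultimately show ?thesis by (auto simp: mod_iso_def)
qed

text \<open>Any map \<open>h\<close> whose fibres are the cosets of \<open>V\<close> carries the
  operations of \<open>M / V\<close> over to its range. The quotient is thus realised in every type
  that has room for such a map.\<close>

lemma transport_quotient: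
  fixes h :: "'m \<Rightarrow> 'u" and M :: "('a,'m) module"
  assumes M: "module R M" and V: "submodule V R M"
    and h: "\<And>x y. x \<in> carrier M \<Longrightarrow> y \<in> carrier M \<Longrightarrow> h x = h y \<longleftrightarrow> x \<ominus>\<^bsub>M\<^esub> y \<in> V"
  shows "\<exists>L :: ('a,'u) module. module R L \<and> h \<in> mod_hom R M L \<and> h ` carrier M = carrier L
    \<and> (\<forall>x\<in>carrier M. h x = \<zero>\<^bsub>L\<^esub> \<longleftrightarrow> x \<in> V)"
proof -
  interpret M: module R M by fact
  note cos = coset_eq_iff[OF M V]
  define s where "s = inv_into (carrier M) h"
  have s: "s (h x) \<in> carrier M" "h (s (h x)) = h x" if "x \<in> carrier M" for x
    using that by (auto simp: s_def inv_into_into f_inv_into_f)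
  define L :: "('a,'u) module" where "L = \<lparr>carrier = h ` carrier M, monoid.mult = undefined, one = undefined,
     ring.zero = h \<zero>\<^bsub>M\<^esub>, ring.add = (\<lambda>x y. h (s x \<oplus>\<^bsub>M\<^esub> s y)), smult = (\<lambda>a x. h (a \<odot>\<^bsub>M\<^esub> s x))\<rparr>"
  have hc: "h x = h y \<longleftrightarrow> V +>\<^bsub>M\<^esub> x = V +>\<^bsub>M\<^esub> y" if "x \<in> carrier M" "y \<in> carrier M" for x y
    using h cos that by simp
  note ch = mod_homD[OF coset_hom[OF M V]]
  have cs: "V +>\<^bsub>M\<^esub> s (h x) = V +>\<^bsub>M\<^esub> x" if "x \<in> carrier M" for x
    using hc s that by metis
  have add: "h (x \<oplus>\<^bsub>M\<^esub> y) = h x \<oplus>\<^bsub>L\<^esub> h y" if "x \<in> carrier M" "y \<in> carrier M" for x y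
  proof -
    have "h (x \<oplus>\<^bsub>M\<^esub> y) = h (s (h x) \<oplus>\<^bsub>M\<^esub> s (h y))"
      using that s by (simp add: hc ch(2) cs)
    then show ?thesis by (simp add: L_def)
  qed
  have sm: "h (a \<odot>\<^bsub>M\<^esub> x) = a \<odot>\<^bsub>L\<^esub> h x" if "a \<in> carrier R" "x \<in> carrier M" for a x
  proof -
    have "h (a \<odot>\<^bsub>M\<^esub> x) = h (a \<odot>\<^bsub>M\<^esub> s (h x))"
      using that s by (simp add: hc ch(3) cs)
    then show ?thesis by (simp add: L_def)
  qed
  have car: "h ` carrier M = carrier L" and z: "h \<zero>\<^bsub>M\<^esub> = \<zero>\<^bsub>L\<^esub>" by (simp_all add: L_def)
  have "module R L" by (rule module_image[OF M car add sm z])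
  moreover have "h \<in> mod_hom R M L" using add sm car by (auto intro!: mod_homI)
  moreover have "\<forall>x\<in>carrier M. h x = \<zero>\<^bsub>L\<^esub> \<longleftrightarrow> x \<in> V"
    using h[of _ "\<zero>\<^bsub>M\<^esub>"] z by (simp add: M.minus_r_zero)
  ultimately show ?thesis using car by blast
qed


lemma (in module) minus_as_smult:
  "x \<in> carrier M \<Longrightarrow> y \<in> carrier M \<Longrightarrow> x \<ominus>\<^bsub>M\<^esub> y = x \<oplus>\<^bsub>M\<^esub> (\<ominus>\<^bsub>R\<^esub> \<one>\<^bsub>R\<^esub>) \<odot>\<^bsub>M\<^esub> y"
  by (simp add: a_minus_def smult_l_minus)

lemma (in module) minus_self: "x \<in> carrier M \<Longrightarrow> x \<ominus>\<^bsub>M\<^esub> x = \<zero>\<^bsub>M\<^esub>"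
  by (simp add: minus_zero_iff)

lemma (in module) add_minus_cancel:
  "x \<in> carrier M \<Longrightarrow> y \<in> carrier M \<Longrightarrow> (x \<ominus>\<^bsub>M\<^esub> y) \<oplus>\<^bsub>M\<^esub> y = x"
  by (simp add: a_minus_def M.a_assoc M.l_neg)

lemma (in module) minus_add_cancel:
  "x \<in> carrier M \<Longrightarrow> y \<in> carrier M \<Longrightarrow> (x \<oplus>\<^bsub>M\<^esub> y) \<ominus>\<^bsub>M\<^esub> y = x"
  by (simp add: a_minus_def M.a_assoc M.r_neg)

lemma (in module) minus_minus_swap:
  assumes "x \<in> carrier M" "y \<in> carrier M" "z \<in> carrier M" "w \<in> carrier M"
  shows "(x \<oplus>\<^bsub>M\<^esub> y) \<ominus>\<^bsub>M\<^esub> (z \<oplus>\<^bsub>M\<^esub> w) = (x \<ominus>\<^bsub>M\<^esub> z) \<oplus>\<^bsub>M\<^esub> (y \<ominus>\<^bsub>M\<^esub> w)"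
  using assms by (simp add: a_minus_def M.minus_add M.a_assoc M.a_lcomm)

lemma (in module) smult_minus:
  assumes "a \<in> carrier R" "x \<in> carrier M" "y \<in> carrier M"
  shows "a \<odot>\<^bsub>M\<^esub> (x \<ominus>\<^bsub>M\<^esub> y) = a \<odot>\<^bsub>M\<^esub> x \<ominus>\<^bsub>M\<^esub> a \<odot>\<^bsub>M\<^esub> y"
  using assms by (simp add: a_minus_def smult_r_distr smult_r_minus)

section \<open>Subquotients belonging to a Serre class\<close>

locale serre_class = R?: cring R for R :: "('a,'r) ring_scheme" (structure) +
  fixes S :: "('a,'u) module set"
  assumes serre: "serre_subcategory R S"
    and inf: "infinite (UNIV :: 'u set)"
begin

lemmas serre_unfolded = serre[unfolded serre_subcategory_def]

lemma S_nonempty: "S \<noteq> {}"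
  and S_module: "L \<in> S \<Longrightarrow> module R L"
  and S_iso: "L \<in> S \<Longrightarrow> module R L' \<Longrightarrow> mod_iso R L L' \<Longrightarrow> L' \<in> S"
  and S_sub: "L \<in> S \<Longrightarrow> submodule N R L \<Longrightarrow> L\<lparr>carrier := N\<rparr> \<in> S"
  and S_quot: "L \<in> S \<Longrightarrow> submodule N R L \<Longrightarrow> belongs_to R (quot_mod L N) S"
  and S_ext: "module R L' \<Longrightarrow> submodule N R L' \<Longrightarrow> L'\<lparr>carrier := N\<rparr> \<in> S \<Longrightarrow>
    belongs_to R (quot_mod L' N) S \<Longrightarrow> L' \<in> S"
  using serre_unfolded by blast+

text \<open>For submodules \<open>V \<subseteq> U\<close> of \<open>M\<close>, the following says that \<open>U / V\<close> belongs to \<open>S\<close>.\<close>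

definition sq :: "('a,'m) module \<Rightarrow> 'm set \<Rightarrow> 'm set \<Rightarrow> bool" where
  "sq M U V \<longleftrightarrow> (\<exists>L\<in>S. \<exists>f\<in>mod_hom R (M\<lparr>carrier := U\<rparr>) L.
     f ` U = carrier L \<and> (\<forall>u\<in>U. f u = \<zero>\<^bsub>L\<^esub> \<longleftrightarrow> u \<in> V))"

text \<open>Composition with the coset map turns an isomorphism from the quotient into a surjection
  with kernel \<open>V\<close>, and \<open>hom_onto_iso\<close> leads back. Arguments about
  subquotients can then work with representatives instead of cosets.\<close>

lemma belongs_quot_iff:
  assumes P: "module R P" and V: "submodule V R P"
  shows "belongs_to R (quot_mod P V) S \<longleftrightarrow> (\<exists>L\<in>S. \<exists>f\<in>mod_hom R P L.
     f ` carrier P = carrier L \<and> (\<forall>x\<in>carrier P. f x = \<zero>\<^bsub>L\<^esub> \<longleftrightarrow> x \<in> V))"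
proof
  interpret P: module R P by fact
  note Q = quot_module[OF P V]
  interpret Q: module R "quot_mod P V" by (rule Q)
  have c0: "V +>\<^bsub>P\<^esub> x = V \<longleftrightarrow> x \<in> V" if "x \<in> carrier P" for x
    using coset_eq_iff[OF P V, of x "\<zero>\<^bsub>P\<^esub>"] coset_zero[OF P V] that by (simp add: P.minus_r_zero)
  {
    assume "belongs_to R (quot_mod P V) S"
    then obtain L g where L: "L \<in> S" and g: "g \<in> mod_hom R (quot_mod P V) L"
      and b: "bij_betw g (carrier (quot_mod P V)) (carrier L)"
      by (auto simp: belongs_to_def mod_iso_def)
    interpret L: module R L by (rule S_module[OF L])
    note g0 = mod_hom_zero[OF Q S_module[OF L] g]
    let ?f = "\<lambda>x. g (V +>\<^bsub>P\<^esub> x)"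
    have "?f \<in> mod_hom R P L" by (rule mod_hom_comp[OF coset_hom[OF P V] g])
    moreover have "?f ` carrier P = carrier L"
      using b quot_carrier[OF P V] by (auto simp: bij_betw_def image_image)
    moreover have "?f x = \<zero>\<^bsub>L\<^esub> \<longleftrightarrow> x \<in> V" if x: "x \<in> carrier P" for x
    proof -
      have "?f x = \<zero>\<^bsub>L\<^esub> \<longleftrightarrow> V +>\<^bsub>P\<^esub> x = \<zero>\<^bsub>quot_mod P V\<^esub>"
        using b g0 mod_homD(1)[OF coset_hom[OF P V] x] Q.M.zero_closed
        unfolding bij_betw_def by (metis inj_on_eq_iff)
      then show ?thesis using c0[OF x] by (simp add: quot_mod_simps)
    qed
    ultimately show "\<exists>L\<in>S. \<exists>f\<in>mod_hom R P L.
      f ` carrier P = carrier L \<and> (\<forall>x\<in>carrier P. f x = \<zero>\<^bsub>L\<^esub> \<longleftrightarrow> x \<in> V)"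
      using L by blast
  next
    assume "\<exists>L\<in>S. \<exists>f\<in>mod_hom R P L.
      f ` carrier P = carrier L \<and> (\<forall>x\<in>carrier P. f x = \<zero>\<^bsub>L\<^esub> \<longleftrightarrow> x \<in> V)"
    then obtain L f where L: "L \<in> S" "f \<in> mod_hom R P L" "f ` carrier P = carrier L"
      "\<And>x. x \<in> carrier P \<Longrightarrow> f x = \<zero>\<^bsub>L\<^esub> \<longleftrightarrow> x \<in> V" by blast
    have "mod_iso R (quot_mod P V) L"
      by (rule hom_onto_iso[OF P Q S_module[OF L(1)] coset_hom[OF P V] _ L(2,3)])
        (use L(4) c0 quot_carrier[OF P V] in \<open>simp_all add: quot_mod_simps\<close>)
    then show "belongs_to R (quot_mod P V) S" using L(1) by (auto simp: belongs_to_def)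
  }
qed

lemma sq_iff:
  assumes "module R M" "submodule U R M" "submodule V R M" "V \<subseteq> U"
  shows "belongs_to R (quot_mod (M\<lparr>carrier := U\<rparr>) V) S \<longleftrightarrow> sq M U V"
  using belongs_quot_iff[OF module_restrict[OF assms(1,2)] submodule_restrict[OF assms]]
  by (simp add: sq_def)

lemma sqE:
  assumes M: "module R M" and U: "submodule U R M" and sq: "sq M U V"
  obtains L f where "L \<in> S" "module R L" "f \<in> mod_hom R (M\<lparr>carrier := U\<rparr>) L"
    "f ` U = carrier L" "\<And>u. u \<in> U \<Longrightarrow> f u \<in> carrier L"
    "\<And>u v. u \<in> U \<Longrightarrow> v \<in> U \<Longrightarrow> f (u \<oplus>\<^bsub>M\<^esub> v) = f u \<oplus>\<^bsub>L\<^esub> f v"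
    "\<And>a u. a \<in> carrier R \<Longrightarrow> u \<in> U \<Longrightarrow> f (a \<odot>\<^bsub>M\<^esub> u) = a \<odot>\<^bsub>L\<^esub> f u"
    "\<And>u. u \<in> U \<Longrightarrow> f u = \<zero>\<^bsub>L\<^esub> \<longleftrightarrow> u \<in> V"
    "\<And>u v. u \<in> U \<Longrightarrow> v \<in> U \<Longrightarrow> f u = f v \<longleftrightarrow> u \<ominus>\<^bsub>M\<^esub> v \<in> V"
proof -
  interpret M: module R M by fact
  from sq obtain L f where L: "L \<in> S" and f: "f \<in> mod_hom R (M\<lparr>carrier := U\<rparr>) L"
    "f ` U = carrier L" "\<And>u. u \<in> U \<Longrightarrow> f u = \<zero>\<^bsub>L\<^esub> \<longleftrightarrow> u \<in> V"
    by (auto simp: sq_def)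
  interpret L: module R L by (rule S_module[OF L])
  note f' = mod_homD[OF f(1), simplified]
  have uc: "u \<in> carrier M" if "u \<in> U" for u using that M.submoduleE(1)[OF U] by blast
  have eq: "f u = f v \<longleftrightarrow> u \<ominus>\<^bsub>M\<^esub> v \<in> V" if "u \<in> U" "v \<in> U" for u v
  proof -
    have "f (u \<ominus>\<^bsub>M\<^esub> v) = f u \<ominus>\<^bsub>L\<^esub> f v"
      using that uc M.submoduleE(4)[OF U, of "\<ominus> \<one>" v]
      by (simp add: M.minus_as_smult L.minus_as_smult f')
    then have "f u = f v \<longleftrightarrow> f (u \<ominus>\<^bsub>M\<^esub> v) = \<zero>\<^bsub>L\<^esub>" using that f'(1) by (simp add: L.minus_zero_iff)
    then show ?thesis using f(3)[OF M.submodule_minus[OF U that]] by simp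
  qed
  show ?thesis by (rule that[OF L S_module[OF L] f(1,2) f' f(3) eq])
qed

text \<open>
  The additive relation \<open>\<Gamma>\<close> exhibits \<open>U / V\<close> as a subquotient of \<open>U' / V'\<close>. Connecting homomorphisms
  are used in this form, without being constructed.
\<close>

lemma sq_transfer:
  assumes M: "module R M" and U: "submodule U R M" and V: "submodule V R M" and VU: "V \<subseteq> U"
    and M': "module R M'" and U': "submodule U' R M'"
    and sq: "sq M' U' V'"
    and tot: "\<And>u. u \<in> U \<Longrightarrow> \<exists>u'\<in>U'. \<Gamma> u u'"
    and add: "\<And>u v u' v'. \<Gamma> u u' \<Longrightarrow> \<Gamma> v v' \<Longrightarrow> u \<in> U \<Longrightarrow> v \<in> U \<Longrightarrow> u' \<in> U' \<Longrightarrow> v' \<in> U' \<Longrightarrow>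
        \<Gamma> (u \<oplus>\<^bsub>M\<^esub> v) (u' \<oplus>\<^bsub>M'\<^esub> v')"
    and smult: "\<And>a u u'. a \<in> carrier R \<Longrightarrow> \<Gamma> u u' \<Longrightarrow> u \<in> U \<Longrightarrow> u' \<in> U' \<Longrightarrow>
        \<Gamma> (a \<odot>\<^bsub>M\<^esub> u) (a \<odot>\<^bsub>M'\<^esub> u')"
    and ker: "\<And>u u'. \<Gamma> u u' \<Longrightarrow> u \<in> U \<Longrightarrow> u' \<in> U' \<Longrightarrow> u' \<in> V' \<Longrightarrow> u \<in> V"
  shows "sq M U V"
proof -
  interpret M: module R M by fact
  interpret M': module R M' by fact
  obtain L f where L: "L \<in> S" "module R L" and
    f: "f ` U' = carrier L" "\<And>u. u \<in> U' \<Longrightarrow> f u \<in> carrier L"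
    "\<And>u v. u \<in> U' \<Longrightarrow> v \<in> U' \<Longrightarrow> f (u \<oplus>\<^bsub>M'\<^esub> v) = f u \<oplus>\<^bsub>L\<^esub> f v"
    "\<And>a u. a \<in> carrier R \<Longrightarrow> u \<in> U' \<Longrightarrow> f (a \<odot>\<^bsub>M'\<^esub> u) = a \<odot>\<^bsub>L\<^esub> f u"
    "\<And>u. u \<in> U' \<Longrightarrow> f u = \<zero>\<^bsub>L\<^esub> \<longleftrightarrow> u \<in> V'"
    "\<And>u v. u \<in> U' \<Longrightarrow> v \<in> U' \<Longrightarrow> f u = f v \<longleftrightarrow> u \<ominus>\<^bsub>M'\<^esub> v \<in> V'"
    by (rule sqE[OF M' U' sq]) (rule that; assumption)
  interpret L: module R L by fact
  note Us = M.submoduleE[OF U] and Vs = M.submoduleE[OF V] and U's = M'.submoduleE[OF U']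
  have img: "submodule (f ` {u' \<in> U'. \<exists>u\<in>W. \<Gamma> u u'}) R L"
    if W: "submodule W R M" "W \<subseteq> U" for W
  proof (rule L.submoduleI')
    note Ws = M.submoduleE[OF W(1)]
    have z: "\<zero>\<^bsub>M\<^esub> \<in> W" by (rule M.submodule_zero[OF W(1)])
    obtain u0 where u0: "u0 \<in> U'" "\<Gamma> \<zero>\<^bsub>M\<^esub> u0" using tot z W(2) by blast
    \<comment> \<open>Totality only gives some partner of zero; scaling by \<open>\<zero>\<close>
      makes that partner zero.\<close>
    have "\<Gamma> (\<zero>\<^bsub>R\<^esub> \<odot>\<^bsub>M\<^esub> \<zero>\<^bsub>M\<^esub>) (\<zero>\<^bsub>R\<^esub> \<odot>\<^bsub>M'\<^esub> u0)"
      using smult u0 z W(2) by blast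
    then have g0: "\<Gamma> \<zero>\<^bsub>M\<^esub> \<zero>\<^bsub>M'\<^esub>" using u0(1) U's(1) by (simp add: subset_iff)
    have "f \<zero>\<^bsub>M'\<^esub> = \<zero>\<^bsub>L\<^esub>"
    proof -
      have "f (\<zero>\<^bsub>R\<^esub> \<odot>\<^bsub>M'\<^esub> \<zero>\<^bsub>M'\<^esub>) = \<zero>\<^bsub>R\<^esub> \<odot>\<^bsub>L\<^esub> f \<zero>\<^bsub>M'\<^esub>"
        using f(4) M'.submodule_zero[OF U'] by blast
      then show ?thesis using f(2)[OF M'.submodule_zero[OF U']] by simp
    qed
    then show "\<zero>\<^bsub>L\<^esub> \<in> f ` {u' \<in> U'. \<exists>u\<in>W. \<Gamma> u u'}"
      using g0 M'.submodule_zero[OF U'] z by (intro image_eqI[of _ _ "\<zero>\<^bsub>M'\<^esub>"]) auto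
    show "a \<oplus>\<^bsub>L\<^esub> b \<in> f ` {u' \<in> U'. \<exists>u\<in>W. \<Gamma> u u'}"
      if "a \<in> f ` {u' \<in> U'. \<exists>u\<in>W. \<Gamma> u u'}" "b \<in> f ` {u' \<in> U'. \<exists>u\<in>W. \<Gamma> u u'}" for a b
    proof -
      from that obtain u u' v v' where *: "a = f u'" "b = f v'" "u' \<in> U'" "v' \<in> U'" "u \<in> W" "v \<in> W"
        "\<Gamma> u u'" "\<Gamma> v v'" by auto
      then have "\<Gamma> (u \<oplus>\<^bsub>M\<^esub> v) (u' \<oplus>\<^bsub>M'\<^esub> v')" using add W(2) by blast
      moreover have "u \<oplus>\<^bsub>M\<^esub> v \<in> W" "u' \<oplus>\<^bsub>M'\<^esub> v' \<in> U'" using *(3-6) Ws(5) U's(5) by simp_all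
      moreover have "a \<oplus>\<^bsub>L\<^esub> b = f (u' \<oplus>\<^bsub>M'\<^esub> v')" using * f(3) by simp
      ultimately show ?thesis by blast
    qed
    show "a \<odot>\<^bsub>L\<^esub> b \<in> f ` {u' \<in> U'. \<exists>u\<in>W. \<Gamma> u u'}"
      if "a \<in> carrier R" "b \<in> f ` {u' \<in> U'. \<exists>u\<in>W. \<Gamma> u u'}" for a b
    proof -
      from that obtain v v' where *: "b = f v'" "v' \<in> U'" "v \<in> W" "\<Gamma> v v'" by auto
      then have "\<Gamma> (a \<odot>\<^bsub>M\<^esub> v) (a \<odot>\<^bsub>M'\<^esub> v')" using smult that W(2) by blast
      moreover have "a \<odot>\<^bsub>M\<^esub> v \<in> W" "a \<odot>\<^bsub>M'\<^esub> v' \<in> U'" using *(2,3) that(1) Ws(4) U's(4) by simp_all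
      moreover have "a \<odot>\<^bsub>L\<^esub> b = f (a \<odot>\<^bsub>M'\<^esub> v')" using * that f(4) by simp
      ultimately show ?thesis by blast
    qed
  qed (use f(2) in auto)
  \<comment> \<open>\<open>N / K\<close> is a subquotient of \<open>L\<close>, hence isomorphic to a
    member of \<open>S\<close>. The map from \<open>U\<close> to \<open>N / K\<close> that
    \<open>\<Gamma>\<close> induces will turn out to have kernel \<open>V\<close>.\<close>
  define N where "N = f ` {u' \<in> U'. \<exists>u\<in>U. \<Gamma> u u'}"
  define K where "K = f ` {u' \<in> U'. \<exists>u\<in>V. \<Gamma> u u'}"
  have N: "submodule N R L" unfolding N_def by (rule img[OF U subset_refl])
  have K: "submodule K R L" unfolding K_def by (rule img[OF V VU])
  have KN: "K \<subseteq> N" using VU by (auto simp: K_def N_def)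
  have LN: "L\<lparr>carrier := N\<rparr> \<in> S" by (rule S_sub[OF L(1) N])
  have KLN: "submodule K R (L\<lparr>carrier := N\<rparr>)" by (rule submodule_restrict[OF L(2) N K KN])
  have "belongs_to R (quot_mod (L\<lparr>carrier := N\<rparr>) K) S" by (rule S_quot[OF LN KLN])
  then have "sq L N K" using sq_iff[OF L(2) N K KN] by simp
  then obtain L2 g where L2: "L2 \<in> S" "module R L2" and
    g: "g ` N = carrier L2" "\<And>u. u \<in> N \<Longrightarrow> g u \<in> carrier L2"
    "\<And>u v. u \<in> N \<Longrightarrow> v \<in> N \<Longrightarrow> g (u \<oplus>\<^bsub>L\<^esub> v) = g u \<oplus>\<^bsub>L2\<^esub> g v"
    "\<And>a u. a \<in> carrier R \<Longrightarrow> u \<in> N \<Longrightarrow> g (a \<odot>\<^bsub>L\<^esub> u) = a \<odot>\<^bsub>L2\<^esub> g u"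
    "\<And>u. u \<in> N \<Longrightarrow> g u = \<zero>\<^bsub>L2\<^esub> \<longleftrightarrow> u \<in> K"
    "\<And>u v. u \<in> N \<Longrightarrow> v \<in> N \<Longrightarrow> g u = g v \<longleftrightarrow> u \<ominus>\<^bsub>L\<^esub> v \<in> K"
    by (rule sqE[OF L(2) N]) (rule that; assumption)
  define p where "p u = (SOME u'. u' \<in> U' \<and> \<Gamma> u u')" for u
  have p: "p u \<in> U'" "\<Gamma> u (p u)" if "u \<in> U" for u
    using someI_ex[of "\<lambda>u'. u' \<in> U' \<and> \<Gamma> u u'"] tot[OF that] by (auto simp: p_def)
  define h where "h u = g (f (p u))" for u
  have fN: "f u' \<in> N" if "\<Gamma> u u'" "u \<in> U" "u' \<in> U'" for u u' using that by (auto simp: N_def)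
  \<comment> \<open>Two partners of \<open>u\<close> differ by a partner of zero, whose image under
    \<open>f\<close> lies in \<open>K\<close>. So the choice made by \<open>p\<close> does not
    matter modulo \<open>K\<close>.\<close>
  have h: "h u = g (f u')" if *: "\<Gamma> u u'" "u \<in> U" "u' \<in> U'" for u u'
  proof -
    have "\<Gamma> (u \<oplus>\<^bsub>M\<^esub> (\<ominus> \<one>) \<odot>\<^bsub>M\<^esub> u) (p u \<oplus>\<^bsub>M'\<^esub> (\<ominus> \<one>) \<odot>\<^bsub>M'\<^esub> u')"
      by (intro add smult p) (use * Us U's in auto)
    moreover have "u \<in> carrier M" using Us * by blast
    then have "u \<oplus>\<^bsub>M\<^esub> (\<ominus> \<one>) \<odot>\<^bsub>M\<^esub> u = \<zero>\<^bsub>M\<^esub>"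
      by (metis M.minus_as_smult M.minus_self)
    ultimately have "\<Gamma> \<zero>\<^bsub>M\<^esub> (p u \<oplus>\<^bsub>M'\<^esub> (\<ominus> \<one>) \<odot>\<^bsub>M'\<^esub> u')" by simp
    then have "f (p u \<oplus>\<^bsub>M'\<^esub> (\<ominus> \<one>) \<odot>\<^bsub>M'\<^esub> u') \<in> K"
      unfolding K_def using M.submodule_zero[OF V] p * U's
      by (intro imageI) (auto intro!: bexI[of _ "\<zero>\<^bsub>M\<^esub>"])
    then have "f (p u) \<ominus>\<^bsub>L\<^esub> f u' \<in> K"
      using p * U's f by (simp add: L.minus_as_smult)
    then show ?thesis unfolding h_def using g(6) fN p * by blast
  qed
  have "h \<in> mod_hom R (M\<lparr>carrier := U\<rparr>) L2"
  proof (rule mod_homI)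
    fix u assume "u \<in> carrier (M\<lparr>carrier := U\<rparr>)"
    then have u: "u \<in> U" by simp
    then show "h u \<in> carrier L2" unfolding h_def using g(2) fN p by blast
    { fix v assume "v \<in> carrier (M\<lparr>carrier := U\<rparr>)"
      then have v: "v \<in> U" by simp
      have "h (u \<oplus>\<^bsub>M\<^esub> v) = g (f (p u \<oplus>\<^bsub>M'\<^esub> p v))"
        by (rule h[OF add]) (use u v p Us U's in auto)
      also have "\<dots> = h u \<oplus>\<^bsub>L2\<^esub> h v"
        unfolding h_def using u v p fN[OF p(2) _ p(1)] by (simp add: f(3) g(3))
      finally show "h (u \<oplus>\<^bsub>M\<lparr>carrier := U\<rparr>\<^esub> v) = h u \<oplus>\<^bsub>L2\<^esub> h v" by simp }
    { fix a assume a: "a \<in> carrier R"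
      have "h (a \<odot>\<^bsub>M\<^esub> u) = g (f (a \<odot>\<^bsub>M'\<^esub> p u))"
        by (rule h[OF smult]) (use a u p Us U's in auto)
      also have "\<dots> = a \<odot>\<^bsub>L2\<^esub> h u"
        unfolding h_def using a u p fN[OF p(2) _ p(1)] by (simp add: f(4) g(4))
      finally show "h (a \<odot>\<^bsub>M\<lparr>carrier := U\<rparr>\<^esub> u) = a \<odot>\<^bsub>L2\<^esub> h u" by simp }
  qed
  moreover have "h ` U = carrier L2"
  proof
    show "h ` U \<subseteq> carrier L2" unfolding h_def using g(2) fN p by blast
    show "carrier L2 \<subseteq> h ` U"
    proof
      fix y assume "y \<in> carrier L2"
      then obtain u u' where "u \<in> U" "u' \<in> U'" "\<Gamma> u u'" "y = g (f u')" unfolding g(1)[symmetric] N_def by blast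
      then show "y \<in> h ` U" using h by (metis imageI)
    qed
  qed
  moreover have "h u = \<zero>\<^bsub>L2\<^esub> \<longleftrightarrow> u \<in> V" if u: "u \<in> U" for u
  proof
    assume "u \<in> V"
    then have "f (p u) \<in> K" using p u by (auto simp: K_def)
    then show "h u = \<zero>\<^bsub>L2\<^esub>" unfolding h_def using g(5) fN p u by blast
  next
    assume "h u = \<zero>\<^bsub>L2\<^esub>"
    then have "f (p u) \<in> K" unfolding h_def using g(5) fN p u by blast
    \<comment> \<open>\<open>f\<close> takes \<open>p u\<close> and a partner \<open>v'\<close> of
      some \<open>v\<close> in \<open>V\<close> to the same element, so their difference lies in
      \<open>V'\<close>. It is a partner of \<open>u - v\<close>, and \<open>ker\<close> puts
      \<open>u - v\<close>, hence \<open>u\<close>, into \<open>V\<close>.\<close>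
    then obtain v v' where v: "f (p u) = f v'" "v' \<in> U'" "v \<in> V" "\<Gamma> v v'" by (auto simp: K_def)
    then have "p u \<ominus>\<^bsub>M'\<^esub> v' \<in> V'" using f(6) p u by blast
    moreover have "\<Gamma> (u \<oplus>\<^bsub>M\<^esub> (\<ominus> \<one>) \<odot>\<^bsub>M\<^esub> v) (p u \<oplus>\<^bsub>M'\<^esub> (\<ominus> \<one>) \<odot>\<^bsub>M'\<^esub> v')"
      by (intro add smult p) (use u v VU Us U's in auto)
    moreover have c: "u \<in> carrier M" "v \<in> carrier M" "p u \<in> carrier M'" "v' \<in> carrier M'"
      using u v p VU Us(1) U's(1) by blast+
    moreover have "u \<ominus>\<^bsub>M\<^esub> v \<in> U" "p u \<ominus>\<^bsub>M'\<^esub> v' \<in> U'"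
      using M.submodule_minus[OF U] M'.submodule_minus[OF U'] u v p VU by blast+
    ultimately have "u \<ominus>\<^bsub>M\<^esub> v \<in> V" using ker by (simp add: M.minus_as_smult M'.minus_as_smult)
    then have "(u \<ominus>\<^bsub>M\<^esub> v) \<oplus>\<^bsub>M\<^esub> v \<in> V" using v Vs by blast
    then show "u \<in> V" using c by (simp add: M.add_minus_cancel)
  qed
  ultimately show ?thesis using L2 by (auto simp: sq_def)
qed

lemma sq_mono:
  assumes M: "module R M" and "submodule U R M" "submodule U' R M" "submodule V' R M"
    and "U' \<subseteq> U" "V \<subseteq> V'" "V' \<subseteq> U'" and sq: "sq M U V"
  shows "sq M U' V'"
  by (rule sq_transfer[OF M assms(3,4,7) M assms(2) sq, where \<Gamma> = "(=)"])
    (use assms in auto)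

text \<open>The relation is the graph of \<open>f\<close>. Since \<open>V\<close> may be larger than
  the preimage of \<open>V'\<close>, in general \<open>U / V\<close> is a quotient of a submodule of
  \<open>U' / V'\<close>.\<close>

lemma sq_inj:
  assumes M: "module R M" and U: "submodule U R M" and V: "submodule V R M" and VU: "V \<subseteq> U"
    and M': "module R M'" and U': "submodule U' R M'"
    and sq: "sq M' U' V'"
    and f: "f \<in> mod_hom R M M'" "\<And>u. u \<in> U \<Longrightarrow> f u \<in> U'"
    and ker: "\<And>u. u \<in> U \<Longrightarrow> f u \<in> V' \<Longrightarrow> u \<in> V"
  shows "sq M U V"
proof -
  interpret M: module R M by fact
  have c: "u \<in> carrier M" if "u \<in> U" for u using that M.submoduleE(1)[OF U] by blast
  show ?thesis
    by (rule sq_transfer[OF M U V VU M' U' sq, where \<Gamma> = "\<lambda>u u'. u' = f u"])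
      (use f ker c in \<open>auto simp: mod_homD[OF f(1)]\<close>)
qed

text \<open>The relation is the graph of \<open>f\<close> read backwards and modulo
  \<open>V\<close>, so that \<open>f\<close> has to reach the elements of \<open>U\<close> only up
  to \<open>V\<close>.\<close>

lemma sq_surj:
  assumes M: "module R M" and U: "submodule U R M" and V: "submodule V R M" and VU: "V \<subseteq> U"
    and M': "module R M'" and U': "submodule U' R M'"
    and sq: "sq M' U' V'"
    and f: "f \<in> mod_hom R M' M"
    and onto: "\<And>u. u \<in> U \<Longrightarrow> \<exists>u'\<in>U'. u \<ominus>\<^bsub>M\<^esub> f u' \<in> V"
    and ker: "\<And>u. u \<in> U' \<Longrightarrow> u \<in> V' \<Longrightarrow> f u \<in> V"
  shows "sq M U V"
proof -
  interpret M: module R M by fact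
  interpret M': module R M' by fact
  have c: "u \<in> carrier M" if "u \<in> U" for u using that M.submoduleE(1)[OF U] by blast
  have c': "u \<in> carrier M'" if "u \<in> U'" for u using that M'.submoduleE(1)[OF U'] by blast
  note Vs = M.submoduleE[OF V]
  show ?thesis
  proof (rule sq_transfer[OF M U V VU M' U' sq, where \<Gamma> = "\<lambda>u u'. u \<ominus>\<^bsub>M\<^esub> f u' \<in> V"])
    fix u v u' v' assume "u \<ominus>\<^bsub>M\<^esub> f u' \<in> V" "v \<ominus>\<^bsub>M\<^esub> f v' \<in> V" "u \<in> U" "v \<in> U" "u' \<in> U'" "v' \<in> U'"
    then show "(u \<oplus>\<^bsub>M\<^esub> v) \<ominus>\<^bsub>M\<^esub> f (u' \<oplus>\<^bsub>M'\<^esub> v') \<in> V"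
      using Vs c c' mod_homD(1)[OF f] by (simp add: mod_homD(2)[OF f] M.minus_minus_swap)
  next
    fix a u u' assume "a \<in> carrier R" "u \<ominus>\<^bsub>M\<^esub> f u' \<in> V" "u \<in> U" "u' \<in> U'"
    moreover from this have "a \<odot>\<^bsub>M\<^esub> (u \<ominus>\<^bsub>M\<^esub> f u') \<in> V" using Vs by blast
    ultimately show "a \<odot>\<^bsub>M\<^esub> u \<ominus>\<^bsub>M\<^esub> f (a \<odot>\<^bsub>M'\<^esub> u') \<in> V"
      using c c' mod_homD(1)[OF f] by (simp add: mod_homD(3)[OF f] M.smult_minus)
  next
    fix u u' assume "u \<ominus>\<^bsub>M\<^esub> f u' \<in> V" "u \<in> U" "u' \<in> U'" "u' \<in> V'"
    then have "(u \<ominus>\<^bsub>M\<^esub> f u') \<oplus>\<^bsub>M\<^esub> f u' \<in> V" using ker Vs by blast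
    then show "u \<in> V" using c c' mod_homD(1)[OF f] \<open>u \<in> U\<close> \<open>u' \<in> U'\<close> by (simp add: M.add_minus_cancel)
  qed (use onto in auto)
qed

text \<open>A nonempty class that is closed under submodules contains a zero module.\<close>

lemma sq_trivial:
  assumes M: "module R M" and U: "submodule U R M"
  shows "sq M U U"
proof -
  obtain L where L: "L \<in> S" using S_nonempty by blast
  interpret L: module R L by (rule S_module[OF L])
  have "L\<lparr>carrier := {\<zero>\<^bsub>L\<^esub>}\<rparr> \<in> S" by (rule S_sub[OF L L.submodule_trivial])
  moreover have "(\<lambda>_. \<zero>\<^bsub>L\<^esub>) \<in> mod_hom R (M\<lparr>carrier := U\<rparr>) (L\<lparr>carrier := {\<zero>\<^bsub>L\<^esub>}\<rparr>)"
    by (rule mod_homI) auto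
  moreover have "U \<noteq> {}" using module.submodule_zero[OF M U] by blast
  ultimately show ?thesis by (force simp: sq_def)
qed

lemma inj_pairs: "\<exists>j :: 'u \<times> 'u \<Rightarrow> 'u. inj j"
proof -
  have "|(UNIV :: 'u set) \<times> (UNIV :: 'u set)| =o |UNIV :: 'u set|"
    by (rule card_of_Times_same_infinite[OF inf])
  then obtain j where "bij_betw j ((UNIV :: 'u set) \<times> (UNIV :: 'u set)) (UNIV :: 'u set)"
    using card_of_ordIso by blast
  then show ?thesis by (auto simp: bij_betw_def)
qed

text \<open>
  The class \<open>S\<close> is closed under extensions within the type \<open>'u\<close> only. The module \<open>U / V\<close>, whose
  elements may lie in another type, is carried into \<open>'u\<close> by an injection of \<open>'u \<times> 'u\<close> into \<open>'u\<close>.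
\<close>

lemma sq_ext:
  assumes M: "module R M" and U: "submodule U R M" and V: "submodule V R M" and W: "submodule W R M"
    and VW: "V \<subseteq> W" and WU: "W \<subseteq> U"
    and sq1: "sq M W V" and sq2: "sq M U W"
  shows "sq M U V"
proof -
  interpret M: module R M by fact
  obtain L1 f1 where L1: "L1 \<in> S" "module R L1" and
    f1h: "f1 \<in> mod_hom R (M\<lparr>carrier := W\<rparr>) L1" and
    f1: "f1 ` W = carrier L1" "\<And>u. u \<in> W \<Longrightarrow> f1 u \<in> carrier L1"
    "\<And>u. u \<in> W \<Longrightarrow> f1 u = \<zero>\<^bsub>L1\<^esub> \<longleftrightarrow> u \<in> V"
    "\<And>u v. u \<in> W \<Longrightarrow> v \<in> W \<Longrightarrow> f1 u = f1 v \<longleftrightarrow> u \<ominus>\<^bsub>M\<^esub> v \<in> V"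
    by (rule sqE[OF M W sq1]) (rule that; assumption)
  obtain L2 f2 where L2: "L2 \<in> S" "module R L2" and
    f2h: "f2 \<in> mod_hom R (M\<lparr>carrier := U\<rparr>) L2" and
    f2: "f2 ` U = carrier L2" "\<And>u. u \<in> U \<Longrightarrow> f2 u \<in> carrier L2"
    "\<And>u. u \<in> U \<Longrightarrow> f2 u = \<zero>\<^bsub>L2\<^esub> \<longleftrightarrow> u \<in> W"
    "\<And>u v. u \<in> U \<Longrightarrow> v \<in> U \<Longrightarrow> f2 u = f2 v \<longleftrightarrow> u \<ominus>\<^bsub>M\<^esub> v \<in> W"
    by (rule sqE[OF M U sq2]) (rule that; assumption)
  have Uc: "u \<in> carrier M" if "u \<in> U" for u using that M.submoduleE(1)[OF U] by blast
  have MU: "module R (M\<lparr>carrier := U\<rparr>)" by (rule module_restrict[OF M U])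
  interpret MU: module R "M\<lparr>carrier := U\<rparr>" by (rule MU)
  \<comment> \<open>The map \<open>h\<close> below labels the class of \<open>u\<close> modulo
    \<open>V\<close> by a pair: the class of \<open>u\<close> modulo \<open>W\<close>, and the class
    modulo \<open>V\<close> of what remains in \<open>W\<close> after subtracting the chosen
    representative \<open>s (f2 u)\<close>.\<close>
  define s where "s = inv_into U f2"
  have s: "s (f2 u) \<in> U" "f2 (s (f2 u)) = f2 u" if "u \<in> U" for u
    using that by (auto simp: s_def inv_into_into f_inv_into_f)
  define r where "r u = u \<ominus>\<^bsub>M\<^esub> s (f2 u)" for u
  have r: "r u \<in> W" if "u \<in> U" for u
    using f2(4)[OF that s(1)[OF that]] s[OF that] by (simp add: r_def)
  obtain j :: "'u \<times> 'u \<Rightarrow> 'u" where j: "inj j" using inj_pairs by blast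
  define h where "h u = j (f1 (r u), f2 u)" for u
  have heq: "h u = h v \<longleftrightarrow> u \<ominus>\<^bsub>M\<^esub> v \<in> V" if u: "u \<in> U" and v: "v \<in> U" for u v
  proof -
    have "h u = h v \<longleftrightarrow> f2 u = f2 v \<and> r u \<ominus>\<^bsub>M\<^esub> r v \<in> V"
      unfolding h_def f1(4)[OF r[OF u] r[OF v], symmetric] by (auto simp: inj_eq[OF j])
    also have "\<dots> \<longleftrightarrow> f2 u = f2 v \<and> u \<ominus>\<^bsub>M\<^esub> v \<in> V"
    proof (rule conj_cong[OF refl])
      assume "f2 u = f2 v"
      then have "r u \<ominus>\<^bsub>M\<^esub> r v = u \<ominus>\<^bsub>M\<^esub> v"
        using Uc[OF u] Uc[OF v] Uc[OF s(1)[OF v]]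
        by (simp add: r_def a_minus_def M.minus_add M.a_assoc M.a_lcomm M.r_neg M.l_neg M.a_comm)
      then show "r u \<ominus>\<^bsub>M\<^esub> r v \<in> V \<longleftrightarrow> u \<ominus>\<^bsub>M\<^esub> v \<in> V" by simp
    qed
    also have "\<dots> \<longleftrightarrow> u \<ominus>\<^bsub>M\<^esub> v \<in> V" using f2(4)[OF u v] VW by blast
    finally show ?thesis .
  qed
  have VMU: "submodule V R (M\<lparr>carrier := U\<rparr>)" by (rule submodule_restrict[OF M U V]) (use VW WU in blast)
  have WMU: "submodule W R (M\<lparr>carrier := U\<rparr>)" by (rule submodule_restrict[OF M U W WU])
  have minusU: "x \<ominus>\<^bsub>M\<lparr>carrier := U\<rparr>\<^esub> y = x \<ominus>\<^bsub>M\<^esub> y" if "x \<in> U" "y \<in> U" for x y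
    using that MU.minus_as_smult[of x y] M.minus_as_smult[OF Uc Uc, of x y] by simp
  obtain L :: "('a,'u) module" where L: "module R L" and h: "h \<in> mod_hom R (M\<lparr>carrier := U\<rparr>) L"
    "h ` U = carrier L" "\<And>x. x \<in> U \<Longrightarrow> h x = \<zero>\<^bsub>L\<^esub> \<longleftrightarrow> x \<in> V"
    using transport_quotient[OF MU VMU, of h] heq minusU by auto
  interpret L: module R L by fact
  define N where "N = h ` W"
  have N: "submodule N R L" unfolding N_def by (rule submodule_image[OF MU L h(1) WMU])
  have LN: "module R (L\<lparr>carrier := N\<rparr>)" by (rule module_restrict[OF L N])
  have hW: "h \<in> mod_hom R (M\<lparr>carrier := W\<rparr>) (L\<lparr>carrier := N\<rparr>)"
    using mod_hom_restrict[OF h(1), of W N] WU by (auto simp: N_def)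
  \<comment> \<open>In the transported copy \<open>L\<close> of \<open>U / V\<close>, the image
    \<open>N\<close> of \<open>W\<close> is isomorphic to \<open>L1\<close> and the quotient by
    \<open>N\<close> to \<open>L2\<close>. Closure under extensions inside \<open>'u\<close> then
    applies to \<open>L\<close>.\<close>
  have "mod_iso R L1 (L\<lparr>carrier := N\<rparr>)"
    by (rule hom_onto_iso[OF module_restrict[OF M W] L1(2) LN f1h _ hW])
      (use f1 h WU in \<open>auto simp: N_def\<close>)
  then have NS: "L\<lparr>carrier := N\<rparr> \<in> S" by (rule S_iso[OF L1(1) LN])
  have hN: "h u \<in> N \<longleftrightarrow> u \<in> W" if u: "u \<in> U" for u
  proof
    assume "h u \<in> N"
    then obtain w where w: "w \<in> W" "h u = h w" by (auto simp: N_def)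
    then have "u \<ominus>\<^bsub>M\<^esub> w \<in> W" using heq u WU VW by blast
    then have "(u \<ominus>\<^bsub>M\<^esub> w) \<oplus>\<^bsub>M\<^esub> w \<in> W" using w M.submoduleE(5)[OF W] by blast
    then show "u \<in> W" using u w WU Uc by (simp add: M.add_minus_cancel subset_iff)
  qed (auto simp: N_def)
  note Q = quot_module[OF L N]
  have hc: "(\<lambda>u. N +>\<^bsub>L\<^esub> h u) \<in> mod_hom R (M\<lparr>carrier := U\<rparr>) (quot_mod L N)"
    by (rule mod_hom_comp[OF h(1) coset_hom[OF L N]])
  have "mod_iso R (quot_mod L N) L2"
  proof (rule hom_onto_iso[OF MU Q L2(2) hc _ f2h])
    show "(\<lambda>u. N +>\<^bsub>L\<^esub> h u) ` carrier (M\<lparr>carrier := U\<rparr>) = carrier (quot_mod L N)"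
      using quot_carrier[OF L N] h(2) by (auto simp: image_image[symmetric])
    fix x assume "x \<in> carrier (M\<lparr>carrier := U\<rparr>)"
    then have x: "x \<in> U" by simp
    then have "h x \<in> carrier L" using h(2) by blast
    then have "N +>\<^bsub>L\<^esub> h x = N \<longleftrightarrow> h x \<in> N"
      using coset_eq_iff[OF L N, of "h x" "\<zero>\<^bsub>L\<^esub>"] coset_zero[OF L N] by (simp add: L.minus_r_zero)
    then show "N +>\<^bsub>L\<^esub> h x = \<zero>\<^bsub>quot_mod L N\<^esub> \<longleftrightarrow> f2 x = \<zero>\<^bsub>L2\<^esub>"
      using hN[OF x] f2(3)[OF x] by (simp add: quot_mod_simps)
  qed (use f2(1) in simp)
  then have "belongs_to R (quot_mod L N) S" using L2(1) by (auto simp: belongs_to_def)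
  then have "L \<in> S" by (rule S_ext[OF L N NS])
  then show ?thesis using h by (auto simp: sq_def)
qed

end

section \<open>The long exact sequence modulo a Serre class\<close>

text \<open>Relative cycles, and with \<open>bnd\<close> relative boundaries: the full preimages of
  the kernel and of the image of a map induced on quotients. The homology of a complex of quotients
  thereby becomes a quotient of two submodules of the original term.\<close>

definition cyc :: "('b \<Rightarrow> 'c) \<Rightarrow> 'b set \<Rightarrow> 'c set \<Rightarrow> 'b set" where
  "cyc f U V = {u \<in> U. f u \<in> V}"

definition bnd :: "('a,'b) module \<Rightarrow> ('d \<Rightarrow> 'b) \<Rightarrow> 'd set \<Rightarrow> 'b set \<Rightarrow> 'b set" where
  "bnd P f U V = {f y \<oplus>\<^bsub>P\<^esub> v | y v. y \<in> U \<and> v \<in> V}"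

lemma submodule_cyc:
  assumes "module R M" "module R N" "f \<in> mod_hom R M N" "submodule U R M" "submodule V R N"
  shows "submodule (cyc f U V) R M"
  unfolding cyc_def by (rule submodule_vimage[OF assms])

lemma submodule_bnd:
  assumes N: "module R N" and P: "module R P" and f: "f \<in> mod_hom R N P"
    and U: "submodule U R N" and V: "submodule V R P"
  shows "submodule (bnd P f U V) R P"
proof -
  interpret P: module R P by fact
  interpret N: module R N by fact
  note Us = N.submoduleE[OF U] and Vs = P.submoduleE[OF V]
  have Uc: "u \<in> carrier N" if "u \<in> U" for u using that Us(1) by blast
  have Vc: "u \<in> carrier P" if "u \<in> V" for u using that Vs(1) by blast
  note f' = mod_homD[OF f]
  show ?thesis
  proof (rule P.submoduleI')
    show "bnd P f U V \<subseteq> carrier P" using f'(1) Uc Vc by (auto simp: bnd_def)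
    show "\<zero>\<^bsub>P\<^esub> \<in> bnd P f U V"
      unfolding bnd_def using N.submodule_zero[OF U] P.submodule_zero[OF V] mod_hom_zero[OF N P f]
      by (auto intro!: exI[of _ "\<zero>\<^bsub>N\<^esub>"] exI[of _ "\<zero>\<^bsub>P\<^esub>"])
    fix a b assume "a \<in> bnd P f U V"
    then obtain y v where a: "a = f y \<oplus>\<^bsub>P\<^esub> v" "y \<in> U" "v \<in> V" by (auto simp: bnd_def)
    { assume "b \<in> bnd P f U V"
      then obtain z w where b: "b = f z \<oplus>\<^bsub>P\<^esub> w" "z \<in> U" "w \<in> V" by (auto simp: bnd_def)
      have "a \<oplus>\<^bsub>P\<^esub> b = f (y \<oplus>\<^bsub>N\<^esub> z) \<oplus>\<^bsub>P\<^esub> (v \<oplus>\<^bsub>P\<^esub> w)"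
        using a b Uc Vc f' by (simp add: P.a_assoc P.a_lcomm)
      then show "a \<oplus>\<^bsub>P\<^esub> b \<in> bnd P f U V" unfolding bnd_def using a b Us(5) Vs(5) by blast }
    { fix c assume c: "c \<in> carrier R"
      have "c \<odot>\<^bsub>P\<^esub> a = f (c \<odot>\<^bsub>N\<^esub> y) \<oplus>\<^bsub>P\<^esub> (c \<odot>\<^bsub>P\<^esub> v)"
        using a c Uc Vc f' by (simp add: P.smult_r_distr)
      then show "c \<odot>\<^bsub>P\<^esub> a \<in> bnd P f U V" unfolding bnd_def using a c Us(4) Vs(4) by blast }
  qed
qed

text \<open>
  Three submodules \<open>V \<subseteq> X \<subseteq> Y\<close> of the terms of a complex \<open>E \<rightarrow> D \<rightarrow> B \<rightarrow> C\<close>, giving the short exact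
  sequence of complexes \<open>X/V \<rightarrow> Y/V \<rightarrow> Y/X\<close>.
\<close>

locale complex_triple = serre_class R S
  for R :: "('a,'r) ring_scheme" (structure) and S :: "('a,'u) module set" +
  fixes PE :: "('a,'e) module" and PD :: "('a,'d) module" and PB :: "('a,'b) module" and PC :: "('a,'c) module"
    and a2 a1 a0 VD XD YD VB XB YB VC YE
  assumes mods: "module R PE" "module R PD" "module R PB" "module R PC"
    and homs: "a2 \<in> mod_hom R PE PD" "a1 \<in> mod_hom R PD PB" "a0 \<in> mod_hom R PB PC"
    and subs: "submodule VD R PD" "submodule XD R PD" "submodule YD R PD"
      "submodule VB R PB" "submodule XB R PB" "submodule YB R PB"
      "submodule VC R PC" "submodule YE R PE"
    and incl: "VD \<subseteq> XD" "XD \<subseteq> YD" "VB \<subseteq> XB" "XB \<subseteq> YB"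
    and maps: "\<And>y. y \<in> YE \<Longrightarrow> a2 y \<in> YD" "\<And>y. y \<in> XD \<Longrightarrow> a1 y \<in> XB" "\<And>y. y \<in> YD \<Longrightarrow> a1 y \<in> YB"
      "\<And>y. y \<in> VD \<Longrightarrow> a1 y \<in> VB" "\<And>y. y \<in> VB \<Longrightarrow> a0 y \<in> VC"
    and zero1: "\<And>y. y \<in> YE \<Longrightarrow> a1 (a2 y) = \<zero>\<^bsub>PB\<^esub>"
    and zero0: "\<And>y. y \<in> YD \<Longrightarrow> a0 (a1 y) = \<zero>\<^bsub>PC\<^esub>"
begin

sublocale E: module R PE by (rule mods)
sublocale D: module R PD by (rule mods)
sublocale B: module R PB by (rule mods)
sublocale C: module R PC by (rule mods)

lemma carriers:
  "e \<in> YE \<Longrightarrow> e \<in> carrier PE" "d \<in> YD \<Longrightarrow> d \<in> carrier PD" "b \<in> YB \<Longrightarrow> b \<in> carrier PB"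
  "d \<in> XD \<Longrightarrow> d \<in> carrier PD" "b \<in> XB \<Longrightarrow> b \<in> carrier PB"
  "d \<in> VD \<Longrightarrow> d \<in> carrier PD" "b \<in> VB \<Longrightarrow> b \<in> carrier PB"
  using E.submoduleE(1)[OF subs(8)] D.submoduleE(1)[OF subs(3)] B.submoduleE(1)[OF subs(6)] incl by blast+

text \<open>The piece \<open>H_D(Y/X) -> H_B(X/V) -> H_B(Y/V)\<close> of the long exact sequence.
  \<open>?W\<close> consists of the cycles of \<open>X/V\<close> that bound in \<open>Y/V\<close>:
  modulo \<open>?W\<close> the cycles embed into \<open>H_B(Y/V)\<close>, and \<open>?W\<close>
  modulo boundaries is the image of the connecting homomorphism, whose graph, read backwards, is the
  second relation.\<close>

lemma sq_sub:
  assumes mid: "sq PB (cyc a0 YB VC) (bnd PB a1 YD VB)"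
    and quo: "sq PD (cyc a1 YD XB) (bnd PD a2 YE XD)"
  shows "sq PB (cyc a0 XB VC) (bnd PB a1 XD VB)"
proof -
  let ?W = "cyc a0 XB VC \<inter> bnd PB a1 YD VB"
  have cX: "submodule (cyc a0 XB VC) R PB" and cY: "submodule (cyc a0 YB VC) R PB"
    and cq: "submodule (cyc a1 YD XB) R PD"
    by (rule submodule_cyc[OF mods(3,4) homs(3) subs(5,7)] submodule_cyc[OF mods(3,4) homs(3) subs(6,7)]
        submodule_cyc[OF mods(2,3) homs(2) subs(3,5)])+
  have bX: "submodule (bnd PB a1 XD VB) R PB" and bY: "submodule (bnd PB a1 YD VB) R PB"
    by (rule submodule_bnd[OF mods(2,3) homs(2) subs(2,4)] submodule_bnd[OF mods(2,3) homs(2) subs(3,4)])+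
  have W: "submodule ?W R PB" by (rule B.submodule_Int[OF cX bY])
  have bW: "bnd PB a1 XD VB \<subseteq> ?W"
  proof
    fix u assume "u \<in> bnd PB a1 XD VB"
    then obtain x v where u: "u = a1 x \<oplus>\<^bsub>PB\<^esub> v" "x \<in> XD" "v \<in> VB" by (auto simp: bnd_def)
    have "u \<in> XB" using u incl maps(2) B.submoduleE(5)[OF subs(5)] by blast
    moreover have "a0 u = a0 v"
      using u incl carriers zero0[of x] mod_homD[OF homs(3)] mod_homD(1)[OF homs(2)] by (auto simp: subset_iff)
    moreover have "x \<in> YD" using u incl by blast
    ultimately show "u \<in> ?W" using u maps(5) unfolding cyc_def bnd_def by auto
  qed
  have "sq PB (cyc a0 XB VC) ?W"
    by (rule sq_transfer[OF mods(3) cX W _ mods(3) cY mid, where \<Gamma> = "(=)"])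
      (use incl in \<open>auto simp: cyc_def\<close>)
  moreover have "sq PB ?W (bnd PB a1 XD VB)"
  proof (rule sq_transfer[OF mods(3) W bX bW mods(2) cq quo,
        where \<Gamma> = "\<lambda>u y. \<exists>v\<in>VB. u = a1 y \<oplus>\<^bsub>PB\<^esub> v"])
    fix u assume "u \<in> ?W"
    then obtain y v where u: "u \<in> XB" "u = a1 y \<oplus>\<^bsub>PB\<^esub> v" "y \<in> YD" "v \<in> VB" by (auto simp: cyc_def bnd_def)
    have "a1 y = u \<ominus>\<^bsub>PB\<^esub> v" using u carriers mod_homD(1)[OF homs(2)] by (simp add: B.minus_add_cancel)
    moreover have "u \<ominus>\<^bsub>PB\<^esub> v \<in> XB" using u(1,4) incl B.submodule_minus[OF subs(5)] by blast
    ultimately have "y \<in> cyc a1 YD XB" using u(3) by (simp add: cyc_def)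
    then show "\<exists>u'\<in>cyc a1 YD XB. \<exists>v\<in>VB. u = a1 u' \<oplus>\<^bsub>PB\<^esub> v" using u by blast
  next
    fix u v u' v'
    assume "\<exists>w\<in>VB. u = a1 u' \<oplus>\<^bsub>PB\<^esub> w" "\<exists>w\<in>VB. v = a1 v' \<oplus>\<^bsub>PB\<^esub> w" and c: "u' \<in> cyc a1 YD XB" "v' \<in> cyc a1 YD XB"
    then obtain w w' where w: "w \<in> VB" "u = a1 u' \<oplus>\<^bsub>PB\<^esub> w" "w' \<in> VB" "v = a1 v' \<oplus>\<^bsub>PB\<^esub> w'" by blast
    then have "u \<oplus>\<^bsub>PB\<^esub> v = a1 (u' \<oplus>\<^bsub>PD\<^esub> v') \<oplus>\<^bsub>PB\<^esub> (w \<oplus>\<^bsub>PB\<^esub> w')"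
      using c carriers mod_homD[OF homs(2)] by (simp add: cyc_def B.a_assoc B.a_lcomm)
    then show "\<exists>w\<in>VB. u \<oplus>\<^bsub>PB\<^esub> v = a1 (u' \<oplus>\<^bsub>PD\<^esub> v') \<oplus>\<^bsub>PB\<^esub> w"
      using w B.submoduleE(5)[OF subs(4)] by blast
  next
    fix a u u' assume a: "a \<in> carrier R" and "\<exists>w\<in>VB. u = a1 u' \<oplus>\<^bsub>PB\<^esub> w" and c: "u' \<in> cyc a1 YD XB"
    then obtain w where w: "w \<in> VB" "u = a1 u' \<oplus>\<^bsub>PB\<^esub> w" by blast
    then have "a \<odot>\<^bsub>PB\<^esub> u = a1 (a \<odot>\<^bsub>PD\<^esub> u') \<oplus>\<^bsub>PB\<^esub> (a \<odot>\<^bsub>PB\<^esub> w)"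
      using a c carriers mod_homD[OF homs(2)] by (simp add: cyc_def B.smult_r_distr)
    then show "\<exists>w\<in>VB. a \<odot>\<^bsub>PB\<^esub> u = a1 (a \<odot>\<^bsub>PD\<^esub> u') \<oplus>\<^bsub>PB\<^esub> w"
      using w a B.submoduleE(4)[OF subs(4)] by blast
  next
    fix u y assume "\<exists>v\<in>VB. u = a1 y \<oplus>\<^bsub>PB\<^esub> v" "y \<in> bnd PD a2 YE XD"
    then obtain v y2 x where *: "v \<in> VB" "u = a1 y \<oplus>\<^bsub>PB\<^esub> v" "y = a2 y2 \<oplus>\<^bsub>PD\<^esub> x" "y2 \<in> YE" "x \<in> XD"
      by (auto simp: bnd_def)
    then have "a1 y = a1 x"
      using carriers maps(1) mod_homD[OF homs(2)] zero1 by simp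
    then show "u \<in> bnd PB a1 XD VB" using * by (auto simp: bnd_def)
  qed
  ultimately show ?thesis using sq_ext[OF mods(3) cX bX W bW] by blast
qed

text \<open>The piece \<open>H_D(Y/V) -> H_D(Y/X) -> H_B(X/V)\<close> of the same sequence. On
  representatives the connecting homomorphism is \<open>a1\<close> itself, and \<open>?W\<close> is
  its kernel; \<open>?W\<close> modulo boundaries is the image of \<open>H_D(Y/V)\<close>.\<close>

lemma sq_quot:
  assumes mid: "sq PD (cyc a1 YD VB) (bnd PD a2 YE VD)"
    and sub: "sq PB (cyc a0 XB VC) (bnd PB a1 XD VB)"
  shows "sq PD (cyc a1 YD XB) (bnd PD a2 YE XD)"
proof -
  let ?W = "cyc a1 (cyc a1 YD XB) (bnd PB a1 XD VB)"
  have cX: "submodule (cyc a0 XB VC) R PB" and cY: "submodule (cyc a1 YD VB) R PD"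
    and cq: "submodule (cyc a1 YD XB) R PD"
    by (rule submodule_cyc[OF mods(3,4) homs(3) subs(5,7)] submodule_cyc[OF mods(2,3) homs(2) subs(3,4)]
        submodule_cyc[OF mods(2,3) homs(2) subs(3,5)])+
  have bX: "submodule (bnd PB a1 XD VB) R PB" and bq: "submodule (bnd PD a2 YE XD) R PD"
    by (rule submodule_bnd[OF mods(2,3) homs(2) subs(2,4)] submodule_bnd[OF mods(1,2) homs(1) subs(8,2)])+
  have W: "submodule ?W R PD" by (rule submodule_cyc[OF mods(2,3) homs(2) cq bX])
  have Wq: "?W \<subseteq> cyc a1 YD XB" by (auto simp: cyc_def)
  have bW: "bnd PD a2 YE XD \<subseteq> ?W"
  proof
    fix u assume "u \<in> bnd PD a2 YE XD"
    then obtain y x where u: "u = a2 y \<oplus>\<^bsub>PD\<^esub> x" "y \<in> YE" "x \<in> XD" by (auto simp: bnd_def)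
    have "u \<in> YD" using u incl maps(1) D.submoduleE(5)[OF subs(3)] by blast
    moreover have "a1 u = a1 x \<oplus>\<^bsub>PB\<^esub> \<zero>\<^bsub>PB\<^esub>"
      using u carriers maps(1) mod_homD[OF homs(2)] zero1 by simp
    moreover have "a1 x \<oplus>\<^bsub>PB\<^esub> \<zero>\<^bsub>PB\<^esub> \<in> XB" using u maps(2) carriers by simp
    ultimately show "u \<in> ?W" using u B.submodule_zero[OF subs(4)] by (auto simp: cyc_def bnd_def)
  qed
  have "sq PD (cyc a1 YD XB) ?W"
  proof (rule sq_inj[OF mods(2) cq W Wq mods(3) cX sub homs(2)])
    fix u assume "u \<in> cyc a1 YD XB"
    then show "a1 u \<in> cyc a0 XB VC" using zero0 C.submodule_zero[OF subs(7)] by (auto simp: cyc_def)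
  qed (auto simp: cyc_def)
  moreover have "sq PD ?W (bnd PD a2 YE XD)"
  proof (rule sq_transfer[OF mods(2) W bq bW mods(2) cY mid,
        where \<Gamma> = "\<lambda>u y. \<exists>x\<in>XD. u = y \<oplus>\<^bsub>PD\<^esub> x"])
    fix u assume "u \<in> ?W"
    then obtain x v where u: "u \<in> YD" "a1 u = a1 x \<oplus>\<^bsub>PB\<^esub> v" "x \<in> XD" "v \<in> VB" by (auto simp: cyc_def bnd_def)
    \<comment> \<open>Subtracting the element \<open>x\<close> of \<open>XD\<close>, which has the
      same image as \<open>u\<close> up to \<open>VB\<close>, leaves a cycle of
      \<open>Y/V\<close>.\<close>
    have "a1 (u \<ominus>\<^bsub>PD\<^esub> x) = a1 u \<ominus>\<^bsub>PB\<^esub> a1 x"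
      using u carriers mod_hom_minus[OF mods(2,3) homs(2)] by blast
    also have "\<dots> = v" using u carriers maps(2) 
      by (simp add: B.a_comm[of "a1 x" v] B.minus_add_cancel)
    finally have "u \<ominus>\<^bsub>PD\<^esub> x \<in> cyc a1 YD VB"
      using u incl D.submodule_minus[OF subs(3)] by (auto simp: cyc_def)
    moreover have "u = (u \<ominus>\<^bsub>PD\<^esub> x) \<oplus>\<^bsub>PD\<^esub> x" using u carriers by (simp add: D.add_minus_cancel)
    ultimately show "\<exists>u'\<in>cyc a1 YD VB. \<exists>x\<in>XD. u = u' \<oplus>\<^bsub>PD\<^esub> x" using u by blast
  next
    fix u v u' v'
    assume "\<exists>w\<in>XD. u = u' \<oplus>\<^bsub>PD\<^esub> w" "\<exists>w\<in>XD. v = v' \<oplus>\<^bsub>PD\<^esub> w" and c: "u' \<in> cyc a1 YD VB" "v' \<in> cyc a1 YD VB"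
    then obtain w w' where w: "w \<in> XD" "u = u' \<oplus>\<^bsub>PD\<^esub> w" "w' \<in> XD" "v = v' \<oplus>\<^bsub>PD\<^esub> w'" by blast
    then have "u \<oplus>\<^bsub>PD\<^esub> v = (u' \<oplus>\<^bsub>PD\<^esub> v') \<oplus>\<^bsub>PD\<^esub> (w \<oplus>\<^bsub>PD\<^esub> w')"
      using c carriers by (simp add: cyc_def D.a_assoc D.a_lcomm)
    then show "\<exists>w\<in>XD. u \<oplus>\<^bsub>PD\<^esub> v = (u' \<oplus>\<^bsub>PD\<^esub> v') \<oplus>\<^bsub>PD\<^esub> w"
      using w D.submoduleE(5)[OF subs(2)] by blast
  next
    fix a u u' assume a: "a \<in> carrier R" and "\<exists>w\<in>XD. u = u' \<oplus>\<^bsub>PD\<^esub> w" and c: "u' \<in> cyc a1 YD VB"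
    then obtain w where w: "w \<in> XD" "u = u' \<oplus>\<^bsub>PD\<^esub> w" by blast
    then have "a \<odot>\<^bsub>PD\<^esub> u = (a \<odot>\<^bsub>PD\<^esub> u') \<oplus>\<^bsub>PD\<^esub> (a \<odot>\<^bsub>PD\<^esub> w)"
      using a c carriers by (simp add: cyc_def D.smult_r_distr)
    then show "\<exists>w\<in>XD. a \<odot>\<^bsub>PD\<^esub> u = (a \<odot>\<^bsub>PD\<^esub> u') \<oplus>\<^bsub>PD\<^esub> w"
      using w a D.submoduleE(4)[OF subs(2)] by blast
  next
    fix u y assume "\<exists>x\<in>XD. u = y \<oplus>\<^bsub>PD\<^esub> x" "y \<in> bnd PD a2 YE VD"
    then obtain x y2 w where *: "x \<in> XD" "u = y \<oplus>\<^bsub>PD\<^esub> x" "y = a2 y2 \<oplus>\<^bsub>PD\<^esub> w" "y2 \<in> YE" "w \<in> VD"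
      by (auto simp: bnd_def)
    then have "u = a2 y2 \<oplus>\<^bsub>PD\<^esub> (w \<oplus>\<^bsub>PD\<^esub> x)"
      using carriers maps(1) by (simp add: D.a_assoc)
    moreover have "w \<oplus>\<^bsub>PD\<^esub> x \<in> XD" using * incl D.submoduleE(5)[OF subs(2)] by blast
    ultimately show "u \<in> bnd PD a2 YE XD" using * by (auto simp: bnd_def)
  qed
  ultimately show ?thesis using sq_ext[OF mods(2) cq bq W bW Wq] by blast
qed

end

section \<open>Powers of a module and matrices\<close>

text \<open>The product of copies of \<open>M\<close>, for finite \<open>B\<close> the direct sum.
  Its elements are extensional, like those of \<open>hom_mod\<close>, so that equal vectors are
  equal elements. The index set may be infinite: \<open>hom_module\<close> takes a whole
  carrier.\<close>

definition pow_mod :: "'b set \<Rightarrow> ('a,'m,'x) module_scheme \<Rightarrow> ('a,'b \<Rightarrow> 'm) module" where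
  "pow_mod B M = \<lparr>carrier = B \<rightarrow>\<^sub>E carrier M, monoid.mult = undefined, one = undefined,
     ring.zero = (\<lambda>b\<in>B. \<zero>\<^bsub>M\<^esub>), ring.add = (\<lambda>u v. \<lambda>b\<in>B. u b \<oplus>\<^bsub>M\<^esub> v b),
     smult = (\<lambda>a u. \<lambda>b\<in>B. a \<odot>\<^bsub>M\<^esub> u b)\<rparr>"

lemma pow_mod_simps [simp]:
  "carrier (pow_mod B M) = B \<rightarrow>\<^sub>E carrier M" "\<zero>\<^bsub>pow_mod B M\<^esub> = (\<lambda>b\<in>B. \<zero>\<^bsub>M\<^esub>)"
  "u \<oplus>\<^bsub>pow_mod B M\<^esub> v = (\<lambda>b\<in>B. u b \<oplus>\<^bsub>M\<^esub> v b)" "a \<odot>\<^bsub>pow_mod B M\<^esub> u = (\<lambda>b\<in>B. a \<odot>\<^bsub>M\<^esub> u b)"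
  by (simp_all add: pow_mod_def)

lemma pow_module:
  assumes "module R M"
  shows "module R (pow_mod B M)"
proof -
  interpret M: module R M by fact
  have "abelian_group (pow_mod B M)"
  proof (rule abelian_groupI)
    fix u assume "u \<in> carrier (pow_mod B M)"
    then show "\<exists>v\<in>carrier (pow_mod B M). v \<oplus>\<^bsub>pow_mod B M\<^esub> u = \<zero>\<^bsub>pow_mod B M\<^esub>"
      by (intro bexI[of _ "\<lambda>b\<in>B. \<ominus>\<^bsub>M\<^esub> u b"]) (auto simp: M.l_neg PiE_iff fun_eq_iff)
    show "\<zero>\<^bsub>pow_mod B M\<^esub> \<oplus>\<^bsub>pow_mod B M\<^esub> u = u"
      using \<open>u \<in> _\<close> by (auto simp: PiE_iff fun_eq_iff extensional_def)
  qed (auto simp: fun_eq_iff PiE_iff M.a_assoc intro: M.a_comm)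
  then show ?thesis
    by (rule moduleI[OF M.R.cring_axioms])
      (auto simp: fun_eq_iff PiE_iff M.smult_l_distr M.smult_r_distr M.smult_assoc1 extensional_def)
qed

lemma pow_minus:
  assumes M: "module R M" and "u \<in> B \<rightarrow>\<^sub>E carrier M" "v \<in> B \<rightarrow>\<^sub>E carrier M"
  shows "u \<ominus>\<^bsub>pow_mod B M\<^esub> v = (\<lambda>b\<in>B. u b \<ominus>\<^bsub>M\<^esub> v b)"
proof -
  interpret M: module R M by fact
  interpret P: module R "pow_mod B M" by (rule pow_module[OF M])
  show ?thesis using assms P.minus_as_smult[of u v]
    by (auto simp: fun_eq_iff M.minus_as_smult PiE_iff)
qed

lemma submodule_pow:
  assumes M: "module R M" and U: "submodule U R M"
  shows "submodule (B \<rightarrow>\<^sub>E U) R (pow_mod B M)"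
proof -
  interpret M: module R M by fact
  interpret P: module R "pow_mod B M" by (rule pow_module[OF M])
  note Us = M.submoduleE[OF U]
  show ?thesis
    by (rule P.submoduleI') (use Us(1,4,5) M.submodule_zero[OF U] in \<open>auto simp: PiE_iff\<close>)
qed

text \<open>The matrix \<open>A\<close>, with rows \<open>C\<close> and columns \<open>B\<close>,
  acts on columns of elements of \<open>M\<close>. Once tensor products with finite free modules,
  and Hom modules from them, are identified with powers of \<open>M\<close>, all differentials have
  this form.\<close>

definition mact ::
  "('a,'m,'x) module_scheme \<Rightarrow> 'c set \<Rightarrow> 'b set \<Rightarrow> ('c \<Rightarrow> 'b \<Rightarrow> 'a) \<Rightarrow> ('b \<Rightarrow> 'm) \<Rightarrow> 'c \<Rightarrow> 'm" where
  "mact M C B A u = (\<lambda>c\<in>C. \<Oplus>\<^bsub>M\<^esub>b\<in>B. A c b \<odot>\<^bsub>M\<^esub> u b)"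

lemma (in abelian_monoid) finsum_swap:
  assumes "finite A" "finite B" "\<And>a b. a \<in> A \<Longrightarrow> b \<in> B \<Longrightarrow> f a b \<in> carrier G"
  shows "(\<Oplus>a\<in>A. \<Oplus>b\<in>B. f a b) = (\<Oplus>b\<in>B. \<Oplus>a\<in>A. f a b)"
  using assms(1,3)
proof (induction A)
  case (insert x A)
  have "(\<Oplus>b\<in>B. \<Oplus>a\<in>insert x A. f a b) = (\<Oplus>b\<in>B. f x b \<oplus> (\<Oplus>a\<in>A. f a b))"
    by (rule finsum_cong') (use insert in \<open>auto simp: finsum_insert intro!: finsum_closed\<close>)
  also have "\<dots> = (\<Oplus>b\<in>B. f x b) \<oplus> (\<Oplus>b\<in>B. \<Oplus>a\<in>A. f a b)"
    by (rule finsum_addf) (use insert in \<open>auto intro!: finsum_closed\<close>)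
  finally show ?case using insert by (simp add: finsum_insert Pi_iff)
qed simp

lemma (in module) finsum_smult_rdistr:
  assumes "finite A" "x \<in> carrier M" "f \<in> A \<rightarrow> carrier R"
  shows "(\<Oplus>i\<in>A. f i) \<odot>\<^bsub>M\<^esub> x = (\<Oplus>\<^bsub>M\<^esub>i\<in>A. f i \<odot>\<^bsub>M\<^esub> x)"
  using assms(1,3)
proof (induction A)
  case (insert a A)
  then show ?case using assms(2) by (simp add: Pi_iff smult_l_distr)
qed (simp add: assms(2))

lemma mod_hom_finsum:
  assumes M: "module R M" and N: "module R N" and f: "f \<in> mod_hom R M N"
    and "finite A" "u \<in> A \<rightarrow> carrier M"
  shows "f (\<Oplus>\<^bsub>M\<^esub>a\<in>A. u a) = (\<Oplus>\<^bsub>N\<^esub>a\<in>A. f (u a))"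
proof -
  interpret M: module R M by fact
  interpret N: module R N by fact
  note f' = mod_homD[OF f] mod_hom_zero[OF M N f]
  show ?thesis using assms(4,5)
  proof (induction A)
    case (insert a A)
    then have "f (\<Oplus>\<^bsub>M\<^esub>a\<in>insert a A. u a) = f (u a \<oplus>\<^bsub>M\<^esub> (\<Oplus>\<^bsub>M\<^esub>a\<in>A. u a))"
      by (simp add: M.finsum_insert Pi_iff)
    also have "\<dots> = f (u a) \<oplus>\<^bsub>N\<^esub> f (\<Oplus>\<^bsub>M\<^esub>a\<in>A. u a)"
      using insert by (intro f' M.finsum_closed) auto
    finally show ?case using insert f' by (simp add: N.finsum_insert Pi_iff)
  qed (simp add: f')
qed

lemma (in module) submodule_finsum:
  assumes U: "submodule U R M" and "finite A" "\<And>a. a \<in> A \<Longrightarrow> u a \<in> U"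
  shows "(\<Oplus>\<^bsub>M\<^esub>a\<in>A. u a) \<in> U"
  using assms(2,3)
proof (induction A)
  case (insert a A)
  then have "(\<Oplus>\<^bsub>M\<^esub>a\<in>insert a A. u a) = u a \<oplus>\<^bsub>M\<^esub> (\<Oplus>\<^bsub>M\<^esub>a\<in>A. u a)"
    using submoduleE(1)[OF U] by (intro M.finsum_insert) auto
  then show ?case using insert submoduleE(5)[OF U] by simp
qed (simp add: submodule_zero[OF U])

context module begin

lemma mact_sub:
  assumes "finite B" "A \<in> C \<rightarrow> B \<rightarrow> carrier R" "submodule U R M" "u \<in> B \<rightarrow>\<^sub>E U"
  shows "mact M C B A u \<in> C \<rightarrow>\<^sub>E U"
  unfolding mact_def using assms submoduleE(4)[OF assms(3)]
  by (auto intro!: submodule_finsum simp: Pi_iff PiE_iff)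

lemma mact_closed:
  assumes "finite B" "A \<in> C \<rightarrow> B \<rightarrow> carrier R" "u \<in> B \<rightarrow>\<^sub>E carrier M"
  shows "mact M C B A u \<in> C \<rightarrow>\<^sub>E carrier M"
  using mact_sub[OF assms(1,2) carrier_is_submodule assms(3)] .

lemma mact_hom:
  assumes B: "finite B" and A: "A \<in> C \<rightarrow> B \<rightarrow> carrier R"
  shows "mact M C B A \<in> mod_hom R (pow_mod B M) (pow_mod C M)"
proof (rule mod_homI)
  fix u assume u: "u \<in> carrier (pow_mod B M)"
  then have u': "\<And>b. b \<in> B \<Longrightarrow> u b \<in> carrier M" by auto
  have A': "\<And>c b. c \<in> C \<Longrightarrow> b \<in> B \<Longrightarrow> A c b \<in> carrier R" using A by auto
  show "mact M C B A u \<in> carrier (pow_mod C M)" using mact_closed[OF B A] u by simp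
  { fix v assume v: "v \<in> carrier (pow_mod B M)"
    then have v': "\<And>b. b \<in> B \<Longrightarrow> v b \<in> carrier M" by auto
    have "(\<Oplus>\<^bsub>M\<^esub>b\<in>B. A c b \<odot>\<^bsub>M\<^esub> (\<lambda>b\<in>B. u b \<oplus>\<^bsub>M\<^esub> v b) b) =
      (\<Oplus>\<^bsub>M\<^esub>b\<in>B. A c b \<odot>\<^bsub>M\<^esub> u b) \<oplus>\<^bsub>M\<^esub> (\<Oplus>\<^bsub>M\<^esub>b\<in>B. A c b \<odot>\<^bsub>M\<^esub> v b)" if c: "c \<in> C" for c
    proof -
      have "(\<Oplus>\<^bsub>M\<^esub>b\<in>B. A c b \<odot>\<^bsub>M\<^esub> (\<lambda>b\<in>B. u b \<oplus>\<^bsub>M\<^esub> v b) b) =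
        (\<Oplus>\<^bsub>M\<^esub>b\<in>B. A c b \<odot>\<^bsub>M\<^esub> u b \<oplus>\<^bsub>M\<^esub> A c b \<odot>\<^bsub>M\<^esub> v b)"
        by (rule M.finsum_cong') (use u' v' A' c in \<open>auto simp: smult_r_distr\<close>)
      then show ?thesis using u' v' A' c by (simp add: M.finsum_addf Pi_iff)
    qed
    then show "mact M C B A (u \<oplus>\<^bsub>pow_mod B M\<^esub> v) = mact M C B A u \<oplus>\<^bsub>pow_mod C M\<^esub> mact M C B A v"
      by (auto simp: mact_def fun_eq_iff) }
  { fix a assume a: "a \<in> carrier R"
    have "(\<Oplus>\<^bsub>M\<^esub>b\<in>B. A c b \<odot>\<^bsub>M\<^esub> (\<lambda>b\<in>B. a \<odot>\<^bsub>M\<^esub> u b) b) =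
      a \<odot>\<^bsub>M\<^esub> (\<Oplus>\<^bsub>M\<^esub>b\<in>B. A c b \<odot>\<^bsub>M\<^esub> u b)" if c: "c \<in> C" for c
    proof -
      have "(\<Oplus>\<^bsub>M\<^esub>b\<in>B. A c b \<odot>\<^bsub>M\<^esub> (\<lambda>b\<in>B. a \<odot>\<^bsub>M\<^esub> u b) b) =
        (\<Oplus>\<^bsub>M\<^esub>b\<in>B. a \<odot>\<^bsub>M\<^esub> (A c b \<odot>\<^bsub>M\<^esub> u b))"
        by (rule M.finsum_cong') (use u' a A' c in \<open>auto simp: smult_assoc1[symmetric] R.m_comm\<close>)
      also have "\<dots> = a \<odot>\<^bsub>M\<^esub> (\<Oplus>\<^bsub>M\<^esub>b\<in>B. A c b \<odot>\<^bsub>M\<^esub> u b)"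
        using u' a A' c by (intro finsum_smult_ldistr[symmetric] B) auto
      finally show ?thesis .
    qed
    then show "mact M C B A (a \<odot>\<^bsub>pow_mod B M\<^esub> u) = a \<odot>\<^bsub>pow_mod C M\<^esub> mact M C B A u"
      by (auto simp: mact_def fun_eq_iff) }
qed

lemma mact_mact:
  assumes B: "finite B" and D: "finite D" and A: "A \<in> C \<rightarrow> B \<rightarrow> carrier R" and A': "A' \<in> B \<rightarrow> D \<rightarrow> carrier R"
    and u: "u \<in> D \<rightarrow>\<^sub>E carrier M"
  shows "mact M C B A (mact M B D A' u) = mact M C D (\<lambda>c d. \<Oplus>b\<in>B. A c b \<otimes> A' b d) u"
proof
  fix c
  have a: "\<And>c b. c \<in> C \<Longrightarrow> b \<in> B \<Longrightarrow> A c b \<in> carrier R" "\<And>b d. b \<in> B \<Longrightarrow> d \<in> D \<Longrightarrow> A' b d \<in> carrier R"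
    "\<And>d. d \<in> D \<Longrightarrow> u d \<in> carrier M"
    using A A' u by auto
  show "mact M C B A (mact M B D A' u) c = mact M C D (\<lambda>c d. \<Oplus>b\<in>B. A c b \<otimes> A' b d) u c"
  proof (cases "c \<in> C")
    case c: True
    have "mact M C B A (mact M B D A' u) c = (\<Oplus>\<^bsub>M\<^esub>b\<in>B. A c b \<odot>\<^bsub>M\<^esub> (\<Oplus>\<^bsub>M\<^esub>d\<in>D. A' b d \<odot>\<^bsub>M\<^esub> u d))"
      unfolding mact_def using c a by (auto intro!: M.finsum_cong' M.finsum_closed)
    also have "\<dots> = (\<Oplus>\<^bsub>M\<^esub>b\<in>B. \<Oplus>\<^bsub>M\<^esub>d\<in>D. (A c b \<otimes> A' b d) \<odot>\<^bsub>M\<^esub> u d)"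
      using c a by (intro M.finsum_cong') (auto simp: finsum_smult_ldistr[OF D] smult_assoc1 Pi_iff intro!: M.finsum_closed M.finsum_cong')
    also have "\<dots> = (\<Oplus>\<^bsub>M\<^esub>d\<in>D. \<Oplus>\<^bsub>M\<^esub>b\<in>B. (A c b \<otimes> A' b d) \<odot>\<^bsub>M\<^esub> u d)"
      using c a by (intro M.finsum_swap B D) auto
    also have "\<dots> = (\<Oplus>\<^bsub>M\<^esub>d\<in>D. (\<Oplus>b\<in>B. A c b \<otimes> A' b d) \<odot>\<^bsub>M\<^esub> u d)"
      using c a by (intro M.finsum_cong') (auto simp: finsum_smult_rdistr[OF B] Pi_iff intro!: M.finsum_closed)
    finally show ?thesis using c by (simp add: mact_def)
  qed (simp add: mact_def)
qed

lemma mact_zero: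
  assumes "\<And>c b. c \<in> C \<Longrightarrow> b \<in> B \<Longrightarrow> A c b = \<zero>" "u \<in> B \<rightarrow>\<^sub>E carrier M"
  shows "mact M C B A u = \<zero>\<^bsub>pow_mod C M\<^esub>"
proof -
  have "(\<Oplus>\<^bsub>M\<^esub>b\<in>B. A c b \<odot>\<^bsub>M\<^esub> u b) = \<zero>\<^bsub>M\<^esub>" if "c \<in> C" for c
  proof -
    have "(\<Oplus>\<^bsub>M\<^esub>b\<in>B. A c b \<odot>\<^bsub>M\<^esub> u b) = (\<Oplus>\<^bsub>M\<^esub>b\<in>B. \<zero>\<^bsub>M\<^esub>)"
      by (rule M.finsum_cong') (use assms that in \<open>auto simp: PiE_iff\<close>)
    then show ?thesis by simp
  qed
  then show ?thesis by (auto simp: mact_def)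
qed

end

text \<open>The entries are scalars, so a matrix acts compatibly with every homomorphism of
  coefficients. With \<open>eval_hom\<close> this also gives the action on each coordinate of a
  power.\<close>

lemma mact_natural:
  assumes M: "module R M" and N: "module R N" and f: "f \<in> mod_hom R M N"
    and B: "finite B" and A: "A \<in> C \<rightarrow> B \<rightarrow> carrier R" and u: "u \<in> B \<rightarrow>\<^sub>E carrier M"
  shows "mact N C B A (\<lambda>b\<in>B. f (u b)) = (\<lambda>c\<in>C. f (mact M C B A u c))"
proof
  fix c
  interpret M: module R M by fact
  interpret N: module R N by fact
  have a: "\<And>c b. c \<in> C \<Longrightarrow> b \<in> B \<Longrightarrow> A c b \<in> carrier R" "\<And>d. d \<in> B \<Longrightarrow> u d \<in> carrier M"
    using A u by auto
  show "mact N C B A (\<lambda>b\<in>B. f (u b)) c = (\<lambda>c\<in>C. f (mact M C B A u c)) c"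
  proof (cases "c \<in> C")
    case c: True
    have "f (\<Oplus>\<^bsub>M\<^esub>b\<in>B. A c b \<odot>\<^bsub>M\<^esub> u b) = (\<Oplus>\<^bsub>N\<^esub>b\<in>B. f (A c b \<odot>\<^bsub>M\<^esub> u b))"
      using a c by (intro mod_hom_finsum[OF M N f B]) auto
    also have "\<dots> = (\<Oplus>\<^bsub>N\<^esub>b\<in>B. A c b \<odot>\<^bsub>N\<^esub> (\<lambda>b\<in>B. f (u b)) b)"
      using a c mod_homD(1)[OF f] by (intro N.finsum_cong') (auto simp: mod_homD(3)[OF f])
    finally show ?thesis using c by (simp add: mact_def)
  qed (simp add: mact_def)
qed

definition mat_step ::
  "('a,'r) ring_scheme \<Rightarrow> 'c set \<Rightarrow> 'b set \<Rightarrow> 'd set \<Rightarrow> ('c \<Rightarrow> 'b \<Rightarrow> 'a) \<Rightarrow> ('b \<Rightarrow> 'd \<Rightarrow> 'a) \<Rightarrow> bool" where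
  "mat_step R C B D A A' \<longleftrightarrow> finite C \<and> finite B \<and> finite D
     \<and> A \<in> C \<rightarrow> B \<rightarrow> carrier R \<and> A' \<in> B \<rightarrow> D \<rightarrow> carrier R
     \<and> (\<forall>c\<in>C. \<forall>d\<in>D. (\<Oplus>\<^bsub>R\<^esub>b\<in>B. A c b \<otimes>\<^bsub>R\<^esub> A' b d) = \<zero>\<^bsub>R\<^esub>)"

lemma mat_stepD:
  assumes "mat_step R C B D A A'"
  shows "finite C" "finite B" "finite D" "A \<in> C \<rightarrow> B \<rightarrow> carrier R" "A' \<in> B \<rightarrow> D \<rightarrow> carrier R"
  using assms by (auto simp: mat_step_def)

lemma mat_step_zero:
  assumes M: "module R M" and st: "mat_step R C B D A A'" and y: "y \<in> D \<rightarrow>\<^sub>E carrier M"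
  shows "mact M C B A (mact M B D A' y) = \<zero>\<^bsub>pow_mod C M\<^esub>"
proof -
  interpret M: module R M by fact
  note s = mat_stepD[OF st]
  show ?thesis unfolding M.mact_mact[OF s(2,3,4,5) y]
    by (rule M.mact_zero[OF _ y]) (use st in \<open>auto simp: mat_step_def\<close>)
qed

lemma PiE_zero: "B \<rightarrow>\<^sub>E {\<zero>\<^bsub>M\<^esub>} = {\<zero>\<^bsub>pow_mod B M\<^esub>}"
  by (auto simp: PiE_iff fun_eq_iff extensional_def)

lemma eval_hom: "b \<in> B \<Longrightarrow> (\<lambda>u. u b) \<in> mod_hom R (pow_mod B M) M"
  by (rule mod_homI) auto

section \<open>Homology of matrix complexes with coefficients in a subquotient\<close>

context serre_class begin

text \<open>A finite power is an iterated extension. \<open>?W\<close> collects the vectors whose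
  coordinate at \<open>b\<close> lies in \<open>V\<close>: the quotient by it embeds into
  \<open>U / V\<close> by evaluation at \<open>b\<close>, and \<open>?W\<close> modulo
  \<open>V\<close> into the power over the remaining indices.\<close>

lemma sq_power:
  assumes M: "module R M" and U: "submodule U R M" and V: "submodule V R M" and VU: "V \<subseteq> U"
    and "finite B" and sq: "sq M U V"
  shows "sq (pow_mod B M) (B \<rightarrow>\<^sub>E U) (B \<rightarrow>\<^sub>E V)"
  using \<open>finite B\<close>
proof (induction B)
  case empty
  have "submodule ({} \<rightarrow>\<^sub>E U) R (pow_mod {} M)" by (rule submodule_pow[OF M U])
  from sq_trivial[OF pow_module[OF M] this] show ?case by simp
next
  case (insert b B)
  let ?P = "pow_mod (insert b B) M"
  let ?W = "{u \<in> insert b B \<rightarrow>\<^sub>E U. u b \<in> V}"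
  have P: "module R ?P" and Q: "module R (pow_mod B M)" by (rule pow_module[OF M])+
  have e: "(\<lambda>u. u b) \<in> mod_hom R ?P M" by (rule eval_hom) simp
  have UP: "submodule (insert b B \<rightarrow>\<^sub>E U) R ?P" and VP: "submodule (insert b B \<rightarrow>\<^sub>E V) R ?P"
    by (rule submodule_pow[OF M U] submodule_pow[OF M V])+
  have W: "submodule ?W R ?P" by (rule submodule_vimage[OF P M e UP V])
  have "sq ?P (insert b B \<rightarrow>\<^sub>E U) ?W"
    by (rule sq_inj[OF P UP W _ M U sq e]) auto
  moreover have "sq ?P ?W (insert b B \<rightarrow>\<^sub>E V)"
  proof (rule sq_inj[OF P W VP _ Q submodule_pow[OF M U] insert.IH])
    show "(\<lambda>u. restrict u B) \<in> mod_hom R ?P (pow_mod B M)"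
      by (rule mod_homI) (auto simp: fun_eq_iff)
    show "u \<in> insert b B \<rightarrow>\<^sub>E V" if "u \<in> ?W" "restrict u B \<in> B \<rightarrow>\<^sub>E V" for u
      using that by (auto simp: PiE_iff)
  qed (use VU in auto)
  ultimately show ?case
    by (intro sq_ext[OF P UP VP W]) (use VU in auto)
qed

text \<open>
  For \<open>V \<subseteq> U\<close>, the homology at \<open>B\<close> of the complex \<open>D \<rightarrow> B \<rightarrow> C\<close> of matrices with coefficients in
  \<open>U / V\<close> belongs to \<open>S\<close>.
\<close>

definition mh :: "('a,'m) module \<Rightarrow> 'c set \<Rightarrow> 'b set \<Rightarrow> 'd set \<Rightarrow> ('c \<Rightarrow> 'b \<Rightarrow> 'a) \<Rightarrow> ('b \<Rightarrow> 'd \<Rightarrow> 'a)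
    \<Rightarrow> 'm set \<Rightarrow> 'm set \<Rightarrow> bool" where
  "mh M C B D A A' U V \<longleftrightarrow> sq (pow_mod B M) (cyc (mact M C B A) (B \<rightarrow>\<^sub>E U) (C \<rightarrow>\<^sub>E V))
     (bnd (pow_mod B M) (mact M B D A') (D \<rightarrow>\<^sub>E U) (B \<rightarrow>\<^sub>E V))"

lemma mh_submodules:
  assumes M: "module R M" and U: "submodule U R M" and V: "submodule V R M" and VU: "V \<subseteq> U"
    and st: "mat_step R C B D A A'"
  shows "submodule (cyc (mact M C B A) (B \<rightarrow>\<^sub>E U) (C \<rightarrow>\<^sub>E V)) R (pow_mod B M)"
    and "submodule (bnd (pow_mod B M) (mact M B D A') (D \<rightarrow>\<^sub>E U) (B \<rightarrow>\<^sub>E V)) R (pow_mod B M)"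
    and "bnd (pow_mod B M) (mact M B D A') (D \<rightarrow>\<^sub>E U) (B \<rightarrow>\<^sub>E V) \<subseteq>
      cyc (mact M C B A) (B \<rightarrow>\<^sub>E U) (C \<rightarrow>\<^sub>E V)"
    and "B \<rightarrow>\<^sub>E V \<subseteq> bnd (pow_mod B M) (mact M B D A') (D \<rightarrow>\<^sub>E U) (B \<rightarrow>\<^sub>E V)"
proof -
  interpret M: module R M by fact
  note s = mat_stepD[OF st]
  interpret PB: module R "pow_mod B M" by (rule pow_module[OF M])
  interpret PC: module R "pow_mod C M" by (rule pow_module[OF M])
  interpret PD: module R "pow_mod D M" by (rule pow_module[OF M])
  note h = M.mact_hom[OF s(2,4)] and h' = M.mact_hom[OF s(3,5)]
  note P = pow_module[OF M] and sp = submodule_pow[OF M]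
  show 1: "submodule (cyc (mact M C B A) (B \<rightarrow>\<^sub>E U) (C \<rightarrow>\<^sub>E V)) R (pow_mod B M)"
    by (rule submodule_cyc[OF P P h sp[OF U] sp[OF V]])
  show 2: "submodule (bnd (pow_mod B M) (mact M B D A') (D \<rightarrow>\<^sub>E U) (B \<rightarrow>\<^sub>E V)) R (pow_mod B M)"
    by (rule submodule_bnd[OF P P h' sp[OF U] sp[OF V]])
  show "bnd (pow_mod B M) (mact M B D A') (D \<rightarrow>\<^sub>E U) (B \<rightarrow>\<^sub>E V) \<subseteq>
      cyc (mact M C B A) (B \<rightarrow>\<^sub>E U) (C \<rightarrow>\<^sub>E V)"
  proof
    fix u assume "u \<in> bnd (pow_mod B M) (mact M B D A') (D \<rightarrow>\<^sub>E U) (B \<rightarrow>\<^sub>E V)"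
    then obtain y v where u: "u = mact M B D A' y \<oplus>\<^bsub>pow_mod B M\<^esub> v" "y \<in> D \<rightarrow>\<^sub>E U" "v \<in> B \<rightarrow>\<^sub>E V"
      unfolding bnd_def by blast
    have y: "mact M B D A' y \<in> B \<rightarrow>\<^sub>E U" by (rule M.mact_sub[OF s(3,5) U u(2)])
    have vU: "v \<in> B \<rightarrow>\<^sub>E U" using u(3) VU by auto
    have Uc: "T \<rightarrow>\<^sub>E U \<subseteq> T \<rightarrow>\<^sub>E carrier M" for T using M.submoduleE(1)[OF U] by auto
    have uc: "u \<in> B \<rightarrow>\<^sub>E U" using PB.submoduleE(5)[OF sp[OF U] y vU] u(1) by simp
    have c: "v \<in> B \<rightarrow>\<^sub>E carrier M" "y \<in> D \<rightarrow>\<^sub>E carrier M" "mact M B D A' y \<in> B \<rightarrow>\<^sub>E carrier M"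
      using vU u(2) y Uc by blast+
    have "mact M C B A u = mact M C B A (mact M B D A' y) \<oplus>\<^bsub>pow_mod C M\<^esub> mact M C B A v"
      unfolding u(1) by (rule mod_homD(2)[OF h]) (use c in simp_all)
    moreover have "mact M C B A v \<in> carrier (pow_mod C M)" using M.mact_closed[OF s(2,4) c(1)] by simp
    ultimately have "mact M C B A u = mact M C B A v"
      unfolding mat_step_zero[OF M st c(2)] using PC.l_zero by metis
    then show "u \<in> cyc (mact M C B A) (B \<rightarrow>\<^sub>E U) (C \<rightarrow>\<^sub>E V)"
      using uc M.mact_sub[OF s(2,4) V u(3)] by (simp add: cyc_def)
  qed
  show "B \<rightarrow>\<^sub>E V \<subseteq> bnd (pow_mod B M) (mact M B D A') (D \<rightarrow>\<^sub>E U) (B \<rightarrow>\<^sub>E V)"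
  proof
    fix v assume v: "v \<in> B \<rightarrow>\<^sub>E V"
    have z: "\<zero>\<^bsub>pow_mod D M\<^esub> \<in> D \<rightarrow>\<^sub>E U" using M.submodule_zero[OF U] by auto
    have "v \<in> carrier (pow_mod B M)" using v M.submoduleE(1)[OF V] by auto
    then have "v = mact M B D A' \<zero>\<^bsub>pow_mod D M\<^esub> \<oplus>\<^bsub>pow_mod B M\<^esub> v"
      by (simp del: pow_mod_simps add: mod_hom_zero[OF P P h'])
    then show "v \<in> bnd (pow_mod B M) (mact M B D A') (D \<rightarrow>\<^sub>E U) (B \<rightarrow>\<^sub>E V)"
      unfolding bnd_def using v z by blast
  qed
qed

text \<open>The homology with coefficients in \<open>U / V\<close> is a subquotient of the finite
  power of \<open>U / V\<close> indexed by \<open>B\<close>. This yields \<open>G_i(H_j(C))\<close>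
  from \<open>H_j(C)\<close>.\<close>

lemma mh_of_sq:
  assumes M: "module R M" and U: "submodule U R M" and V: "submodule V R M" and VU: "V \<subseteq> U"
    and st: "mat_step R C B D A A'" and sq: "sq M U V"
  shows "mh M C B D A A' U V"
  unfolding mh_def
  by (rule sq_mono[OF pow_module[OF M] submodule_pow[OF M U] mh_submodules(1,2)[OF assms(1-5)] _
        mh_submodules(4,3)[OF assms(1-5)] sq_power[OF M U V VU mat_stepD(2)[OF st] sq]])
    (auto simp: cyc_def)

lemma mh_triple:
  assumes M: "module R M" and V: "submodule V R M" and N: "submodule N R M" and Y: "submodule Y R M"
    and VN: "V \<subseteq> N" and NY: "N \<subseteq> Y"
    and st0: "mat_step R C B D a0 a1" and st1: "mat_step R B D E a1 a2"
  shows "complex_triple R S (pow_mod E M) (pow_mod D M) (pow_mod B M) (pow_mod C M)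
    (mact M D E a2) (mact M B D a1) (mact M C B a0) (D \<rightarrow>\<^sub>E V) (D \<rightarrow>\<^sub>E N) (D \<rightarrow>\<^sub>E Y)
    (B \<rightarrow>\<^sub>E V) (B \<rightarrow>\<^sub>E N) (B \<rightarrow>\<^sub>E Y) (C \<rightarrow>\<^sub>E V) (E \<rightarrow>\<^sub>E Y)"
proof -
  interpret M: module R M by fact
  note s0 = mat_stepD[OF st0] and s1 = mat_stepD[OF st1]
  have Yc: "Z \<rightarrow>\<^sub>E Y \<subseteq> Z \<rightarrow>\<^sub>E carrier M" for Z using M.submoduleE(1)[OF Y] by auto
  show ?thesis
  proof (rule complex_triple.intro[OF serre_class_axioms], rule complex_triple_axioms.intro, goal_cases)
    \<comment> \<open>Goals 20 to 26 are the locale assumptions \<open>maps\<close>,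
      \<open>zero1\<close> and \<open>zero0\<close>; the rules at the end close all others.\<close>
    case (20 y) then show ?case by (rule M.mact_sub[OF s1(3,5) Y])
  next
    case (21 y) then show ?case by (rule M.mact_sub[OF s0(3,5) N])
  next
    case (22 y) then show ?case by (rule M.mact_sub[OF s0(3,5) Y])
  next
    case (23 y) then show ?case by (rule M.mact_sub[OF s0(3,5) V])
  next
    case (24 y) then show ?case by (rule M.mact_sub[OF s0(2,4) V])
  next
    case (25 y) then show ?case using mat_step_zero[OF M st1] Yc by blast
  next
    case (26 y) then show ?case using mat_step_zero[OF M st0] Yc by blast
  qed (rule pow_module[OF M] submodule_pow[OF M V] submodule_pow[OF M N] submodule_pow[OF M Y]
      M.mact_hom[OF s1(3,5)] M.mact_hom[OF s0(3,5)] M.mact_hom[OF s0(2,4)] PiE_mono[OF VN] PiE_mono[OF NY])+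
qed

text \<open>The long exact sequence in the coefficients \<open>N / V\<close>, \<open>Y / V\<close>,
  \<open>Y / N\<close>: the homology of \<open>N / V\<close> at \<open>B\<close> lies between that
  of \<open>Y / N\<close> at \<open>D\<close> and that of \<open>Y / V\<close> at
  \<open>B\<close>.\<close>

lemma mh_sub:
  assumes "module R M" "submodule V R M" "submodule N R M" "submodule Y R M"
    and "V \<subseteq> N" "N \<subseteq> Y" "mat_step R C B D a0 a1" "mat_step R B D E a1 a2"
    and "mh M C B D a0 a1 Y V" "mh M B D E a1 a2 Y N"
  shows "mh M C B D a0 a1 N V"
  using complex_triple.sq_sub[OF mh_triple[OF assms(1-8)]] assms(9,10) by (simp add: mh_def)

text \<open>One place earlier in the same sequence: the homology of \<open>Y / N\<close> at
  \<open>D\<close> lies between that of \<open>Y / V\<close> at \<open>D\<close> and that of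
  \<open>N / V\<close> at \<open>B\<close>.\<close>

lemma mh_quot:
  assumes "module R M" "submodule V R M" "submodule N R M" "submodule Y R M"
    and "V \<subseteq> N" "N \<subseteq> Y" "mat_step R C B D a0 a1" "mat_step R B D E a1 a2"
    and "mh M B D E a1 a2 Y V" "mh M C B D a0 a1 N V"
  shows "mh M B D E a1 a2 Y N"
  using complex_triple.sq_quot[OF mh_triple[OF assms(1-8)]] assms(9,10) by (simp add: mh_def)

lemma bnd_zero:
  assumes P: "module R P" and f: "\<And>y. y \<in> U \<Longrightarrow> f y \<in> carrier P"
  shows "bnd P f U {\<zero>\<^bsub>P\<^esub>} = f ` U"
proof -
  interpret P: module R P by fact
  show ?thesis using f by (force simp: bnd_def)
qed

lemma mh_carrier:
  assumes M: "module R M" and st: "mat_step R C B D A A'"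
  shows "mh M C B D A A' (carrier M) {\<zero>\<^bsub>M\<^esub>} \<longleftrightarrow>
    sq (pow_mod B M) {u \<in> B \<rightarrow>\<^sub>E carrier M. mact M C B A u = \<zero>\<^bsub>pow_mod C M\<^esub>}
      (mact M B D A' ` (D \<rightarrow>\<^sub>E carrier M))"
proof -
  interpret M: module R M by fact
  note s = mat_stepD[OF st]
  show ?thesis
    unfolding mh_def PiE_zero
    by (subst bnd_zero[OF pow_module[OF M]]) (use M.mact_closed[OF s(3,5)] in \<open>auto simp: cyc_def simp del: pow_mod_simps(2-)\<close>)
qed

lemma mh_carrier_submodules:
  assumes M: "module R M" and st: "mat_step R C B D A A'"
  shows "submodule {u \<in> B \<rightarrow>\<^sub>E carrier M. mact M C B A u = \<zero>\<^bsub>pow_mod C M\<^esub>} R (pow_mod B M)"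
    and "submodule (mact M B D A' ` (D \<rightarrow>\<^sub>E carrier M)) R (pow_mod B M)"
    and "mact M B D A' ` (D \<rightarrow>\<^sub>E carrier M) \<subseteq> {u \<in> B \<rightarrow>\<^sub>E carrier M. mact M C B A u = \<zero>\<^bsub>pow_mod C M\<^esub>}"
proof -
  interpret M: module R M by fact
  note s = mat_stepD[OF st]
  have 1: "bnd (pow_mod B M) (mact M B D A') (D \<rightarrow>\<^sub>E carrier M) (B \<rightarrow>\<^sub>E {\<zero>\<^bsub>M\<^esub>}) = mact M B D A' ` (D \<rightarrow>\<^sub>E carrier M)"
    unfolding PiE_zero by (rule bnd_zero[OF pow_module[OF M]]) (use M.mact_closed[OF s(3,5)] in auto)
  have 2: "cyc (mact M C B A) (B \<rightarrow>\<^sub>E carrier M) (C \<rightarrow>\<^sub>E {\<zero>\<^bsub>M\<^esub>}) = {u \<in> B \<rightarrow>\<^sub>E carrier M. mact M C B A u = \<zero>\<^bsub>pow_mod C M\<^esub>}"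
    unfolding PiE_zero by (simp add: cyc_def)
  have z: "{\<zero>\<^bsub>M\<^esub>} \<subseteq> carrier M" by simp
  note * = mh_submodules[OF M M.carrier_is_submodule M.submodule_trivial z st, unfolded 1 2]
  show "submodule {u \<in> B \<rightarrow>\<^sub>E carrier M. mact M C B A u = \<zero>\<^bsub>pow_mod C M\<^esub>} R (pow_mod B M)"
    "submodule (mact M B D A' ` (D \<rightarrow>\<^sub>E carrier M)) R (pow_mod B M)"
    "mact M B D A' ` (D \<rightarrow>\<^sub>E carrier M) \<subseteq> {u \<in> B \<rightarrow>\<^sub>E carrier M. mact M C B A u = \<zero>\<^bsub>pow_mod C M\<^esub>}"
    by (rule *)+
qed

text \<open>Homology commutes with finite powers of the coefficients: \<open>?F\<close> transposes a
  \<open>B\<close>-tuple of \<open>E\<close>-tuples, and a matrix acts on each of the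
  \<open>E\<close> coordinates separately. This carries the assumption on \<open>M\<close> over to
  the terms of the complex \<open>C\<close>, which are powers of \<open>M\<close>.\<close>

lemma mh_power:
  assumes M: "module R M" and st: "mat_step R C B D A A'" and E: "finite E"
    and mh: "mh M C B D A A' (carrier M) {\<zero>\<^bsub>M\<^esub>}"
  shows "mh (pow_mod E M) C B D A A' (carrier (pow_mod E M)) {\<zero>\<^bsub>pow_mod E M\<^esub>}"
proof -
  let ?N = "pow_mod E M"
  note N = pow_module[OF M, of E]
  interpret M: module R M by fact
  interpret N: module R ?N by (rule N)
  note s = mat_stepD[OF st]
  let ?F = "\<lambda>u. \<lambda>e\<in>E. \<lambda>b\<in>B. u b e"
  have nat: "mact M C B A (\<lambda>b\<in>B. u b e) = (\<lambda>c\<in>C. mact ?N C B A u c e)"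
    if "u \<in> B \<rightarrow>\<^sub>E carrier ?N" "e \<in> E" for u e
    by (rule mact_natural[OF N M eval_hom s(2,4)]) (use that in auto)
  have nat': "mact M B D A' (\<lambda>b\<in>D. u b e) = (\<lambda>c\<in>B. mact ?N B D A' u c e)"
    if "u \<in> D \<rightarrow>\<^sub>E carrier ?N" "e \<in> E" for u e
    by (rule mact_natural[OF N M eval_hom s(3,5)]) (use that in auto)
  let ?Z = "{u \<in> B \<rightarrow>\<^sub>E carrier M. mact M C B A u = \<zero>\<^bsub>pow_mod C M\<^esub>}"
  let ?I = "mact M B D A' ` (D \<rightarrow>\<^sub>E carrier M)"
  note ms = mh_carrier_submodules[OF M st]
  have "sq (pow_mod E (pow_mod B M)) (E \<rightarrow>\<^sub>E ?Z) (E \<rightarrow>\<^sub>E ?I)"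
    by (rule sq_power[OF pow_module[OF M] ms E]) (use mh mh_carrier[OF M st] in simp)
  note sqE = this
  show ?thesis
    unfolding mh_carrier[OF N st]
  proof (rule sq_inj[OF pow_module[OF N] mh_carrier_submodules[OF N st] pow_module[OF pow_module[OF M]]
        submodule_pow[OF pow_module[OF M] ms(1)] sqE])
    show "?F \<in> mod_hom R (pow_mod B ?N) (pow_mod E (pow_mod B M))"
      by (rule mod_homI) (auto simp: fun_eq_iff PiE_iff)
    fix u assume u: "u \<in> {u \<in> B \<rightarrow>\<^sub>E carrier ?N. mact ?N C B A u = \<zero>\<^bsub>pow_mod C ?N\<^esub>}"
    have "(\<lambda>b\<in>B. u b e) \<in> ?Z" if "e \<in> E" for e
      using u nat[of u e] that by (auto simp: PiE_iff fun_eq_iff)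
    then show "?F u \<in> E \<rightarrow>\<^sub>E ?Z" by auto
    assume "?F u \<in> E \<rightarrow>\<^sub>E ?I"
    then have "\<forall>e\<in>E. \<exists>y\<in>D \<rightarrow>\<^sub>E carrier M. (\<lambda>b\<in>B. u b e) = mact M B D A' y"
      by (auto simp: PiE_iff)
    then obtain y where y: "\<And>e. e \<in> E \<Longrightarrow> y e \<in> D \<rightarrow>\<^sub>E carrier M"
      "\<And>e. e \<in> E \<Longrightarrow> (\<lambda>b\<in>B. u b e) = mact M B D A' (y e)" by metis
    define z where "z = (\<lambda>d\<in>D. \<lambda>e\<in>E. y e d)"
    have z: "z \<in> D \<rightarrow>\<^sub>E carrier ?N" using y(1) by (simp add: z_def PiE_iff)
    have ze: "(\<lambda>d\<in>D. z d e) = y e" if "e \<in> E" for e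
      using y(1)[OF that] that by (auto simp: z_def fun_eq_iff PiE_iff extensional_def)
    have mz: "mact ?N B D A' z \<in> B \<rightarrow>\<^sub>E carrier ?N" by (rule N.mact_closed[OF s(3,5) z])
    have "u b e = mact ?N B D A' z b e" if "b \<in> B" "e \<in> E" for b e
      using fun_cong[OF nat'[OF z that(2)], of b] fun_cong[OF y(2)[OF that(2)], of b] ze[OF that(2)] that by simp
    moreover have "u b e = mact ?N B D A' z b e" if "b \<in> B" "e \<notin> E" for b e
      using u mz that by (auto simp: PiE_iff extensional_def)
    moreover have "u b = mact ?N B D A' z b" if "b \<notin> B" for b
      using u mz that by (auto simp: PiE_iff extensional_def)
    ultimately have "u = mact ?N B D A' z" by (metis ext)
    then show "u \<in> mact ?N B D A' ` (D \<rightarrow>\<^sub>E carrier ?N)" using z by blast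
  qed
qed

lemma pow_map_hom:
  assumes f: "f \<in> mod_hom R W W'"
  shows "(\<lambda>u. \<lambda>b\<in>B. f (u b)) \<in> mod_hom R (pow_mod B W) (pow_mod B W')"
  by (rule mod_homI) (auto simp: fun_eq_iff PiE_iff mod_homD[OF f])

text \<open>The isomorphism between \<open>W\<close> modulo the kernel of \<open>f\<close> and the
  image of \<open>f\<close>, applied to the coefficients. For a differential \<open>f\<close> it
  leads from boundaries to chains modulo cycles.\<close>

lemma mh_kernel:
  assumes W: "module R W" and W': "module R W'" and f: "f \<in> mod_hom R W W'"
    and st: "mat_step R C B D A A'"
    and mh: "mh W' C B D A A' (f ` carrier W) {\<zero>\<^bsub>W'\<^esub>}"
  shows "mh W C B D A A' (carrier W) {w \<in> carrier W. f w = \<zero>\<^bsub>W'\<^esub>}"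
proof -
  interpret W: module R W by fact
  interpret W': module R W' by fact
  note s = mat_stepD[OF st]
  let ?K = "{w \<in> carrier W. f w = \<zero>\<^bsub>W'\<^esub>}"
  have K: "submodule ?K R W"
    using submodule_vimage[OF W W' f W.carrier_is_submodule W'.submodule_trivial] by simp
  have I: "submodule (f ` carrier W) R W'" by (rule submodule_image[OF W W' f W.carrier_is_submodule])
  have z: "{\<zero>\<^bsub>W'\<^esub>} \<subseteq> f ` carrier W" using W'.submodule_zero[OF I] by simp
  let ?F = "\<lambda>u. \<lambda>b\<in>B. f (u b)"
  note natural = mact_natural[OF W W' f]
  have Kc: "?K \<subseteq> carrier W" by auto
  note ms = mh_submodules[OF W W.carrier_is_submodule K Kc st]
  note ms' = mh_submodules[OF W' I W'.submodule_trivial z st]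
  show ?thesis unfolding mh_def
  proof (rule sq_inj[OF pow_module[OF W] ms(1,2,3) pow_module[OF W'] ms'(1) mh[unfolded mh_def] pow_map_hom[OF f]])
    fix u assume u: "u \<in> cyc (mact W C B A) (B \<rightarrow>\<^sub>E carrier W) (C \<rightarrow>\<^sub>E ?K)"
    then have uc: "u \<in> B \<rightarrow>\<^sub>E carrier W" and uk: "mact W C B A u \<in> C \<rightarrow>\<^sub>E ?K" by (auto simp: cyc_def)
    have "mact W' C B A (?F u) = (\<lambda>c\<in>C. f (mact W C B A u c))" by (rule natural[OF s(2,4) uc])
    moreover have "(\<lambda>c\<in>C. f (mact W C B A u c)) \<in> C \<rightarrow>\<^sub>E {\<zero>\<^bsub>W'\<^esub>}"
      by (rule PiE_I) (use uk in \<open>auto simp: PiE_iff\<close>)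
    ultimately have "mact W' C B A (?F u) \<in> C \<rightarrow>\<^sub>E {\<zero>\<^bsub>W'\<^esub>}" by simp
    then show "?F u \<in> cyc (mact W' C B A) (B \<rightarrow>\<^sub>E f ` carrier W) (C \<rightarrow>\<^sub>E {\<zero>\<^bsub>W'\<^esub>})"
      using uc by (auto simp: cyc_def)
    assume "?F u \<in> bnd (pow_mod B W') (mact W' B D A') (D \<rightarrow>\<^sub>E f ` carrier W) (B \<rightarrow>\<^sub>E {\<zero>\<^bsub>W'\<^esub>})"
    moreover have "mact W' B D A' y \<in> carrier (pow_mod B W')" if "y \<in> D \<rightarrow>\<^sub>E f ` carrier W" for y
      using W'.mact_closed[OF s(3,5), of y] that W'.submoduleE(1)[OF I] by (auto simp: PiE_iff subset_iff)
    ultimately have "?F u \<in> mact W' B D A' ` (D \<rightarrow>\<^sub>E f ` carrier W)"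
      unfolding PiE_zero using bnd_zero[OF pow_module[OF W']] by metis
    then obtain y' where y': "y' \<in> D \<rightarrow>\<^sub>E f ` carrier W" "?F u = mact W' B D A' y'" by blast
    define y where "y = (\<lambda>d\<in>D. inv_into (carrier W) f (y' d))"
    have y: "y \<in> D \<rightarrow>\<^sub>E carrier W" using y'(1) by (auto simp: y_def PiE_iff intro!: inv_into_into)
    have "(\<lambda>d\<in>D. f (y d)) = y'"
    proof
      fix d show "(\<lambda>d\<in>D. f (y d)) d = y' d"
        using y'(1) by (cases "d \<in> D") (auto simp: y_def PiE_iff extensional_def f_inv_into_f)
    qed
    with natural[OF s(3,5) y] y'(2) have eq: "?F u = (\<lambda>b\<in>B. f (mact W B D A' y b))" by simp
    have my: "mact W B D A' y \<in> B \<rightarrow>\<^sub>E carrier W" by (rule W.mact_closed[OF s(3,5) y])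
    \<comment> \<open>\<open>u\<close> and the boundary of the lifted vector \<open>y\<close> agree
      after applying \<open>f\<close>. Their difference is a vector over the kernel, which a
      relative boundary absorbs.\<close>
    define v where "v = u \<ominus>\<^bsub>pow_mod B W\<^esub> mact W B D A' y"
    have v: "v = (\<lambda>b\<in>B. u b \<ominus>\<^bsub>W\<^esub> mact W B D A' y b)" unfolding v_def by (rule pow_minus[OF W uc my])
    have "v b \<in> ?K" if b: "b \<in> B" for b
    proof -
      have "f (u b) = f (mact W B D A' y b)" using fun_cong[OF eq, of b] b by simp
      then show ?thesis using b uc my mod_homD(1)[OF f]
        by (auto simp: v PiE_iff mod_hom_minus[OF W W' f] W'.minus_self)
    qed
    then have vK: "v \<in> B \<rightarrow>\<^sub>E ?K" by (auto simp: v)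
    interpret P: module R "pow_mod B W" by (rule pow_module[OF W])
    have "u = v \<oplus>\<^bsub>pow_mod B W\<^esub> mact W B D A' y"
      unfolding v_def by (rule P.add_minus_cancel[symmetric]) (use uc my in auto)
    also have "\<dots> = mact W B D A' y \<oplus>\<^bsub>pow_mod B W\<^esub> v"
      by (rule P.a_comm) (use vK my Kc in \<open>auto simp: PiE_iff\<close>)
    finally show "u \<in> bnd (pow_mod B W) (mact W B D A') (D \<rightarrow>\<^sub>E carrier W) (B \<rightarrow>\<^sub>E ?K)"
      unfolding bnd_def using y vK by blast
  qed
qed

text \<open>The isomorphism of \<open>mh_kernel\<close> in the other direction. Cycles over the
  image are lifted coordinate by coordinate, and the lift is a cycle up to the kernel. For a cochain
  differential it leads from cochains modulo cocycles to coboundaries.\<close>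

lemma mh_image:
  assumes W: "module R W" and W': "module R W'" and f: "f \<in> mod_hom R W W'"
    and st: "mat_step R C B D A A'"
    and mh: "mh W C B D A A' (carrier W) {w \<in> carrier W. f w = \<zero>\<^bsub>W'\<^esub>}"
  shows "mh W' C B D A A' (f ` carrier W) {\<zero>\<^bsub>W'\<^esub>}"
proof -
  interpret W: module R W by fact
  interpret W': module R W' by fact
  note s = mat_stepD[OF st]
  let ?K = "{w \<in> carrier W. f w = \<zero>\<^bsub>W'\<^esub>}"
  have K: "submodule ?K R W"
    using submodule_vimage[OF W W' f W.carrier_is_submodule W'.submodule_trivial] by simp
  have I: "submodule (f ` carrier W) R W'" by (rule submodule_image[OF W W' f W.carrier_is_submodule])
  have z: "{\<zero>\<^bsub>W'\<^esub>} \<subseteq> f ` carrier W" using W'.submodule_zero[OF I] by simp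
  let ?F = "\<lambda>u. \<lambda>b\<in>B. f (u b)"
  note natural = mact_natural[OF W W' f]
  have Kc: "?K \<subseteq> carrier W" by auto
  note ms = mh_submodules[OF W W.carrier_is_submodule K Kc st]
  note ms' = mh_submodules[OF W' I W'.submodule_trivial z st]
  interpret P': module R "pow_mod B W'" by (rule pow_module[OF W'])
  show ?thesis unfolding mh_def
  proof (rule sq_surj[OF pow_module[OF W'] ms'(1,2,3) pow_module[OF W] ms(1) mh[unfolded mh_def] pow_map_hom[OF f]])
    fix u assume u: "u \<in> cyc (mact W' C B A) (B \<rightarrow>\<^sub>E f ` carrier W) (C \<rightarrow>\<^sub>E {\<zero>\<^bsub>W'\<^esub>})"
    define w where "w = (\<lambda>b\<in>B. inv_into (carrier W) f (u b))"
    have w: "w \<in> B \<rightarrow>\<^sub>E carrier W" using u by (auto simp: w_def cyc_def PiE_iff intro!: inv_into_into)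
    have Fw: "?F w = u"
    proof
      fix d show "?F w d = u d"
        using u by (cases "d \<in> B") (auto simp: cyc_def w_def PiE_iff extensional_def f_inv_into_f)
    qed
    have mw: "mact W C B A w \<in> C \<rightarrow>\<^sub>E carrier W" by (rule W.mact_closed[OF s(2,4) w])
    have "mact W' C B A u = (\<lambda>c\<in>C. f (mact W C B A w c))" using natural[OF s(2,4) w] Fw by simp
    moreover have "mact W' C B A u \<in> C \<rightarrow>\<^sub>E {\<zero>\<^bsub>W'\<^esub>}" using u by (auto simp: cyc_def)
    ultimately have "f (mact W C B A w c) = \<zero>\<^bsub>W'\<^esub>" if "c \<in> C" for c
      using that by (metis PiE_mem restrict_apply' singletonD)
    then have "w \<in> cyc (mact W C B A) (B \<rightarrow>\<^sub>E carrier W) (C \<rightarrow>\<^sub>E ?K)"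
      using w mw by (auto simp: cyc_def PiE_iff)
    moreover have "u \<in> carrier (pow_mod B W')" using P'.submoduleE(1)[OF ms'(1)] u by blast
    then have "u \<ominus>\<^bsub>pow_mod B W'\<^esub> ?F w \<in> bnd (pow_mod B W') (mact W' B D A') (D \<rightarrow>\<^sub>E f ` carrier W) (B \<rightarrow>\<^sub>E {\<zero>\<^bsub>W'\<^esub>})"
      using P'.submodule_zero[OF ms'(2)] Fw P'.minus_self by presburger
    ultimately show "\<exists>u'\<in>cyc (mact W C B A) (B \<rightarrow>\<^sub>E carrier W) (C \<rightarrow>\<^sub>E ?K).
      u \<ominus>\<^bsub>pow_mod B W'\<^esub> ?F u' \<in> bnd (pow_mod B W') (mact W' B D A') (D \<rightarrow>\<^sub>E f ` carrier W) (B \<rightarrow>\<^sub>E {\<zero>\<^bsub>W'\<^esub>})"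
      by blast
  next
    fix w assume "w \<in> bnd (pow_mod B W) (mact W B D A') (D \<rightarrow>\<^sub>E carrier W) (B \<rightarrow>\<^sub>E ?K)"
    then obtain y v where w: "w = mact W B D A' y \<oplus>\<^bsub>pow_mod B W\<^esub> v" "y \<in> D \<rightarrow>\<^sub>E carrier W" "v \<in> B \<rightarrow>\<^sub>E ?K"
      unfolding bnd_def by blast
    have my: "mact W B D A' y \<in> B \<rightarrow>\<^sub>E carrier W" by (rule W.mact_closed[OF s(3,5) w(2)])
    have "?F w = ?F (mact W B D A' y) \<oplus>\<^bsub>pow_mod B W'\<^esub> ?F v"
      unfolding w(1) by (rule mod_homD(2)[OF pow_map_hom[OF f]]) (use my w(3) in \<open>auto simp: PiE_iff\<close>)
    also have "?F (mact W B D A' y) = mact W' B D A' (\<lambda>d\<in>D. f (y d))"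
      by (rule natural[OF s(3,5) w(2), symmetric])
    finally have eq: "?F w = mact W' B D A' (\<lambda>d\<in>D. f (y d)) \<oplus>\<^bsub>pow_mod B W'\<^esub> ?F v" .
    have "?F v \<in> B \<rightarrow>\<^sub>E {\<zero>\<^bsub>W'\<^esub>}" by (rule PiE_I) (use w(3) in \<open>auto simp: PiE_iff\<close>)
    moreover have "(\<lambda>d\<in>D. f (y d)) \<in> D \<rightarrow>\<^sub>E f ` carrier W" by (rule PiE_I) (use w(2) in \<open>auto simp: PiE_iff\<close>)
    ultimately show "?F w \<in> bnd (pow_mod B W') (mact W' B D A') (D \<rightarrow>\<^sub>E f ` carrier W) (B \<rightarrow>\<^sub>E {\<zero>\<^bsub>W'\<^esub>})"
      unfolding bnd_def eq by blast
  qed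
qed

end

section \<open>Comparing two complexes of matrices\<close>

text \<open>
  A complex of finite free modules, given by its bases and matrices. The indices are shifted by one:
  degree \<open>n\<close> of the complex has the basis \<open>B (Suc n)\<close>, and \<open>B 0\<close> is empty.
\<close>

locale mat_complex = R?: cring R for R :: "('a,'r) ring_scheme" (structure) +
  fixes B :: "nat \<Rightarrow> 'b set" and A :: "nat \<Rightarrow> 'b \<Rightarrow> 'b \<Rightarrow> 'a"
  assumes fin: "\<And>n. finite (B n)" and ent: "\<And>n. A n \<in> B n \<rightarrow> B (Suc n) \<rightarrow> carrier R"
    and comp: "\<And>n c e. c \<in> B n \<Longrightarrow> e \<in> B (Suc (Suc n)) \<Longrightarrow>
      (\<Oplus>b\<in>B (Suc n). A n c b \<otimes> A (Suc n) b e) = \<zero>"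
    and B0: "B 0 = {}"
begin

abbreviation T :: "nat \<Rightarrow> 'b \<Rightarrow> 'b \<Rightarrow> 'a" where "T n b c \<equiv> A n c b"

lemma ent_mem: "c \<in> B n \<Longrightarrow> b \<in> B (Suc n) \<Longrightarrow> A n c b \<in> carrier R"
  using ent by blast

lemma step: "mat_step R (B n) (B (Suc n)) (B (Suc (Suc n))) (A n) (A (Suc n))"
  using fin ent comp by (simp add: mat_step_def)

lemma costep: "mat_step R (B (Suc (Suc n))) (B (Suc n)) (B n) (T (Suc n)) (T n)"
proof -
  have "(\<Oplus>b\<in>B (Suc n). A (Suc n) b c \<otimes> A n d b) = \<zero>" if "c \<in> B (Suc (Suc n))" "d \<in> B n" for c d
  proof -
    have "(\<Oplus>b\<in>B (Suc n). A (Suc n) b c \<otimes> A n d b) = (\<Oplus>b\<in>B (Suc n). A n d b \<otimes> A (Suc n) b c)"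
      using that by (intro finsum_cong') (auto simp: ent_mem m_comm)
    then show ?thesis using comp that by simp
  qed
  then show ?thesis using fin ent_mem by (auto simp: mat_step_def)
qed

end

text \<open>
  The part of \<open>H\<^sub>0 = R / \<aa>\<close> that is needed: modulo \<open>\<aa>\<close>, the form \<open>\<epsilon>\<close> vanishes on boundaries and takes
  the value one at \<open>w\<close>.
\<close>

definition mat_aug ::
  "('a,'r) ring_scheme \<Rightarrow> 'a set \<Rightarrow> (nat \<Rightarrow> 'b set) \<Rightarrow> (nat \<Rightarrow> 'b \<Rightarrow> 'b \<Rightarrow> 'a) \<Rightarrow> bool" where
  "mat_aug R \<aa> B A \<longleftrightarrow> (\<exists>\<epsilon> w. \<epsilon> \<in> B 1 \<rightarrow> carrier R \<and> w \<in> B 1 \<rightarrow> carrier R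
     \<and> (\<Oplus>\<^bsub>R\<^esub>b\<in>B 1. \<epsilon> b \<otimes>\<^bsub>R\<^esub> w b) \<ominus>\<^bsub>R\<^esub> \<one>\<^bsub>R\<^esub> \<in> \<aa>
     \<and> (\<forall>d\<in>B 2. (\<Oplus>\<^bsub>R\<^esub>b\<in>B 1. \<epsilon> b \<otimes>\<^bsub>R\<^esub> A 1 b d) \<in> \<aa>))"

text \<open>\<open>z\<close> is the difference of \<open>a z\<close> and \<open>(a - 1) z\<close>,
  and both lie in \<open>V\<close>.\<close>

lemma (in module) smult_near_one:
  assumes V: "submodule V R M" and z: "z \<in> carrier M" and kill: "\<And>r. r \<in> I \<Longrightarrow> r \<odot>\<^bsub>M\<^esub> z \<in> V"
    and a: "a \<in> carrier R" "a \<ominus> \<one> \<in> I" and az: "a \<odot>\<^bsub>M\<^esub> z \<in> V"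
  shows "z \<in> V"
proof -
  have "a \<odot>\<^bsub>M\<^esub> z \<ominus>\<^bsub>M\<^esub> (a \<ominus> \<one>) \<odot>\<^bsub>M\<^esub> z \<in> V"
    using kill[OF a(2)] az by (intro submodule_minus[OF V])
  moreover have "(a \<ominus> \<one>) \<odot>\<^bsub>M\<^esub> z = a \<odot>\<^bsub>M\<^esub> z \<ominus>\<^bsub>M\<^esub> z"
    using a z by (simp add: a_minus_def smult_l_distr smult_l_minus)
  moreover have "a \<odot>\<^bsub>M\<^esub> z \<ominus>\<^bsub>M\<^esub> (a \<odot>\<^bsub>M\<^esub> z \<ominus>\<^bsub>M\<^esub> z) = z"
    using a z by (simp add: a_minus_def M.minus_add M.a_assoc[symmetric] M.r_neg M.minus_minus)
  ultimately show ?thesis by simp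
qed

locale serre_complex = serre_class R S + mat_complex R B A
  for R :: "('a,'r) ring_scheme" (structure) and S :: "('a,'u) module set"
    and B :: "nat \<Rightarrow> 'b set" and A :: "nat \<Rightarrow> 'b \<Rightarrow> 'b \<Rightarrow> 'a"
begin

text \<open>
  For \<open>V \<subseteq> U \<subseteq> M\<close> these say that the \<open>i\<close>-th homology (cohomology) of the complex with coefficients in
  \<open>U / V\<close> belongs to \<open>S\<close>.
\<close>

definition hc :: "('a,'m) module \<Rightarrow> nat \<Rightarrow> 'm set \<Rightarrow> 'm set \<Rightarrow> bool" where
  "hc M i U V \<longleftrightarrow> mh M (B i) (B (Suc i)) (B (Suc (Suc i))) (A i) (A (Suc i)) U V"

definition hk :: "('a,'m) module \<Rightarrow> nat \<Rightarrow> 'm set \<Rightarrow> 'm set \<Rightarrow> bool" where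
  "hk M i U V \<longleftrightarrow> mh M (B (Suc (Suc i))) (B (Suc i)) (B i) (T (Suc i)) (T i) U V"

lemma hc_sub:
  assumes "module R M" "submodule V R M" "submodule N R M" "submodule Y R M" "V \<subseteq> N" "N \<subseteq> Y"
    "hc M i Y V" "hc M (Suc i) Y N"
  shows "hc M i N V"
  using mh_sub[OF assms(1-6) step step, of i] assms(7,8) by (simp add: hc_def)

lemma hk_quot:
  assumes "module R M" "submodule V R M" "submodule N R M" "submodule Y R M" "V \<subseteq> N" "N \<subseteq> Y"
    "hk M i Y V" "hk M (Suc i) N V"
  shows "hk M i Y N"
  using mh_quot[OF assms(1-6) costep costep, of i] assms(7,8) by (simp add: hk_def)

text \<open>\<open>Z / V\<close> is a quotient of \<open>Z / I Z\<close>, the part of the zeroth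
  homology with coefficients in \<open>Z\<close> that matters here. Without identifying that
  homology, \<open>z\<close> is sent to the vector of its multiples by \<open>w\<close>. If this is
  a boundary, applying \<open>\<epsilon>\<close> shows that \<open>\<epsilon>(w) z\<close> lies in
  \<open>V\<close>, and \<open>\<epsilon>(w)\<close> is one modulo \<open>I\<close>.\<close>

lemma sq_of_hc:
  assumes M: "module R M" and Z: "submodule Z R M" and V: "submodule V R M" and VZ: "V \<subseteq> Z"
    and aug: "mat_aug R I B A" and kill: "\<And>r z. r \<in> I \<Longrightarrow> z \<in> Z \<Longrightarrow> r \<odot>\<^bsub>M\<^esub> z \<in> V"
    and hc: "hc M 0 Z {\<zero>\<^bsub>M\<^esub>}"
  shows "sq M Z V"
proof -
  interpret M: module R M by fact
  obtain \<epsilon> w where e: "\<epsilon> \<in> B 1 \<rightarrow> carrier R" and w: "w \<in> B 1 \<rightarrow> carrier R"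
    and ew: "(\<Oplus>b\<in>B 1. \<epsilon> b \<otimes> w b) \<ominus> \<one> \<in> I"
    and eA: "\<And>d. d \<in> B 2 \<Longrightarrow> (\<Oplus>b\<in>B 1. \<epsilon> b \<otimes> A 1 b d) \<in> I"
    using aug by (auto simp: mat_aug_def)
  have ewc: "(\<Oplus>b\<in>B 1. \<epsilon> b \<otimes> w b) \<in> carrier R" using e w by (intro finsum_closed) auto
  have zZ: "{\<zero>\<^bsub>M\<^esub>} \<subseteq> Z" using M.submodule_zero[OF Z] by simp
  have Zc: "z \<in> carrier M" if "z \<in> Z" for z using M.submoduleE(1)[OF Z] that by blast
  have st: "mat_step R (B 0) (B 1) (B 2) (A 0) (A 1)" using step[of 0] by (simp add: numeral_2_eq_2)
  note s = mat_stepD[OF st]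
  note ms = mh_submodules[OF M Z M.submodule_trivial zZ st]
  let ?c = "mact M (B 0) (B 1) (A 0)" and ?d = "mact M (B 1) (B 2) (A 1)"
  have sq: "sq (pow_mod (B 1) M) (cyc ?c (B 1 \<rightarrow>\<^sub>E Z) (B 0 \<rightarrow>\<^sub>E {\<zero>\<^bsub>M\<^esub>}))
     (bnd (pow_mod (B 1) M) ?d (B 2 \<rightarrow>\<^sub>E Z) (B 1 \<rightarrow>\<^sub>E {\<zero>\<^bsub>M\<^esub>}))"
    using hc by (simp add: hc_def mh_def numeral_2_eq_2)
  let ?f = "\<lambda>z. \<lambda>b\<in>B 1. w b \<odot>\<^bsub>M\<^esub> z"
  have f: "?f \<in> mod_hom R M (pow_mod (B 1) M)"
    using w by (intro mod_homI) (auto simp: fun_eq_iff M.smult_r_distr M.smult_assoc1[symmetric] Pi_iff m_comm)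
  show ?thesis
  proof (rule sq_inj[OF M Z V VZ pow_module[OF M] ms(1) sq f])
    fix z assume z: "z \<in> Z"
    have fz: "?f z \<in> B 1 \<rightarrow>\<^sub>E Z" using z w M.submoduleE(4)[OF Z] by (auto simp: Pi_iff)
    \<comment> \<open>\<open>B 0\<close> is empty, so every vector of degree zero is a
      cycle.\<close>
    moreover have "?c (?f z) \<in> B 0 \<rightarrow>\<^sub>E {\<zero>\<^bsub>M\<^esub>}" unfolding mact_def by (rule PiE_I) (auto simp: B0)
    ultimately show "?f z \<in> cyc ?c (B 1 \<rightarrow>\<^sub>E Z) (B 0 \<rightarrow>\<^sub>E {\<zero>\<^bsub>M\<^esub>})" by (simp add: cyc_def del: One_nat_def)
    assume "?f z \<in> bnd (pow_mod (B 1) M) ?d (B 2 \<rightarrow>\<^sub>E Z) (B 1 \<rightarrow>\<^sub>E {\<zero>\<^bsub>M\<^esub>})"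
    moreover have "?d y \<in> carrier (pow_mod (B 1) M)" if "y \<in> B 2 \<rightarrow>\<^sub>E Z" for y
      using M.mact_closed[OF s(3,5), of y] that Zc by (auto simp: PiE_iff)
    ultimately have "?f z \<in> ?d ` (B 2 \<rightarrow>\<^sub>E Z)"
      unfolding PiE_zero using bnd_zero[OF pow_module[OF M]] by metis
    then obtain y where y: "y \<in> B 2 \<rightarrow>\<^sub>E Z" "?f z = ?d y" by blast
    then have yc: "y \<in> B 2 \<rightarrow>\<^sub>E carrier M" using Zc by (auto simp: PiE_iff)
    \<comment> \<open>\<open>\<epsilon>\<close> becomes a matrix with a single row, so that
      \<open>mact_mact\<close> composes it with the differential.\<close>
    have e': "(\<lambda>_. \<epsilon>) \<in> {()} \<rightarrow> B 1 \<rightarrow> carrier R" using e by auto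
    have "(\<Oplus>b\<in>B 1. \<epsilon> b \<otimes> w b) \<odot>\<^bsub>M\<^esub> z = (\<Oplus>\<^bsub>M\<^esub>b\<in>B 1. (\<epsilon> b \<otimes> w b) \<odot>\<^bsub>M\<^esub> z)"
      using e w Zc[OF z] by (intro M.finsum_smult_rdistr fin) auto
    also have "\<dots> = mact M {()} (B 1) (\<lambda>_. \<epsilon>) (?f z) ()"
      unfolding mact_def using e w Zc[OF z] by (auto simp: M.smult_assoc1 Pi_iff intro!: M.finsum_cong')
    also have "\<dots> = (\<Oplus>\<^bsub>M\<^esub>d\<in>B 2. (\<Oplus>b\<in>B 1. \<epsilon> b \<otimes> A 1 b d) \<odot>\<^bsub>M\<^esub> y d)"
      unfolding y(2) M.mact_mact[OF s(2,3) e' s(5) yc] by (simp add: mact_def)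
    also have "\<dots> \<in> V"
      using eA kill y(1) by (intro M.submodule_finsum[OF V s(3)]) auto
    finally have "(\<Oplus>b\<in>B 1. \<epsilon> b \<otimes> w b) \<odot>\<^bsub>M\<^esub> z \<in> V" .
    then show "z \<in> V" using M.smult_near_one[OF V Zc[OF z] kill ewc ew] z by blast
  qed
qed

text \<open>The elements of \<open>M / V\<close> killed by \<open>I\<close> are homomorphisms from
  \<open>R / I\<close> to \<open>M / V\<close>, hence cocycles of degree zero. Here \<open>z\<close>
  becomes the cochain of its multiples by \<open>\<epsilon>\<close>, a cocycle modulo
  \<open>V\<close> because \<open>\<epsilon>\<close> takes boundaries into \<open>I\<close>; pairing
  with \<open>w\<close> recovers \<open>z\<close> modulo \<open>V\<close>.\<close>

lemma sq_of_hk: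
  assumes M: "module R M" and Z: "submodule Z R M" and V: "submodule V R M" and VZ: "V \<subseteq> Z"
    and aug: "mat_aug R I B A" and kill: "\<And>r z. r \<in> I \<Longrightarrow> z \<in> Z \<Longrightarrow> r \<odot>\<^bsub>M\<^esub> z \<in> V"
    and hk: "hk M 0 (carrier M) V"
  shows "sq M Z V"
proof -
  interpret M: module R M by fact
  obtain \<epsilon> w where e: "\<epsilon> \<in> B 1 \<rightarrow> carrier R" and w: "w \<in> B 1 \<rightarrow> carrier R"
    and ew: "(\<Oplus>b\<in>B 1. \<epsilon> b \<otimes> w b) \<ominus> \<one> \<in> I"
    and eA: "\<And>d. d \<in> B 2 \<Longrightarrow> (\<Oplus>b\<in>B 1. \<epsilon> b \<otimes> A 1 b d) \<in> I"
    using aug by (auto simp: mat_aug_def)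
  have ewc: "(\<Oplus>b\<in>B 1. \<epsilon> b \<otimes> w b) \<in> carrier R" using e w by (intro finsum_closed) auto
  have Vc: "V \<subseteq> carrier M" by (rule M.submoduleE(1)[OF V])
  have Zc: "z \<in> carrier M" if "z \<in> Z" for z using M.submoduleE(1)[OF Z] that by blast
  have st: "mat_step R (B 2) (B 1) (B 0) (T 1) (T 0)" using costep[of 0] by (simp add: numeral_2_eq_2)
  note s = mat_stepD[OF st]
  note ms = mh_submodules[OF M M.carrier_is_submodule V Vc st]
  let ?c = "mact M (B 2) (B 1) (T 1)" and ?d = "mact M (B 1) (B 0) (T 0)"
  have sq: "sq (pow_mod (B 1) M) (cyc ?c (B 1 \<rightarrow>\<^sub>E carrier M) (B 2 \<rightarrow>\<^sub>E V))
     (bnd (pow_mod (B 1) M) ?d (B 0 \<rightarrow>\<^sub>E carrier M) (B 1 \<rightarrow>\<^sub>E V))"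
    using hk by (simp add: hk_def mh_def numeral_2_eq_2)
  let ?f = "\<lambda>z. \<lambda>b\<in>B 1. \<epsilon> b \<odot>\<^bsub>M\<^esub> z"
  have f: "?f \<in> mod_hom R M (pow_mod (B 1) M)"
    using e by (intro mod_homI) (auto simp: fun_eq_iff M.smult_r_distr M.smult_assoc1[symmetric] Pi_iff m_comm)
  show ?thesis
  proof (rule sq_inj[OF M Z V VZ pow_module[OF M] ms(1) sq f])
    fix z assume z: "z \<in> Z"
    have fz: "?f z \<in> B 1 \<rightarrow>\<^sub>E carrier M" using Zc[OF z] e by auto
    have "?c (?f z) d \<in> V" if d: "d \<in> B 2" for d
    proof -
      have "?c (?f z) d = (\<Oplus>\<^bsub>M\<^esub>b\<in>B 1. (\<epsilon> b \<otimes> A 1 b d) \<odot>\<^bsub>M\<^esub> z)"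
        unfolding mact_def using e d Zc[OF z] s(4)
        by (auto simp: M.smult_assoc1[symmetric] Pi_iff m_comm intro!: M.finsum_cong')
      also have "\<dots> = (\<Oplus>b\<in>B 1. \<epsilon> b \<otimes> A 1 b d) \<odot>\<^bsub>M\<^esub> z"
        using e d Zc[OF z] s(4) by (intro M.finsum_smult_rdistr[symmetric] fin) auto
      finally show ?thesis using kill[OF eA[OF d] z] by simp
    qed
    then show "?f z \<in> cyc ?c (B 1 \<rightarrow>\<^sub>E carrier M) (B 2 \<rightarrow>\<^sub>E V)"
      using fz M.mact_closed[OF s(2,4) fz] by (auto simp: cyc_def PiE_iff)
    assume "?f z \<in> bnd (pow_mod (B 1) M) ?d (B 0 \<rightarrow>\<^sub>E carrier M) (B 1 \<rightarrow>\<^sub>E V)"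
    then obtain y v where v: "v \<in> B 1 \<rightarrow>\<^sub>E V" "?f z = ?d y \<oplus>\<^bsub>pow_mod (B 1) M\<^esub> v" by (auto simp: bnd_def)
    have "\<epsilon> b \<odot>\<^bsub>M\<^esub> z \<in> V" if b: "b \<in> B 1" for b
    proof -
      \<comment> \<open>\<open>B 0\<close> is empty, so the coboundary \<open>?d y\<close> is zero
        and only the part \<open>v\<close> over \<open>V\<close> remains.\<close>
      have "\<epsilon> b \<odot>\<^bsub>M\<^esub> z = v b"
        using fun_cong[OF v(2), of b] b v(1) Vc by (auto simp: mact_def B0 PiE_iff)
      then show ?thesis using v(1) b by auto
    qed
    then have "(\<Oplus>\<^bsub>M\<^esub>b\<in>B 1. w b \<odot>\<^bsub>M\<^esub> (\<epsilon> b \<odot>\<^bsub>M\<^esub> z)) \<in> V"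
      using w M.submoduleE(4)[OF V] by (intro M.submodule_finsum[OF V s(2)]) auto
    also have "(\<Oplus>\<^bsub>M\<^esub>b\<in>B 1. w b \<odot>\<^bsub>M\<^esub> (\<epsilon> b \<odot>\<^bsub>M\<^esub> z)) = (\<Oplus>\<^bsub>M\<^esub>b\<in>B 1. (\<epsilon> b \<otimes> w b) \<odot>\<^bsub>M\<^esub> z)"
      using e w Zc[OF z] by (intro M.finsum_cong') (auto simp: M.smult_assoc1[symmetric] m_comm Pi_iff)
    also have "\<dots> = (\<Oplus>b\<in>B 1. \<epsilon> b \<otimes> w b) \<odot>\<^bsub>M\<^esub> z"
      using e w Zc[OF z] by (intro M.finsum_smult_rdistr[symmetric] fin) auto
    finally show "z \<in> V" using M.smult_near_one[OF V Zc[OF z] kill ewc ew] z by blast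
  qed
qed

text \<open>
  The induction hypothesis is that the homology of the matrix complex with coefficients in the
  boundaries of \<open>W\<close> belongs to \<open>S\<close>. Then so does the homology with coefficients in the cycles one
  degree higher. In degree zero the latter surjects onto the homology of \<open>W\<close>, which is killed by \<open>I\<close>.
\<close>

lemma chain_comparison:
  fixes W :: "nat \<Rightarrow> ('a,'w) module"
  assumes W: "\<And>n. module R (W n)" and \<delta>: "\<And>n. \<delta> n \<in> mod_hom R (W (Suc n)) (W n)"
    and W0: "carrier (W 0) = {\<zero>\<^bsub>W 0\<^esub>}"
    and \<delta>\<delta>: "\<And>n w. w \<in> carrier (W (Suc (Suc n))) \<Longrightarrow> \<delta> n (\<delta> (Suc n) w) = \<zero>\<^bsub>W n\<^esub>"
    and kill: "\<And>n r w. r \<in> I \<Longrightarrow> w \<in> carrier (W (Suc n)) \<Longrightarrow> \<delta> n w = \<zero>\<^bsub>W n\<^esub> \<Longrightarrow>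
      r \<odot>\<^bsub>W (Suc n)\<^esub> w \<in> \<delta> (Suc n) ` carrier (W (Suc (Suc n)))"
    and aug: "mat_aug R I B A"
    and hyp: "\<And>n i. hc (W n) i (carrier (W n)) {\<zero>\<^bsub>W n\<^esub>}"
  shows "sq (W (Suc n)) {w \<in> carrier (W (Suc n)). \<delta> n w = \<zero>\<^bsub>W n\<^esub>}
    (\<delta> (Suc n) ` carrier (W (Suc (Suc n))))"
proof -
  \<comment> \<open>The indices differ by one: \<open>Z n\<close> lies in \<open>W (Suc n)\<close>,
    but \<open>D n\<close> in \<open>W n\<close>. The homology at \<open>W (Suc n)\<close> is
    \<open>Z n\<close> modulo \<open>D (Suc n)\<close>.\<close>
  define Z where "Z n = {w \<in> carrier (W (Suc n)). \<delta> n w = \<zero>\<^bsub>W n\<^esub>}" for n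
  define D where "D n = \<delta> n ` carrier (W (Suc n))" for n
  have car: "submodule (carrier (W n)) R (W n)" and triv: "submodule {\<zero>\<^bsub>W n\<^esub>} R (W n)" for n
    by (rule module.carrier_is_submodule[OF W] module.submodule_trivial[OF W])+
  have D: "submodule (D n) R (W n)" for n unfolding D_def by (rule submodule_image[OF W W \<delta> car])
  have Z: "submodule (Z n) R (W (Suc n))" for n
    using submodule_vimage[OF W W \<delta> car triv, of n] by (simp add: Z_def)
  have zD: "{\<zero>\<^bsub>W n\<^esub>} \<subseteq> D n" and zZ: "{\<zero>\<^bsub>W (Suc n)\<^esub>} \<subseteq> Z n" for n
    using module.submodule_zero[OF W D] module.submodule_zero[OF W Z] by auto
  have DZ: "D (Suc n) \<subseteq> Z n" for n using \<delta>\<delta> mod_homD(1)[OF \<delta>] by (auto simp: D_def Z_def)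
  have Zc: "Z n \<subseteq> carrier (W (Suc n))" for n by (auto simp: Z_def)
  have step: "(\<forall>i. hc (W (Suc n)) i (Z n) {\<zero>\<^bsub>W (Suc n)\<^esub>}) \<and> sq (W (Suc n)) (Z n) (D (Suc n))"
    if IH: "\<And>i. hc (W n) i (D n) {\<zero>\<^bsub>W n\<^esub>}" for n
  proof -
    \<comment> \<open>Through \<open>\<delta> n\<close> the quotient of \<open>W (Suc n)\<close> by
      its cycles is isomorphic to \<open>D n\<close>.\<close>
    have "hc (W (Suc n)) i (carrier (W (Suc n))) (Z n)" for i
      using mh_kernel[OF W W \<delta> mat_complex.step[OF mat_complex_axioms] IH[unfolded hc_def D_def]]
      by (simp add: hc_def Z_def)
    then have 1: "hc (W (Suc n)) i (Z n) {\<zero>\<^bsub>W (Suc n)\<^esub>}" for i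
      by (intro hc_sub[OF W triv Z car zZ Zc hyp])
    have "sq (W (Suc n)) (Z n) (D (Suc n))"
      by (rule sq_of_hc[OF W Z D DZ aug _ 1]) (use kill in \<open>auto simp: Z_def D_def\<close>)
    with 1 show ?thesis by blast
  qed
  have claim: "\<forall>i. hc (W n) i (D n) {\<zero>\<^bsub>W n\<^esub>}" for n
  proof (induction n)
    case 0
    have D0: "D 0 = {\<zero>\<^bsub>W 0\<^esub>}" using zD[of 0] mod_homD(1)[OF \<delta>, of _ 0] W0 by (auto simp: D_def)
    show ?case unfolding D0 hc_def
      by (intro allI mh_of_sq[OF W triv triv subset_refl mat_complex.step[OF mat_complex_axioms]] sq_trivial[OF W triv])
  next
    case (Suc n)
    then have *: "\<And>i. hc (W (Suc n)) i (Z n) {\<zero>\<^bsub>W (Suc n)\<^esub>}" "sq (W (Suc n)) (Z n) (D (Suc n))"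
      using step by blast+
    have "hc (W (Suc n)) i (Z n) (D (Suc n))" for i
      unfolding hc_def by (rule mh_of_sq[OF W Z D DZ mat_complex.step[OF mat_complex_axioms] *(2)])
    then show ?case by (intro allI hc_sub[OF W triv D Z zD DZ *(1)])
  qed
  show ?thesis using step claim unfolding Z_def D_def by blast
qed

text \<open>The dual induction runs over the coefficients \<open>W n / Z n\<close>, isomorphic to
  the coboundaries \<open>D n\<close>. From these the long exact sequence gives
  \<open>W (Suc n) / D n\<close>. The cohomology is a submodule of the latter killed by
  \<open>I\<close>, so \<open>sq_of_hk\<close> applies; dividing it out gives
  \<open>W (Suc n) / Z (Suc n)\<close>.\<close>

lemma cochain_comparison:
  fixes W :: "nat \<Rightarrow> ('a,'w) module"
  assumes W: "\<And>n. module R (W n)" and \<delta>: "\<And>n. \<delta> n \<in> mod_hom R (W n) (W (Suc n))"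
    and W0: "carrier (W 0) = {\<zero>\<^bsub>W 0\<^esub>}"
    and \<delta>\<delta>: "\<And>n w. w \<in> carrier (W n) \<Longrightarrow> \<delta> (Suc n) (\<delta> n w) = \<zero>\<^bsub>W (Suc (Suc n))\<^esub>"
    and kill: "\<And>n r w. r \<in> I \<Longrightarrow> w \<in> carrier (W (Suc n)) \<Longrightarrow> \<delta> (Suc n) w = \<zero>\<^bsub>W (Suc (Suc n))\<^esub> \<Longrightarrow>
      r \<odot>\<^bsub>W (Suc n)\<^esub> w \<in> \<delta> n ` carrier (W n)"
    and aug: "mat_aug R I B A"
    and hyp: "\<And>n i. hk (W n) i (carrier (W n)) {\<zero>\<^bsub>W n\<^esub>}"
  shows "sq (W (Suc n)) {w \<in> carrier (W (Suc n)). \<delta> (Suc n) w = \<zero>\<^bsub>W (Suc (Suc n))\<^esub>} (\<delta> n ` carrier (W n))"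
proof -
  define Z where "Z n = {w \<in> carrier (W n). \<delta> n w = \<zero>\<^bsub>W (Suc n)\<^esub>}" for n
  define D where "D n = \<delta> n ` carrier (W n)" for n
  have car: "submodule (carrier (W n)) R (W n)" and triv: "submodule {\<zero>\<^bsub>W n\<^esub>} R (W n)" for n
    by (rule module.carrier_is_submodule[OF W] module.submodule_trivial[OF W])+
  have D: "submodule (D n) R (W (Suc n))" for n unfolding D_def by (rule submodule_image[OF W W \<delta> car])
  have Z: "submodule (Z n) R (W n)" for n
    using submodule_vimage[OF W W \<delta> car triv, of n] by (simp add: Z_def)
  have zD: "{\<zero>\<^bsub>W (Suc n)\<^esub>} \<subseteq> D n" for n
    using module.submodule_zero[OF W D] by auto
  have DZ: "D n \<subseteq> Z (Suc n)" for n using \<delta>\<delta> mod_homD(1)[OF \<delta>] by (auto simp: D_def Z_def)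
  have Zc: "Z n \<subseteq> carrier (W n)" for n by (auto simp: Z_def)
  have step: "(\<forall>i. hk (W (Suc n)) i (carrier (W (Suc n))) (D n)) \<and> sq (W (Suc n)) (Z (Suc n)) (D n)"
    if IH: "\<And>i. hk (W n) i (carrier (W n)) (Z n)" for n
  proof -
    have "hk (W (Suc n)) i (D n) {\<zero>\<^bsub>W (Suc n)\<^esub>}" for i
      using mh_image[OF W W \<delta> costep IH[unfolded hk_def Z_def]] by (simp add: hk_def D_def)
    then have 1: "hk (W (Suc n)) i (carrier (W (Suc n))) (D n)" for i
      by (intro hk_quot[OF W triv D car zD _ hyp]) (use DZ Zc in blast)
    have "sq (W (Suc n)) (Z (Suc n)) (D n)"
      by (rule sq_of_hk[OF W Z D DZ aug _ 1]) (use kill in \<open>auto simp: Z_def D_def\<close>)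
    with 1 show ?thesis by blast
  qed
  have claim: "\<forall>i. hk (W n) i (carrier (W n)) (Z n)" for n
  proof (induction n)
    case 0
    have Z0: "Z 0 = carrier (W 0)" using W0 mod_hom_zero[OF W W \<delta>] by (auto simp: Z_def)
    show ?case unfolding Z0 hk_def
      by (intro allI mh_of_sq[OF W car car subset_refl costep] sq_trivial[OF W car])
  next
    case (Suc n)
    then have *: "\<And>i. hk (W (Suc n)) i (carrier (W (Suc n))) (D n)" "sq (W (Suc n)) (Z (Suc n)) (D n)"
      using step by blast+
    have "hk (W (Suc n)) i (Z (Suc n)) (D n)" for i
      unfolding hk_def by (rule mh_of_sq[OF W Z D DZ costep *(2)])
    then show ?case by (intro allI hk_quot[OF W D Z car DZ Zc *(1)])
  qed
  show ?thesis using step claim unfolding Z_def D_def by blast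
qed

end

section \<open>Free modules\<close>

lemma self_mod_simps [simp]:
  "carrier (self_mod R) = carrier R" "\<zero>\<^bsub>self_mod R\<^esub> = \<zero>\<^bsub>R\<^esub>"
  "x \<oplus>\<^bsub>self_mod R\<^esub> y = x \<oplus>\<^bsub>R\<^esub> y" "a \<odot>\<^bsub>self_mod R\<^esub> x = a \<otimes>\<^bsub>R\<^esub> x"
  by (simp_all add: self_mod_def)

lemma self_module:
  assumes "cring R"
  shows "module R (self_mod R)"
proof -
  interpret cring R by fact
  have "abelian_group (self_mod R)"
    by (rule abelian_groupI) (auto simp: a_ac intro: bexI[of _ "\<ominus>\<^bsub>R\<^esub> _"] l_neg)
  then show ?thesis
    by (rule moduleI[OF assms]) (auto simp: l_distr r_distr m_assoc)
qed

lemma finsum_self: "finsum (self_mod R) f A = finsum R f A"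
  by (simp add: finsum_def finprod_def self_mod_def)

lemma free_mod_simps [simp]:
  "\<zero>\<^bsub>free_mod R B\<^esub> = (\<lambda>b. \<zero>\<^bsub>R\<^esub>)"
  "u \<oplus>\<^bsub>free_mod R B\<^esub> v = (\<lambda>b. u b \<oplus>\<^bsub>R\<^esub> v b)" "a \<odot>\<^bsub>free_mod R B\<^esub> u = (\<lambda>b. a \<otimes>\<^bsub>R\<^esub> u b)"
  by (simp_all add: free_mod_def)

lemma free_carrier:
  "u \<in> carrier (free_mod R B) \<longleftrightarrow> (\<forall>b\<in>B. u b \<in> carrier R) \<and> (\<forall>b. b \<notin> B \<longrightarrow> u b = \<zero>\<^bsub>R\<^esub>)
     \<and> finite {b. u b \<noteq> \<zero>\<^bsub>R\<^esub>}"
  by (simp add: free_mod_def)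

context cring begin

lemma free_mem: "u \<in> carrier (free_mod R B) \<Longrightarrow> u b \<in> carrier R"
  by (cases "b \<in> B") (auto simp: free_carrier)

lemma free_supp: "u \<in> carrier (free_mod R B) \<Longrightarrow> {b. u b \<noteq> \<zero>} \<subseteq> B"
  by (auto simp: free_carrier)

lemma free_module: "module R (free_mod R B)"
proof -
  have fin_add: "finite {b. u b \<oplus> v b \<noteq> \<zero>}" if "finite {b. u b \<noteq> \<zero>}" "finite {b. v b \<noteq> \<zero>}" for u v :: "'c \<Rightarrow> 'a"
    by (rule finite_subset[OF _ finite_UnI[OF that]]) auto
  have fin_smult: "finite {b. a \<otimes> u b \<noteq> \<zero>}" if "finite {b. u b \<noteq> \<zero>}" "a \<in> carrier R" for a and u :: "'c \<Rightarrow> 'a"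
    by (rule finite_subset[OF _ that(1)]) (use that(2) in auto)
  have "abelian_group (free_mod R B)"
  proof (rule abelian_groupI)
    fix u assume u: "u \<in> carrier (free_mod R B)"
    show "\<exists>v\<in>carrier (free_mod R B). v \<oplus>\<^bsub>free_mod R B\<^esub> u = \<zero>\<^bsub>free_mod R B\<^esub>"
    proof (rule bexI[of _ "\<lambda>b. \<ominus> u b"])
      have "{b. \<ominus> u b \<noteq> \<zero>} \<subseteq> {b. u b \<noteq> \<zero>}" by auto
      then show "(\<lambda>b. \<ominus> u b) \<in> carrier (free_mod R B)"
        using u finite_subset by (fastforce simp: free_carrier)
    qed (use free_mem[OF u] in \<open>simp add: l_neg\<close>)
    show "\<zero>\<^bsub>free_mod R B\<^esub> \<oplus>\<^bsub>free_mod R B\<^esub> u = u" using free_mem[OF u] by simp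
    fix v assume v: "v \<in> carrier (free_mod R B)"
    show "u \<oplus>\<^bsub>free_mod R B\<^esub> v \<in> carrier (free_mod R B)"
      using u v by (auto simp: free_carrier fin_add)
    show "u \<oplus>\<^bsub>free_mod R B\<^esub> v = v \<oplus>\<^bsub>free_mod R B\<^esub> u"
      using free_mem[OF u] free_mem[OF v] by (simp add: a_comm)
    fix w assume w: "w \<in> carrier (free_mod R B)"
    show "u \<oplus>\<^bsub>free_mod R B\<^esub> v \<oplus>\<^bsub>free_mod R B\<^esub> w = u \<oplus>\<^bsub>free_mod R B\<^esub> (v \<oplus>\<^bsub>free_mod R B\<^esub> w)"
      using free_mem[OF u] free_mem[OF v] free_mem[OF w] by (simp add: a_assoc)
  qed (simp add: free_carrier)
  then show ?thesis
    by (rule moduleI[OF is_cring])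
      (simp_all add: free_mem l_distr r_distr m_assoc, simp add: free_carrier fin_smult)
qed

lemma basis_vec_mem: "b \<in> B \<Longrightarrow> basis_vec R b \<in> carrier (free_mod R B)"
  by (auto simp: free_carrier basis_vec_def intro: finite_subset[of _ "{b}"])

lemma free_eval_hom: "(\<lambda>u. u b) \<in> mod_hom R (free_mod R B) (self_mod R)"
  by (rule mod_homI) (auto simp: free_mem)

text \<open>Induction over the support: removing one coordinate subtracts a multiple of a basis
  vector.\<close>

lemma free_generated:
  assumes N: "submodule N R (free_mod R B)" and b: "\<And>b. b \<in> B \<Longrightarrow> basis_vec R b \<in> N"
    and u: "u \<in> carrier (free_mod R B)"
  shows "u \<in> N"
proof -
  interpret F: module R "free_mod R B" by (rule free_module)
  note Ns = F.submoduleE[OF N]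
  have "u \<in> carrier (free_mod R B) \<longrightarrow> u \<in> N" if "finite T" "{b. u b \<noteq> \<zero>} = T" for T u
    using that
  proof (induction T arbitrary: u rule: finite_induct)
    case empty
    then have "u = (\<lambda>_. \<zero>)" by auto
    then show ?case using F.submodule_zero[OF N] by simp
  next
    case (insert x T)
    show ?case
    proof
      assume u: "u \<in> carrier (free_mod R B)"
      have x: "x \<in> B" using u insert.prems by (auto simp: free_carrier)
      let ?v = "u(x := \<zero>)"
      have s: "{b. ?v b \<noteq> \<zero>} = T" using insert by auto
      moreover have "?v \<in> carrier (free_mod R B)"
        using u insert.hyps(1) s by (simp add: free_carrier)
      ultimately have "?v \<in> N" using insert.IH by blast
      moreover have "u x \<odot>\<^bsub>free_mod R B\<^esub> basis_vec R x \<in> N"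
        using Ns(4)[OF free_mem[OF u] b[OF x]] by blast
      moreover have "u = ?v \<oplus>\<^bsub>free_mod R B\<^esub> (u x \<odot>\<^bsub>free_mod R B\<^esub> basis_vec R x)"
        using free_mem[OF u] by (auto simp: fun_eq_iff basis_vec_def)
      ultimately show "u \<in> N" using Ns(5) by metis
    qed
  qed
  then show ?thesis using u by (auto simp: free_carrier)
qed

end

lemma hom_eq_submodule:
  assumes M: "module R M" and N: "module R N" and f: "f \<in> mod_hom R M N" and g: "g \<in> mod_hom R M N"
  shows "submodule {u \<in> carrier M. f u = g u} R M"
proof -
  interpret M: module R M by fact
  show ?thesis
    by (rule M.submoduleI')
      (use mod_hom_zero[OF M N f] mod_hom_zero[OF M N g] mod_homD(2,3)[OF f] mod_homD(2,3)[OF g] in auto)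
qed

lemma free_hom_ext:
  assumes X: "module R X'" and f: "f \<in> mod_hom R (free_mod R B) X'" and g: "g \<in> mod_hom R (free_mod R B) X'"
    and eq: "\<And>b. b \<in> B \<Longrightarrow> f (basis_vec R b) = g (basis_vec R b)" and u: "u \<in> carrier (free_mod R B)"
  shows "f u = g u"
proof -
  interpret X: module R X' by fact
  have "u \<in> {u \<in> carrier (free_mod R B). f u = g u}"
    by (rule X.R.free_generated[OF hom_eq_submodule[OF X.R.free_module X f g] _ u])
      (use eq X.R.basis_vec_mem in auto)
  then show ?thesis by simp
qed

text \<open>The linear extension of \<open>g\<close> from the basis. Summing over the support admits
  infinite bases, as the free modules behind tensor products and the chosen resolution require;
  \<open>lin_superset\<close> enlarges the range of summation.\<close>

definition lin :: "('a,'r) ring_scheme \<Rightarrow> ('a,'m) module \<Rightarrow> ('b \<Rightarrow> 'm) \<Rightarrow> ('b \<Rightarrow> 'a) \<Rightarrow> 'm" where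
  "lin R M g u = (\<Oplus>\<^bsub>M\<^esub>b\<in>{b. u b \<noteq> \<zero>\<^bsub>R\<^esub>}. u b \<odot>\<^bsub>M\<^esub> g b)"

lemma lin_superset:
  assumes M: "module R M" and g: "g \<in> B \<rightarrow> carrier M" and u: "u \<in> carrier (free_mod R B)"
    and T: "finite T" "{b. u b \<noteq> \<zero>\<^bsub>R\<^esub>} \<subseteq> T" "T \<subseteq> B"
  shows "lin R M g u = (\<Oplus>\<^bsub>M\<^esub>b\<in>T. u b \<odot>\<^bsub>M\<^esub> g b)"
proof -
  interpret M: module R M by fact
  have "g b \<in> carrier M" if "b \<in> T" for b using g T(3) that by blast
  then show ?thesis unfolding lin_def
    by (intro M.add.finprod_mono_neutral_cong_left[OF T(1,2), folded finsum_def])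
      (use M.R.free_mem[OF u] in auto)
qed

lemma lin_hom:
  assumes M: "module R M" and g: "g \<in> B \<rightarrow> carrier M"
  shows "lin R M g \<in> mod_hom R (free_mod R B) M"
proof (rule mod_homI)
  interpret M: module R M by fact
  interpret F: module R "free_mod R B" by (rule M.R.free_module)
  fix u assume u: "u \<in> carrier (free_mod R B)"
  have fu: "finite {b. u b \<noteq> \<zero>\<^bsub>R\<^esub>}" and su: "{b. u b \<noteq> \<zero>\<^bsub>R\<^esub>} \<subseteq> B"
    using u M.R.free_supp by (auto simp: free_carrier)
  note mu = M.R.free_mem[OF u]
  show "lin R M g u \<in> carrier M" unfolding lin_def
    using g su mu by (intro M.finsum_closed) (auto intro!: M.smult_closed)
  { fix v assume v: "v \<in> carrier (free_mod R B)"
    have fv: "finite {b. v b \<noteq> \<zero>\<^bsub>R\<^esub>}" and sv: "{b. v b \<noteq> \<zero>\<^bsub>R\<^esub>} \<subseteq> B"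
      using v M.R.free_supp by (auto simp: free_carrier)
    note mv = M.R.free_mem[OF v]
    let ?T = "{b. u b \<noteq> \<zero>\<^bsub>R\<^esub>} \<union> {b. v b \<noteq> \<zero>\<^bsub>R\<^esub>}"
    have uv: "u \<oplus>\<^bsub>free_mod R B\<^esub> v \<in> carrier (free_mod R B)" using u v by blast
    have T: "finite ?T" "?T \<subseteq> B" using fu fv su sv by auto
    have gT: "g b \<in> carrier M" if "b \<in> ?T" for b using g T that by blast
    have "lin R M g (u \<oplus>\<^bsub>free_mod R B\<^esub> v) = (\<Oplus>\<^bsub>M\<^esub>b\<in>?T. (u b \<oplus>\<^bsub>R\<^esub> v b) \<odot>\<^bsub>M\<^esub> g b)"
      by (subst lin_superset[OF M g uv T(1) _ T(2)]) auto
    also have "\<dots> = (\<Oplus>\<^bsub>M\<^esub>b\<in>?T. u b \<odot>\<^bsub>M\<^esub> g b \<oplus>\<^bsub>M\<^esub> v b \<odot>\<^bsub>M\<^esub> g b)"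
      using gT mu mv by (intro M.finsum_cong') (auto simp: M.smult_l_distr)
    also have "\<dots> = (\<Oplus>\<^bsub>M\<^esub>b\<in>?T. u b \<odot>\<^bsub>M\<^esub> g b) \<oplus>\<^bsub>M\<^esub> (\<Oplus>\<^bsub>M\<^esub>b\<in>?T. v b \<odot>\<^bsub>M\<^esub> g b)"
      using gT mu mv by (intro M.finsum_addf) auto
    also have "\<dots> = lin R M g u \<oplus>\<^bsub>M\<^esub> lin R M g v"
      by (subst (1 2) lin_superset[OF M g _ T(1) _ T(2)]) (use u v in auto)
    finally show "lin R M g (u \<oplus>\<^bsub>free_mod R B\<^esub> v) = lin R M g u \<oplus>\<^bsub>M\<^esub> lin R M g v" . }
  { fix a assume a: "a \<in> carrier R"
    let ?T = "{b. u b \<noteq> \<zero>\<^bsub>R\<^esub>}"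
    have au: "a \<odot>\<^bsub>free_mod R B\<^esub> u \<in> carrier (free_mod R B)" using u a by blast
    have gT: "g b \<in> carrier M" if "b \<in> ?T" for b using g su that by blast
    have "lin R M g (a \<odot>\<^bsub>free_mod R B\<^esub> u) = (\<Oplus>\<^bsub>M\<^esub>b\<in>?T. (a \<otimes>\<^bsub>R\<^esub> u b) \<odot>\<^bsub>M\<^esub> g b)"
      by (subst lin_superset[OF M g au fu _ su]) (use a in auto)
    also have "\<dots> = (\<Oplus>\<^bsub>M\<^esub>b\<in>?T. a \<odot>\<^bsub>M\<^esub> (u b \<odot>\<^bsub>M\<^esub> g b))"
      using gT mu a by (intro M.finsum_cong') (auto simp: M.smult_assoc1)
    also have "\<dots> = a \<odot>\<^bsub>M\<^esub> lin R M g u"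
      unfolding lin_def using gT mu a fu by (intro M.finsum_smult_ldistr[symmetric]) auto
    finally show "lin R M g (a \<odot>\<^bsub>free_mod R B\<^esub> u) = a \<odot>\<^bsub>M\<^esub> lin R M g u" . }
qed

lemma lin_basis:
  assumes M: "module R M" and g: "g \<in> B \<rightarrow> carrier M" and b: "b \<in> B"
  shows "lin R M g (basis_vec R b) = g b"
proof -
  interpret M: module R M by fact
  have "lin R M g (basis_vec R b) = (\<Oplus>\<^bsub>M\<^esub>c\<in>{b}. basis_vec R b c \<odot>\<^bsub>M\<^esub> g c)"
    by (rule lin_superset[OF M g M.R.basis_vec_mem[OF b]]) (use b in \<open>auto simp: basis_vec_def\<close>)
  also have "\<dots> = g b" using g b by (simp add: basis_vec_def Pi_iff)
  finally show ?thesis .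
qed

lemma free_hom_expand:
  assumes M: "module R M" and f: "f \<in> mod_hom R (free_mod R B) M" and B: "finite B"
    and u: "u \<in> carrier (free_mod R B)"
  shows "f u = (\<Oplus>\<^bsub>M\<^esub>b\<in>B. u b \<odot>\<^bsub>M\<^esub> f (basis_vec R b))"
proof -
  interpret M: module R M by fact
  have g: "(\<lambda>b. f (basis_vec R b)) \<in> B \<rightarrow> carrier M"
    by (intro Pi_I mod_homD(1)[OF f] M.R.basis_vec_mem)
  have "f u = lin R M (\<lambda>b. f (basis_vec R b)) u"
    by (rule free_hom_ext[OF M f lin_hom[OF M g] _ u]) (simp add: lin_basis[OF M g])
  also have "\<dots> = (\<Oplus>\<^bsub>M\<^esub>b\<in>B. u b \<odot>\<^bsub>M\<^esub> f (basis_vec R b))"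
    by (rule lin_superset[OF M g u B]) (use M.R.free_supp[OF u] in auto)
  finally show ?thesis .
qed

lemma quot_lift:
  assumes M: "module R M" and N: "submodule N R M" and f: "f \<in> mod_hom R M L" and L: "module R L"
    and ker: "\<And>x. x \<in> N \<Longrightarrow> f x = \<zero>\<^bsub>L\<^esub>"
  shows "\<exists>h\<in>mod_hom R (quot_mod M N) L. \<forall>x\<in>carrier M. h (N +>\<^bsub>M\<^esub> x) = f x"
proof -
  interpret M: module R M by fact
  interpret L: module R L by fact
  define h where "h C = f (SOME x. x \<in> carrier M \<and> N +>\<^bsub>M\<^esub> x = C)" for C
  have h: "h (N +>\<^bsub>M\<^esub> x) = f x" if x: "x \<in> carrier M" for x
  proof -
    define y where "y = (SOME y. y \<in> carrier M \<and> N +>\<^bsub>M\<^esub> y = N +>\<^bsub>M\<^esub> x)"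
    have y: "y \<in> carrier M" "N +>\<^bsub>M\<^esub> y = N +>\<^bsub>M\<^esub> x"
      using someI[of "\<lambda>y. y \<in> carrier M \<and> N +>\<^bsub>M\<^esub> y = N +>\<^bsub>M\<^esub> x" x] x by (auto simp: y_def)
    then have "f (y \<ominus>\<^bsub>M\<^esub> x) = \<zero>\<^bsub>L\<^esub>" using coset_eq_iff[OF M N y(1) x] ker by blast
    then have "f y = f x"
      using mod_hom_minus[OF M L f y(1) x] y x mod_homD(1)[OF f] by (simp add: L.minus_zero_iff)
    then show ?thesis by (simp add: h_def y_def)
  qed
  note c = mod_homD[OF coset_hom[OF M N]]
  have "h \<in> mod_hom R (quot_mod M N) L"
  proof (rule mod_homI)
    fix a C assume "C \<in> carrier (quot_mod M N)"
    then obtain x where x: "x \<in> carrier M" "C = N +>\<^bsub>M\<^esub> x" using quot_carrier[OF M N] by blast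
    then show "h C \<in> carrier L" using h mod_homD(1)[OF f] by simp
    { assume a: "a \<in> carrier R"
      then have "a \<odot>\<^bsub>quot_mod M N\<^esub> C = N +>\<^bsub>M\<^esub> (a \<odot>\<^bsub>M\<^esub> x)" using x c(3) by simp
      then show "h (a \<odot>\<^bsub>quot_mod M N\<^esub> C) = a \<odot>\<^bsub>L\<^esub> h C"
        using h x a mod_homD(3)[OF f] by simp }
    fix D assume "D \<in> carrier (quot_mod M N)"
    then obtain y where y: "y \<in> carrier M" "D = N +>\<^bsub>M\<^esub> y" using quot_carrier[OF M N] by blast
    then have "C \<oplus>\<^bsub>quot_mod M N\<^esub> D = N +>\<^bsub>M\<^esub> (x \<oplus>\<^bsub>M\<^esub> y)" using x c(2) by simp
    then show "h (C \<oplus>\<^bsub>quot_mod M N\<^esub> D) = h C \<oplus>\<^bsub>L\<^esub> h D"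
      using h x y mod_homD(2)[OF f] by simp
  qed
  then show ?thesis using h by blast
qed

section \<open>Tensor products\<close>

lemma generated_submodule_facts:
  assumes M: "module R M" and A: "A \<subseteq> carrier M"
  shows "submodule (generated_submodule R M A) R M" and "A \<subseteq> generated_submodule R M A"
proof -
  interpret M: module R M by fact
  have c: "generated_submodule R M A \<subseteq> carrier M"
    unfolding generated_submodule_def using A M.carrier_is_submodule by blast
  show "submodule (generated_submodule R M A) R M"
    by (rule M.submoduleI')
      (use c in \<open>auto simp: generated_submodule_def M.submodule_zero M.submoduleE(4,5)\<close>)
  show "A \<subseteq> generated_submodule R M A" by (auto simp: generated_submodule_def)
qed

lemma generated_submodule_min: "submodule N R M \<Longrightarrow> A \<subseteq> N \<Longrightarrow> generated_submodule R M A \<subseteq> N"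
  by (auto simp: generated_submodule_def)

definition tens :: "('a,'r) ring_scheme \<Rightarrow> ('a,'p) module \<Rightarrow> ('a,'m) module \<Rightarrow> 'p \<Rightarrow> 'm \<Rightarrow> ('p \<times> 'm \<Rightarrow> 'a) set" where
  "tens R P M p m = tensor_null R P M +>\<^bsub>tensor_free R P M\<^esub> basis_vec R (p, m)"

locale tensor_pair = P: module R P + M: module R M
  for R :: "('a,'r) ring_scheme" and P :: "('a,'p) module" and M :: "('a,'m) module"
begin

abbreviation "F \<equiv> tensor_free R P M"
abbreviation "N \<equiv> tensor_null R P M"

lemma F: "module R F"
  unfolding tensor_free_def by (rule P.R.free_module)

sublocale F: module R F by (rule F)

lemma basis_mem: "p \<in> carrier P \<Longrightarrow> m \<in> carrier M \<Longrightarrow> basis_vec R (p, m) \<in> carrier F"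
  unfolding tensor_free_def by (rule P.R.basis_vec_mem) simp

lemma relations_sub: "tensor_relations R P M \<subseteq> carrier F"
  unfolding tensor_relations_def Let_def
  by (intro Un_least subsetI; elim CollectE exE conjE; hypsubst)
    (intro F.minus_closed F.a_closed F.smult_closed basis_mem P.a_closed M.a_closed P.smult_closed M.smult_closed; assumption)+

lemma N: "submodule N R F"
  unfolding tensor_null_def by (rule generated_submodule_facts[OF F relations_sub])

lemma rel_null: "r \<in> tensor_relations R P M \<Longrightarrow> r \<in> N"
  unfolding tensor_null_def using generated_submodule_facts(2)[OF F relations_sub] by blast

lemma tensor_module: "module R (tensor_mod R P M)"
  unfolding tensor_mod_def by (rule quot_module[OF F N])

sublocale T: module R "tensor_mod R P M" by (rule tensor_module)

lemma coset: "(\<lambda>u. N +>\<^bsub>F\<^esub> u) \<in> mod_hom R F (tensor_mod R P M)"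
  unfolding tensor_mod_def by (rule coset_hom[OF F N])

lemma tens_closed: "p \<in> carrier P \<Longrightarrow> m \<in> carrier M \<Longrightarrow> tens R P M p m \<in> carrier (tensor_mod R P M)"
  unfolding tens_def by (rule mod_homD(1)[OF coset basis_mem])

lemma coset_eqI: "u \<ominus>\<^bsub>F\<^esub> v \<in> N \<Longrightarrow> u \<in> carrier F \<Longrightarrow> v \<in> carrier F \<Longrightarrow> N +>\<^bsub>F\<^esub> u = N +>\<^bsub>F\<^esub> v"
  using coset_eq_iff[OF F N] by blast

lemma tens_bilinear:
  "p \<in> carrier P \<Longrightarrow> p' \<in> carrier P \<Longrightarrow> m \<in> carrier M \<Longrightarrow>
    tens R P M (p \<oplus>\<^bsub>P\<^esub> p') m = tens R P M p m \<oplus>\<^bsub>tensor_mod R P M\<^esub> tens R P M p' m"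
  "p \<in> carrier P \<Longrightarrow> m \<in> carrier M \<Longrightarrow> m' \<in> carrier M \<Longrightarrow>
    tens R P M p (m \<oplus>\<^bsub>M\<^esub> m') = tens R P M p m \<oplus>\<^bsub>tensor_mod R P M\<^esub> tens R P M p m'"
  "a \<in> carrier R \<Longrightarrow> p \<in> carrier P \<Longrightarrow> m \<in> carrier M \<Longrightarrow>
    tens R P M (a \<odot>\<^bsub>P\<^esub> p) m = a \<odot>\<^bsub>tensor_mod R P M\<^esub> tens R P M p m"
  "a \<in> carrier R \<Longrightarrow> p \<in> carrier P \<Longrightarrow> m \<in> carrier M \<Longrightarrow>
    tens R P M p (a \<odot>\<^bsub>M\<^esub> m) = a \<odot>\<^bsub>tensor_mod R P M\<^esub> tens R P M p m"
proof goal_cases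
  case 1
  have "basis_vec R (p \<oplus>\<^bsub>P\<^esub> p', m) \<ominus>\<^bsub>F\<^esub> (basis_vec R (p, m) \<oplus>\<^bsub>F\<^esub> basis_vec R (p', m)) \<in> N"
    by (rule rel_null) (use 1 in \<open>unfold tensor_relations_def Let_def, blast\<close>)
  then show ?case unfolding tens_def
    by (subst mod_homD(2)[OF coset, symmetric]; (rule coset_eqI)?) (use 1 in \<open>simp_all add: basis_mem\<close>)
next
  case 2
  have "basis_vec R (p, m \<oplus>\<^bsub>M\<^esub> m') \<ominus>\<^bsub>F\<^esub> (basis_vec R (p, m) \<oplus>\<^bsub>F\<^esub> basis_vec R (p, m')) \<in> N"
    by (rule rel_null) (use 2 in \<open>unfold tensor_relations_def Let_def, blast\<close>)
  then show ?case unfolding tens_def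
    by (subst mod_homD(2)[OF coset, symmetric]; (rule coset_eqI)?) (use 2 in \<open>simp_all add: basis_mem\<close>)
next
  case 3
  have "basis_vec R (a \<odot>\<^bsub>P\<^esub> p, m) \<ominus>\<^bsub>F\<^esub> a \<odot>\<^bsub>F\<^esub> basis_vec R (p, m) \<in> N"
    by (rule rel_null) (use 3 in \<open>unfold tensor_relations_def Let_def, blast\<close>)
  then show ?case unfolding tens_def
    by (subst mod_homD(3)[OF coset, symmetric]; (rule coset_eqI)?) (use 3 in \<open>simp_all add: basis_mem\<close>)
next
  case 4
  have "basis_vec R (p, a \<odot>\<^bsub>M\<^esub> m) \<ominus>\<^bsub>F\<^esub> a \<odot>\<^bsub>F\<^esub> basis_vec R (p, m) \<in> N"
    by (rule rel_null) (use 4 in \<open>unfold tensor_relations_def Let_def, blast\<close>)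
  then show ?case unfolding tens_def
    by (subst mod_homD(3)[OF coset, symmetric]; (rule coset_eqI)?) (use 4 in \<open>simp_all add: basis_mem\<close>)
qed

text \<open>Pulled back to the free module on pairs, both maps are determined by the basis vectors,
  which represent the elementary tensors. Identities between maps of tensor products are proved
  through this.\<close>

lemma tensor_hom_ext:
  assumes L: "module R L" and f: "f \<in> mod_hom R (tensor_mod R P M) L" and g: "g \<in> mod_hom R (tensor_mod R P M) L"
    and eq: "\<And>p m. p \<in> carrier P \<Longrightarrow> m \<in> carrier M \<Longrightarrow> f (tens R P M p m) = g (tens R P M p m)"
    and t: "t \<in> carrier (tensor_mod R P M)"
  shows "f t = g t"
proof -
  obtain u where u: "u \<in> carrier F" "t = N +>\<^bsub>F\<^esub> u"
    using t quot_carrier[OF F N] unfolding tensor_mod_def by blast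
  have "f (N +>\<^bsub>F\<^esub> u) = g (N +>\<^bsub>F\<^esub> u)"
  proof (rule free_hom_ext[OF L, where f = "\<lambda>u. f (N +>\<^bsub>F\<^esub> u)" and g = "\<lambda>u. g (N +>\<^bsub>F\<^esub> u)"])
    show "(\<lambda>u. f (N +>\<^bsub>F\<^esub> u)) \<in> mod_hom R (free_mod R (carrier P \<times> carrier M)) L"
      "(\<lambda>u. g (N +>\<^bsub>F\<^esub> u)) \<in> mod_hom R (free_mod R (carrier P \<times> carrier M)) L"
      using mod_hom_comp[OF coset f] mod_hom_comp[OF coset g] by (simp_all add: tensor_free_def)
  qed (use eq u in \<open>auto simp: tens_def tensor_free_def\<close>)
  then show ?thesis using u by simp
qed

text \<open>The universal property: by bilinearity the linear extension of \<open>\<beta>\<close>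
  kills the relations, hence the submodule that they generate, and so factors through the
  quotient.\<close>

lemma tensor_lift:
  assumes L: "module R L" and cl: "\<And>p m. p \<in> carrier P \<Longrightarrow> m \<in> carrier M \<Longrightarrow> \<beta> p m \<in> carrier L"
    and bil: "\<And>p p' m. p \<in> carrier P \<Longrightarrow> p' \<in> carrier P \<Longrightarrow> m \<in> carrier M \<Longrightarrow>
        \<beta> (p \<oplus>\<^bsub>P\<^esub> p') m = \<beta> p m \<oplus>\<^bsub>L\<^esub> \<beta> p' m"
      "\<And>p m m'. p \<in> carrier P \<Longrightarrow> m \<in> carrier M \<Longrightarrow> m' \<in> carrier M \<Longrightarrow>
        \<beta> p (m \<oplus>\<^bsub>M\<^esub> m') = \<beta> p m \<oplus>\<^bsub>L\<^esub> \<beta> p m'"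
      "\<And>a p m. a \<in> carrier R \<Longrightarrow> p \<in> carrier P \<Longrightarrow> m \<in> carrier M \<Longrightarrow> \<beta> (a \<odot>\<^bsub>P\<^esub> p) m = a \<odot>\<^bsub>L\<^esub> \<beta> p m"
      "\<And>a p m. a \<in> carrier R \<Longrightarrow> p \<in> carrier P \<Longrightarrow> m \<in> carrier M \<Longrightarrow> \<beta> p (a \<odot>\<^bsub>M\<^esub> m) = a \<odot>\<^bsub>L\<^esub> \<beta> p m"
  shows "\<exists>h\<in>mod_hom R (tensor_mod R P M) L. \<forall>p\<in>carrier P. \<forall>m\<in>carrier M. h (tens R P M p m) = \<beta> p m"
proof -
  interpret L: module R L by fact
  let ?g = "\<lambda>(p, m). \<beta> p m"
  have g: "?g \<in> carrier P \<times> carrier M \<rightarrow> carrier L" using cl by auto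
  let ?l = "lin R L ?g"
  have l: "?l \<in> mod_hom R F L" unfolding tensor_free_def by (rule lin_hom[OF L g])
  have lb: "?l (basis_vec R (p, m)) = \<beta> p m" if "p \<in> carrier P" "m \<in> carrier M" for p m
    using lin_basis[OF L g, of "(p, m)"] that by simp
  have K: "submodule {u \<in> carrier F. ?l u \<in> {\<zero>\<^bsub>L\<^esub>}} R F"
    by (rule submodule_vimage[OF F L l F.carrier_is_submodule L.submodule_trivial])
  have "?l r = \<zero>\<^bsub>L\<^esub>" if "r \<in> tensor_relations R P M" for r
    using that unfolding tensor_relations_def Let_def
    by (elim UnE CollectE exE conjE; hypsubst)
      (simp_all add: mod_hom_minus[OF F L l] mod_homD(2,3)[OF l] basis_mem lb bil cl L.minus_self del: free_mod_simps)
  then have "tensor_relations R P M \<subseteq> {u \<in> carrier F. ?l u \<in> {\<zero>\<^bsub>L\<^esub>}}" using relations_sub by auto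
  then have "N \<subseteq> {u \<in> carrier F. ?l u \<in> {\<zero>\<^bsub>L\<^esub>}}"
    unfolding tensor_null_def by (rule generated_submodule_min[OF K])
  then obtain h where h: "h \<in> mod_hom R (quot_mod F N) L" "\<And>x. x \<in> carrier F \<Longrightarrow> h (N +>\<^bsub>F\<^esub> x) = ?l x"
    using quot_lift[OF F N l L] by blast
  then show ?thesis unfolding tensor_mod_def[symmetric]
    by (intro bexI[of _ h]) (auto simp: tens_def basis_mem lb)
qed

end

text \<open>Relates the coordinate formula for \<open>free_map\<close>, a sum over fibres of
  \<open>g\<close>, to linear extension, from which its linearity and its values on basis vectors
  follow.\<close>

lemma free_map_lin:
  assumes "cring R" and g: "g \<in> B \<rightarrow> B'" and u: "u \<in> carrier (free_mod R B)"
  shows "free_map R B' g u = lin R (free_mod R B') (\<lambda>b. basis_vec R (g b)) u"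
proof
  fix c
  interpret cring R by fact
  note F' = free_module[of B']
  interpret F': module R "free_mod R B'" by (rule F')
  have gm: "(\<lambda>b. basis_vec R (g b)) \<in> B \<rightarrow> carrier (free_mod R B')"
    using g by (intro Pi_I basis_vec_mem) blast
  have fu: "finite {b. u b \<noteq> \<zero>\<^bsub>R\<^esub>}" and su: "{b. u b \<noteq> \<zero>\<^bsub>R\<^esub>} \<subseteq> B" using u free_supp by (auto simp: free_carrier)
  show "free_map R B' g u c = lin R (free_mod R B') (\<lambda>b. basis_vec R (g b)) u c"
  proof (cases "c \<in> B'")
    case False
    have "lin R (free_mod R B') (\<lambda>b. basis_vec R (g b)) u \<in> carrier (free_mod R B')"
      by (rule mod_homD(1)[OF lin_hom[OF F' gm] u])
    then show ?thesis using False by (simp add: free_map_def free_carrier)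
  next
    case True
    have "lin R (free_mod R B') (\<lambda>b. basis_vec R (g b)) u c =
      (\<Oplus>\<^bsub>self_mod R\<^esub>b\<in>{b. u b \<noteq> \<zero>\<^bsub>R\<^esub>}. (u b \<odot>\<^bsub>free_mod R B'\<^esub> basis_vec R (g b)) c)"
      unfolding lin_def
      by (rule mod_hom_finsum[OF F' self_module[OF is_cring] free_eval_hom fu])
        (use gm su free_mem[OF u] in \<open>auto intro!: F'.smult_closed simp del: free_mod_simps\<close>)
    also have "\<dots> = (\<Oplus>\<^bsub>R\<^esub>b\<in>{b. u b \<noteq> \<zero>\<^bsub>R\<^esub>}. u b \<otimes>\<^bsub>R\<^esub> basis_vec R (g b) c)" by (simp add: finsum_self)
    also have "\<dots> = (\<Oplus>\<^bsub>R\<^esub>b\<in>{b. u b \<noteq> \<zero>\<^bsub>R\<^esub> \<and> g b = c}. u b)"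
      by (rule add.finprod_mono_neutral_cong_left[OF fu, folded finsum_def, symmetric])
        (use free_mem[OF u] in \<open>auto simp: basis_vec_def\<close>)
    finally show ?thesis using True by (simp add: free_map_def)
  qed
qed

text \<open>The universal property provides the map \<open>h\<close> with these properties. Every
  representative of a class \<open>C\<close> contributes the coset \<open>h C\<close> to the union
  that defines \<open>tensor_map\<close>, so the two maps agree.\<close>

lemma tensor_map_facts:
  assumes P: "module R P" and P': "module R P'" and M: "module R M" and f: "f \<in> mod_hom R P P'"
  shows tensor_map_hom: "tensor_map R P' M f \<in> mod_hom R (tensor_mod R P M) (tensor_mod R P' M)"
    and tensor_map_tens: "\<And>p m. p \<in> carrier P \<Longrightarrow> m \<in> carrier M \<Longrightarrow>
      tensor_map R P' M f (tens R P M p m) = tens R P' M (f p) m"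
proof -
  interpret M: module R M by fact
  interpret T: tensor_pair R P M using P M by (rule tensor_pair.intro)
  interpret T': tensor_pair R P' M using P' M by (rule tensor_pair.intro)
  note f' = mod_homD[OF f]
  obtain h where h: "h \<in> mod_hom R (tensor_mod R P M) (tensor_mod R P' M)"
    "\<And>p m. p \<in> carrier P \<Longrightarrow> m \<in> carrier M \<Longrightarrow> h (tens R P M p m) = tens R P' M (f p) m"
    using T.tensor_lift[OF T'.tensor_module, of "\<lambda>p m. tens R P' M (f p) m"]
    by (auto simp: f' T'.tens_bilinear T'.tens_closed)
  let ?g = "map_prod f id"
  have g: "?g \<in> carrier P \<times> carrier M \<rightarrow> carrier P' \<times> carrier M" using f'(1) by auto
  have gm: "(\<lambda>b. basis_vec R (?g b)) \<in> carrier P \<times> carrier M \<rightarrow> carrier (free_mod R (carrier P' \<times> carrier M))"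
    using g by (intro Pi_I M.R.basis_vec_mem) blast
  have key: "T'.N +>\<^bsub>T'.F\<^esub> free_map R (carrier P' \<times> carrier M) ?g u = h (T.N +>\<^bsub>T.F\<^esub> u)"
    if u: "u \<in> carrier T.F" for u
  proof -
    have u': "u \<in> carrier (free_mod R (carrier P \<times> carrier M))" using u by (simp add: tensor_free_def)
    have "free_map R (carrier P' \<times> carrier M) ?g u =
      lin R (free_mod R (carrier P' \<times> carrier M)) (\<lambda>b. basis_vec R (?g b)) u"
      by (rule free_map_lin[OF M.R.is_cring g u'])
    moreover have "T'.N +>\<^bsub>T'.F\<^esub> lin R (free_mod R (carrier P' \<times> carrier M)) (\<lambda>b. basis_vec R (?g b)) u = h (T.N +>\<^bsub>T.F\<^esub> u)"
    proof (rule free_hom_ext[OF T'.tensor_module _ _ _ u',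
          where f = "\<lambda>u. T'.N +>\<^bsub>T'.F\<^esub> lin R (free_mod R (carrier P' \<times> carrier M)) (\<lambda>b. basis_vec R (?g b)) u"
            and g = "\<lambda>u. h (T.N +>\<^bsub>T.F\<^esub> u)"])
      show "(\<lambda>u. T'.N +>\<^bsub>T'.F\<^esub> lin R (free_mod R (carrier P' \<times> carrier M)) (\<lambda>b. basis_vec R (?g b)) u)
          \<in> mod_hom R (free_mod R (carrier P \<times> carrier M)) (tensor_mod R P' M)"
        by (rule mod_hom_comp[OF lin_hom[OF M.R.free_module gm]]) (use T'.coset in \<open>simp add: tensor_free_def\<close>)
      show "(\<lambda>u. h (T.N +>\<^bsub>T.F\<^esub> u)) \<in> mod_hom R (free_mod R (carrier P \<times> carrier M)) (tensor_mod R P' M)"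
        using mod_hom_comp[OF T.coset h(1)] by (simp add: tensor_free_def)
      fix b assume "b \<in> carrier P \<times> carrier M"
      then show "T'.N +>\<^bsub>T'.F\<^esub> lin R (free_mod R (carrier P' \<times> carrier M)) (\<lambda>b. basis_vec R (?g b)) (basis_vec R b) =
        h (T.N +>\<^bsub>T.F\<^esub> basis_vec R b)"
        using h(2) by (auto simp: lin_basis[OF M.R.free_module gm] tens_def)
    qed
    ultimately show ?thesis by simp
  qed
  have eq: "tensor_map R P' M f C = h C" if C: "C \<in> carrier (tensor_mod R P M)" for C
  proof -
    obtain u where u: "u \<in> carrier T.F" "C = T.N +>\<^bsub>T.F\<^esub> u"
      using C quot_carrier[OF T.F T.N] unfolding tensor_mod_def by blast
    have v: "v \<in> carrier T.F \<and> T.N +>\<^bsub>T.F\<^esub> v = C" if "v \<in> C" for v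
      using coset_mem[OF T.F T.N u(1)] that u(2) by blast
    have "u \<in> C" using coset_self[OF T.F T.N u(1)] u(2) by blast
    moreover have "T'.N +>\<^bsub>T'.F\<^esub> free_map R (carrier P' \<times> carrier M) ?g v = h C" if "v \<in> C" for v
      using key[of v] v[OF that] by simp
    ultimately show ?thesis unfolding tensor_map_def by blast
  qed
  show "tensor_map R P' M f \<in> mod_hom R (tensor_mod R P M) (tensor_mod R P' M)"
    by (rule mod_homI) (use h(1) in \<open>simp_all add: eq mod_homD[OF h(1)]\<close>)
  show "tensor_map R P' M f (tens R P M p m) = tens R P' M (f p) m" if "p \<in> carrier P" "m \<in> carrier M" for p m
    using that by (simp add: eq T.tens_closed h(2))
qed

section \<open>Homology of complexes of finite free modules\<close>

lemma (in serre_class) sq_iso: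
  assumes M: "module R M" and P: "module R P" and \<theta>: "\<theta> \<in> mod_hom R M P" "bij_betw \<theta> (carrier M) (carrier P)"
    and U: "submodule U R M" and V: "submodule V R M" and VU: "V \<subseteq> U"
  shows "sq M U V \<longleftrightarrow> sq P (\<theta> ` U) (\<theta> ` V)"
proof
  interpret M: module R M by fact
  interpret P: module R P by fact
  have U': "submodule (\<theta> ` U) R P" and V': "submodule (\<theta> ` V) R P"
    by (rule submodule_image[OF M P \<theta>(1) U] submodule_image[OF M P \<theta>(1) V])+
  have VU': "\<theta> ` V \<subseteq> \<theta> ` U" using VU by blast
  have Uc: "U \<subseteq> carrier M" and Vc: "V \<subseteq> carrier M" by (rule M.submoduleE(1)[OF U] M.submoduleE(1)[OF V])+
  {
    assume sq: "sq M U V"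
    show "sq P (\<theta> ` U) (\<theta> ` V)"
    proof (rule sq_surj[OF P U' V' VU' M U sq \<theta>(1)])
      fix u assume "u \<in> \<theta> ` U"
      then obtain w where w: "w \<in> U" "u = \<theta> w" by blast
      moreover from this have "u \<ominus>\<^bsub>P\<^esub> \<theta> w = \<zero>\<^bsub>P\<^esub>" using Uc mod_homD(1)[OF \<theta>(1)] by (auto simp: P.minus_self)
      moreover note P.submodule_zero[OF V']
      ultimately show "\<exists>u'\<in>U. u \<ominus>\<^bsub>P\<^esub> \<theta> u' \<in> \<theta> ` V" by (metis (no_types))
    qed auto
  next
    assume sq: "sq P (\<theta> ` U) (\<theta> ` V)"
    show "sq M U V"
    proof (rule sq_inj[OF M U V VU P U' sq \<theta>(1)])
      fix u assume "u \<in> U" "\<theta> u \<in> \<theta> ` V"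
      then show "u \<in> V" using \<theta>(2) Uc Vc by (auto simp: bij_betw_def inj_on_def subset_iff)
    qed auto
  }
qed

lemma iso_image_kernel:
  assumes M: "module R M" "module R M'" and P: "module R P" "module R P'"
    and \<theta>: "\<theta> \<in> mod_hom R M P" "bij_betw \<theta> (carrier M) (carrier P)"
    and \<theta>': "\<theta>' \<in> mod_hom R M' P'" "bij_betw \<theta>' (carrier M') (carrier P')"
    and d: "\<And>x. x \<in> carrier M \<Longrightarrow> d x \<in> carrier M'"
    and com: "\<And>x. x \<in> carrier M \<Longrightarrow> \<theta>' (d x) = \<delta> (\<theta> x)"
  shows "\<theta> ` {x \<in> carrier M. d x = \<zero>\<^bsub>M'\<^esub>} = {u \<in> carrier P. \<delta> u = \<zero>\<^bsub>P'\<^esub>}"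
proof -
  interpret M': module R M' by fact
  note z = mod_hom_zero[OF M(2) P(2) \<theta>'(1)]
  have inj: "\<theta>' y = \<zero>\<^bsub>P'\<^esub> \<longleftrightarrow> y = \<zero>\<^bsub>M'\<^esub>" if "y \<in> carrier M'" for y
    using \<theta>'(2) that z M'.zero_closed unfolding bij_betw_def by (metis inj_on_eq_iff)
  have onto: "carrier P = \<theta> ` carrier M" using \<theta>(2) by (simp add: bij_betw_def)
  show ?thesis
    unfolding onto using inj d by (auto simp: com[symmetric])
qed

lemma iso_image_image:
  assumes \<theta>: "bij_betw \<theta> (carrier M) (carrier P)"
    and com: "\<And>x. x \<in> carrier M \<Longrightarrow> \<theta>' (d x) = \<delta> (\<theta> x)"
  shows "\<theta>' ` d ` carrier M = \<delta> ` carrier P"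
proof -
  have onto: "carrier P = \<theta> ` carrier M" using \<theta> by (simp add: bij_betw_def)
  show ?thesis unfolding onto image_image using com by simp
qed

lemma iso_zero_comp:
  assumes M: "module R M'" and P: "module R P'" and \<theta>': "\<theta>' \<in> mod_hom R M' P'" "inj_on \<theta>' (carrier M')"
    and y: "y \<in> carrier M'" "\<theta>' y = \<zero>\<^bsub>P'\<^esub>"
  shows "y = \<zero>\<^bsub>M'\<^esub>"
  using mod_hom_zero[OF M P \<theta>'(1)] \<theta>'(2) y abelian_monoid.zero_closed[of M'] M
  by (metis abelian_group_def inj_on_def module_def)

context serre_complex begin

text \<open>The isomorphisms \<open>\<theta>\<close> carry the cycles and boundaries of the complex
  to those of the matrices, while \<open>sq_iff\<close> replaces the cosets in the definition of
  homology by \<open>sq\<close>.\<close>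

lemma chain_link:
  assumes M: "module R M" and C: "\<And>n. module R (C n)" and d: "\<And>n. d n \<in> mod_hom R (C (Suc n)) (C n)"
    and \<theta>: "\<And>n. \<theta> n \<in> mod_hom R (C n) (pow_mod (B (Suc n)) M)"
      "\<And>n. bij_betw (\<theta> n) (carrier (C n)) (carrier (pow_mod (B (Suc n)) M))"
    and com: "\<And>n x. x \<in> carrier (C (Suc n)) \<Longrightarrow>
      \<theta> n (d n x) = mact M (B (Suc n)) (B (Suc (Suc n))) (A (Suc n)) (\<theta> (Suc n) x)"
  shows "belongs_to R (chain_homology C d i) S \<longleftrightarrow> hc M i (carrier M) {\<zero>\<^bsub>M\<^esub>}"
proof -
  interpret M: module R M by fact
  define Z where "Z = (case i of 0 \<Rightarrow> carrier (C 0) | Suc n \<Rightarrow> a_kernel (C (Suc n)) (C n) (d n))"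
  define I where "I = d i ` carrier (C (Suc i))"
  note P = pow_module[OF M] and d' = mod_homD[OF d]
  have Ker: "a_kernel (C (Suc n)) (C n) (d n) = {x \<in> carrier (C (Suc n)). d n x = \<zero>\<^bsub>C n\<^esub>}" for n
    by (simp add: a_kernel_def')
  have car: "submodule (carrier (C n)) R (C n)" and triv: "submodule {\<zero>\<^bsub>C n\<^esub>} R (C n)" for n
    by (rule module.carrier_is_submodule[OF C] module.submodule_trivial[OF C])+
  have Z: "submodule Z R (C i)"
    using car submodule_vimage[OF C C d car triv] by (cases i) (auto simp: Z_def Ker)
  have I: "submodule I R (C i)" unfolding I_def by (rule submodule_image[OF C C d car])
  \<comment> \<open>That the differential squares to zero is read off from the matrices, because
    \<open>\<theta> n\<close> is injective.\<close>
  have dd: "d n (d (Suc n) x) = \<zero>\<^bsub>C n\<^esub>" if x: "x \<in> carrier (C (Suc (Suc n)))" for n x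
  proof (rule iso_zero_comp[OF C P \<theta>(1)])
    show "inj_on (\<theta> n) (carrier (C n))" using \<theta>(2) by (simp add: bij_betw_def)
    have tx: "\<theta> (Suc (Suc n)) x \<in> B (Suc (Suc (Suc n))) \<rightarrow>\<^sub>E carrier M" using mod_homD(1)[OF \<theta>(1) x] by simp
    show "\<theta> n (d n (d (Suc n) x)) = \<zero>\<^bsub>pow_mod (B (Suc n)) M\<^esub>"
      unfolding com[OF d'(1)[OF x]] com[OF x] by (rule mat_step_zero[OF M step tx])
  qed (intro d'(1) x)
  have IZ: "I \<subseteq> Z" using d' dd by (cases i) (auto simp: I_def Z_def Ker)
  have "belongs_to R (chain_homology C d i) S \<longleftrightarrow> sq (C i) Z I"
    unfolding chain_homology_def Z_def[symmetric] I_def[symmetric] by (rule sq_iff[OF C Z I IZ])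
  also have "\<dots> \<longleftrightarrow> sq (pow_mod (B (Suc i)) M) (\<theta> i ` Z) (\<theta> i ` I)"
    by (rule sq_iso[OF C P \<theta> Z I IZ])
  also have "\<theta> i ` I = mact M (B (Suc i)) (B (Suc (Suc i))) (A (Suc i)) ` (B (Suc (Suc i)) \<rightarrow>\<^sub>E carrier M)"
    unfolding I_def pow_mod_simps(1)[symmetric] by (rule iso_image_image[OF \<theta>(2)]) (rule com)
  also have "\<theta> i ` Z = {u \<in> B (Suc i) \<rightarrow>\<^sub>E carrier M. mact M (B i) (B (Suc i)) (A i) u = \<zero>\<^bsub>pow_mod (B i) M\<^esub>}"
  proof (cases i)
    case 0
    \<comment> \<open>In degree zero all elements are cycles. On the side of the matrices this holds
      because the matrix has no rows.\<close>
    have "mact M (B 0) (B (Suc 0)) (A 0) u = \<zero>\<^bsub>pow_mod (B 0) M\<^esub>" for u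
      by (simp add: mact_def B0 fun_eq_iff)
    then show ?thesis using \<theta>(2)[of 0] 0 by (simp add: Z_def bij_betw_def)
  next
    case (Suc n)
    have Zn: "Z = {x \<in> carrier (C (Suc n)). d n x = \<zero>\<^bsub>C n\<^esub>}" by (simp add: Z_def Ker Suc)
    show ?thesis unfolding Zn Suc pow_mod_simps(1)[symmetric]
      by (rule iso_image_kernel[where R = R and \<theta>' = "\<theta> n"]) (simp_all add: C P \<theta> com d'(1) del: pow_mod_simps)
  qed
  finally show ?thesis unfolding hc_def mh_carrier[OF M step] by (simp only:)
qed

text \<open>The argument of \<open>chain_link\<close> for the transposed matrices, which go upwards
  in degree.\<close>

lemma cochain_link:
  assumes M: "module R M" and C: "\<And>n. module R (C n)" and d: "\<And>n. d n \<in> mod_hom R (C n) (C (Suc n))"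
    and \<theta>: "\<And>n. \<theta> n \<in> mod_hom R (C n) (pow_mod (B (Suc n)) M)"
      "\<And>n. bij_betw (\<theta> n) (carrier (C n)) (carrier (pow_mod (B (Suc n)) M))"
    and com: "\<And>n x. x \<in> carrier (C n) \<Longrightarrow>
      \<theta> (Suc n) (d n x) = mact M (B (Suc (Suc n))) (B (Suc n)) (T (Suc n)) (\<theta> n x)"
  shows "belongs_to R (cochain_cohomology C d i) S \<longleftrightarrow> hk M i (carrier M) {\<zero>\<^bsub>M\<^esub>}"
proof -
  interpret M: module R M by fact
  define Z where "Z = a_kernel (C i) (C (Suc i)) (d i)"
  define I where "I = (case i of 0 \<Rightarrow> {\<zero>\<^bsub>C 0\<^esub>} | Suc n \<Rightarrow> d n ` carrier (C n))"
  note P = pow_module[OF M] and d' = mod_homD[OF d]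
  have Ker: "Z = {x \<in> carrier (C i). d i x = \<zero>\<^bsub>C (Suc i)\<^esub>}"
    by (simp add: Z_def a_kernel_def')
  have car: "submodule (carrier (C n)) R (C n)" and triv: "submodule {\<zero>\<^bsub>C n\<^esub>} R (C n)" for n
    by (rule module.carrier_is_submodule[OF C] module.submodule_trivial[OF C])+
  have Z: "submodule Z R (C i)"
    using submodule_vimage[OF C C d car triv] by (simp add: Ker)
  have I: "submodule I R (C i)"
    using triv submodule_image[OF C C d car] by (cases i) (auto simp: I_def)
  have dd: "d (Suc n) (d n x) = \<zero>\<^bsub>C (Suc (Suc n))\<^esub>" if x: "x \<in> carrier (C n)" for n x
  proof (rule iso_zero_comp[OF C P \<theta>(1)])
    show "inj_on (\<theta> (Suc (Suc n))) (carrier (C (Suc (Suc n))))" using \<theta>(2) by (simp add: bij_betw_def)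
    have tx: "\<theta> n x \<in> B (Suc n) \<rightarrow>\<^sub>E carrier M" using mod_homD(1)[OF \<theta>(1) x] by simp
    show "\<theta> (Suc (Suc n)) (d (Suc n) (d n x)) = \<zero>\<^bsub>pow_mod (B (Suc (Suc (Suc n)))) M\<^esub>"
      unfolding com[OF d'(1)[OF x]] com[OF x] by (rule mat_step_zero[OF M costep tx])
  qed (intro d'(1) x)
  have IZ: "I \<subseteq> Z" using d' dd mod_hom_zero[OF C C d] module.submodule_zero[OF C car]
    by (cases i) (auto simp: I_def Ker)
  have "belongs_to R (cochain_cohomology C d i) S \<longleftrightarrow> sq (C i) Z I"
    unfolding cochain_cohomology_def Z_def[symmetric] I_def[symmetric] by (rule sq_iff[OF C Z I IZ])
  also have "\<dots> \<longleftrightarrow> sq (pow_mod (B (Suc i)) M) (\<theta> i ` Z) (\<theta> i ` I)"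
    by (rule sq_iso[OF C P \<theta> Z I IZ])
  also have "\<theta> i ` Z = {u \<in> B (Suc i) \<rightarrow>\<^sub>E carrier M.
      mact M (B (Suc (Suc i))) (B (Suc i)) (T (Suc i)) u = \<zero>\<^bsub>pow_mod (B (Suc (Suc i))) M\<^esub>}"
    unfolding Ker pow_mod_simps(1)[symmetric]
    by (rule iso_image_kernel[where R = R and \<theta>' = "\<theta> (Suc i)"]) (simp_all add: C P \<theta> com d'(1) del: pow_mod_simps)
  also have "\<theta> i ` I = mact M (B (Suc i)) (B i) (T i) ` (B i \<rightarrow>\<^sub>E carrier M)"
  proof (cases i)
    case 0
    \<comment> \<open>In degree zero the coboundaries are zero by definition. For the matrices they
      are the image of a power with empty index set, whose only element goes to zero.\<close>
    have "mact M (B (Suc 0)) (B 0) (T 0) u = \<zero>\<^bsub>pow_mod (B (Suc 0)) M\<^esub>" for u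
      by (simp add: mact_def B0)
    moreover have "B 0 \<rightarrow>\<^sub>E carrier M \<noteq> {}" by (simp add: B0)
    ultimately show ?thesis using mod_hom_zero[OF C P \<theta>(1), of 0] 0 by (simp add: I_def image_constant_conv)
  next
    case (Suc n)
    have In: "I = d n ` carrier (C n)" by (simp add: I_def Suc)
    show ?thesis unfolding In Suc pow_mod_simps(1)[symmetric] by (rule iso_image_image[OF \<theta>(2)]) (rule com)
  qed
  finally show ?thesis unfolding hk_def mh_carrier[OF M costep] by (simp only:)
qed

end

section \<open>From differentials of free modules to matrices\<close>

definition shift_basis :: "(nat \<Rightarrow> 'b set) \<Rightarrow> nat \<Rightarrow> 'b set" where
  "shift_basis B = case_nat {} B"

text \<open>Column \<open>b\<close> lists the coordinates of the image of the basis vector at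
  \<open>b\<close>. The matrix at index 0 has no rows, and its entries are dummies.\<close>

definition shift_matrix ::
  "('a,'r) ring_scheme \<Rightarrow> (nat \<Rightarrow> ('b \<Rightarrow> 'a) \<Rightarrow> ('b \<Rightarrow> 'a)) \<Rightarrow> nat \<Rightarrow> 'b \<Rightarrow> 'b \<Rightarrow> 'a" where
  "shift_matrix R d = case_nat (\<lambda>_ _. \<zero>\<^bsub>R\<^esub>) (\<lambda>n c b. d n (basis_vec R b) c)"

lemma shift_simps [simp]:
  "shift_basis B 0 = {}" "shift_basis B (Suc n) = B n"
  "shift_matrix R d (Suc n) c b = d n (basis_vec R b) c"
  by (simp_all add: shift_basis_def shift_matrix_def)

locale finite_free_complex = R?: cring R for R :: "('a,'r) ring_scheme" (structure) +
  fixes B :: "nat \<Rightarrow> 'b set" and d :: "nat \<Rightarrow> ('b \<Rightarrow> 'a) \<Rightarrow> ('b \<Rightarrow> 'a)"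
  assumes finite_basis: "\<And>n. finite (B n)"
    and d: "\<And>n. d n \<in> mod_hom R (free_mod R (B (Suc n))) (free_mod R (B n))"
    and dd: "\<And>n u. u \<in> carrier (free_mod R (B (Suc (Suc n)))) \<Longrightarrow> d n (d (Suc n) u) = \<zero>\<^bsub>free_mod R (B n)\<^esub>"
begin

lemma d_expand:
  assumes u: "u \<in> carrier (free_mod R (B (Suc n)))"
  shows "d n u c = (\<Oplus>b\<in>B (Suc n). u b \<otimes> d n (basis_vec R b) c)"
proof -
  have h: "(\<lambda>u. d n u c) \<in> mod_hom R (free_mod R (B (Suc n))) (self_mod R)"
    by (rule mod_hom_comp[OF d free_eval_hom])
  show ?thesis
    using free_hom_expand[OF self_module[OF is_cring] h finite_basis u] by (simp add: finsum_self)
qed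

lemma d_entry: "b \<in> B (Suc n) \<Longrightarrow> d n (basis_vec R b) c \<in> carrier R"
  by (rule free_mem[OF mod_homD(1)[OF d basis_vec_mem]])

lemma mat_complex: "mat_complex R (shift_basis B) (shift_matrix R d)"
proof
  fix n
  show "finite (shift_basis B n)" by (cases n) (simp_all add: finite_basis)
  show "shift_matrix R d n \<in> shift_basis B n \<rightarrow> shift_basis B (Suc n) \<rightarrow> carrier R"
    by (cases n) (auto simp: d_entry)
  fix c e assume ce: "c \<in> shift_basis B n" "e \<in> shift_basis B (Suc (Suc n))"
  then obtain k where k: "n = Suc k" "e \<in> B (Suc (Suc k))" by (cases n) auto
  have de: "d (Suc k) (basis_vec R e) \<in> carrier (free_mod R (B (Suc k)))"
    by (rule mod_homD(1)[OF d basis_vec_mem[OF k(2)]])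
  have "(\<Oplus>b\<in>B (Suc k). d k (basis_vec R b) c \<otimes> d (Suc k) (basis_vec R e) b) =
    (\<Oplus>b\<in>B (Suc k). d (Suc k) (basis_vec R e) b \<otimes> d k (basis_vec R b) c)"
    using d_entry free_mem[OF de] by (intro finsum_cong') (auto simp: m_comm)
  also have "\<dots> = d k (d (Suc k) (basis_vec R e)) c" by (rule d_expand[OF de, symmetric])
  also have "\<dots> = \<zero>" using dd[OF basis_vec_mem[OF k(2)]] by simp
  finally show "(\<Oplus>b\<in>shift_basis B (Suc n). shift_matrix R d n c b \<otimes> shift_matrix R d (Suc n) b e) = \<zero>"
    by (simp add: k)
qed simp

end

lemma hom_mod_simps [simp]:
  "carrier (hom_mod R P M) = mod_hom R P M \<inter> extensional (carrier P)"
  "\<zero>\<^bsub>hom_mod R P M\<^esub> = (\<lambda>x\<in>carrier P. \<zero>\<^bsub>M\<^esub>)"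
  "f \<oplus>\<^bsub>hom_mod R P M\<^esub> g = (\<lambda>x\<in>carrier P. f x \<oplus>\<^bsub>M\<^esub> g x)"
  "a \<odot>\<^bsub>hom_mod R P M\<^esub> f = (\<lambda>x\<in>carrier P. a \<odot>\<^bsub>M\<^esub> f x)"
  by (simp_all add: hom_mod_def)

text \<open>The extensional functions on \<open>carrier P\<close> form a power of \<open>M\<close>,
  in which the homomorphisms are a submodule. As records, this restricted power and
  \<open>hom_mod\<close> coincide.\<close>

lemma hom_module:
  assumes P: "module R P" and M: "module R M"
  shows "module R (hom_mod R P M)"
proof -
  interpret P: module R P by fact
  interpret M: module R M by fact
  interpret E: module R "pow_mod (carrier P) M" by (rule pow_module[OF M])
  have "submodule (mod_hom R P M \<inter> extensional (carrier P)) R (pow_mod (carrier P) M)"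
  proof (rule E.submoduleI')
    show "mod_hom R P M \<inter> extensional (carrier P) \<subseteq> carrier (pow_mod (carrier P) M)"
      by (auto simp: mod_hom_def PiE_def)
    show "\<zero>\<^bsub>pow_mod (carrier P) M\<^esub> \<in> mod_hom R P M \<inter> extensional (carrier P)"
      by (auto intro!: mod_homI)
    fix f g a assume f: "f \<in> mod_hom R P M \<inter> extensional (carrier P)"
    then have f': "f \<in> mod_hom R P M" by simp
    { assume "g \<in> mod_hom R P M \<inter> extensional (carrier P)"
      then have g': "g \<in> mod_hom R P M" by simp
      show "f \<oplus>\<^bsub>pow_mod (carrier P) M\<^esub> g \<in> mod_hom R P M \<inter> extensional (carrier P)"
        using mod_homD[OF f'] mod_homD[OF g']
        by (auto intro!: mod_homI simp: M.a_ac M.smult_r_distr) }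
    { assume "a \<in> carrier R"
      then show "a \<odot>\<^bsub>pow_mod (carrier P) M\<^esub> f \<in> mod_hom R P M \<inter> extensional (carrier P)"
        using mod_homD[OF f']
        by (auto intro!: mod_homI simp: M.smult_r_distr M.smult_assoc1[symmetric] P.R.m_comm) }
  qed
  then have "module R ((pow_mod (carrier P) M)\<lparr>carrier := mod_hom R P M \<inter> extensional (carrier P)\<rparr>)"
    by (rule module_restrict[OF pow_module[OF M]])
  then show ?thesis by (simp add: pow_mod_def hom_mod_def)
qed

lemma hom_free_iso:
  assumes M: "module R M"
  shows "(\<lambda>f. \<lambda>b\<in>B. f (basis_vec R b)) \<in> mod_hom R (hom_mod R (free_mod R B) M) (pow_mod B M)"
    and "bij_betw (\<lambda>f. \<lambda>b\<in>B. f (basis_vec R b)) (carrier (hom_mod R (free_mod R B) M)) (carrier (pow_mod B M))"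
proof -
  interpret M: module R M by fact
  note bm = M.R.basis_vec_mem[where B = B]
  let ?\<theta> = "\<lambda>f. \<lambda>b\<in>B. f (basis_vec R b)"
  show hom: "?\<theta> \<in> mod_hom R (hom_mod R (free_mod R B) M) (pow_mod B M)"
    by (rule mod_homI) (auto simp: bm fun_eq_iff mod_hom_def Pi_iff)
  show "bij_betw ?\<theta> (carrier (hom_mod R (free_mod R B) M)) (carrier (pow_mod B M))"
  proof (rule bij_betw_imageI)
    show "inj_on ?\<theta> (carrier (hom_mod R (free_mod R B) M))"
    proof (rule inj_onI)
      fix f g assume f: "f \<in> carrier (hom_mod R (free_mod R B) M)" and g: "g \<in> carrier (hom_mod R (free_mod R B) M)"
        and eq: "?\<theta> f = ?\<theta> g"
      have "f u = g u" if "u \<in> carrier (free_mod R B)" for u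
      proof (rule free_hom_ext[OF M _ _ _ that])
        fix b assume "b \<in> B"
        then show "f (basis_vec R b) = g (basis_vec R b)" using fun_cong[OF eq, of b] by simp
      qed (use f g in auto)
      then show "f = g" using f g by (auto intro: extensionalityI)
    qed
    show "?\<theta> ` carrier (hom_mod R (free_mod R B) M) = carrier (pow_mod B M)"
    proof
      show "?\<theta> ` carrier (hom_mod R (free_mod R B) M) \<subseteq> carrier (pow_mod B M)"
        using mod_homD(1)[OF hom] by blast
      show "carrier (pow_mod B M) \<subseteq> ?\<theta> ` carrier (hom_mod R (free_mod R B) M)"
      proof
        fix v assume v: "v \<in> carrier (pow_mod B M)"
        then have v': "v \<in> B \<rightarrow> carrier M" by auto
        let ?f = "restrict (lin R M v) (carrier (free_mod R B))"
        interpret F: module R "free_mod R B" by (rule M.R.free_module)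
        have "?f \<in> mod_hom R (free_mod R B) M"
          by (rule mod_homI) (use mod_homD[OF lin_hom[OF M v']] F.a_closed F.smult_closed in \<open>simp_all del: free_mod_simps\<close>)
        moreover have "?\<theta> ?f = v"
        proof
          fix b show "?\<theta> ?f b = v b"
            using v lin_basis[OF M v'] bm by (cases "b \<in> B") (auto simp: PiE_def extensional_def)
        qed
        ultimately show "v \<in> ?\<theta> ` carrier (hom_mod R (free_mod R B) M)"
          by (intro image_eqI[of _ _ ?f]) auto
      qed
    qed
  qed
qed

lemma basis_vec_app: "basis_vec R b c = (if c = b then \<one>\<^bsub>R\<^esub> else \<zero>\<^bsub>R\<^esub>)"
  by (simp add: basis_vec_def)

lemma tensor_free_iso:
  assumes M: "module R M" and B: "finite B"
  shows "\<exists>\<theta>\<in>mod_hom R (tensor_mod R (free_mod R B) M) (pow_mod B M).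
    bij_betw \<theta> (carrier (tensor_mod R (free_mod R B) M)) (carrier (pow_mod B M)) \<and>
    (\<forall>p\<in>carrier (free_mod R B). \<forall>m\<in>carrier M. \<theta> (tens R (free_mod R B) M p m) = (\<lambda>b\<in>B. p b \<odot>\<^bsub>M\<^esub> m))"
proof -
  interpret M: module R M by fact
  let ?F = "free_mod R B"
  note F = M.R.free_module[of B] and P = pow_module[OF M, of B]
  interpret T: tensor_pair R ?F M using F M by (rule tensor_pair.intro)
  interpret P: module R "pow_mod B M" by (rule P)
  note fm = M.R.free_mem
  obtain \<theta> where \<theta>: "\<theta> \<in> mod_hom R (tensor_mod R ?F M) (pow_mod B M)"
    "\<And>p m. p \<in> carrier ?F \<Longrightarrow> m \<in> carrier M \<Longrightarrow> \<theta> (tens R ?F M p m) = (\<lambda>b\<in>B. p b \<odot>\<^bsub>M\<^esub> m)"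
  proof -
    have "\<exists>h\<in>mod_hom R (tensor_mod R ?F M) (pow_mod B M). \<forall>p\<in>carrier ?F. \<forall>m\<in>carrier M.
        h (tens R ?F M p m) = (\<lambda>b\<in>B. p b \<odot>\<^bsub>M\<^esub> m)"
      by (rule T.tensor_lift[OF P])
        (auto simp: fm fun_eq_iff M.smult_l_distr M.smult_r_distr M.smult_assoc1[symmetric] M.R.m_comm)
    then show ?thesis using that by blast
  qed
  let ?e = "\<lambda>b. basis_vec R b"
  \<comment> \<open>The inverse of \<open>\<theta>\<close>: a vector goes to the sum of its entries
    tensored with the basis vectors. The sum exists because \<open>B\<close> is finite.\<close>
  let ?\<psi> = "\<lambda>v. \<Oplus>\<^bsub>tensor_mod R ?F M\<^esub>b\<in>B. tens R ?F M (?e b) (v b)"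
  note bm = M.R.basis_vec_mem[where B = B]
  have tc: "tens R ?F M (?e b) m \<in> carrier (tensor_mod R ?F M)" if "b \<in> B" "m \<in> carrier M" for b m
    by (rule T.tens_closed[OF bm[OF that(1)] that(2)])
  have \<psi>: "?\<psi> \<in> mod_hom R (pow_mod B M) (tensor_mod R ?F M)"
  proof (rule mod_homI)
    fix v a assume v: "v \<in> carrier (pow_mod B M)"
    then have v': "\<And>b. b \<in> B \<Longrightarrow> v b \<in> carrier M" by auto
    show "?\<psi> v \<in> carrier (tensor_mod R ?F M)" using tc v' by (intro T.T.finsum_closed) auto
    { fix w assume "w \<in> carrier (pow_mod B M)"
      then have w': "\<And>b. b \<in> B \<Longrightarrow> w b \<in> carrier M" by auto
      have "?\<psi> (v \<oplus>\<^bsub>pow_mod B M\<^esub> w) = (\<Oplus>\<^bsub>tensor_mod R ?F M\<^esub>b\<in>B.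
          tens R ?F M (?e b) (v b) \<oplus>\<^bsub>tensor_mod R ?F M\<^esub> tens R ?F M (?e b) (w b))"
        using v' w' tc bm by (intro T.T.finsum_cong' refl Pi_I) (simp_all add: T.tens_bilinear)
      also have "\<dots> = ?\<psi> v \<oplus>\<^bsub>tensor_mod R ?F M\<^esub> ?\<psi> w"
        using v' w' tc by (intro T.T.finsum_addf) auto
      finally show "?\<psi> (v \<oplus>\<^bsub>pow_mod B M\<^esub> w) = ?\<psi> v \<oplus>\<^bsub>tensor_mod R ?F M\<^esub> ?\<psi> w" . }
    { assume a: "a \<in> carrier R"
      have "?\<psi> (a \<odot>\<^bsub>pow_mod B M\<^esub> v) = (\<Oplus>\<^bsub>tensor_mod R ?F M\<^esub>b\<in>B.
          a \<odot>\<^bsub>tensor_mod R ?F M\<^esub> tens R ?F M (?e b) (v b))"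
        using v' a tc bm by (intro T.T.finsum_cong' refl Pi_I) (simp_all add: T.tens_bilinear)
      also have "\<dots> = a \<odot>\<^bsub>tensor_mod R ?F M\<^esub> ?\<psi> v"
        using v' tc a by (intro T.T.finsum_smult_ldistr[symmetric] B) auto
      finally show "?\<psi> (a \<odot>\<^bsub>pow_mod B M\<^esub> v) = a \<odot>\<^bsub>tensor_mod R ?F M\<^esub> ?\<psi> v" . }
  qed
  have left: "?\<psi> (\<theta> t) = t" if t: "t \<in> carrier (tensor_mod R ?F M)" for t
  proof (rule T.tensor_hom_ext[OF T.tensor_module mod_hom_comp[OF \<theta>(1) \<psi>] _ _ t, where g = "\<lambda>t. t"])
    show "(\<lambda>t. t) \<in> mod_hom R (tensor_mod R ?F M) (tensor_mod R ?F M)" by (rule mod_homI) auto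
    fix p m assume p: "p \<in> carrier ?F" and m: "m \<in> carrier M"
    have h: "(\<lambda>p. tens R ?F M p m) \<in> mod_hom R ?F (tensor_mod R ?F M)"
      by (rule mod_homI) (use m in \<open>simp_all del: free_mod_simps add: T.tens_closed T.tens_bilinear\<close>)
    have "?\<psi> (\<theta> (tens R ?F M p m)) = (\<Oplus>\<^bsub>tensor_mod R ?F M\<^esub>b\<in>B. p b \<odot>\<^bsub>tensor_mod R ?F M\<^esub> tens R ?F M (?e b) m)"
      using p m tc bm fm[OF p] by (intro T.T.finsum_cong' refl Pi_I) (simp_all add: \<theta>(2) T.tens_bilinear)
    also have "\<dots> = tens R ?F M p m"
      by (rule free_hom_expand[OF T.tensor_module h B p, symmetric])
    finally show "?\<psi> (\<theta> (tens R ?F M p m)) = tens R ?F M p m" .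
  qed
  have right: "\<theta> (?\<psi> v) = v" if v: "v \<in> carrier (pow_mod B M)" for v
  proof
    fix c
    have v': "\<And>b. b \<in> B \<Longrightarrow> v b \<in> carrier M" using v by auto
    have \<psi>v: "?\<psi> v \<in> carrier (tensor_mod R ?F M)" by (rule mod_homD(1)[OF \<psi> v])
    show "\<theta> (?\<psi> v) c = v c"
    proof (cases "c \<in> B")
      case True
      have h: "(\<lambda>t. \<theta> t c) \<in> mod_hom R (tensor_mod R ?F M) M"
        by (rule mod_hom_comp[OF \<theta>(1) eval_hom[OF True]])
      have "\<theta> (?\<psi> v) c = (\<Oplus>\<^bsub>M\<^esub>b\<in>B. \<theta> (tens R ?F M (?e b) (v b)) c)"
        by (rule mod_hom_finsum[OF T.tensor_module M h B]) (use tc v' in auto)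
      also have "\<dots> = (\<Oplus>\<^bsub>M\<^esub>b\<in>B. if c = b then v b else \<zero>\<^bsub>M\<^esub>)"
        using True v' bm by (intro M.finsum_cong' refl Pi_I) (simp_all add: \<theta>(2) basis_vec_app)
      also have "\<dots> = v c" using M.finsum_singleton[OF True B, of v] v' by auto
      finally show ?thesis .
    next
      case False
      then show ?thesis using v mod_homD(1)[OF \<theta>(1) \<psi>v] by (auto simp: PiE_def extensional_def)
    qed
  qed
  have "bij_betw \<theta> (carrier (tensor_mod R ?F M)) (carrier (pow_mod B M))"
    by (rule bij_betw_byWitness[of _ ?\<psi>])
      (intro ballI image_subsetI left right mod_homD(1)[OF \<theta>(1)] mod_homD(1)[OF \<psi>]; assumption)+
  then show ?thesis using \<theta> by blast
qed

locale serre_free_complex = serre_class R S + finite_free_complex R B d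
  for R :: "('a,'r) ring_scheme" (structure) and S :: "('a,'u) module set"
    and B :: "nat \<Rightarrow> 'b set" and d :: "nat \<Rightarrow> ('b \<Rightarrow> 'a) \<Rightarrow> ('b \<Rightarrow> 'a)"
begin

sublocale mat: serre_complex R S "shift_basis B" "shift_matrix R d"
  by (rule serre_complex.intro[OF serre_class_axioms mat_complex])

text \<open>Under the isomorphisms of \<open>tensor_free_iso\<close> the differential tensored with
  \<open>M\<close> becomes the matrix of \<open>d\<close>. By \<open>tensor_hom_ext\<close> it
  suffices to compare the two on elementary tensors.\<close>

lemma tensor_link:
  assumes M: "module R M"
  shows "belongs_to R (tensor_homology R (\<lambda>n. free_mod R (B n)) d M i) S \<longleftrightarrow> mat.hc M i (carrier M) {\<zero>\<^bsub>M\<^esub>}"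
proof -
  interpret M: module R M by fact
  have "\<forall>n. \<exists>\<theta>. \<theta> \<in> mod_hom R (tensor_mod R (free_mod R (B n)) M) (pow_mod (B n) M) \<and>
    bij_betw \<theta> (carrier (tensor_mod R (free_mod R (B n)) M)) (carrier (pow_mod (B n) M)) \<and>
    (\<forall>p\<in>carrier (free_mod R (B n)). \<forall>m\<in>carrier M.
      \<theta> (tens R (free_mod R (B n)) M p m) = (\<lambda>b\<in>B n. p b \<odot>\<^bsub>M\<^esub> m))"
    using tensor_free_iso[OF M finite_basis] by blast
  then obtain \<theta> where \<theta>: "\<And>n. \<theta> n \<in> mod_hom R (tensor_mod R (free_mod R (B n)) M) (pow_mod (B n) M)"
    "\<And>n. bij_betw (\<theta> n) (carrier (tensor_mod R (free_mod R (B n)) M)) (carrier (pow_mod (B n) M))"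
    "\<And>n p m. p \<in> carrier (free_mod R (B n)) \<Longrightarrow> m \<in> carrier M \<Longrightarrow>
      \<theta> n (tens R (free_mod R (B n)) M p m) = (\<lambda>b\<in>B n. p b \<odot>\<^bsub>M\<^esub> m)" by metis
  have T: "tensor_pair R (free_mod R (B n)) M" for n
    using free_module M by (rule tensor_pair.intro)
  note tm = tensor_map_hom[OF free_module free_module M d]
  note tt = tensor_map_tens[OF free_module free_module M d]
  have mat: "(\<lambda>c b. d n (basis_vec R b) c) \<in> B n \<rightarrow> B (Suc n) \<rightarrow> carrier R" for n by (auto simp: d_entry)
  have com: "\<theta> n (tensor_map R (free_mod R (B n)) M (d n) t) =
      mact M (B n) (B (Suc n)) (\<lambda>c b. d n (basis_vec R b) c) (\<theta> (Suc n) t)"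
    if t: "t \<in> carrier (tensor_mod R (free_mod R (B (Suc n))) M)" for n t
  proof (rule tensor_pair.tensor_hom_ext[OF T pow_module[OF M] mod_hom_comp[OF tm \<theta>(1)]
        mod_hom_comp[OF \<theta>(1) M.mact_hom[OF finite_basis mat]] _ t])
    fix p m assume p: "p \<in> carrier (free_mod R (B (Suc n)))" and m: "m \<in> carrier M"
    have dp: "d n p \<in> carrier (free_mod R (B n))" by (rule mod_homD(1)[OF d p])
    have "d n p c \<odot>\<^bsub>M\<^esub> m = (\<Oplus>\<^bsub>M\<^esub>b\<in>B (Suc n). d n (basis_vec R b) c \<odot>\<^bsub>M\<^esub> (\<lambda>b\<in>B (Suc n). p b \<odot>\<^bsub>M\<^esub> m) b)" for c
    proof -
      have "d n p c \<odot>\<^bsub>M\<^esub> m = (\<Oplus>\<^bsub>M\<^esub>b\<in>B (Suc n). (p b \<otimes> d n (basis_vec R b) c) \<odot>\<^bsub>M\<^esub> m)"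
        unfolding d_expand[OF p] using m free_mem[OF p] d_entry
        by (intro M.finsum_smult_rdistr finite_basis) auto
      also have "\<dots> = (\<Oplus>\<^bsub>M\<^esub>b\<in>B (Suc n). d n (basis_vec R b) c \<odot>\<^bsub>M\<^esub> (\<lambda>b\<in>B (Suc n). p b \<odot>\<^bsub>M\<^esub> m) b)"
        using m free_mem[OF p] d_entry
        by (intro M.finsum_cong') (auto simp: M.smult_assoc1[symmetric] m_comm)
      finally show ?thesis .
    qed
    then show "\<theta> n (tensor_map R (free_mod R (B n)) M (d n) (tens R (free_mod R (B (Suc n))) M p m)) =
      mact M (B n) (B (Suc n)) (\<lambda>c b. d n (basis_vec R b) c) (\<theta> (Suc n) (tens R (free_mod R (B (Suc n))) M p m))"
      unfolding tt[OF p m] \<theta>(3)[OF p m] \<theta>(3)[OF dp m] by (simp add: mact_def)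
  qed
  show ?thesis unfolding tensor_homology_def
    by (rule mat.chain_link[OF M, where \<theta> = \<theta>])
      (use T tm \<theta> com in \<open>simp_all add: tensor_pair.tensor_module shift_matrix_def\<close>)
qed

text \<open>A homomorphism from a free module is recorded by its values on the basis; composition
  with \<open>d\<close> then acts on these values by the transposed matrix.\<close>

lemma hom_link:
  assumes M: "module R M"
  shows "belongs_to R (hom_cohomology R (\<lambda>n. free_mod R (B n)) d M i) S \<longleftrightarrow> mat.hk M i (carrier M) {\<zero>\<^bsub>M\<^esub>}"
proof -
  interpret M: module R M by fact
  let ?\<theta> = "\<lambda>n f. \<lambda>b\<in>B n. f (basis_vec R b)"
  let ?d = "\<lambda>n f. \<lambda>x\<in>carrier (free_mod R (B (Suc n))). f (d n x)"
  have hom: "?d n \<in> mod_hom R (hom_mod R (free_mod R (B n)) M) (hom_mod R (free_mod R (B (Suc n))) M)" for n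
  proof -
    interpret F: module R "free_mod R (B (Suc n))" by (rule free_module)
    show ?thesis
    proof (rule mod_homI)
      fix f assume "f \<in> carrier (hom_mod R (free_mod R (B n)) M)"
      then have f: "f \<in> mod_hom R (free_mod R (B n)) M" by simp
      have "?d n f \<in> mod_hom R (free_mod R (B (Suc n))) M"
        using mod_homD[OF mod_hom_comp[OF d f]] F.a_closed F.smult_closed
        by (intro mod_homI) (simp_all del: free_mod_simps)
      then show "?d n f \<in> carrier (hom_mod R (free_mod R (B (Suc n))) M)" by simp
    qed (use mod_homD(1)[OF d] in \<open>auto simp: fun_eq_iff\<close>)
  qed
  have com: "?\<theta> (Suc n) (?d n f) = mact M (B (Suc n)) (B n) (\<lambda>b c. d n (basis_vec R b) c) (?\<theta> n f)"
    if "f \<in> carrier (hom_mod R (free_mod R (B n)) M)" for n f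
  proof
    fix b
    have f: "f \<in> mod_hom R (free_mod R (B n)) M" using that by simp
    show "?\<theta> (Suc n) (?d n f) b = mact M (B (Suc n)) (B n) (\<lambda>b c. d n (basis_vec R b) c) (?\<theta> n f) b"
    proof (cases "b \<in> B (Suc n)")
      case True
      note e = basis_vec_mem[OF True]
      have "f (d n (basis_vec R b)) = (\<Oplus>\<^bsub>M\<^esub>c\<in>B n. d n (basis_vec R b) c \<odot>\<^bsub>M\<^esub> f (basis_vec R c))"
        by (rule free_hom_expand[OF M f finite_basis mod_homD(1)[OF d e]])
      also have "\<dots> = (\<Oplus>\<^bsub>M\<^esub>c\<in>B n. d n (basis_vec R b) c \<odot>\<^bsub>M\<^esub> ?\<theta> n f c)"
        using d_entry[OF True] mod_homD(1)[OF f basis_vec_mem] by (intro M.finsum_cong') auto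
      finally show ?thesis using True e by (simp add: mact_def)
    qed (simp add: mact_def)
  qed
  show ?thesis unfolding hom_cohomology_def
    by (rule mat.cochain_link[OF M, where \<theta> = ?\<theta>])
      (use hom_module[OF free_module M] hom hom_free_iso[OF M] com in \<open>simp_all add: shift_matrix_def del: hom_mod_simps\<close>)
qed

end

section \<open>Complexes with null-homotopic multiplications\<close>

text \<open>The maps \<open>h\<close> form a null-homotopy of the multiplication by \<open>x\<close>.\<close>

definition mat_null ::
  "('a,'r) ring_scheme \<Rightarrow> 'a \<Rightarrow> (nat \<Rightarrow> 'b set) \<Rightarrow> (nat \<Rightarrow> 'b \<Rightarrow> 'b \<Rightarrow> 'a) \<Rightarrow> bool" where
  "mat_null R x B A \<longleftrightarrow> x \<in> carrier R \<and> (\<exists>h. (\<forall>n. h n \<in> B (Suc n) \<rightarrow> B n \<rightarrow> carrier R) \<and>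
     (\<forall>n. \<forall>b\<in>B (Suc n). \<forall>b'\<in>B (Suc n).
       (\<Oplus>\<^bsub>R\<^esub>c\<in>B (Suc (Suc n)). A (Suc n) b c \<otimes>\<^bsub>R\<^esub> h (Suc n) c b') \<oplus>\<^bsub>R\<^esub>
       (\<Oplus>\<^bsub>R\<^esub>c\<in>B n. h n b c \<otimes>\<^bsub>R\<^esub> A n c b') = (if b = b' then x else \<zero>\<^bsub>R\<^esub>)))"

lemma (in module) mact_add:
  assumes B: "finite B" and A: "A \<in> C \<rightarrow> B \<rightarrow> carrier R" and A': "A' \<in> C \<rightarrow> B \<rightarrow> carrier R"
    and u: "u \<in> B \<rightarrow>\<^sub>E carrier M"
  shows "mact M C B (\<lambda>c b. A c b \<oplus> A' c b) u = mact M C B A u \<oplus>\<^bsub>pow_mod C M\<^esub> mact M C B A' u"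
proof
  fix c
  show "mact M C B (\<lambda>c b. A c b \<oplus> A' c b) u c = (mact M C B A u \<oplus>\<^bsub>pow_mod C M\<^esub> mact M C B A' u) c"
  proof (cases "c \<in> C")
    case c: True
    have a: "\<And>b. b \<in> B \<Longrightarrow> A c b \<in> carrier R" "\<And>b. b \<in> B \<Longrightarrow> A' c b \<in> carrier R" "\<And>b. b \<in> B \<Longrightarrow> u b \<in> carrier M"
      using A A' u c by auto
    have "(\<Oplus>\<^bsub>M\<^esub>b\<in>B. (A c b \<oplus> A' c b) \<odot>\<^bsub>M\<^esub> u b) = (\<Oplus>\<^bsub>M\<^esub>b\<in>B. A c b \<odot>\<^bsub>M\<^esub> u b \<oplus>\<^bsub>M\<^esub> A' c b \<odot>\<^bsub>M\<^esub> u b)"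
      using a by (intro M.finsum_cong' refl Pi_I) (simp_all add: smult_l_distr)
    also have "\<dots> = (\<Oplus>\<^bsub>M\<^esub>b\<in>B. A c b \<odot>\<^bsub>M\<^esub> u b) \<oplus>\<^bsub>M\<^esub> (\<Oplus>\<^bsub>M\<^esub>b\<in>B. A' c b \<odot>\<^bsub>M\<^esub> u b)"
      using a by (intro M.finsum_addf) auto
    finally show ?thesis using c by (simp add: mact_def)
  qed (simp add: mact_def)
qed

text \<open>On a cycle \<open>u\<close> the summand that starts with \<open>A\<close> vanishes, so
  the homotopy identity exhibits the multiple of \<open>u\<close> as the boundary of
  \<open>h1 u\<close>. The form for a single place applies to chains and, after transposition, to
  cochains.\<close>

lemma (in module) mact_homotopy:
  assumes fin: "finite C" "finite B" "finite D"
    and A: "A \<in> C \<rightarrow> B \<rightarrow> carrier R" "h0 \<in> B \<rightarrow> C \<rightarrow> carrier R" "A' \<in> B \<rightarrow> D \<rightarrow> carrier R" "h1 \<in> D \<rightarrow> B \<rightarrow> carrier R"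
    and x: "x \<in> carrier R"
    and id: "\<And>b b'. b \<in> B \<Longrightarrow> b' \<in> B \<Longrightarrow> (\<Oplus>d\<in>D. A' b d \<otimes> h1 d b') \<oplus> (\<Oplus>c\<in>C. h0 b c \<otimes> A c b') = (if b = b' then x else \<zero>)"
    and u: "u \<in> B \<rightarrow>\<^sub>E carrier M" "mact M C B A u = \<zero>\<^bsub>pow_mod C M\<^esub>"
  shows "x \<odot>\<^bsub>pow_mod B M\<^esub> u = mact M B D A' (mact M D B h1 u)"
proof -
  interpret P: module R "pow_mod B M" by (rule pow_module[OF module_axioms])
  have c1: "(\<lambda>b b'. \<Oplus>d\<in>D. A' b d \<otimes> h1 d b') \<in> B \<rightarrow> B \<rightarrow> carrier R"
    by (intro Pi_I R.finsum_closed R.m_closed) (use A in auto)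
  have c2: "(\<lambda>b b'. \<Oplus>c\<in>C. h0 b c \<otimes> A c b') \<in> B \<rightarrow> B \<rightarrow> carrier R"
    by (intro Pi_I R.finsum_closed R.m_closed) (use A in auto)
  have m1: "mact M B D A' (mact M D B h1 u) \<in> carrier (pow_mod B M)"
    using mact_closed[OF fin(3) A(3) mact_closed[OF fin(2) A(4) u(1)]] by simp
  have "x \<odot>\<^bsub>pow_mod B M\<^esub> u = mact M B B (\<lambda>b b'. (\<Oplus>d\<in>D. A' b d \<otimes> h1 d b') \<oplus> (\<Oplus>c\<in>C. h0 b c \<otimes> A c b')) u"
  proof
    fix b
    show "(x \<odot>\<^bsub>pow_mod B M\<^esub> u) b = mact M B B (\<lambda>b b'. (\<Oplus>d\<in>D. A' b d \<otimes> h1 d b') \<oplus> (\<Oplus>c\<in>C. h0 b c \<otimes> A c b')) u b"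
    proof (cases "b \<in> B")
      case b: True
      have "(\<Oplus>\<^bsub>M\<^esub>b'\<in>B. ((\<Oplus>d\<in>D. A' b d \<otimes> h1 d b') \<oplus> (\<Oplus>c\<in>C. h0 b c \<otimes> A c b')) \<odot>\<^bsub>M\<^esub> u b') =
        (\<Oplus>\<^bsub>M\<^esub>b'\<in>B. if b = b' then x \<odot>\<^bsub>M\<^esub> u b' else \<zero>\<^bsub>M\<^esub>)"
        using b u(1) x by (intro M.finsum_cong' refl Pi_I) (auto simp: id PiE_iff)
      also have "\<dots> = x \<odot>\<^bsub>M\<^esub> u b"
        using M.finsum_singleton[OF b fin(2), of "\<lambda>b. x \<odot>\<^bsub>M\<^esub> u b"] u(1) x by auto
      finally show ?thesis using b by (simp add: mact_def)
    qed (simp add: mact_def)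
  qed
  also have "\<dots> = mact M B D A' (mact M D B h1 u) \<oplus>\<^bsub>pow_mod B M\<^esub> mact M B C h0 (mact M C B A u)"
    unfolding mact_mact[OF fin(3,2) A(3,4) u(1)] mact_mact[OF fin(1,2) A(2,1) u(1)]
    by (rule mact_add[OF fin(2) c1 c2 u(1)])
  also have "mact M B C h0 (mact M C B A u) = \<zero>\<^bsub>pow_mod B M\<^esub>"
    unfolding u(2) by (rule mod_hom_zero[OF pow_module pow_module mact_hom[OF fin(1) A(2)]]) (rule module_axioms)+
  finally show ?thesis unfolding P.r_zero[OF m1] .
qed

lemma (in mat_complex) mat_null_chain:
  assumes M: "module R M" and x: "mat_null R x B A"
    and u: "u \<in> B (Suc n) \<rightarrow>\<^sub>E carrier M" "mact M (B n) (B (Suc n)) (A n) u = \<zero>\<^bsub>pow_mod (B n) M\<^esub>"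
  shows "x \<odot>\<^bsub>pow_mod (B (Suc n)) M\<^esub> u \<in> mact M (B (Suc n)) (B (Suc (Suc n))) (A (Suc n)) ` (B (Suc (Suc n)) \<rightarrow>\<^sub>E carrier M)"
proof -
  interpret M: module R M by fact
  obtain h where xc: "x \<in> carrier R" and h: "\<And>n. h n \<in> B (Suc n) \<rightarrow> B n \<rightarrow> carrier R"
    and id: "\<And>n b b'. b \<in> B (Suc n) \<Longrightarrow> b' \<in> B (Suc n) \<Longrightarrow>
       (\<Oplus>c\<in>B (Suc (Suc n)). A (Suc n) b c \<otimes> h (Suc n) c b') \<oplus>
       (\<Oplus>c\<in>B n. h n b c \<otimes> A n c b') = (if b = b' then x else \<zero>)"
    using x unfolding mat_null_def by blast
  have "x \<odot>\<^bsub>pow_mod (B (Suc n)) M\<^esub> u = mact M (B (Suc n)) (B (Suc (Suc n))) (A (Suc n))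
      (mact M (B (Suc (Suc n))) (B (Suc n)) (h (Suc n)) u)"
    by (rule M.mact_homotopy[OF fin fin fin ent h ent h xc id u])
  then show ?thesis using M.mact_closed[OF fin h u(1)] by blast
qed

lemma (in mat_complex) mat_null_cochain:
  assumes M: "module R M" and x: "mat_null R x B A"
    and u: "u \<in> B (Suc n) \<rightarrow>\<^sub>E carrier M"
      "mact M (B (Suc (Suc n))) (B (Suc n)) (T (Suc n)) u = \<zero>\<^bsub>pow_mod (B (Suc (Suc n))) M\<^esub>"
  shows "x \<odot>\<^bsub>pow_mod (B (Suc n)) M\<^esub> u \<in> mact M (B (Suc n)) (B n) (T n) ` (B n \<rightarrow>\<^sub>E carrier M)"
proof -
  interpret M: module R M by fact
  obtain h where xc: "x \<in> carrier R" and h: "\<And>n. h n \<in> B (Suc n) \<rightarrow> B n \<rightarrow> carrier R"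
    and id: "\<And>n b b'. b \<in> B (Suc n) \<Longrightarrow> b' \<in> B (Suc n) \<Longrightarrow>
       (\<Oplus>c\<in>B (Suc (Suc n)). A (Suc n) b c \<otimes> h (Suc n) c b') \<oplus>
       (\<Oplus>c\<in>B n. h n b c \<otimes> A n c b') = (if b = b' then x else \<zero>)"
    using x unfolding mat_null_def by blast
  have hm: "h n b c \<in> carrier R" if "b \<in> B (Suc n)" "c \<in> B n" for n b c using h that by blast
  have T: "T n \<in> B (Suc n) \<rightarrow> B n \<rightarrow> carrier R" for n using ent_mem by auto
  have hT: "(\<lambda>c b. h n b c) \<in> B n \<rightarrow> B (Suc n) \<rightarrow> carrier R" for n using hm by auto
  \<comment> \<open>Transposing the homotopy identity exchanges its two summands, so the transposed
    homotopy serves the dual complex.\<close>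
  have id': "(\<Oplus>c\<in>B n. T n b c \<otimes> h n b' c) \<oplus> (\<Oplus>c\<in>B (Suc (Suc n)). h (Suc n) c b \<otimes> T (Suc n) c b') =
      (if b = b' then x else \<zero>)" if b: "b \<in> B (Suc n)" "b' \<in> B (Suc n)" for b b'
  proof -
    have 1: "(\<Oplus>c\<in>B n. T n b c \<otimes> h n b' c) = (\<Oplus>c\<in>B n. h n b' c \<otimes> A n c b)"
      using b by (intro finsum_cong' refl Pi_I) (simp_all add: hm ent_mem m_comm)
    have 2: "(\<Oplus>c\<in>B (Suc (Suc n)). h (Suc n) c b \<otimes> T (Suc n) c b') =
        (\<Oplus>c\<in>B (Suc (Suc n)). A (Suc n) b' c \<otimes> h (Suc n) c b)"
      using b by (intro finsum_cong' refl Pi_I) (simp_all add: hm ent_mem m_comm)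
    have c: "(\<Oplus>c\<in>B n. h n b' c \<otimes> A n c b) \<in> carrier R"
      "(\<Oplus>c\<in>B (Suc (Suc n)). A (Suc n) b' c \<otimes> h (Suc n) c b) \<in> carrier R"
      using b by (intro finsum_closed Pi_I; simp add: hm ent_mem)+
    show ?thesis unfolding 1 2 using id[OF b(2,1)] a_comm[OF c] by auto
  qed
  have "x \<odot>\<^bsub>pow_mod (B (Suc n)) M\<^esub> u = mact M (B (Suc n)) (B n) (T n)
      (mact M (B n) (B (Suc n)) (\<lambda>c b. h n b c) u)"
    by (rule M.mact_homotopy[OF fin fin fin T hT T hT xc id' u])
  then show ?thesis using M.mact_closed[OF fin hT u(1)] by blast
qed

lemma ideal_submodule_self:
  assumes "cring R" and N: "submodule N R (self_mod R)"
  shows "ideal N R"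
proof -
  interpret cring R by fact
  interpret F: module R "self_mod R" by (rule self_module[OF assms(1)])
  note Ns = F.submoduleE[OF N]
  have neg: "\<ominus>\<^bsub>R\<^esub> a \<in> N" if "a \<in> N" for a
    using Ns(4)[of "\<ominus>\<^bsub>R\<^esub> \<one>\<^bsub>R\<^esub>" a] that Ns(1) by (auto simp: l_minus)
  show ?thesis
  proof (rule idealI[OF ring_axioms])
    show "subgroup N (add_monoid R)"
      by (rule add.subgroupI) (use Ns neg in \<open>auto simp: a_inv_def[symmetric]\<close>)
    show "x \<otimes>\<^bsub>R\<^esub> a \<in> N" if "a \<in> N" "x \<in> carrier R" for a x using Ns(4)[OF that(2,1)] by simp
    then show "a \<otimes>\<^bsub>R\<^esub> x \<in> N" if "a \<in> N" "x \<in> carrier R" for a x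
      using that Ns(1) by (metis m_comm self_mod_simps(1) subsetD)
  qed
qed

lemma submodule_self_ideal:
  assumes "cring R" and N: "ideal N R"
  shows "submodule N R (self_mod R)"
proof -
  interpret cring R by fact
  interpret ideal N R by fact
  interpret F: module R "self_mod R" by (rule self_module[OF assms(1)])
  show ?thesis by (rule F.submoduleI') (use a_subset I_l_closed in auto)
qed

text \<open>The scalars that take \<open>w\<close> into \<open>V\<close> form an ideal, so it is
  enough to test generators.\<close>

lemma ideal_kill:
  fixes R :: "('a,'r) ring_scheme" and M :: "('a,'m) module"
  assumes M: "module R M" and V: "submodule V R M" and w: "w \<in> carrier M" and K: "K \<subseteq> carrier R"
    and kill: "\<And>x. x \<in> K \<Longrightarrow> x \<odot>\<^bsub>M\<^esub> w \<in> V" and r: "r \<in> Idl\<^bsub>R\<^esub> K"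
  shows "r \<odot>\<^bsub>M\<^esub> w \<in> V"
proof -
  interpret M: module R M by fact
  note S = self_module[OF M.R.is_cring]
  have h: "(\<lambda>r. r \<odot>\<^bsub>M\<^esub> w) \<in> mod_hom R (self_mod R) M"
    using w by (intro mod_homI) (auto simp: M.smult_l_distr M.smult_assoc1)
  have "submodule {r \<in> carrier (self_mod R). r \<odot>\<^bsub>M\<^esub> w \<in> V} R (self_mod R)"
    by (rule submodule_vimage[OF S M h module.carrier_is_submodule[OF S] V])
  then have "ideal {r \<in> carrier R. r \<odot>\<^bsub>M\<^esub> w \<in> V} R" using ideal_submodule_self[OF M.R.is_cring] by simp
  moreover have "K \<subseteq> {r \<in> carrier R. r \<odot>\<^bsub>M\<^esub> w \<in> V}" using K kill by auto
  ultimately show ?thesis using M.R.genideal_minimal r by blast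
qed

section \<open>The comparison of two matrix complexes\<close>

context serre_class begin

text \<open>The same condition as \<open>hc\<close>, with coefficients in all of \<open>M\<close>.
  The complex is an argument here instead of being fixed by the locale, so that two complexes can
  occur in one statement; likewise for \<open>mhk\<close>.\<close>

definition mhc :: "('a,'m) module \<Rightarrow> (nat \<Rightarrow> 'b set) \<Rightarrow> (nat \<Rightarrow> 'b \<Rightarrow> 'b \<Rightarrow> 'a) \<Rightarrow> nat \<Rightarrow> bool" where
  "mhc M B A i \<longleftrightarrow> mh M (B i) (B (Suc i)) (B (Suc (Suc i))) (A i) (A (Suc i)) (carrier M) {\<zero>\<^bsub>M\<^esub>}"

definition mhk :: "('a,'m) module \<Rightarrow> (nat \<Rightarrow> 'b set) \<Rightarrow> (nat \<Rightarrow> 'b \<Rightarrow> 'b \<Rightarrow> 'a) \<Rightarrow> nat \<Rightarrow> bool" where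
  "mhk M B A i \<longleftrightarrow> mh M (B (Suc (Suc i))) (B (Suc i)) (B i) (\<lambda>b c. A (Suc i) c b) (\<lambda>b c. A i c b)
     (carrier M) {\<zero>\<^bsub>M\<^esub>}"

text \<open>\<open>(B, A)\<close> plays the role of \<open>P\<close>, seen through its augmentation.
  The powers of \<open>M\<close> indexed by \<open>E\<close>, with the matrices \<open>D\<close> or
  their transposes, form \<open>C\<close>; the null-homotopies make its homology killed by the
  generators, hence by the ideal. \<open>mh_power\<close> provides the assumption on the terms of
  \<open>C\<close>.\<close>

lemma matrix_comparison:
  assumes P: "mat_complex R B A" and aug: "mat_aug R (Idl K) B A"
    and Q: "mat_complex R E D" and K: "K \<subseteq> carrier R" and null: "\<And>x. x \<in> K \<Longrightarrow> mat_null R x E D"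
    and M: "module R M"
  shows "(\<And>i. mhc M B A i) \<Longrightarrow> mhc M E D n" and "(\<And>i. mhk M B A i) \<Longrightarrow> mhk M E D n"
proof -
  interpret M: module R M by fact
  interpret P: serre_complex R S B A by (rule serre_complex.intro[OF serre_class_axioms P])
  interpret Q: mat_complex R E D by (rule Q)
  let ?W = "\<lambda>n. pow_mod (E n) M"
  note W = pow_module[OF M]
  have W0: "carrier (?W 0) = {\<zero>\<^bsub>?W 0\<^esub>}" by (simp add: Q.B0 fun_eq_iff)
  have Qt: "Q.T n \<in> E (Suc n) \<rightarrow> E n \<rightarrow> carrier R" for n using Q.ent_mem by auto
  { assume hyp: "\<And>i. mhc M B A i"
    let ?\<delta> = "\<lambda>n. mact M (E n) (E (Suc n)) (D n)"
    have kill: "r \<odot>\<^bsub>?W (Suc n)\<^esub> w \<in> ?\<delta> (Suc n) ` carrier (?W (Suc (Suc n)))"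
      if r: "r \<in> Idl K" and w: "w \<in> carrier (?W (Suc n))" "?\<delta> n w = \<zero>\<^bsub>?W n\<^esub>" for n r w
    proof (rule ideal_kill[OF W _ w(1) K _ r])
      show "submodule (?\<delta> (Suc n) ` carrier (?W (Suc (Suc n)))) R (?W (Suc n))"
        using mh_carrier_submodules(2)[OF M Q.step] by simp
      show "x \<odot>\<^bsub>?W (Suc n)\<^esub> w \<in> ?\<delta> (Suc n) ` carrier (?W (Suc (Suc n)))" if "x \<in> K" for x
        using Q.mat_null_chain[OF M null[OF that], of w n] w unfolding pow_mod_simps(1) by blast
    qed
    have "sq (?W (Suc n)) {w \<in> carrier (?W (Suc n)). ?\<delta> n w = \<zero>\<^bsub>?W n\<^esub>} (?\<delta> (Suc n) ` carrier (?W (Suc (Suc n))))"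
    proof (rule P.chain_comparison[OF W _ W0 _ kill aug])
      show "?\<delta> n \<in> mod_hom R (?W (Suc n)) (?W n)" for n by (rule M.mact_hom[OF Q.fin Q.ent])
      show "?\<delta> n (?\<delta> (Suc n) w) = \<zero>\<^bsub>?W n\<^esub>" if "w \<in> carrier (?W (Suc (Suc n)))" for n w
        using mat_step_zero[OF M Q.step] that unfolding pow_mod_simps(1) by blast
      show "P.hc (?W n) i (carrier (?W n)) {\<zero>\<^bsub>?W n\<^esub>}" for n i
        using mh_power[OF M P.step Q.fin] hyp unfolding P.hc_def mhc_def by blast
    qed
    then show "mhc M E D n" unfolding mhc_def mh_carrier[OF M Q.step] pow_mod_simps(1) . }
  { assume hyp: "\<And>i. mhk M B A i"
    let ?\<delta> = "\<lambda>n. mact M (E (Suc n)) (E n) (Q.T n)"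
    have kill: "r \<odot>\<^bsub>?W (Suc n)\<^esub> w \<in> ?\<delta> n ` carrier (?W n)"
      if r: "r \<in> Idl K" and w: "w \<in> carrier (?W (Suc n))" "?\<delta> (Suc n) w = \<zero>\<^bsub>?W (Suc (Suc n))\<^esub>" for n r w
    proof (rule ideal_kill[OF W _ w(1) K _ r])
      show "submodule (?\<delta> n ` carrier (?W n)) R (?W (Suc n))"
        using mh_carrier_submodules(2)[OF M Q.costep] by simp
      show "x \<odot>\<^bsub>?W (Suc n)\<^esub> w \<in> ?\<delta> n ` carrier (?W n)" if "x \<in> K" for x
        using Q.mat_null_cochain[OF M null[OF that], of w n] w unfolding pow_mod_simps(1) by blast
    qed
    have "sq (?W (Suc n)) {w \<in> carrier (?W (Suc n)). ?\<delta> (Suc n) w = \<zero>\<^bsub>?W (Suc (Suc n))\<^esub>} (?\<delta> n ` carrier (?W n))"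
    proof (rule P.cochain_comparison[OF W _ W0 _ kill aug])
      show "?\<delta> n \<in> mod_hom R (?W n) (?W (Suc n))" for n by (rule M.mact_hom[OF Q.fin Qt])
      show "?\<delta> (Suc n) (?\<delta> n w) = \<zero>\<^bsub>?W (Suc (Suc n))\<^esub>" if "w \<in> carrier (?W n)" for n w
        using mat_step_zero[OF M Q.costep] that unfolding pow_mod_simps(1) by blast
      show "P.hk (?W n) i (carrier (?W n)) {\<zero>\<^bsub>?W n\<^esub>}" for n i
        using mh_power[OF M P.costep Q.fin] hyp unfolding P.hk_def mhk_def by blast
    qed
    then show "mhk M E D n" unfolding mhk_def mh_carrier[OF M Q.costep] pow_mod_simps(1) . }
qed

end

text \<open>
  The dual of a complex with \<open>B N = {}\<close>, made into a chain complex by reversing the degrees.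
  Truncated subtraction takes all degrees above \<open>N\<close> to \<open>B 0 = {}\<close>.
\<close>

definition rev_matrix :: "nat \<Rightarrow> (nat \<Rightarrow> 'b \<Rightarrow> 'b \<Rightarrow> 'a) \<Rightarrow> nat \<Rightarrow> 'b \<Rightarrow> 'b \<Rightarrow> 'a" where
  "rev_matrix N A n b c = A (N - Suc n) c b"

context mat_complex begin

text \<open>Since \<open>B 0\<close> is empty, an element of \<open>B (N - Suc n)\<close> shows that
  this subtraction is not truncated. The successor form removes all subtractions from the
  calculations with reversed degrees.\<close>

lemma rev_index:
  assumes "b \<in> B (N - Suc n)"
  obtains k where "N = Suc (Suc n) + k" "N - Suc n = Suc k" "N - n = Suc (Suc k)" "N - Suc (Suc n) = k"
proof -
  have "N - Suc n \<noteq> 0" using assms B0 by (cases "N - Suc n") auto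
  then have "N = Suc (Suc n) + (N - Suc (Suc n))" by simp
  then show ?thesis using that by fastforce
qed

lemma rev_complex:
  assumes N: "B N = {}"
  shows "mat_complex R (\<lambda>n. B (N - n)) (rev_matrix N A)"
proof
  fix n
  show "finite (B (N - n))" by (rule fin)
  show "rev_matrix N A n \<in> B (N - n) \<rightarrow> B (N - Suc n) \<rightarrow> carrier R"
  proof (intro Pi_I)
    fix b c assume b: "b \<in> B (N - n)" and c: "c \<in> B (N - Suc n)"
    obtain k where "N - Suc n = Suc k" "N - n = Suc (Suc k)" using rev_index[OF c] by metis
    then show "rev_matrix N A n b c \<in> carrier R" using b c by (simp add: rev_matrix_def ent_mem)
  qed
  fix c e assume c: "c \<in> B (N - n)" and e: "e \<in> B (N - Suc (Suc n))"
  have "N - Suc (Suc n) \<noteq> 0" using e B0 by (cases "N - Suc (Suc n)") auto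
  then obtain k where k: "N - Suc (Suc n) = k" "N - Suc n = Suc k" "N - n = Suc (Suc k)"
    by (auto simp: algebra_simps)
  have "(\<Oplus>b\<in>B (Suc k). A (Suc k) b c \<otimes> A k e b) = (\<Oplus>b\<in>B (Suc k). A k e b \<otimes> A (Suc k) b c)"
    using c e k by (intro finsum_cong' refl Pi_I) (simp_all add: ent_mem m_comm)
  also have "\<dots> = \<zero>" by (rule comp) (use c e k in auto)
  finally show "(\<Oplus>b\<in>B (N - Suc n). rev_matrix N A n c b \<otimes> rev_matrix N A (Suc n) b e) = \<zero>"
    using k by (simp add: rev_matrix_def)
qed (use N in simp)

text \<open>The homotopy is transposed and its degrees are reversed; the two summands of the
  identity change places, as for cochains.\<close>

lemma rev_null:
  assumes x: "mat_null R x B A"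
  shows "mat_null R x (\<lambda>n. B (N - n)) (rev_matrix N A)"
proof -
  obtain h where xc: "x \<in> carrier R" and h: "\<And>n. h n \<in> B (Suc n) \<rightarrow> B n \<rightarrow> carrier R"
    and id: "\<And>n b b'. b \<in> B (Suc n) \<Longrightarrow> b' \<in> B (Suc n) \<Longrightarrow>
       (\<Oplus>c\<in>B (Suc (Suc n)). A (Suc n) b c \<otimes> h (Suc n) c b') \<oplus>
       (\<Oplus>c\<in>B n. h n b c \<otimes> A n c b') = (if b = b' then x else \<zero>)"
    using x unfolding mat_null_def by blast
  have hm: "h n b c \<in> carrier R" if "b \<in> B (Suc n)" "c \<in> B n" for n b c using h that by blast
  have "(\<Oplus>c\<in>B (N - Suc (Suc n)). rev_matrix N A (Suc n) b c \<otimes> h (N - Suc (Suc n)) b' c) \<oplus>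
       (\<Oplus>c\<in>B (N - n). h (N - Suc n) c b \<otimes> rev_matrix N A n c b') = (if b = b' then x else \<zero>)"
    if b: "b \<in> B (N - Suc n)" "b' \<in> B (N - Suc n)" for n b b'
  proof -
    obtain k where k: "N - Suc n = Suc k" "N - n = Suc (Suc k)" "N - Suc (Suc n) = k"
      using rev_index[OF b(1)] by metis
    note bk = b[unfolded k]
    have 1: "(\<Oplus>c\<in>B k. A k c b \<otimes> h k b' c) = (\<Oplus>c\<in>B k. h k b' c \<otimes> A k c b)"
      using bk by (intro finsum_cong' refl Pi_I) (simp_all add: hm ent_mem m_comm)
    have 2: "(\<Oplus>c\<in>B (Suc (Suc k)). h (Suc k) c b \<otimes> A (Suc k) b' c) =
        (\<Oplus>c\<in>B (Suc (Suc k)). A (Suc k) b' c \<otimes> h (Suc k) c b)"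
      using bk by (intro finsum_cong' refl Pi_I) (simp_all add: hm ent_mem m_comm)
    have c: "(\<Oplus>c\<in>B k. h k b' c \<otimes> A k c b) \<in> carrier R"
      "(\<Oplus>c\<in>B (Suc (Suc k)). A (Suc k) b' c \<otimes> h (Suc k) c b) \<in> carrier R"
      using bk by (intro finsum_closed Pi_I; simp add: hm ent_mem)+
    show ?thesis unfolding k rev_matrix_def 1 2 using id[OF bk(2,1)] a_comm[OF c] by auto
  qed
  moreover have "(\<lambda>b c. h (N - Suc n) c b) \<in> B (N - Suc n) \<rightarrow> B (N - n) \<rightarrow> carrier R" for n
  proof (intro Pi_I)
    fix b c assume b: "b \<in> B (N - Suc n)" and c: "c \<in> B (N - n)"
    obtain k where "N - Suc n = Suc k" "N - n = Suc (Suc k)" using rev_index[OF b] by metis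
    then show "h (N - Suc n) c b \<in> carrier R" using b c by (simp add: hm)
  qed
  ultimately show ?thesis unfolding mat_null_def
    by (intro conjI xc exI[of _ "\<lambda>n b c. h (N - Suc n) c b"] allI ballI) auto
qed

end

context serre_class begin

lemma mh_empty:
  assumes M: "module R M"
  shows "mh M C {} D A A' (carrier M) {\<zero>\<^bsub>M\<^esub>}"
proof -
  interpret P: module R "pow_mod {} M" by (rule pow_module[OF M])
  interpret M: module R M by fact
  have 1: "cyc (mact M C {} A) ({} \<rightarrow>\<^sub>E carrier M) (C \<rightarrow>\<^sub>E {\<zero>\<^bsub>M\<^esub>}) = {\<zero>\<^bsub>pow_mod {} M\<^esub>}"
    by (auto simp: cyc_def mact_def fun_eq_iff)
  have "D \<rightarrow>\<^sub>E carrier M \<noteq> {}" using M.zero_closed by (metis PiE_eq_empty_iff empty_iff)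
  then have 2: "bnd (pow_mod {} M) (mact M {} D A') (D \<rightarrow>\<^sub>E carrier M) ({} \<rightarrow>\<^sub>E {\<zero>\<^bsub>M\<^esub>}) = {\<zero>\<^bsub>pow_mod {} M\<^esub>}"
    by (auto simp: bnd_def fun_eq_iff)
  show ?thesis unfolding mh_def 1 2 by (rule sq_trivial[OF pow_module[OF M] P.submodule_trivial])
qed

lemma rev_homology:
  assumes M: "module R M" and E: "\<And>n. n \<ge> N \<Longrightarrow> B n = {}"
  shows "(\<And>i. mhc M (\<lambda>n. B (N - n)) (rev_matrix N A) i) \<Longrightarrow> mhk M B A k"
    and "(\<And>i. mhk M (\<lambda>n. B (N - n)) (rev_matrix N A) i) \<Longrightarrow> mhc M B A k"
proof -
  have *: "N - (N - Suc (Suc k)) = Suc (Suc k)" "N - Suc (N - Suc (Suc k)) = Suc k"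
    "N - Suc (Suc (N - Suc (Suc k))) = k" if "Suc k < N"
    using that by auto
  have r: "rev_matrix N A n = (\<lambda>b c. A (N - Suc n) c b)" for n by (simp add: rev_matrix_def fun_eq_iff)
  { assume "\<And>i. mhc M (\<lambda>n. B (N - n)) (rev_matrix N A) i"
    \<comment> \<open>Reversed degree \<open>N - k - 2\<close> is degree \<open>k\<close> of the
      original complex, because of the shift of the bases by one. If \<open>Suc k\<close> is not
      below \<open>N\<close>, the basis at \<open>Suc k\<close> is empty and the homology is
      zero.\<close>
    from this[of "N - Suc (Suc k)"] show "mhk M B A k"
      by (cases "Suc k < N") (simp_all add: mhc_def mhk_def * r E mh_empty[OF M]) }
  { assume "\<And>i. mhk M (\<lambda>n. B (N - n)) (rev_matrix N A) i"
    from this[of "N - Suc (Suc k)"] show "mhc M B A k"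
      by (cases "Suc k < N") (simp_all add: mhc_def mhk_def * r E mh_empty[OF M]) }
qed

end

context finite_free_complex begin

text \<open>The entries are read off on basis vectors. Degree zero has its own condition because no
  differential leaves it; in the shifted matrices this is the empty sum over
  \<open>shift_basis B 0\<close>.\<close>

lemma free_null:
  assumes x: "x \<in> carrier R" and h: "\<And>n. h n \<in> mod_hom R (free_mod R (B n)) (free_mod R (B (Suc n)))"
    and id0: "\<And>u. u \<in> carrier (free_mod R (B 0)) \<Longrightarrow> d 0 (h 0 u) = x \<odot>\<^bsub>free_mod R (B 0)\<^esub> u"
    and id: "\<And>n u. u \<in> carrier (free_mod R (B (Suc n))) \<Longrightarrow>
      d (Suc n) (h (Suc n) u) \<oplus>\<^bsub>free_mod R (B (Suc n))\<^esub> h n (d n u) = x \<odot>\<^bsub>free_mod R (B (Suc n))\<^esub> u"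
  shows "mat_null R x (shift_basis B) (shift_matrix R d)"
proof -
  have h_entry: "h n (basis_vec R b) c \<in> carrier R" if "b \<in> B n" for n b c
    by (rule free_mem[OF mod_homD(1)[OF h basis_vec_mem[OF that]]])
  have h_expand: "h n u c = (\<Oplus>b\<in>B n. u b \<otimes> h n (basis_vec R b) c)" if u: "u \<in> carrier (free_mod R (B n))" for n u c
    using free_hom_expand[OF self_module[OF is_cring] mod_hom_comp[OF h free_eval_hom] finite_basis u]
    by (simp add: finsum_self)
  have dh: "(\<Oplus>c\<in>B (Suc n). d n (basis_vec R c) b \<otimes> h n (basis_vec R b') c) = d n (h n (basis_vec R b')) b"
    if b': "b' \<in> B n" for n b b'
  proof -
    have hb: "h n (basis_vec R b') \<in> carrier (free_mod R (B (Suc n)))"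
      by (rule mod_homD(1)[OF h basis_vec_mem[OF b']])
    show ?thesis unfolding d_expand[OF hb] using b'
      by (intro finsum_cong' refl Pi_I) (simp_all add: h_entry d_entry m_comm)
  qed
  have hd: "(\<Oplus>c\<in>B n. h n (basis_vec R c) b \<otimes> d n (basis_vec R b') c) = h n (d n (basis_vec R b')) b"
    if b': "b' \<in> B (Suc n)" for n b b'
  proof -
    have hb: "d n (basis_vec R b') \<in> carrier (free_mod R (B n))"
      by (rule mod_homD(1)[OF d basis_vec_mem[OF b']])
    show ?thesis unfolding h_expand[OF hb] using b'
      by (intro finsum_cong' refl Pi_I) (simp_all add: h_entry d_entry m_comm)
  qed
  define H where "H = case_nat (\<lambda>_ _. \<zero>) (\<lambda>n c b. h n (basis_vec R b) c)"
  have HS: "H (Suc n) c b = h n (basis_vec R b) c" for n c b by (simp add: H_def)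
  have "H n \<in> shift_basis B (Suc n) \<rightarrow> shift_basis B n \<rightarrow> carrier R" for n
    by (cases n) (auto simp: HS h_entry)
  moreover have "(\<Oplus>c\<in>shift_basis B (Suc (Suc n)). shift_matrix R d (Suc n) b c \<otimes> H (Suc n) c b') \<oplus>
       (\<Oplus>c\<in>shift_basis B n. H n b c \<otimes> shift_matrix R d n c b') = (if b = b' then x else \<zero>)"
    if "b \<in> shift_basis B (Suc n)" "b' \<in> shift_basis B (Suc n)" for n b b'
  proof -
    have b: "b \<in> B n" "b' \<in> B n" using that by auto
    note e = basis_vec_mem[OF b(2)]
    have dhc: "d n (h n (basis_vec R b')) b \<in> carrier R"
      by (rule free_mem[OF mod_homD(1)[OF d mod_homD(1)[OF h e]]])
    show ?thesis
    proof (cases n)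
      case 0
      have "d 0 (h 0 (basis_vec R b')) b = x \<otimes> basis_vec R b' b" using id0[of "basis_vec R b'"] e 0 by simp
      then show ?thesis using 0 b dhc x by (simp add: HS dh basis_vec_app)
    next
      case (Suc k)
      have "d (Suc k) (h (Suc k) (basis_vec R b')) b \<oplus> h k (d k (basis_vec R b')) b = x \<otimes> basis_vec R b' b"
        using fun_cong[OF id[of "basis_vec R b'" k], of b] e Suc by simp
      then show ?thesis using Suc b x by (simp add: HS dh hd basis_vec_app)
    qed
  qed
  ultimately show ?thesis unfolding mat_null_def using x by blast
qed

text \<open>With a single basis element in degree zero, both \<open>\<epsilon>\<close> and
  \<open>w\<close> can be taken constantly one.\<close>

lemma free_aug:
  assumes B0: "B 0 = {b0}" and I: "ideal I R"
    and d0: "\<And>c. c \<in> B 1 \<Longrightarrow> d 0 (basis_vec R c) b0 \<in> I"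
  shows "mat_aug R I (shift_basis B) (shift_matrix R d)"
proof -
  interpret I: ideal I R by fact
  have "(\<lambda>_. \<one>) \<in> shift_basis B 1 \<rightarrow> carrier R" by simp
  moreover have "(\<Oplus>b\<in>shift_basis B 1. \<one> \<otimes> \<one>) \<ominus> \<one> \<in> I"
    by (simp add: B0 a_minus_def r_neg)
  moreover have "(\<Oplus>b\<in>shift_basis B 1. \<one> \<otimes> shift_matrix R d 1 b c) \<in> I" if "c \<in> shift_basis B 2" for c
  proof -
    have "c \<in> B 1" using that by (simp add: numeral_2_eq_2)
    then show ?thesis using d0 d_entry[of c 0 b0] by (simp add: B0)
  qed
  ultimately show ?thesis unfolding mat_aug_def by blast
qed

end

section \<open>The Koszul complex\<close>

context cring begin

text \<open>For \<open>j\<close> outside \<open>J\<close>, the sign in the exterior product of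
  \<open>e_j\<close> with \<open>e_J\<close>: the factor \<open>e_j\<close> has to move past the
  elements of \<open>J\<close> below \<open>j\<close>.\<close>

definition sg :: "nat \<Rightarrow> nat set \<Rightarrow> 'a" where
  "sg j J = (\<ominus> \<one>) [^] card {i \<in> J. i < j}"

lemma sg_closed [simp]: "sg j J \<in> carrier R"
  by (simp add: sg_def)

lemma sg_insert:
  assumes "finite J" "l \<notin> J"
  shows "sg j (insert l J) = (if l < j then \<ominus> sg j J else sg j J)"
proof (cases "l < j")
  case True
  then have "{i \<in> insert l J. i < j} = insert l {i \<in> J. i < j}" by auto
  then have "card {i \<in> insert l J. i < j} = Suc (card {i \<in> J. i < j})" using assms by simp
  then show ?thesis using True by (simp add: sg_def r_minus)
next
  case False
  then have "{i \<in> insert l J. i < j} = {i \<in> J. i < j}" by auto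
  then show ?thesis using False by (simp add: sg_def)
qed

lemma sg_square: "sg j J \<otimes> sg j J = \<one>"
proof -
  have "(\<ominus> \<one>) [^] (n::nat) \<otimes> (\<ominus> \<one>) [^] n = \<one>" for n
    by (induction n) (simp_all add: l_minus r_minus)
  then show ?thesis by (simp add: sg_def)
qed

text \<open>Adding the smaller of \<open>j\<close> and \<open>l\<close> to the set flips the sign of
  the larger one, and not conversely, so exactly one sign changes. The first form makes the
  differential square to zero; the second gives the cancellation in
  \<open>KD_kh_inside\<close>.\<close>

lemma sg_swap:
  assumes "finite J" "j \<notin> J" "l \<notin> J" "j \<noteq> l"
  shows "sg j J \<otimes> sg l (insert j J) = \<ominus> (sg l J \<otimes> sg j (insert l J))"
    and "sg j (insert l J) \<otimes> sg l (insert j J) = \<ominus> (sg l J \<otimes> sg j J)"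
  using assms by (cases j l rule: linorder_cases; simp add: sg_insert l_minus r_minus m_comm)+

text \<open>The terms for \<open>(j, l)\<close> and \<open>(l, j)\<close> cancel. Each step of the
  induction adds the row and the column of the new element \<open>t\<close>, which cancel term by
  term.\<close>

lemma antisym_sum:
  assumes "finite A" and g: "\<And>j l. j \<in> A \<Longrightarrow> l \<in> A \<Longrightarrow> g j l \<in> carrier R"
    and anti: "\<And>j l. j \<in> A \<Longrightarrow> l \<in> A \<Longrightarrow> j \<noteq> l \<Longrightarrow> g j l = \<ominus> g l j"
  shows "(\<Oplus>j\<in>A. \<Oplus>l\<in>A - {j}. g j l) = \<zero>"
  using assms
proof (induction A)
  case (insert t A)
  have c: "(\<Oplus>l\<in>A - {j}. g j l) \<in> carrier R" if "j \<in> insert t A" for j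
    using insert.prems(1) that by (intro finsum_closed) auto
  have "(\<Oplus>l\<in>insert t A - {j}. g j l) = g j t \<oplus> (\<Oplus>l\<in>A - {j}. g j l)" if "j \<in> A" for j
  proof -
    have "insert t A - {j} = insert t (A - {j})" using insert.hyps that by auto
    then show ?thesis using insert.hyps insert.prems(1) that by (simp add: finsum_insert Pi_iff)
  qed
  then have "(\<Oplus>j\<in>A. \<Oplus>l\<in>insert t A - {j}. g j l) = (\<Oplus>j\<in>A. g j t \<oplus> (\<Oplus>l\<in>A - {j}. g j l))"
    using insert.prems(1) c by (intro finsum_cong' refl Pi_I) simp_all
  also have "\<dots> = (\<Oplus>j\<in>A. g j t) \<oplus> (\<Oplus>j\<in>A. \<Oplus>l\<in>A - {j}. g j l)"
    using insert.prems(1) c by (intro finsum_addf) auto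
  also have "\<dots> = (\<Oplus>j\<in>A. g j t)"
  proof -
    have "(\<Oplus>j\<in>A. \<Oplus>l\<in>A - {j}. g j l) = \<zero>" using insert.IH insert.prems by blast
    moreover have "(\<Oplus>j\<in>A. g j t) \<in> carrier R" using insert.prems(1) by (intro finsum_closed) auto
    ultimately show ?thesis by simp
  qed
  finally have 1: "(\<Oplus>j\<in>A. \<Oplus>l\<in>insert t A - {j}. g j l) = (\<Oplus>j\<in>A. g j t)" .
  have c': "(\<Oplus>l\<in>insert t A - {j}. g j l) \<in> carrier R" if "j \<in> insert t A" for j
    using insert.prems(1) that by (intro finsum_closed) auto
  have "(\<Oplus>j\<in>insert t A. \<Oplus>l\<in>insert t A - {j}. g j l) =
      (\<Oplus>l\<in>insert t A - {t}. g t l) \<oplus> (\<Oplus>j\<in>A. \<Oplus>l\<in>insert t A - {j}. g j l)"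
    by (intro finsum_insert Pi_I c') (use insert.hyps in auto)
  also have "insert t A - {t} = A" using insert.hyps by auto
  also have "(\<Oplus>l\<in>A. g t l) \<oplus> (\<Oplus>j\<in>A. \<Oplus>l\<in>insert t A - {j}. g j l) = (\<Oplus>l\<in>A. g t l \<oplus> g l t)"
    unfolding 1 using insert.prems(1) by (intro finsum_addf[symmetric]) auto
  also have "\<dots> = (\<Oplus>l\<in>A. \<zero>)"
  proof (intro finsum_cong' refl Pi_I)
    fix l assume l: "l \<in> A"
    then have "t \<noteq> l" using insert.hyps by blast
    then have "g t l = \<ominus> g l t" using insert.prems(2) l by blast
    then show "g t l \<oplus> g l t = \<zero>" using insert.prems(1) l by (simp add: l_neg)
  qed simp
  finally show ?case by simp
qed simp

end

lemma koszul_basis_finite: "finite (koszul_basis xs n)"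
  unfolding koszul_basis_def by (rule finite_subset[of _ "Pow {..<length xs}"]) auto

lemma koszul_basis_insert:
  "J \<in> koszul_basis xs n \<Longrightarrow> j \<in> {..<length xs} - J \<Longrightarrow> insert j J \<in> koszul_basis xs (Suc n)"
  by (auto simp: koszul_basis_def card_insert_disjoint finite_subset)

lemma koszul_basis_remove:
  "J \<in> koszul_basis xs (Suc n) \<Longrightarrow> k \<in> J \<Longrightarrow> J - {k} \<in> koszul_basis xs n"
  by (auto simp: koszul_basis_def finite_subset card_Diff_singleton)

lemma koszul_basis_fin: "J \<in> koszul_basis xs n \<Longrightarrow> finite J"
  unfolding koszul_basis_def using finite_subset by blast

locale koszul = R?: cring R for R :: "('a,'r) ring_scheme" (structure) +
  fixes xs :: "'a list"
  assumes xs: "set xs \<subseteq> carrier R"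
begin

abbreviation "KB \<equiv> koszul_basis xs"
abbreviation "KD \<equiv> koszul_diff R xs"

lemma x_closed: "j < length xs \<Longrightarrow> xs ! j \<in> carrier R"
  using xs by auto

lemma KD_apply: "KD n u J = (if J \<in> KB n then
    (\<Oplus>j\<in>{..<length xs} - J. sg j J \<otimes> (xs ! j) \<otimes> u (insert j J)) else \<zero>)"
  by (simp add: koszul_diff_def sg_def)

lemma free_finite_iff: "u \<in> carrier (free_mod R (KB n)) \<longleftrightarrow> (\<forall>J. u J \<in> carrier R) \<and> (\<forall>J. J \<notin> KB n \<longrightarrow> u J = \<zero>)"
proof -
  have "finite {J. u J \<noteq> \<zero>}" if "\<forall>J. J \<notin> KB n \<longrightarrow> u J = \<zero>"
    by (rule finite_subset[OF _ koszul_basis_finite[of xs n]]) (use that in auto)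
  then show ?thesis by (auto simp: free_carrier)
qed

lemma KD_term: "u \<in> carrier (free_mod R (KB n)) \<Longrightarrow> j < length xs \<Longrightarrow>
    sg j J \<otimes> (xs ! j) \<otimes> u K \<in> carrier R"
  by (simp add: x_closed free_finite_iff)

lemma KD_hom: "KD n \<in> mod_hom R (free_mod R (KB (Suc n))) (free_mod R (KB n))"
proof (rule mod_homI)
  fix u assume u: "u \<in> carrier (free_mod R (KB (Suc n)))"
  show "KD n u \<in> carrier (free_mod R (KB n))"
    using KD_term[OF u] by (auto simp: free_finite_iff KD_apply intro!: finsum_closed)
  { fix v assume v: "v \<in> carrier (free_mod R (KB (Suc n)))"
    have "(\<Oplus>j\<in>{..<length xs} - J. sg j J \<otimes> (xs ! j) \<otimes> (u (insert j J) \<oplus> v (insert j J))) =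
      (\<Oplus>j\<in>{..<length xs} - J. sg j J \<otimes> (xs ! j) \<otimes> u (insert j J)) \<oplus>
      (\<Oplus>j\<in>{..<length xs} - J. sg j J \<otimes> (xs ! j) \<otimes> v (insert j J))" for J
    proof -
      have "(\<Oplus>j\<in>{..<length xs} - J. sg j J \<otimes> (xs ! j) \<otimes> (u (insert j J) \<oplus> v (insert j J))) =
        (\<Oplus>j\<in>{..<length xs} - J. sg j J \<otimes> (xs ! j) \<otimes> u (insert j J) \<oplus> sg j J \<otimes> (xs ! j) \<otimes> v (insert j J))"
        using u v by (intro finsum_cong' refl Pi_I) (simp_all add: free_finite_iff x_closed r_distr)
      also have "\<dots> = (\<Oplus>j\<in>{..<length xs} - J. sg j J \<otimes> (xs ! j) \<otimes> u (insert j J)) \<oplus>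
        (\<Oplus>j\<in>{..<length xs} - J. sg j J \<otimes> (xs ! j) \<otimes> v (insert j J))"
        using KD_term[OF u] KD_term[OF v] by (intro finsum_addf) auto
      finally show ?thesis .
    qed
    then show "KD n (u \<oplus>\<^bsub>free_mod R (KB (Suc n))\<^esub> v) = KD n u \<oplus>\<^bsub>free_mod R (KB n)\<^esub> KD n v"
      by (auto simp: fun_eq_iff KD_apply) }
  { fix a assume a: "a \<in> carrier R"
    have "(\<Oplus>j\<in>{..<length xs} - J. sg j J \<otimes> (xs ! j) \<otimes> (a \<otimes> u (insert j J))) =
      a \<otimes> (\<Oplus>j\<in>{..<length xs} - J. sg j J \<otimes> (xs ! j) \<otimes> u (insert j J))" for J
    proof -
      have "(\<Oplus>j\<in>{..<length xs} - J. sg j J \<otimes> (xs ! j) \<otimes> (a \<otimes> u (insert j J))) =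
        (\<Oplus>j\<in>{..<length xs} - J. a \<otimes> (sg j J \<otimes> (xs ! j) \<otimes> u (insert j J)))"
        using u a by (intro finsum_cong' refl Pi_I) (simp_all add: free_finite_iff x_closed m_lcomm m_assoc)
      also have "\<dots> = a \<otimes> (\<Oplus>j\<in>{..<length xs} - J. sg j J \<otimes> (xs ! j) \<otimes> u (insert j J))"
        using KD_term[OF u] a by (intro finsum_rdistr[symmetric]) auto
      finally show ?thesis .
    qed
    then show "KD n (a \<odot>\<^bsub>free_mod R (KB (Suc n))\<^esub> u) = a \<odot>\<^bsub>free_mod R (KB n)\<^esub> KD n u"
      using a by (auto simp: fun_eq_iff KD_apply) }
qed

text \<open>At the coordinate \<open>J\<close> the double application is a sum over ordered pairs of
  distinct indices outside \<open>J\<close>, antisymmetric by \<open>sg_swap\<close>.\<close>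

lemma KD_KD:
  assumes u: "u \<in> carrier (free_mod R (KB (Suc (Suc n))))"
  shows "KD n (KD (Suc n) u) = \<zero>\<^bsub>free_mod R (KB n)\<^esub>"
proof
  fix J
  show "KD n (KD (Suc n) u) J = \<zero>\<^bsub>free_mod R (KB n)\<^esub> J"
  proof (cases "J \<in> KB n")
    case J: True
    let ?A = "{..<length xs} - J"
    let ?g = "\<lambda>j l. sg j J \<otimes> (xs ! j) \<otimes> (sg l (insert j J) \<otimes> (xs ! l) \<otimes> u (insert l (insert j J)))"
    have uc: "u I \<in> carrier R" for I using u by (simp add: free_finite_iff)
    have "KD n (KD (Suc n) u) J = (\<Oplus>j\<in>?A. \<Oplus>l\<in>?A - {j}. ?g j l)"
    proof -
      have "sg j J \<otimes> (xs ! j) \<otimes> KD (Suc n) u (insert j J) = (\<Oplus>l\<in>?A - {j}. ?g j l)" if j: "j \<in> ?A" for j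
      proof -
        have "{..<length xs} - insert j J = ?A - {j}" by auto
        then have "KD (Suc n) u (insert j J) = (\<Oplus>l\<in>?A - {j}. sg l (insert j J) \<otimes> (xs ! l) \<otimes> u (insert l (insert j J)))"
          using koszul_basis_insert[OF J j] by (simp add: KD_apply)
        then show ?thesis using j uc
          by (simp add: finsum_rdistr x_closed Pi_iff)
      qed
      then show ?thesis using J uc
        by (simp add: KD_apply) (intro finsum_cong' refl Pi_I; simp add: finsum_closed Pi_iff x_closed)
    qed
    also have "\<dots> = \<zero>"
    proof (rule antisym_sum)
      fix j l assume jl: "j \<in> ?A" "l \<in> ?A"
      then show "?g j l \<in> carrier R" using uc by (simp add: x_closed)
      assume ne: "j \<noteq> l"
      have sw: "sg j J \<otimes> sg l (insert j J) = \<ominus> (sg l J \<otimes> sg j (insert l J))"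
        by (rule sg_swap) (use koszul_basis_fin[OF J] jl ne in auto)
      have x: "xs ! j \<in> carrier R" "xs ! l \<in> carrier R" using jl by (auto simp: x_closed)
      let ?v = "u (insert l (insert j J))"
      have "?g j l = (sg j J \<otimes> sg l (insert j J)) \<otimes> (xs ! j \<otimes> xs ! l \<otimes> ?v)"
        using x uc by (simp add: m_ac)
      also have "\<dots> = \<ominus> ((sg l J \<otimes> sg j (insert l J)) \<otimes> (xs ! j \<otimes> xs ! l \<otimes> ?v))"
        unfolding sw using x uc by (simp add: l_minus)
      also have "(sg l J \<otimes> sg j (insert l J)) \<otimes> (xs ! j \<otimes> xs ! l \<otimes> ?v) = ?g l j"
        using x uc by (simp add: m_ac insert_commute)
      finally show "?g j l = \<ominus> ?g l j" .
    qed simp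
    finally show ?thesis by simp
  qed (simp add: KD_apply)
qed

sublocale K: finite_free_complex R KB KD
  by unfold_locales (rule koszul_basis_finite KD_hom KD_KD, assumption?)+

text \<open>The exterior multiplication by \<open>e\<^sub>k\<close>, a null-homotopy of the multiplication by \<open>x\<^sub>k\<close>.\<close>

definition kh :: "nat \<Rightarrow> nat \<Rightarrow> (nat set \<Rightarrow> 'a) \<Rightarrow> nat set \<Rightarrow> 'a" where
  "kh k n u I = (if I \<in> KB (Suc n) \<and> k \<in> I then sg k (I - {k}) \<otimes> u (I - {k}) else \<zero>)"

lemma kh_hom: "kh k n \<in> mod_hom R (free_mod R (KB n)) (free_mod R (KB (Suc n)))"
  by (rule mod_homI) (auto simp: free_finite_iff kh_def fun_eq_iff r_distr m_lcomm)

text \<open>The product with \<open>e_k\<close> is supported on sets containing \<open>k\<close>, so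
  only the summand \<open>j = k\<close> of the differential survives; its two equal signs multiply
  to one.\<close>

lemma KD_kh_outside:
  assumes u: "u \<in> carrier (free_mod R (KB n))" and J: "J \<in> KB n" and k: "k < length xs" "k \<notin> J"
  shows "KD n (kh k n u) J = xs ! k \<otimes> u J"
proof -
  let ?A = "{..<length xs} - J"
  have uc: "u I \<in> carrier R" for I using u by (simp add: free_finite_iff)
  have kA: "k \<in> ?A" using k by auto
  have "KD n (kh k n u) J = (\<Oplus>j\<in>?A. if k = j then xs ! k \<otimes> u J else \<zero>)"
  proof -
    have "sg j J \<otimes> (xs ! j) \<otimes> kh k n u (insert j J) = (if k = j then xs ! k \<otimes> u J else \<zero>)" if j: "j \<in> ?A" for j
    proof (cases "k = j")
      case True
      have "insert k J - {k} = J" using k by auto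
      moreover have "sg k J \<otimes> (xs ! k) \<otimes> (sg k J \<otimes> u J) = (sg k J \<otimes> sg k J) \<otimes> (xs ! k \<otimes> u J)"
        using x_closed[OF k(1)] uc by (simp add: m_ac)
      ultimately show ?thesis using True koszul_basis_insert[OF J kA] x_closed[OF k(1)] uc
        by (simp add: kh_def sg_square)
    next
      case False
      then show ?thesis using k j by (simp add: kh_def x_closed)
    qed
    then show ?thesis using J uc
      by (simp add: KD_apply) (intro finsum_cong' refl Pi_I; simp add: x_closed)
  qed
  also have "\<dots> = xs ! k \<otimes> u J"
    using finsum_singleton[OF kA, of "\<lambda>_. xs ! k \<otimes> u J"] uc x_closed[OF k(1)] by simp
  finally show ?thesis .
qed

text \<open>The summands for \<open>j\<close> outside \<open>J\<close> occur in both terms with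
  opposite signs, by the second form of \<open>sg_swap\<close>. What remains is the summand
  \<open>j = k\<close> of the second term, where \<open>k\<close> is removed and put back.\<close>

lemma KD_kh_inside:
  assumes u: "u \<in> carrier (free_mod R (KB (Suc n)))" and J: "J \<in> KB (Suc n)" and k: "k < length xs" "k \<in> J"
  shows "KD (Suc n) (kh k (Suc n) u) J \<oplus> kh k n (KD n u) J = xs ! k \<otimes> u J"
proof -
  let ?A = "{..<length xs} - J" and ?J = "J - {k}"
  have uc: "u I \<in> carrier R" for I using u by (simp add: free_finite_iff)
  have J': "?J \<in> KB n" by (rule koszul_basis_remove[OF J k(2)])
  have fin: "finite ?J" by (rule koszul_basis_fin[OF J'])
  have ik: "insert k ?J = J" using k by auto
  note xk = x_closed[OF k(1)]
  let ?t = "\<lambda>j. sg k ?J \<otimes> (sg j ?J \<otimes> (xs ! j) \<otimes> u (insert j ?J))"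
  have tc: "?t j \<in> carrier R" if "j \<in> ?A" for j using that uc by (simp add: x_closed)
  have 1: "KD (Suc n) (kh k (Suc n) u) J = (\<Oplus>j\<in>?A. \<ominus> ?t j)"
  proof -
    have "sg j J \<otimes> (xs ! j) \<otimes> kh k (Suc n) u (insert j J) = \<ominus> ?t j" if j: "j \<in> ?A" for j
    proof -
      have e: "insert j J - {k} = insert j ?J" using j k by auto
      have x: "xs ! j \<in> carrier R" using j by (simp add: x_closed)
      have sw: "sg j J \<otimes> sg k (insert j ?J) = \<ominus> (sg k ?J \<otimes> sg j ?J)"
        using sg_swap(2)[OF fin, of j k] j k ik by auto
      have "sg j J \<otimes> (xs ! j) \<otimes> kh k (Suc n) u (insert j J) =
          sg j J \<otimes> (xs ! j) \<otimes> (sg k (insert j ?J) \<otimes> u (insert j ?J))"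
        using koszul_basis_insert[OF J j] k by (simp add: kh_def e)
      also have "\<dots> = (sg j J \<otimes> sg k (insert j ?J)) \<otimes> ((xs ! j) \<otimes> u (insert j ?J))"
        using x uc by (simp add: m_ac)
      also have "\<dots> = \<ominus> ((sg k ?J \<otimes> sg j ?J) \<otimes> ((xs ! j) \<otimes> u (insert j ?J)))"
        unfolding sw by (rule l_minus) (use x uc in auto)
      also have "(sg k ?J \<otimes> sg j ?J) \<otimes> ((xs ! j) \<otimes> u (insert j ?J)) = ?t j"
        using x uc by (simp add: m_ac)
      finally show ?thesis .
    qed
    then show ?thesis using J tc
      by (simp add: KD_apply) (intro finsum_cong' refl Pi_I; simp)
  qed
  have A': "{..<length xs} - ?J = insert k ?A" using k by auto
  have "kh k n (KD n u) J = sg k ?J \<otimes> (\<Oplus>j\<in>insert k ?A. sg j ?J \<otimes> (xs ! j) \<otimes> u (insert j ?J))"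
    using J J' k by (simp add: kh_def KD_apply A')
  also have "\<dots> = (\<Oplus>j\<in>insert k ?A. ?t j)"
    using uc k by (intro finsum_rdistr) (auto simp: x_closed)
  also have "\<dots> = ?t k \<oplus> (\<Oplus>j\<in>?A. ?t j)"
    using k tc uc xk by (intro finsum_insert) auto
  also have "?t k = (sg k ?J \<otimes> sg k ?J) \<otimes> (xs ! k \<otimes> u J)"
    unfolding ik using uc xk by (simp add: m_ac)
  also have "\<dots> = xs ! k \<otimes> u J" using uc xk by (simp add: sg_square)
  finally have 2: "kh k n (KD n u) J = xs ! k \<otimes> u J \<oplus> (\<Oplus>j\<in>?A. ?t j)" .
  have c: "(\<Oplus>j\<in>?A. ?t j) \<in> carrier R" "(\<Oplus>j\<in>?A. \<ominus> ?t j) \<in> carrier R" using tc by (auto intro!: finsum_closed)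
  have "(\<Oplus>j\<in>?A. \<ominus> ?t j) \<oplus> (\<Oplus>j\<in>?A. ?t j) = (\<Oplus>j\<in>?A. \<ominus> ?t j \<oplus> ?t j)"
    using tc by (intro finsum_addf[symmetric]) auto
  also have "\<dots> = (\<Oplus>j\<in>?A. \<zero>)" using tc by (intro finsum_cong' refl Pi_I) (simp_all add: l_neg)
  finally have "(\<Oplus>j\<in>?A. \<ominus> ?t j) \<oplus> (\<Oplus>j\<in>?A. ?t j) = \<zero>" by simp
  then show ?thesis unfolding 1 2 using c uc xk by (simp add: a_lcomm)
qed

text \<open>The homotopy is \<open>kh k\<close>, where \<open>x\<close> is the entry at position
  \<open>k\<close>. If \<open>k\<close> lies outside \<open>J\<close>, its second summand is zero at
  \<open>J\<close> by the definition of \<open>kh\<close>.\<close>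

lemma koszul_null:
  assumes "x \<in> set xs"
  shows "mat_null R x (shift_basis KB) (shift_matrix R KD)"
proof -
  obtain k where k: "k < length xs" "x = xs ! k" using assms by (metis in_set_conv_nth)
  have x: "x \<in> carrier R" using assms xs by auto
  show ?thesis
  proof (rule K.free_null[OF x kh_hom[of k]])
    fix u assume u: "u \<in> carrier (free_mod R (KB 0))"
    show "KD 0 (kh k 0 u) = x \<odot>\<^bsub>free_mod R (KB 0)\<^esub> u"
    proof
      fix J
      show "KD 0 (kh k 0 u) J = (x \<odot>\<^bsub>free_mod R (KB 0)\<^esub> u) J"
      proof (cases "J \<in> KB 0")
        case True
        then have "k \<notin> J" using koszul_basis_fin[OF True] by (auto simp: koszul_basis_def)
        then show ?thesis using KD_kh_outside[OF u True k(1)] k by simp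
      next
        case False
        then show ?thesis using u x by (simp add: KD_apply free_finite_iff)
      qed
    qed
  next
    fix n u assume u: "u \<in> carrier (free_mod R (KB (Suc n)))"
    show "KD (Suc n) (kh k (Suc n) u) \<oplus>\<^bsub>free_mod R (KB (Suc n))\<^esub> kh k n (KD n u) = x \<odot>\<^bsub>free_mod R (KB (Suc n))\<^esub> u"
    proof
      fix J
      show "(KD (Suc n) (kh k (Suc n) u) \<oplus>\<^bsub>free_mod R (KB (Suc n))\<^esub> kh k n (KD n u)) J = (x \<odot>\<^bsub>free_mod R (KB (Suc n))\<^esub> u) J"
      proof (cases "J \<in> KB (Suc n)")
        case True
        show ?thesis
        proof (cases "k \<in> J")
          case kJ: True
          show ?thesis using KD_kh_inside[OF u True k(1) kJ] k by simp
        next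
          case kJ: False
          have "u J \<in> carrier R" using u by (simp add: free_finite_iff)
          then show ?thesis using KD_kh_outside[OF u True k(1) kJ] k kJ x by (simp add: kh_def)
        qed
      next
        case False
        then show ?thesis using u x by (simp add: KD_apply kh_def free_finite_iff)
      qed
    qed
  qed
qed

text \<open>Degree zero is free on the empty set, and the boundary of a basis vector of degree one
  is a combination of the entries of \<open>xs\<close>.\<close>

lemma koszul_aug: "mat_aug R (Idl (set xs)) (shift_basis KB) (shift_matrix R KD)"
proof (rule K.free_aug)
  show "KB 0 = {{}}" by (auto simp: koszul_basis_def finite_subset)
  show I: "ideal (Idl (set xs)) R" by (rule genideal_ideal[OF xs])
  interpret F: module R "self_mod R" by (rule self_module[OF is_cring])
  have sub: "submodule (Idl (set xs)) R (self_mod R)" by (rule submodule_self_ideal[OF is_cring I])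
  fix I assume I: "I \<in> KB 1"
  have e: "basis_vec R I \<in> carrier (free_mod R (KB 1))" by (rule basis_vec_mem[OF I])
  have "(\<Oplus>\<^bsub>self_mod R\<^esub>j\<in>{..<length xs}. sg j {} \<otimes> (xs ! j) \<otimes> basis_vec R I {j}) \<in> Idl (set xs)"
  proof (rule F.submodule_finsum[OF sub])
    fix j assume "j \<in> {..<length xs}"
    then have "xs ! j \<in> Idl (set xs)" using genideal_self[OF xs] by auto
    then have "(sg j {} \<otimes> basis_vec R I {j}) \<otimes> xs ! j \<in> Idl (set xs)"
      using F.submoduleE(4)[OF sub, of "sg j {} \<otimes> basis_vec R I {j}" "xs ! j"] free_mem[OF e] by simp
    then show "sg j {} \<otimes> (xs ! j) \<otimes> basis_vec R I {j} \<in> Idl (set xs)"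
      using free_mem[OF e] x_closed \<open>j \<in> _\<close> by (simp add: m_ac)
  qed simp
  moreover have "{} \<in> KB 0" by (simp add: koszul_basis_def)
  ultimately show "KD 0 (basis_vec R I) {} \<in> Idl (set xs)"
    by (simp add: KD_apply finsum_self)
qed

text \<open>Degree \<open>length xs\<close> is the last one with a nonempty basis; the shift of the
  indices adds one more to the first empty index.\<close>

lemma koszul_bound: "n \<ge> length xs + 2 \<Longrightarrow> shift_basis KB n = {}"
proof (cases n)
  case (Suc m)
  assume "n \<ge> length xs + 2"
  then have "length xs < m" using Suc by simp
  then have "I \<notin> KB m" for I
    using card_mono[of "{..<length xs}" I] by (auto simp: koszul_basis_def)
  then show ?thesis using Suc by auto
qed simp

end

section \<open>Free resolutions\<close>

lemma (in cring) free_mod_mono: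
  "B \<subseteq> B' \<Longrightarrow> u \<in> carrier (free_mod R B) \<Longrightarrow> u \<in> carrier (free_mod R B')"
  using free_mem[of u B] by (auto simp: free_carrier)

text \<open>Induction on the rank. The values at \<open>b\<close> of the elements of
  \<open>N\<close> form an ideal, which is finitely generated. Lifts of its generators, together
  with generators for the elements that vanish at \<open>b\<close>, suffice: subtracting an element
  with the same value at \<open>b\<close> leaves one that vanishes there.\<close>

lemma free_finitely_generated:
  fixes R :: "('a,'r) ring_scheme" and B :: "'b set"
  assumes R: "cring R" "noetherian_ring R" and B: "finite B" and N: "submodule N R (free_mod R B)"
  shows "\<exists>K. finite K \<and> K \<subseteq> N \<and> N \<subseteq> generated_submodule R (free_mod R B) K"
  using B N
proof (induction B arbitrary: N)
  case empty
  interpret cring R by fact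
  interpret F: module R "free_mod R ({} :: 'b set)" by (rule free_module)
  have "u = \<zero>\<^bsub>free_mod R {}\<^esub>" if "u \<in> carrier (free_mod R {})" for u :: "'b \<Rightarrow> 'a"
    using that by (auto simp: free_carrier)
  then have "N \<subseteq> {\<zero>\<^bsub>free_mod R {}\<^esub>}" using F.submoduleE(1)[OF empty] by blast
  moreover have "submodule (generated_submodule R (free_mod R {}) {}) R (free_mod R ({} :: 'b set))"
    by (rule generated_submodule_facts[OF free_module]) simp
  from F.submodule_zero[OF this] have "{\<zero>\<^bsub>free_mod R {}\<^esub>} \<subseteq> generated_submodule R (free_mod R {}) ({} :: ('b \<Rightarrow> 'a) set)"
    by blast
  ultimately show ?case by (intro exI[of _ "{}"]) blast
next
  case (insert b B)
  interpret cring R by fact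
  interpret noetherian_ring R by fact
  let ?F = "free_mod R (insert b B)" and ?G = "free_mod R B"
  note F = free_module[of "insert b B"] and G = free_module[of B]
  interpret F: module R ?F by (rule F)
  interpret G: module R ?G by (rule G)
  interpret S: module R "self_mod R" by (rule self_module[OF is_cring])
  note S = S.module_axioms
  note Ns = F.submoduleE[OF insert.prems]
  note ev = free_eval_hom[of b "insert b B"]
  have GF: "u \<in> carrier ?F" if "u \<in> carrier ?G" for u using free_mod_mono[OF _ that] by blast
  have FG: "u \<in> carrier ?G" if "u \<in> carrier ?F" "u b = \<zero>\<^bsub>R\<^esub>" for u
    using that by (auto simp: free_carrier)
  \<comment> \<open>Elements of free modules are extended by zero, so \<open>?N'\<close> is
    literally a subset of the free module on the smaller basis.\<close>
  let ?N' = "{u \<in> N. u b = \<zero>\<^bsub>R\<^esub>}"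
  have N': "submodule ?N' R ?G"
  proof (rule G.submoduleI')
    show "?N' \<subseteq> carrier ?G" using Ns(1) FG by blast
    show "\<zero>\<^bsub>?G\<^esub> \<in> ?N'" using F.submodule_zero[OF insert.prems] by simp
    show "u \<oplus>\<^bsub>?G\<^esub> v \<in> ?N'" if "u \<in> ?N'" "v \<in> ?N'" for u v using Ns(5)[of u v] that by simp
    show "a \<odot>\<^bsub>?G\<^esub> u \<in> ?N'" if "a \<in> carrier R" "u \<in> ?N'" for a u using Ns(4)[of a u] that by simp
  qed
  obtain K' where K': "finite K'" "K' \<subseteq> ?N'" "?N' \<subseteq> generated_submodule R ?G K'"
    using insert.IH[OF N'] by blast
  have "submodule ((\<lambda>u. u b) ` N) R (self_mod R)" by (rule submodule_image[OF F S ev insert.prems])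
  then have "ideal ((\<lambda>u. u b) ` N) R" by (rule ideal_submodule_self[OF is_cring])
  then obtain A0 where A0: "A0 \<subseteq> carrier R" "finite A0" "(\<lambda>u. u b) ` N = Idl\<^bsub>R\<^esub> A0"
    using finetely_gen by blast
  have "\<exists>u\<in>N. u b = a" if "a \<in> A0" for a
  proof -
    have "a \<in> (\<lambda>u. u b) ` N" unfolding A0(3) using genideal_self[OF A0(1)] that by blast
    then show ?thesis by auto
  qed
  then obtain l where l: "\<And>a. a \<in> A0 \<Longrightarrow> l a \<in> N" "\<And>a. a \<in> A0 \<Longrightarrow> l a b = a" by metis
  let ?K = "K' \<union> l ` A0"
  have KN: "?K \<subseteq> N" using K'(2) l(1) by blast
  let ?P = "generated_submodule R ?F ?K"
  have KF: "?K \<subseteq> carrier ?F" using KN Ns(1) by blast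
  note P = generated_submodule_facts[OF F KF]
  have PN: "?P \<subseteq> N" by (rule generated_submodule_min[OF insert.prems KN])
  have "submodule ((\<lambda>u. u b) ` ?P) R (self_mod R)" by (rule submodule_image[OF F S ev P(1)])
  then have "ideal ((\<lambda>u. u b) ` ?P) R" by (rule ideal_submodule_self[OF is_cring])
  moreover have "A0 \<subseteq> (\<lambda>u. u b) ` ?P"
  proof
    fix a assume "a \<in> A0"
    then show "a \<in> (\<lambda>u. u b) ` ?P" using P(2) l(2) by (intro image_eqI[of _ _ "l a"]) auto
  qed
  ultimately have IP: "(\<lambda>u. u b) ` N \<subseteq> (\<lambda>u. u b) ` ?P" unfolding A0(3) by (rule genideal_minimal)
  \<comment> \<open>\<open>K'\<close> generates \<open>?N'\<close> inside the smaller free module,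
    whereas \<open>?P\<close> is generated inside the larger one; the intersection mediates between
    them.\<close>
  have "submodule (?P \<inter> carrier ?G) R ?G"
  proof (rule G.submoduleI')
    show "\<zero>\<^bsub>?G\<^esub> \<in> ?P \<inter> carrier ?G" using F.submodule_zero[OF P(1)] G.zero_closed by simp
    show "u \<oplus>\<^bsub>?G\<^esub> v \<in> ?P \<inter> carrier ?G" if "u \<in> ?P \<inter> carrier ?G" "v \<in> ?P \<inter> carrier ?G" for u v
      using F.submoduleE(5)[OF P(1), of u v] G.a_closed[of u v] that by simp
    show "a \<odot>\<^bsub>?G\<^esub> u \<in> ?P \<inter> carrier ?G" if "a \<in> carrier R" "u \<in> ?P \<inter> carrier ?G" for a u
      using F.submoduleE(4)[OF P(1), of a u] G.smult_closed[of a u] that by simp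
  qed simp
  then have "generated_submodule R ?G K' \<subseteq> ?P \<inter> carrier ?G"
    by (rule generated_submodule_min) (use P(2) K'(2) G.submoduleE(1)[OF N'] in blast)
  then have N'P: "?N' \<subseteq> ?P" using K'(3) by blast
  have "N \<subseteq> ?P"
  proof
    fix u assume u: "u \<in> N"
    then obtain v where v: "v \<in> ?P" "u b = v b" using IP by blast
    have c: "u \<in> carrier ?F" "v \<in> carrier ?F" using u v PN Ns(1) by blast+
    have "(u \<ominus>\<^bsub>?F\<^esub> v) b = u b \<ominus>\<^bsub>self_mod R\<^esub> v b" by (rule mod_hom_minus[OF F S ev c])
    also have "\<dots> = \<zero>\<^bsub>R\<^esub>" unfolding v(2) using S.minus_self[of "v b"] free_mem[OF c(2)] by simp
    finally have "u \<ominus>\<^bsub>?F\<^esub> v \<in> ?P"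
      using F.submodule_minus[OF insert.prems u] v PN N'P by blast
    then have "(u \<ominus>\<^bsub>?F\<^esub> v) \<oplus>\<^bsub>?F\<^esub> v \<in> ?P" using F.submoduleE(5)[OF P(1)] v by blast
    then show "u \<in> ?P" unfolding F.add_minus_cancel[OF c] .
  qed
  moreover have "finite ?K" using K'(1) A0(2) by simp
  ultimately show ?case using KN by blast
qed

text \<open>The finite generating set is relabelled by a finite subset of the infinite type
  \<open>'c\<close>, so that all bases of a resolution fit into one prescribed type.\<close>

lemma free_cover:
  fixes R :: "('a,'r) ring_scheme" and B :: "'b set"
  assumes R: "cring R" "noetherian_ring R" and inf: "infinite (UNIV :: 'c set)"
    and B: "finite B" and N: "submodule N R (free_mod R B)"
  shows "\<exists>(B' :: 'c set) f. finite B' \<and> f \<in> mod_hom R (free_mod R B') (free_mod R B) \<and> f ` carrier (free_mod R B') = N"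
proof -
  interpret cring R by fact
  note F = free_module[of B]
  interpret F: module R "free_mod R B" by (rule F)
  obtain K where K: "finite K" "K \<subseteq> N" "N \<subseteq> generated_submodule R (free_mod R B) K"
    using free_finitely_generated[OF R B N] by blast
  obtain B' :: "'c set" where B': "finite B'" "card B' = card K"
    using infinite_arbitrarily_large[OF inf] by blast
  then obtain g where g: "bij_betw g B' K" using finite_same_card_bij K(1) by metis
  have gK: "g b \<in> K" if "b \<in> B'" for b using g that by (auto simp: bij_betw_def)
  have gc: "g \<in> B' \<rightarrow> carrier (free_mod R B)" using gK K(2) F.submoduleE(1)[OF N] by blast
  let ?f = "lin R (free_mod R B) g"
  note f = lin_hom[OF F gc]
  note F' = free_module[of B']
  interpret F': module R "free_mod R B'" by (rule F')
  have "?f ` carrier (free_mod R B') = N"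
  proof
    have "submodule {u \<in> carrier (free_mod R B'). ?f u \<in> N} R (free_mod R B')"
      by (rule submodule_vimage[OF F' F f F'.carrier_is_submodule N])
    moreover have "basis_vec R b \<in> {u \<in> carrier (free_mod R B'). ?f u \<in> N}" if "b \<in> B'" for b
      using gK[OF that] K(2) lin_basis[OF F gc that] basis_vec_mem[OF that] by auto
    ultimately show "?f ` carrier (free_mod R B') \<subseteq> N" using free_generated by blast
    have "submodule (?f ` carrier (free_mod R B')) R (free_mod R B)"
      by (rule submodule_image[OF F' F f F'.carrier_is_submodule])
    moreover have "K \<subseteq> ?f ` carrier (free_mod R B')"
    proof
      fix k assume "k \<in> K"
      then obtain b where "b \<in> B'" "k = g b" using g by (auto simp: bij_betw_def)
      then show "k \<in> ?f ` carrier (free_mod R B')"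
        using lin_basis[OF F gc] basis_vec_mem by (intro image_eqI[of _ _ "basis_vec R b"]) simp_all
    qed
    ultimately show "N \<subseteq> ?f ` carrier (free_mod R B')"
      using generated_submodule_min K(3) by blast
  qed
  then show ?thesis using B'(1) f by blast
qed

text \<open>Dependent choice along pairs of a finite basis and a submodule of its free module,
  namely the one that the next differential has to cover.\<close>

lemma finite_free_continuation:
  fixes R :: "('a,'r) ring_scheme" and B0 :: "'b set"
  assumes R: "cring R" "noetherian_ring R" and inf: "infinite (UNIV :: 'b set)"
    and B0: "finite B0" and N0: "submodule N0 R (free_mod R B0)"
  shows "\<exists>B d. B 0 = B0 \<and> (\<forall>n. finite (B n)) \<and>
    (\<forall>n. d n \<in> mod_hom R (free_mod R (B (Suc n))) (free_mod R (B n))) \<and>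
    d 0 ` carrier (free_mod R (B 1)) = N0 \<and>
    (\<forall>n. d (Suc n) ` carrier (free_mod R (B (Suc (Suc n)))) = a_kernel (free_mod R (B (Suc n))) (free_mod R (B n)) (d n))"
proof -
  interpret cring R by fact
  define P where "P n x \<longleftrightarrow> finite (fst x) \<and> submodule (snd x) R (free_mod R (fst x)) \<and> (n = 0 \<longrightarrow> x = (B0, N0))"
    for n :: nat and x :: "'b set \<times> ('b \<Rightarrow> 'a) set"
  define Q where "Q x y f \<longleftrightarrow> f \<in> mod_hom R (free_mod R (fst y)) (free_mod R (fst x)) \<and>
      f ` carrier (free_mod R (fst y)) = snd x \<and> snd y = a_kernel (free_mod R (fst y)) (free_mod R (fst x)) f"
    for x y :: "'b set \<times> ('b \<Rightarrow> 'a) set" and f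
  have "\<exists>x. P 0 x" using B0 N0 by (auto simp: P_def)
  moreover have "\<exists>y. P (Suc n) y \<and> (\<exists>f. Q x y f)" if x: "P n x" for x n
  proof -
    obtain B' :: "'b set" and f where f: "finite B'" "f \<in> mod_hom R (free_mod R B') (free_mod R (fst x))"
      "f ` carrier (free_mod R B') = snd x"
      using free_cover[OF R inf, of "fst x" "snd x"] x by (auto simp: P_def)
    have "submodule (a_kernel (free_mod R B') (free_mod R (fst x)) f) R (free_mod R B')"
      using submodule_vimage[OF free_module free_module f(2) module.carrier_is_submodule[OF free_module]
          module.submodule_trivial[OF free_module]] by (simp add: a_kernel_def')
    then show ?thesis using f
      by (intro exI[of _ "(B', a_kernel (free_mod R B') (free_mod R (fst x)) f)"]) (auto simp: P_def Q_def)
  qed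
  ultimately obtain s where s: "\<And>n. P n (s n)" "\<And>n. \<exists>f. Q (s n) (s (Suc n)) f"
    using dependent_nat_choice[of P "\<lambda>_ x y. \<exists>f. Q x y f"] by metis
  then obtain d where d: "\<And>n. Q (s n) (s (Suc n)) (d n)" by metis
  have s0: "s 0 = (B0, N0)" using s(1)[of 0] by (simp add: P_def)
  show ?thesis
    by (rule exI[of _ "\<lambda>n. fst (s n)"], rule exI[of _ d])
      (use s(1) d s0 d[of 0] in \<open>auto simp: P_def Q_def\<close>)
qed

text \<open>Degree zero is free on one element \<open>b0\<close> and augmented by the coset of the
  value at \<open>b0\<close>; the continuation starts from the kernel. The rank one in degree zero
  and the entries in \<open>I\<close> are recorded for \<open>free_aug\<close>.\<close>

lemma finite_resolution_quotient:
  fixes R :: "('a,'r) ring_scheme"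
  assumes R: "cring R" "noetherian_ring R" and inf: "infinite (UNIV :: 'b set)" and I: "ideal I R"
  shows "\<exists>(B :: nat \<Rightarrow> 'b set) d \<epsilon> b0. is_free_resolution R (quot_mod (self_mod R) I) B d \<epsilon> \<and> (\<forall>n. finite (B n)) \<and>
    B 0 = {b0} \<and> (\<forall>c\<in>B 1. d 0 (basis_vec R c) b0 \<in> I)"
proof -
  interpret cring R by fact
  note S = self_module[OF R(1)]
  interpret S: module R "self_mod R" by (rule S)
  have sI: "submodule I R (self_mod R)" by (rule submodule_self_ideal[OF R(1) I])
  note Q = quot_module[OF S sI]
  obtain b0 :: 'b where True by blast
  let ?F = "free_mod R {b0}"
  note F = free_module[of "{b0}"]
  interpret F: module R ?F by (rule F)
  interpret Q: module R "quot_mod (self_mod R) I" by (rule Q)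
  let ?\<epsilon> = "\<lambda>u. I +>\<^bsub>self_mod R\<^esub> u b0"
  have \<epsilon>: "?\<epsilon> \<in> mod_hom R ?F (quot_mod (self_mod R) I)"
    by (rule mod_hom_comp[OF free_eval_hom coset_hom[OF S sI]])
  have onto: "?\<epsilon> ` carrier ?F = carrier (quot_mod (self_mod R) I)"
  proof
    show "?\<epsilon> ` carrier ?F \<subseteq> carrier (quot_mod (self_mod R) I)" using mod_homD(1)[OF \<epsilon>] by blast
    show "carrier (quot_mod (self_mod R) I) \<subseteq> ?\<epsilon> ` carrier ?F"
    proof
      fix C assume "C \<in> carrier (quot_mod (self_mod R) I)"
      then obtain r where r: "r \<in> carrier R" "C = I +>\<^bsub>self_mod R\<^esub> r" using quot_carrier[OF S sI] by auto
      have "r \<odot>\<^bsub>?F\<^esub> basis_vec R b0 \<in> carrier ?F" by (rule F.smult_closed[OF r(1) basis_vec_mem]) simp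
      moreover have "(r \<odot>\<^bsub>?F\<^esub> basis_vec R b0) b0 = r" using r by (simp add: basis_vec_app)
      ultimately show "C \<in> ?\<epsilon> ` carrier ?F" using r(2) by (metis (no_types, lifting) image_eqI)
    qed
  qed
  have ker: "a_kernel ?F (quot_mod (self_mod R) I) ?\<epsilon> = {u \<in> carrier ?F. u b0 \<in> I}"
  proof -
    have cI: "I +>\<^bsub>self_mod R\<^esub> r = I \<longleftrightarrow> r \<in> I" if "r \<in> carrier R" for r
      using coset_eq_iff[OF S sI, of r "\<zero>\<^bsub>R\<^esub>"] coset_zero[OF S sI] S.minus_r_zero[of r] that by simp
    show ?thesis
      unfolding a_kernel_def' by (rule Collect_cong) (simp add: quot_mod_simps cI[OF free_mem] cong: conj_cong)
  qed
  have N0: "submodule {u \<in> carrier ?F. u b0 \<in> I} R ?F"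
    by (rule submodule_vimage[OF F S free_eval_hom F.carrier_is_submodule sI])
  obtain B d where B: "B 0 = {b0}" "\<And>n. finite (B n)"
    and d: "\<And>n. d n \<in> mod_hom R (free_mod R (B (Suc n))) (free_mod R (B n))"
      "d 0 ` carrier (free_mod R (B 1)) = {u \<in> carrier ?F. u b0 \<in> I}"
      "\<And>n. d (Suc n) ` carrier (free_mod R (B (Suc (Suc n)))) = a_kernel (free_mod R (B (Suc n))) (free_mod R (B n)) (d n)"
    using finite_free_continuation[OF R inf _ N0] by auto
  have "is_free_resolution R (quot_mod (self_mod R) I) B d ?\<epsilon>"
    unfolding is_free_resolution_def using \<epsilon> onto ker B(1) d by simp
  moreover have "d 0 (basis_vec R c) b0 \<in> I" if "c \<in> B 1" for c
    using d(2) basis_vec_mem[OF that] by blast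
  ultimately show ?thesis using B by blast
qed

section \<open>Chain maps and homotopies between resolutions\<close>

lemma resolutionD:
  assumes "is_free_resolution R N B d \<epsilon>"
  shows "\<epsilon> \<in> mod_hom R (free_mod R (B 0)) N" "\<epsilon> ` carrier (free_mod R (B 0)) = carrier N"
    and "\<And>n. d n \<in> mod_hom R (free_mod R (B (Suc n))) (free_mod R (B n))"
    and "\<And>u. u \<in> carrier (free_mod R (B 0)) \<Longrightarrow> \<epsilon> u = \<zero>\<^bsub>N\<^esub> \<longleftrightarrow> u \<in> d 0 ` carrier (free_mod R (B (Suc 0)))"
    and "\<And>n u. u \<in> carrier (free_mod R (B (Suc n))) \<Longrightarrow> d n u = \<zero>\<^bsub>free_mod R (B n)\<^esub> \<longleftrightarrow>
      u \<in> d (Suc n) ` carrier (free_mod R (B (Suc (Suc n))))"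
    and "\<And>n u. u \<in> carrier (free_mod R (B (Suc (Suc n)))) \<Longrightarrow> d n (d (Suc n) u) = \<zero>\<^bsub>free_mod R (B n)\<^esub>"
    and "\<And>u. u \<in> carrier (free_mod R (B (Suc 0))) \<Longrightarrow> \<epsilon> (d 0 u) = \<zero>\<^bsub>N\<^esub>"
proof -
  let ?F = "\<lambda>n. free_mod R (B n)"
  have f: "\<epsilon> \<in> mod_hom R (?F 0) N" "\<epsilon> ` carrier (?F 0) = carrier N"
    "\<And>n. d n \<in> mod_hom R (?F (Suc n)) (?F n)"
    and ker0: "d 0 ` carrier (?F (Suc 0)) = {u \<in> carrier (?F 0). \<epsilon> u = \<zero>\<^bsub>N\<^esub>}"
    and ker: "\<And>n. d (Suc n) ` carrier (?F (Suc (Suc n))) = {u \<in> carrier (?F (Suc n)). d n u = \<zero>\<^bsub>?F n\<^esub>}"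
    using assms by (simp_all add: is_free_resolution_def a_kernel_def' del: free_mod_simps)
  show "\<epsilon> \<in> mod_hom R (?F 0) N" "\<epsilon> ` carrier (?F 0) = carrier N"
    "\<And>n. d n \<in> mod_hom R (?F (Suc n)) (?F n)" by (rule f)+
  show "\<And>u. u \<in> carrier (?F 0) \<Longrightarrow> \<epsilon> u = \<zero>\<^bsub>N\<^esub> \<longleftrightarrow> u \<in> d 0 ` carrier (?F (Suc 0))"
    "\<And>n u. u \<in> carrier (?F (Suc n)) \<Longrightarrow> d n u = \<zero>\<^bsub>?F n\<^esub> \<longleftrightarrow> u \<in> d (Suc n) ` carrier (?F (Suc (Suc n)))"
    unfolding ker0 ker by blast+
  show "d n (d (Suc n) u) = \<zero>\<^bsub>?F n\<^esub>" if "u \<in> carrier (?F (Suc (Suc n)))" for n u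
    using ker[of n] that by blast
  show "\<epsilon> (d 0 u) = \<zero>\<^bsub>N\<^esub>" if "u \<in> carrier (?F (Suc 0))" for u
    using ker0 that by blast
qed

text \<open>Projectivity of free modules: preimages are chosen for the basis vectors and extended
  linearly.\<close>

lemma free_lift:
  assumes R: "cring R" and X: "module R X'" and Y: "module R Y" and g: "g \<in> mod_hom R (free_mod R B) X'"
    and p: "p \<in> mod_hom R Y X'" and im: "\<And>u. u \<in> carrier (free_mod R B) \<Longrightarrow> g u \<in> p ` carrier Y"
  shows "\<exists>f\<in>mod_hom R (free_mod R B) Y. \<forall>u\<in>carrier (free_mod R B). p (f u) = g u"
proof -
  interpret cring R by fact
  have "\<forall>b\<in>B. \<exists>y\<in>carrier Y. p y = g (basis_vec R b)" using im basis_vec_mem by (metis imageE)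
  then obtain y where y: "\<And>b. b \<in> B \<Longrightarrow> y b \<in> carrier Y" "\<And>b. b \<in> B \<Longrightarrow> p (y b) = g (basis_vec R b)" by metis
  have yc: "y \<in> B \<rightarrow> carrier Y" using y(1) by blast
  have "p (lin R Y y u) = g u" if u: "u \<in> carrier (free_mod R B)" for u
    by (rule free_hom_ext[OF X mod_hom_comp[OF lin_hom[OF Y yc] p] g _ u]) (simp add: lin_basis[OF Y yc] y(2))
  then show ?thesis using lin_hom[OF Y yc] by blast
qed

lemma mod_hom_diff:
  assumes M: "module R M" and N: "module R N" and f: "f \<in> mod_hom R M N" and g: "g \<in> mod_hom R M N"
  shows "(\<lambda>x. f x \<ominus>\<^bsub>N\<^esub> g x) \<in> mod_hom R M N"
proof -
  interpret M: module R M by fact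
  interpret N: module R N by fact
  show ?thesis
    by (rule mod_homI) (use mod_homD[OF f] mod_homD[OF g] in \<open>simp_all add: N.minus_minus_swap N.smult_minus\<close>)
qed

lemma mod_hom_sum:
  assumes M: "module R M" and N: "module R N" and f: "f \<in> mod_hom R M N" and g: "g \<in> mod_hom R M N"
  shows "(\<lambda>x. f x \<oplus>\<^bsub>N\<^esub> g x) \<in> mod_hom R M N"
proof -
  interpret M: module R M by fact
  interpret N: module R N by fact
  show ?thesis
    by (rule mod_homI) (use mod_homD[OF f] mod_homD[OF g] in \<open>simp_all add: N.a_ac N.smult_r_distr\<close>)
qed

text \<open>The identity of \<open>N\<close> is lifted degree by degree with
  \<open>free_lift\<close>; exactness of the target makes every lifting problem solvable.\<close>

lemma resolution_chain_map:
  assumes R: "cring R" and N: "module R N"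
    and F: "is_free_resolution R N B d \<epsilon>" and G: "is_free_resolution R N B' d' \<epsilon>'"
  shows "\<exists>\<phi>. (\<forall>n. \<phi> n \<in> mod_hom R (free_mod R (B n)) (free_mod R (B' n))) \<and>
    (\<forall>u\<in>carrier (free_mod R (B 0)). \<epsilon>' (\<phi> 0 u) = \<epsilon> u) \<and>
    (\<forall>n. \<forall>u\<in>carrier (free_mod R (B (Suc n))). d' n (\<phi> (Suc n) u) = \<phi> n (d n u))"
proof -
  interpret cring R by fact
  note f = resolutionD[OF F] and g = resolutionD[OF G]
  let ?F = "\<lambda>n. free_mod R (B n)" and ?G = "\<lambda>n. free_mod R (B' n)"
  note mF = free_module
  \<comment> \<open>\<open>P\<close> contains the solvability of the next lifting problem, so that
    dependent choice can proceed; \<open>Q\<close> is the commutation with the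
    differentials.\<close>
  define P where "P n \<phi> \<longleftrightarrow> \<phi> \<in> mod_hom R (?F n) (?G n) \<and>
    (\<forall>u\<in>carrier (?F (Suc n)). \<phi> (d n u) \<in> d' n ` carrier (?G (Suc n))) \<and>
    (n = 0 \<longrightarrow> (\<forall>u\<in>carrier (?F 0). \<epsilon>' (\<phi> u) = \<epsilon> u))" for n \<phi>
  define Q where "Q n \<phi> \<psi> \<longleftrightarrow> (\<forall>u\<in>carrier (?F (Suc n)). d' n (\<psi> u) = \<phi> (d n u))" for n \<phi> \<psi>
  have "\<exists>\<phi>. P 0 \<phi>"
  proof -
    have "\<exists>\<phi>\<in>mod_hom R (?F 0) (?G 0). \<forall>u\<in>carrier (?F 0). \<epsilon>' (\<phi> u) = \<epsilon> u"
      by (rule free_lift[OF R N mF f(1) g(1)]) (use f(2) g(2) in blast)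
    then obtain \<phi> where \<phi>: "\<phi> \<in> mod_hom R (?F 0) (?G 0)" "\<And>u. u \<in> carrier (?F 0) \<Longrightarrow> \<epsilon>' (\<phi> u) = \<epsilon> u" by blast
    have "\<phi> (d 0 u) \<in> d' 0 ` carrier (?G (Suc 0))" if u: "u \<in> carrier (?F (Suc 0))" for u
    proof -
      have du: "d 0 u \<in> carrier (?F 0)" by (rule mod_homD(1)[OF f(3) u])
      show ?thesis using g(4)[OF mod_homD(1)[OF \<phi>(1) du]] \<phi>(2)[OF du] f(7)[OF u] by simp
    qed
    then show ?thesis using \<phi> by (auto simp: P_def)
  qed
  moreover have "\<exists>\<psi>. P (Suc n) \<psi> \<and> Q n \<phi> \<psi>" if \<phi>: "P n \<phi>" for n \<phi>
  proof -
    have \<phi>h: "\<phi> \<in> mod_hom R (?F n) (?G n)" using \<phi> by (simp add: P_def)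
    have "\<exists>\<psi>\<in>mod_hom R (?F (Suc n)) (?G (Suc n)). \<forall>u\<in>carrier (?F (Suc n)). d' n (\<psi> u) = \<phi> (d n u)"
      by (rule free_lift[OF R mF mF mod_hom_comp[OF f(3) \<phi>h] g(3)]) (use \<phi> in \<open>auto simp: P_def\<close>)
    then obtain \<psi> where \<psi>: "\<psi> \<in> mod_hom R (?F (Suc n)) (?G (Suc n))"
      "\<And>u. u \<in> carrier (?F (Suc n)) \<Longrightarrow> d' n (\<psi> u) = \<phi> (d n u)" by blast
    have "\<psi> (d (Suc n) u) \<in> d' (Suc n) ` carrier (?G (Suc (Suc n)))" if u: "u \<in> carrier (?F (Suc (Suc n)))" for u
    proof -
      have du: "d (Suc n) u \<in> carrier (?F (Suc n))" by (rule mod_homD(1)[OF f(3) u])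
      have "d' n (\<psi> (d (Suc n) u)) = \<zero>\<^bsub>?G n\<^esub>"
        unfolding \<psi>(2)[OF du] f(6)[OF u] by (rule mod_hom_zero[OF mF mF \<phi>h])
      then show ?thesis using g(5)[OF mod_homD(1)[OF \<psi>(1) du]] by blast
    qed
    then show ?thesis using \<psi> by (auto simp: P_def Q_def)
  qed
  ultimately obtain \<phi> where "\<And>n. P n (\<phi> n)" "\<And>n. Q n (\<phi> n) (\<phi> (Suc n))"
    using dependent_nat_choice[of P Q] by metis
  then show ?thesis by (intro exI[of _ \<phi>]) (auto simp: P_def Q_def)
qed

text \<open>A chain map over the zero map of \<open>N\<close> lifts into boundaries at every stage.
  It serves twice: for multiplication by an element that kills \<open>N\<close>, and for the
  difference between a composite of chain maps and the identity.\<close>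

lemma resolution_null_homotopic:
  assumes R: "cring R" and N: "module R N"
    and F: "is_free_resolution R N B d \<epsilon>" and G: "is_free_resolution R N B' d' \<epsilon>'"
    and \<psi>: "\<And>n. \<psi> n \<in> mod_hom R (free_mod R (B n)) (free_mod R (B' n))"
    and \<psi>0: "\<And>u. u \<in> carrier (free_mod R (B 0)) \<Longrightarrow> \<epsilon>' (\<psi> 0 u) = \<zero>\<^bsub>N\<^esub>"
    and com: "\<And>n u. u \<in> carrier (free_mod R (B (Suc n))) \<Longrightarrow> d' n (\<psi> (Suc n) u) = \<psi> n (d n u)"
  shows "\<exists>h. (\<forall>n. h n \<in> mod_hom R (free_mod R (B n)) (free_mod R (B' (Suc n)))) \<and>
    (\<forall>u\<in>carrier (free_mod R (B 0)). d' 0 (h 0 u) = \<psi> 0 u) \<and>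
    (\<forall>n. \<forall>u\<in>carrier (free_mod R (B (Suc n))).
      d' (Suc n) (h (Suc n) u) = \<psi> (Suc n) u \<ominus>\<^bsub>free_mod R (B' (Suc n))\<^esub> h n (d n u))"
proof -
  interpret cring R by fact
  note f = resolutionD[OF F] and g = resolutionD[OF G]
  let ?F = "\<lambda>n. free_mod R (B n)" and ?G = "\<lambda>n. free_mod R (B' n)"
  note mF = free_module
  define P where "P n h \<longleftrightarrow> h \<in> mod_hom R (?F n) (?G (Suc n)) \<and>
    (\<forall>u\<in>carrier (?F (Suc n)). \<psi> (Suc n) u \<ominus>\<^bsub>?G (Suc n)\<^esub> h (d n u) \<in> d' (Suc n) ` carrier (?G (Suc (Suc n)))) \<and>
    (n = 0 \<longrightarrow> (\<forall>u\<in>carrier (?F 0). d' 0 (h u) = \<psi> 0 u))" for n h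
  define Q where "Q n h k \<longleftrightarrow> (\<forall>u\<in>carrier (?F (Suc n)). d' (Suc n) (k u) = \<psi> (Suc n) u \<ominus>\<^bsub>?G (Suc n)\<^esub> h (d n u))"
    for n h k
  \<comment> \<open>The element that the next homotopy has to hit is a cycle of the target, hence a
    boundary by exactness.\<close>
  have next_im: "\<psi> (Suc n) u \<ominus>\<^bsub>?G (Suc n)\<^esub> h (d n u) \<in> d' (Suc n) ` carrier (?G (Suc (Suc n)))"
    if h: "h \<in> mod_hom R (?F n) (?G (Suc n))" and u: "u \<in> carrier (?F (Suc n))"
      and eq: "d' n (h (d n u)) = \<psi> n (d n u)" for n h u
  proof -
    interpret G: module R "?G n" by (rule mF)
    interpret GS: module R "?G (Suc n)" by (rule mF)
    have hu: "h (d n u) \<in> carrier (?G (Suc n))" by (rule mod_homD(1)[OF h mod_homD(1)[OF f(3) u]])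
    note pu = mod_homD(1)[OF \<psi> u]
    have pd: "\<psi> n (d n u) \<in> carrier (?G n)" by (rule mod_homD(1)[OF \<psi> mod_homD(1)[OF f(3) u]])
    have "d' n (\<psi> (Suc n) u \<ominus>\<^bsub>?G (Suc n)\<^esub> h (d n u)) = \<zero>\<^bsub>?G n\<^esub>"
      unfolding mod_hom_minus[OF mF mF g(3) pu hu] com[OF u] eq by (rule G.minus_self[OF pd])
    moreover have "\<psi> (Suc n) u \<ominus>\<^bsub>?G (Suc n)\<^esub> h (d n u) \<in> carrier (?G (Suc n))" by (rule GS.minus_closed[OF pu hu])
    ultimately show ?thesis using g(5) by blast
  qed
  have "\<exists>h. P 0 h"
  proof -
    have "\<exists>h\<in>mod_hom R (?F 0) (?G (Suc 0)). \<forall>u\<in>carrier (?F 0). d' 0 (h u) = \<psi> 0 u"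
      by (rule free_lift[OF R mF mF \<psi> g(3)]) (use g(4) \<psi>0 mod_homD(1)[OF \<psi>] in blast)
    then obtain h where h: "h \<in> mod_hom R (?F 0) (?G (Suc 0))" "\<And>u. u \<in> carrier (?F 0) \<Longrightarrow> d' 0 (h u) = \<psi> 0 u" by blast
    then show ?thesis using next_im[OF h(1)] mod_homD(1)[OF f(3)] unfolding P_def by blast
  qed
  moreover have "\<exists>k. P (Suc n) k \<and> Q n h k" if h: "P n h" for n h
  proof -
    have hh: "h \<in> mod_hom R (?F n) (?G (Suc n))" using h by (simp add: P_def)
    have "\<exists>k\<in>mod_hom R (?F (Suc n)) (?G (Suc (Suc n))). \<forall>u\<in>carrier (?F (Suc n)).
        d' (Suc n) (k u) = \<psi> (Suc n) u \<ominus>\<^bsub>?G (Suc n)\<^esub> h (d n u)"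
      by (rule free_lift[OF R mF mF mod_hom_diff[OF mF mF \<psi> mod_hom_comp[OF f(3) hh]] g(3)])
        (use h in \<open>auto simp: P_def\<close>)
    then obtain k where k: "k \<in> mod_hom R (?F (Suc n)) (?G (Suc (Suc n)))"
      "\<And>u. u \<in> carrier (?F (Suc n)) \<Longrightarrow> d' (Suc n) (k u) = \<psi> (Suc n) u \<ominus>\<^bsub>?G (Suc n)\<^esub> h (d n u)" by blast
    have "d' (Suc n) (k (d (Suc n) u)) = \<psi> (Suc n) (d (Suc n) u)" if u: "u \<in> carrier (?F (Suc (Suc n)))" for u
    proof -
      interpret GS: module R "?G (Suc n)" by (rule mF)
      have du: "d (Suc n) u \<in> carrier (?F (Suc n))" by (rule mod_homD(1)[OF f(3) u])
      have "h (d n (d (Suc n) u)) = \<zero>\<^bsub>?G (Suc n)\<^esub>" unfolding f(6)[OF u] by (rule mod_hom_zero[OF mF mF hh])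
      then show ?thesis unfolding k(2)[OF du] using GS.minus_r_zero[OF mod_homD(1)[OF \<psi> du]] by simp
    qed
    then have "P (Suc n) k" using k(1) next_im[OF k(1)] by (auto simp: P_def)
    then show ?thesis using k(2) by (auto simp: Q_def)
  qed
  ultimately obtain h where "\<And>n. P n (h n)" "\<And>n. Q n (h n) (h (Suc n))"
    using dependent_nat_choice[of P Q] by metis
  then show ?thesis by (intro exI[of _ h]) (auto simp: P_def Q_def)
qed

text \<open>Multiplication by \<open>x\<close> on the resolution lies over multiplication by
  \<open>x\<close> on \<open>N\<close>, which is zero.\<close>

lemma resolution_mat_null:
  assumes R: "cring R" and N: "module R N" and F: "is_free_resolution R N B d \<epsilon>"
    and cx: "finite_free_complex R B d" and x: "x \<in> carrier R"
    and kill: "\<And>z. z \<in> carrier N \<Longrightarrow> x \<odot>\<^bsub>N\<^esub> z = \<zero>\<^bsub>N\<^esub>"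
  shows "mat_null R x (shift_basis B) (shift_matrix R d)"
proof -
  interpret finite_free_complex R B d by fact
  note f = resolutionD[OF F]
  let ?F = "\<lambda>n. free_mod R (B n)"
  note mF = free_module
  let ?\<psi> = "\<lambda>n u. x \<odot>\<^bsub>?F n\<^esub> u"
  have \<psi>: "?\<psi> n \<in> mod_hom R (?F n) (?F n)" for n
  proof -
    interpret F: module R "?F n" by (rule mF)
    show ?thesis
      by (rule mod_homI) (use x in \<open>simp_all del: free_mod_simps add: F.smult_r_distr F.smult_assoc1[symmetric] m_comm\<close>)
  qed
  have \<psi>0: "\<epsilon> (?\<psi> 0 u) = \<zero>\<^bsub>N\<^esub>" if "u \<in> carrier (?F 0)" for u
    using mod_homD(3)[OF f(1) x that] kill mod_homD(1)[OF f(1) that] by simp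
  have com: "d n (?\<psi> (Suc n) u) = ?\<psi> n (d n u)" if "u \<in> carrier (?F (Suc n))" for n u
    by (rule mod_homD(3)[OF f(3) x that])
  obtain h where h: "\<And>n. h n \<in> mod_hom R (?F n) (?F (Suc n))"
    "\<And>u. u \<in> carrier (?F 0) \<Longrightarrow> d 0 (h 0 u) = ?\<psi> 0 u"
    "\<And>n u. u \<in> carrier (?F (Suc n)) \<Longrightarrow> d (Suc n) (h (Suc n) u) = ?\<psi> (Suc n) u \<ominus>\<^bsub>?F (Suc n)\<^esub> h n (d n u)"
    using resolution_null_homotopic[where \<psi> = ?\<psi>, OF R N F F \<psi> \<psi>0 com] by blast
  show ?thesis
  proof (rule free_null[OF x h(1,2)])
    fix n u assume u: "u \<in> carrier (?F (Suc n))"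
    interpret F: module R "?F (Suc n)" by (rule mF)
    show "d (Suc n) (h (Suc n) u) \<oplus>\<^bsub>?F (Suc n)\<^esub> h n (d n u) = ?\<psi> (Suc n) u"
      unfolding h(3)[OF u]
      by (rule F.add_minus_cancel[OF F.smult_closed[OF x u] mod_homD(1)[OF h(1) mod_homD(1)[OF d u]]])
  qed
qed

section \<open>Independence of the resolution\<close>

lemma chain_submodules:
  fixes C :: "nat \<Rightarrow> ('a,'c) module"
  assumes C: "\<And>n. module R (C n)" and d: "\<And>n. d n \<in> mod_hom R (C (Suc n)) (C n)"
    and dd: "\<And>n x. x \<in> carrier (C (Suc (Suc n))) \<Longrightarrow> d n (d (Suc n) x) = \<zero>\<^bsub>C n\<^esub>"
  shows "submodule (case i of 0 \<Rightarrow> carrier (C 0) | Suc n \<Rightarrow> a_kernel (C (Suc n)) (C n) (d n)) R (C i)"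
    and "submodule (d i ` carrier (C (Suc i))) R (C i)"
    and "d i ` carrier (C (Suc i)) \<subseteq> (case i of 0 \<Rightarrow> carrier (C 0) | Suc n \<Rightarrow> a_kernel (C (Suc n)) (C n) (d n))"
proof -
  have car: "submodule (carrier (C n)) R (C n)" and triv: "submodule {\<zero>\<^bsub>C n\<^esub>} R (C n)" for n
    by (rule module.carrier_is_submodule[OF C] module.submodule_trivial[OF C])+
  show "submodule (case i of 0 \<Rightarrow> carrier (C 0) | Suc n \<Rightarrow> a_kernel (C (Suc n)) (C n) (d n)) R (C i)"
    using car submodule_vimage[OF C C d car triv] by (cases i) (auto simp: a_kernel_def')
  show "submodule (d i ` carrier (C (Suc i))) R (C i)" by (rule submodule_image[OF C C d car])
  show "d i ` carrier (C (Suc i)) \<subseteq> (case i of 0 \<Rightarrow> carrier (C 0) | Suc n \<Rightarrow> a_kernel (C (Suc n)) (C n) (d n))"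
    using mod_homD(1)[OF d] dd by (cases i) (auto simp: a_kernel_def')
qed

lemma cochain_submodules:
  fixes C :: "nat \<Rightarrow> ('a,'c) module"
  assumes C: "\<And>n. module R (C n)" and d: "\<And>n. d n \<in> mod_hom R (C n) (C (Suc n))"
    and dd: "\<And>n x. x \<in> carrier (C n) \<Longrightarrow> d (Suc n) (d n x) = \<zero>\<^bsub>C (Suc (Suc n))\<^esub>"
  shows "submodule (a_kernel (C i) (C (Suc i)) (d i)) R (C i)"
    and "submodule (case i of 0 \<Rightarrow> {\<zero>\<^bsub>C 0\<^esub>} | Suc n \<Rightarrow> d n ` carrier (C n)) R (C i)"
    and "(case i of 0 \<Rightarrow> {\<zero>\<^bsub>C 0\<^esub>} | Suc n \<Rightarrow> d n ` carrier (C n)) \<subseteq> a_kernel (C i) (C (Suc i)) (d i)"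
proof -
  have car: "submodule (carrier (C n)) R (C n)" and triv: "submodule {\<zero>\<^bsub>C n\<^esub>} R (C n)" for n
    by (rule module.carrier_is_submodule[OF C] module.submodule_trivial[OF C])+
  show "submodule (a_kernel (C i) (C (Suc i)) (d i)) R (C i)"
    using submodule_vimage[OF C C d car triv] by (simp add: a_kernel_def')
  show "submodule (case i of 0 \<Rightarrow> {\<zero>\<^bsub>C 0\<^esub>} | Suc n \<Rightarrow> d n ` carrier (C n)) R (C i)"
    using triv submodule_image[OF C C d car] by (cases i) auto
  show "(case i of 0 \<Rightarrow> {\<zero>\<^bsub>C 0\<^esub>} | Suc n \<Rightarrow> d n ` carrier (C n)) \<subseteq> a_kernel (C i) (C (Suc i)) (d i)"
    using mod_homD(1)[OF d] dd mod_hom_zero[OF C C d] module.submodule_zero[OF C car]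
    by (cases i) (auto simp: a_kernel_def')
qed

context serre_class begin

text \<open>\<open>f\<close> is injective on homology: if \<open>f x\<close> is a boundary, then so
  is \<open>g (f x)\<close>, which differs from the cycle \<open>x\<close> by a boundary. So the
  homology of \<open>C\<close> embeds into that of \<open>D\<close>; exchanging the complexes gives
  the converse.\<close>

lemma chain_homology_retract:
  assumes C: "\<And>n. module R (C n)" and d: "\<And>n. d n \<in> mod_hom R (C (Suc n)) (C n)"
    and dd: "\<And>n x. x \<in> carrier (C (Suc (Suc n))) \<Longrightarrow> d n (d (Suc n) x) = \<zero>\<^bsub>C n\<^esub>"
    and D: "\<And>n. module R (D n)" and e: "\<And>n. e n \<in> mod_hom R (D (Suc n)) (D n)"
    and ee: "\<And>n x. x \<in> carrier (D (Suc (Suc n))) \<Longrightarrow> e n (e (Suc n) x) = \<zero>\<^bsub>D n\<^esub>"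
    and f: "\<And>n. f n \<in> mod_hom R (C n) (D n)"
    and fc: "\<And>n x. x \<in> carrier (C (Suc n)) \<Longrightarrow> e n (f (Suc n) x) = f n (d n x)"
    and g: "\<And>n. g n \<in> mod_hom R (D n) (C n)"
    and gc: "\<And>n x. x \<in> carrier (D (Suc n)) \<Longrightarrow> d n (g (Suc n) x) = g n (e n x)"
    and gf0: "\<And>x. x \<in> carrier (C 0) \<Longrightarrow> \<exists>y\<in>carrier (C (Suc 0)). g 0 (f 0 x) = x \<oplus>\<^bsub>C 0\<^esub> d 0 y"
    and gf: "\<And>n x. x \<in> carrier (C (Suc n)) \<Longrightarrow> d n x = \<zero>\<^bsub>C n\<^esub> \<Longrightarrow>
      \<exists>y\<in>carrier (C (Suc (Suc n))). g (Suc n) (f (Suc n) x) = x \<oplus>\<^bsub>C (Suc n)\<^esub> d (Suc n) y"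
    and S: "belongs_to R (chain_homology D e i) S"
  shows "belongs_to R (chain_homology C d i) S"
proof -
  note FC = chain_submodules[where C = C and d = d and i = i, OF C d dd] and FD = chain_submodules[where C = D and d = e and i = i, OF D e ee]
  have sqD: "sq (D i) (case i of 0 \<Rightarrow> carrier (D 0) | Suc n \<Rightarrow> a_kernel (D (Suc n)) (D n) (e n)) (e i ` carrier (D (Suc i)))"
    using S sq_iff[OF D FD] by (simp add: chain_homology_def)
  have "sq (C i) (case i of 0 \<Rightarrow> carrier (C 0) | Suc n \<Rightarrow> a_kernel (C (Suc n)) (C n) (d n)) (d i ` carrier (C (Suc i)))"
  proof (rule sq_inj[OF C FC D FD(1) sqD f])
    fix x assume x: "x \<in> (case i of 0 \<Rightarrow> carrier (C 0) | Suc n \<Rightarrow> a_kernel (C (Suc n)) (C n) (d n))"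
    show "f i x \<in> (case i of 0 \<Rightarrow> carrier (D 0) | Suc n \<Rightarrow> a_kernel (D (Suc n)) (D n) (e n))"
      using x mod_homD(1)[OF f] fc mod_hom_zero[OF C D f] by (cases i) (auto simp: a_kernel_def')
    assume "f i x \<in> e i ` carrier (D (Suc i))"
    then obtain z where z: "z \<in> carrier (D (Suc i))" "f i x = e i z" by blast
    interpret Ci: module R "C i" by (rule C)
    have xc: "x \<in> carrier (C i)" using x by (cases i) (auto simp: a_kernel_def')
    have "\<exists>y\<in>carrier (C (Suc i)). g i (f i x) = x \<oplus>\<^bsub>C i\<^esub> d i y"
    proof (cases i)
      case 0
      then show ?thesis using gf0 xc by simp
    next
      case (Suc n)
      then show ?thesis using gf[of x n] x by (simp add: a_kernel_def')
    qed
    then obtain y where y: "y \<in> carrier (C (Suc i))" "g i (f i x) = x \<oplus>\<^bsub>C i\<^esub> d i y" by blast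
    have "g i (f i x) = d i (g (Suc i) z)" using z gc by simp
    then have "x \<oplus>\<^bsub>C i\<^esub> d i y \<in> d i ` carrier (C (Suc i))" using y(2) mod_homD(1)[OF g z(1)] by (metis imageI)
    then have "(x \<oplus>\<^bsub>C i\<^esub> d i y) \<ominus>\<^bsub>C i\<^esub> d i y \<in> d i ` carrier (C (Suc i))"
      using Ci.submodule_minus[OF FC(2)] y(1) by blast
    then show "x \<in> d i ` carrier (C (Suc i))" unfolding Ci.minus_add_cancel[OF xc mod_homD(1)[OF d y(1)]] .
  qed
  then show ?thesis using sq_iff[OF C FC] by (simp add: chain_homology_def)
qed

text \<open>As for chains. In degree zero there are no coboundaries, so the composite has to be the
  identity on cocycles there.\<close>

lemma cochain_cohomology_retract:
  assumes C: "\<And>n. module R (C n)" and d: "\<And>n. d n \<in> mod_hom R (C n) (C (Suc n))"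
    and dd: "\<And>n x. x \<in> carrier (C n) \<Longrightarrow> d (Suc n) (d n x) = \<zero>\<^bsub>C (Suc (Suc n))\<^esub>"
    and D: "\<And>n. module R (D n)" and e: "\<And>n. e n \<in> mod_hom R (D n) (D (Suc n))"
    and ee: "\<And>n x. x \<in> carrier (D n) \<Longrightarrow> e (Suc n) (e n x) = \<zero>\<^bsub>D (Suc (Suc n))\<^esub>"
    and f: "\<And>n. f n \<in> mod_hom R (C n) (D n)"
    and fc: "\<And>n x. x \<in> carrier (C n) \<Longrightarrow> e n (f n x) = f (Suc n) (d n x)"
    and g: "\<And>n. g n \<in> mod_hom R (D n) (C n)"
    and gc: "\<And>n x. x \<in> carrier (D n) \<Longrightarrow> d n (g n x) = g (Suc n) (e n x)"
    and gf0: "\<And>x. x \<in> carrier (C 0) \<Longrightarrow> d 0 x = \<zero>\<^bsub>C (Suc 0)\<^esub> \<Longrightarrow> g 0 (f 0 x) = x"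
    and gf: "\<And>n x. x \<in> carrier (C (Suc n)) \<Longrightarrow> d (Suc n) x = \<zero>\<^bsub>C (Suc (Suc n))\<^esub> \<Longrightarrow>
      \<exists>y\<in>carrier (C n). g (Suc n) (f (Suc n) x) = x \<oplus>\<^bsub>C (Suc n)\<^esub> d n y"
    and S: "belongs_to R (cochain_cohomology D e i) S"
  shows "belongs_to R (cochain_cohomology C d i) S"
proof -
  note FC = cochain_submodules[where C = C and d = d and i = i, OF C d dd] and FD = cochain_submodules[where C = D and d = e and i = i, OF D e ee]
  let ?IC = "case i of 0 \<Rightarrow> {\<zero>\<^bsub>C 0\<^esub>} | Suc n \<Rightarrow> d n ` carrier (C n)"
  let ?ID = "case i of 0 \<Rightarrow> {\<zero>\<^bsub>D 0\<^esub>} | Suc n \<Rightarrow> e n ` carrier (D n)"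
  have sqD: "sq (D i) (a_kernel (D i) (D (Suc i)) (e i)) ?ID"
    using S sq_iff[OF D FD] by (simp add: cochain_cohomology_def)
  have "sq (C i) (a_kernel (C i) (C (Suc i)) (d i)) ?IC"
  proof (rule sq_inj[OF C FC D FD(1) sqD f])
    fix x assume x: "x \<in> a_kernel (C i) (C (Suc i)) (d i)"
    show "f i x \<in> a_kernel (D i) (D (Suc i)) (e i)"
      using x mod_homD(1)[OF f] fc mod_hom_zero[OF C D f] by (auto simp: a_kernel_def')
    assume fx: "f i x \<in> ?ID"
    interpret Ci: module R "C i" by (rule C)
    have xc: "x \<in> carrier (C i)" "d i x = \<zero>\<^bsub>C (Suc i)\<^esub>" using x by (auto simp: a_kernel_def')
    have "g i (f i x) \<in> ?IC"
    proof (cases i)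
      case 0
      then show ?thesis using fx mod_hom_zero[OF D C g] by simp
    next
      case (Suc n)
      then obtain z where "z \<in> carrier (D n)" "f i x = e n z" using fx by auto
      then have "g i (f i x) = d n (g n z)" "g n z \<in> carrier (C n)" using gc Suc mod_homD(1)[OF g] by auto
      then show ?thesis using Suc by simp
    qed
    moreover have "\<exists>v\<in>?IC. g i (f i x) = x \<oplus>\<^bsub>C i\<^esub> v"
    proof (cases i)
      case 0
      then show ?thesis using gf0 xc Ci.r_zero[OF xc(1)] by simp
    next
      case (Suc n)
      then show ?thesis using gf[of x n] xc by auto
    qed
    then obtain v where v: "v \<in> ?IC" "g i (f i x) = x \<oplus>\<^bsub>C i\<^esub> v" by blast
    ultimately have "(x \<oplus>\<^bsub>C i\<^esub> v) \<ominus>\<^bsub>C i\<^esub> v \<in> ?IC"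
      using Ci.submodule_minus[OF FC(2)] by simp
    moreover have "v \<in> carrier (C i)" using v(1) Ci.submoduleE(1)[OF FC(2)] by blast
    ultimately show "x \<in> ?IC" by (simp only: Ci.minus_add_cancel[OF xc(1)])
  qed
  then show ?thesis using sq_iff[OF C FC] by (simp add: cochain_cohomology_def)
qed

end

lemma tensor_map_square:
  assumes P: "module R P" "module R P1" "module R P2" "module R Q" and M: "module R M"
    and f: "f \<in> mod_hom R P P1" and g: "g \<in> mod_hom R P1 Q"
    and f': "f' \<in> mod_hom R P P2" and g': "g' \<in> mod_hom R P2 Q"
    and eq: "\<And>p. p \<in> carrier P \<Longrightarrow> g (f p) = g' (f' p)"
    and t: "t \<in> carrier (tensor_mod R P M)"
  shows "tensor_map R Q M g (tensor_map R P1 M f t) = tensor_map R Q M g' (tensor_map R P2 M f' t)"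
proof -
  interpret T: tensor_pair R P M using P M by (intro tensor_pair.intro)
  interpret TQ: tensor_pair R Q M using P M by (intro tensor_pair.intro)
  show ?thesis
  proof (rule T.tensor_hom_ext[OF TQ.tensor_module
        mod_hom_comp[OF tensor_map_hom[OF P(1,2) M f] tensor_map_hom[OF P(2,4) M g]]
        mod_hom_comp[OF tensor_map_hom[OF P(1,3) M f'] tensor_map_hom[OF P(3,4) M g']] _ t])
    fix p m assume p: "p \<in> carrier P" and m: "m \<in> carrier M"
    show "tensor_map R Q M g (tensor_map R P1 M f (tens R P M p m)) =
      tensor_map R Q M g' (tensor_map R P2 M f' (tens R P M p m))"
      using tensor_map_tens[OF P(1,2) M f p m] tensor_map_tens[OF P(1,3) M f' p m]
        tensor_map_tens[OF P(2,4) M g mod_homD(1)[OF f p] m] tensor_map_tens[OF P(3,4) M g' mod_homD(1)[OF f' p] m]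
        eq[OF p] by simp
  qed
qed

lemma precomp_hom:
  assumes P: "module R P" and M: "module R M" and f: "f \<in> mod_hom R P Q"
  shows "(\<lambda>g. \<lambda>x\<in>carrier P. g (f x)) \<in> mod_hom R (hom_mod R Q M) (hom_mod R P M)"
proof (rule mod_homI)
  interpret P: module R P by fact
  fix g assume "g \<in> carrier (hom_mod R Q M)"
  then have g: "g \<in> mod_hom R Q M" by simp
  have "(\<lambda>x\<in>carrier P. g (f x)) \<in> mod_hom R P M"
    using mod_homD[OF mod_hom_comp[OF f g]] by (intro mod_homI) simp_all
  then show "(\<lambda>x\<in>carrier P. g (f x)) \<in> carrier (hom_mod R P M)" by simp
qed (use mod_homD(1)[OF f] in \<open>auto simp: fun_eq_iff\<close>)

text \<open>The composite of the two chain maps and the identity both lie over the identity of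
  \<open>N\<close>, so their difference \<open>?\<chi>\<close> lies over zero and is
  null-homotopic.\<close>

lemma resolution_homotopy_equivalence:
  assumes R: "cring R" and N: "module R N"
    and F: "is_free_resolution R N B d \<epsilon>" and G: "is_free_resolution R N B' d' \<epsilon>'"
  obtains \<phi> \<psi> h where
    "\<And>n. \<phi> n \<in> mod_hom R (free_mod R (B n)) (free_mod R (B' n))"
    "\<And>n u. u \<in> carrier (free_mod R (B (Suc n))) \<Longrightarrow> d' n (\<phi> (Suc n) u) = \<phi> n (d n u)"
    "\<And>n. \<psi> n \<in> mod_hom R (free_mod R (B' n)) (free_mod R (B n))"
    "\<And>n u. u \<in> carrier (free_mod R (B' (Suc n))) \<Longrightarrow> d n (\<psi> (Suc n) u) = \<psi> n (d' n u)"
    "\<And>n. h n \<in> mod_hom R (free_mod R (B n)) (free_mod R (B (Suc n)))"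
    "\<And>u. u \<in> carrier (free_mod R (B 0)) \<Longrightarrow> \<psi> 0 (\<phi> 0 u) = u \<oplus>\<^bsub>free_mod R (B 0)\<^esub> d 0 (h 0 u)"
    "\<And>n u. u \<in> carrier (free_mod R (B (Suc n))) \<Longrightarrow> \<psi> (Suc n) (\<phi> (Suc n) u) =
      u \<oplus>\<^bsub>free_mod R (B (Suc n))\<^esub> (d (Suc n) (h (Suc n) u) \<oplus>\<^bsub>free_mod R (B (Suc n))\<^esub> h n (d n u))"
proof -
  interpret cring R by fact
  interpret N: module R N by fact
  note f = resolutionD[OF F] and g = resolutionD[OF G]
  let ?F = "\<lambda>n. free_mod R (B n)" and ?G = "\<lambda>n. free_mod R (B' n)"
  note mF = free_module
  obtain \<phi> where \<phi>: "\<And>n. \<phi> n \<in> mod_hom R (?F n) (?G n)"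
    "\<And>u. u \<in> carrier (?F 0) \<Longrightarrow> \<epsilon>' (\<phi> 0 u) = \<epsilon> u"
    "\<And>n u. u \<in> carrier (?F (Suc n)) \<Longrightarrow> d' n (\<phi> (Suc n) u) = \<phi> n (d n u)"
    using resolution_chain_map[OF R N F G] by blast
  obtain \<psi> where \<psi>: "\<And>n. \<psi> n \<in> mod_hom R (?G n) (?F n)"
    "\<And>u. u \<in> carrier (?G 0) \<Longrightarrow> \<epsilon> (\<psi> 0 u) = \<epsilon>' u"
    "\<And>n u. u \<in> carrier (?G (Suc n)) \<Longrightarrow> d n (\<psi> (Suc n) u) = \<psi> n (d' n u)"
    using resolution_chain_map[OF R N G F] by blast
  let ?\<chi> = "\<lambda>n u. \<psi> n (\<phi> n u) \<ominus>\<^bsub>?F n\<^esub> u"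
  have idh: "(\<lambda>u. u) \<in> mod_hom R (?F n) (?F n)" for n by (rule mod_homI) auto
  note pp = mod_hom_comp[OF \<phi>(1) \<psi>(1)]
  have \<chi>: "?\<chi> n \<in> mod_hom R (?F n) (?F n)" for n by (rule mod_hom_diff[OF mF mF pp idh])
  have \<chi>0: "\<epsilon> (?\<chi> 0 u) = \<zero>\<^bsub>N\<^esub>" if u: "u \<in> carrier (?F 0)" for u
  proof -
    note ph = mod_homD(1)[OF \<phi>(1) u]
    have "\<epsilon> (?\<chi> 0 u) = \<epsilon> (\<psi> 0 (\<phi> 0 u)) \<ominus>\<^bsub>N\<^esub> \<epsilon> u"
      by (rule mod_hom_minus[OF mF N f(1) mod_homD(1)[OF pp u] u])
    also have "\<dots> = \<zero>\<^bsub>N\<^esub>" unfolding \<psi>(2)[OF ph] \<phi>(2)[OF u] by (rule N.minus_self[OF mod_homD(1)[OF f(1) u]])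
    finally show ?thesis .
  qed
  have \<chi>c: "d n (?\<chi> (Suc n) u) = ?\<chi> n (d n u)" if u: "u \<in> carrier (?F (Suc n))" for n u
  proof -
    note ph = mod_homD(1)[OF \<phi>(1) u]
    have "d n (?\<chi> (Suc n) u) = d n (\<psi> (Suc n) (\<phi> (Suc n) u)) \<ominus>\<^bsub>?F n\<^esub> d n u"
      by (rule mod_hom_minus[OF mF mF f(3) mod_homD(1)[OF pp u] u])
    then show ?thesis unfolding \<psi>(3)[OF ph] \<phi>(3)[OF u] .
  qed
  obtain h where h: "\<And>n. h n \<in> mod_hom R (?F n) (?F (Suc n))"
    "\<And>u. u \<in> carrier (?F 0) \<Longrightarrow> d 0 (h 0 u) = ?\<chi> 0 u"
    "\<And>n u. u \<in> carrier (?F (Suc n)) \<Longrightarrow> d (Suc n) (h (Suc n) u) = ?\<chi> (Suc n) u \<ominus>\<^bsub>?F (Suc n)\<^esub> h n (d n u)"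
    using resolution_null_homotopic[where \<psi> = ?\<chi>, OF R N F F \<chi> \<chi>0 \<chi>c] by blast
  have split: "x = u \<oplus>\<^bsub>?F n\<^esub> (x \<ominus>\<^bsub>?F n\<^esub> u)" if "x \<in> carrier (?F n)" "u \<in> carrier (?F n)" for x u n
  proof -
    interpret F: module R "?F n" by (rule mF)
    have "u \<oplus>\<^bsub>?F n\<^esub> (x \<ominus>\<^bsub>?F n\<^esub> u) = (x \<ominus>\<^bsub>?F n\<^esub> u) \<oplus>\<^bsub>?F n\<^esub> u"
      by (rule F.a_comm) (use that in \<open>simp_all del: free_mod_simps\<close>)
    then show ?thesis using F.add_minus_cancel[OF that] by simp
  qed
  show ?thesis
  proof (rule that[OF \<phi>(1,3) \<psi>(1,3) h(1)])
    show "\<psi> 0 (\<phi> 0 u) = u \<oplus>\<^bsub>?F 0\<^esub> d 0 (h 0 u)" if u: "u \<in> carrier (?F 0)" for u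
      unfolding h(2)[OF u] by (rule split[OF mod_homD(1)[OF pp u] u])
    show "\<psi> (Suc n) (\<phi> (Suc n) u) = u \<oplus>\<^bsub>?F (Suc n)\<^esub> (d (Suc n) (h (Suc n) u) \<oplus>\<^bsub>?F (Suc n)\<^esub> h n (d n u))"
      if u: "u \<in> carrier (?F (Suc n))" for n u
    proof -
      interpret F: module R "?F (Suc n)" by (rule mF)
      show ?thesis unfolding h(3)[OF u] F.add_minus_cancel[OF mod_homD(1)[OF \<chi> u] mod_homD(1)[OF h(1) mod_homD(1)[OF f(3) u]]]
        by (rule split[OF mod_homD(1)[OF pp u] u])
    qed
  qed
qed

context serre_class begin

text \<open>Tensoring with \<open>M\<close> preserves the homotopy identity, as a comparison on
  elementary tensors shows; \<open>chain_homology_retract\<close> then applies.\<close>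

lemma tensor_homology_independent:
  assumes N: "module R N" and M: "module R M"
    and F: "is_free_resolution R N B d \<epsilon>" and G: "is_free_resolution R N B' d' \<epsilon>'"
    and S: "belongs_to R (tensor_homology R (\<lambda>n. free_mod R (B' n)) d' M i) S"
  shows "belongs_to R (tensor_homology R (\<lambda>n. free_mod R (B n)) d M i) S"
proof -
  let ?F = "\<lambda>n. free_mod R (B n)" and ?G = "\<lambda>n. free_mod R (B' n)"
  note mF = free_module and f = resolutionD[OF F] and g = resolutionD[OF G]
  obtain \<phi> \<psi> h where \<phi>: "\<And>n. \<phi> n \<in> mod_hom R (?F n) (?G n)"
    "\<And>n u. u \<in> carrier (?F (Suc n)) \<Longrightarrow> d' n (\<phi> (Suc n) u) = \<phi> n (d n u)"
    and \<psi>: "\<And>n. \<psi> n \<in> mod_hom R (?G n) (?F n)"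
    "\<And>n u. u \<in> carrier (?G (Suc n)) \<Longrightarrow> d n (\<psi> (Suc n) u) = \<psi> n (d' n u)"
    and h: "\<And>n. h n \<in> mod_hom R (?F n) (?F (Suc n))"
    and h0: "\<And>u. u \<in> carrier (?F 0) \<Longrightarrow> \<psi> 0 (\<phi> 0 u) = u \<oplus>\<^bsub>?F 0\<^esub> d 0 (h 0 u)"
    and hS: "\<And>n u. u \<in> carrier (?F (Suc n)) \<Longrightarrow> \<psi> (Suc n) (\<phi> (Suc n) u) =
      u \<oplus>\<^bsub>?F (Suc n)\<^esub> (d (Suc n) (h (Suc n) u) \<oplus>\<^bsub>?F (Suc n)\<^esub> h n (d n u))"
    by (rule resolution_homotopy_equivalence[OF is_cring N F G]) (rule that; assumption)
  have TF: "tensor_pair R (?F n) M" and TG: "tensor_pair R (?G n) M" for n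
    using mF M by (auto intro: tensor_pair.intro)
  note tF = tensor_pair.tensor_module[OF TF] and tG = tensor_pair.tensor_module[OF TG]
  let ?TF = "\<lambda>n. tensor_mod R (?F n) M" and ?TG = "\<lambda>n. tensor_mod R (?G n) M"
  note th = tensor_map_hom[OF mF mF M] and tt = tensor_map_tens[OF mF mF M]
  have z: "(\<lambda>_. \<zero>\<^bsub>L\<^esub>) \<in> mod_hom R K L" if "module R L" for K L
  proof -
    interpret L: module R L by fact
    show ?thesis by (rule mod_homI) auto
  qed
  have tz: "tens R P M \<zero>\<^bsub>P\<^esub> m = \<zero>\<^bsub>tensor_mod R P M\<^esub>" if "tensor_pair R P M" "m \<in> carrier M" for P m
  proof -
    interpret T: tensor_pair R P M by fact
    have "(\<lambda>p. tens R P M p m) \<in> mod_hom R P (tensor_mod R P M)"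
      by (rule mod_homI) (use that(2) in \<open>simp_all add: T.tens_closed T.tens_bilinear\<close>)
    from mod_hom_zero[OF T.P.module_axioms T.tensor_module this] show ?thesis .
  qed
  have dd: "tensor_map R (?F n) M (d n) (tensor_map R (?F (Suc n)) M (d (Suc n)) t) = \<zero>\<^bsub>?TF n\<^esub>"
    if t: "t \<in> carrier (?TF (Suc (Suc n)))" for n t
  proof (rule tensor_pair.tensor_hom_ext[OF TF tF mod_hom_comp[OF th[OF f(3)] th[OF f(3)]] z[OF tF] _ t])
    fix p m assume "p \<in> carrier (?F (Suc (Suc n)))" "m \<in> carrier M"
    then show "tensor_map R (?F n) M (d n) (tensor_map R (?F (Suc n)) M (d (Suc n)) (tens R (?F (Suc (Suc n))) M p m)) = \<zero>\<^bsub>?TF n\<^esub>"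
      using tz[OF TF] by (simp only: tt[OF f(3)] mod_homD(1)[OF f(3)] f(6))
  qed
  have ee: "tensor_map R (?G n) M (d' n) (tensor_map R (?G (Suc n)) M (d' (Suc n)) t) = \<zero>\<^bsub>?TG n\<^esub>"
    if t: "t \<in> carrier (?TG (Suc (Suc n)))" for n t
  proof (rule tensor_pair.tensor_hom_ext[OF TG tG mod_hom_comp[OF th[OF g(3)] th[OF g(3)]] z[OF tG] _ t])
    fix p m assume "p \<in> carrier (?G (Suc (Suc n)))" "m \<in> carrier M"
    then show "tensor_map R (?G n) M (d' n) (tensor_map R (?G (Suc n)) M (d' (Suc n)) (tens R (?G (Suc (Suc n))) M p m)) = \<zero>\<^bsub>?TG n\<^esub>"
      using tz[OF TG] by (simp only: tt[OF g(3)] mod_homD(1)[OF g(3)] g(6))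
  qed
  have idT: "(\<lambda>t. t) \<in> mod_hom R (?TF n) (?TF n)" for n by (rule mod_homI) auto
  note bil = tensor_pair.tens_bilinear(1)[OF TF]
  show ?thesis
    unfolding tensor_homology_def
  proof (rule chain_homology_retract[where D = ?TG and e = "\<lambda>n. tensor_map R (?G n) M (d' n)"
        and f = "\<lambda>n. tensor_map R (?G n) M (\<phi> n)" and g = "\<lambda>n. tensor_map R (?F n) M (\<psi> n)",
        OF tF th[OF f(3)] dd tG th[OF g(3)] ee th[OF \<phi>(1)] _ th[OF \<psi>(1)] _ _ _ S[unfolded tensor_homology_def]])
    show "tensor_map R (?G n) M (d' n) (tensor_map R (?G (Suc n)) M (\<phi> (Suc n)) t) =
      tensor_map R (?G n) M (\<phi> n) (tensor_map R (?F n) M (d n) t)" if "t \<in> carrier (?TF (Suc n))" for n t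
      by (rule tensor_map_square[OF mF mF mF mF M _ _ _ _ _ that]; (rule \<phi>(1) g(3) f(3) | rule \<phi>(2), assumption))
    show "tensor_map R (?F n) M (d n) (tensor_map R (?F (Suc n)) M (\<psi> (Suc n)) t) =
      tensor_map R (?F n) M (\<psi> n) (tensor_map R (?G n) M (d' n) t)" if "t \<in> carrier (?TG (Suc n))" for n t
      by (rule tensor_map_square[OF mF mF mF mF M _ _ _ _ _ that]; (rule \<psi>(1) g(3) f(3) | rule \<psi>(2), assumption))
    fix t assume t: "t \<in> carrier (?TF 0)"
    have "tensor_map R (?F 0) M (\<psi> 0) (tensor_map R (?G 0) M (\<phi> 0) t) =
      t \<oplus>\<^bsub>?TF 0\<^esub> tensor_map R (?F 0) M (d 0) (tensor_map R (?F (Suc 0)) M (h 0) t)"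
    proof (rule tensor_pair.tensor_hom_ext[OF TF tF mod_hom_comp[OF th[OF \<phi>(1)] th[OF \<psi>(1)]]
          mod_hom_sum[OF tF tF idT mod_hom_comp[OF th[OF h] th[OF f(3)]]] _ t])
      fix p m assume p: "p \<in> carrier (?F 0)" and m: "m \<in> carrier M"
      show "tensor_map R (?F 0) M (\<psi> 0) (tensor_map R (?G 0) M (\<phi> 0) (tens R (?F 0) M p m)) =
        tens R (?F 0) M p m \<oplus>\<^bsub>?TF 0\<^esub> tensor_map R (?F 0) M (d 0) (tensor_map R (?F (Suc 0)) M (h 0) (tens R (?F 0) M p m))"
        using p m by (simp only: tt[OF \<phi>(1)] tt[OF \<psi>(1)] tt[OF h] tt[OF f(3)] mod_homD(1)[OF \<phi>(1)]
            mod_homD(1)[OF h] mod_homD(1)[OF f(3)] h0 bil)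
    qed
    then show "\<exists>y\<in>carrier (?TF (Suc 0)). tensor_map R (?F 0) M (\<psi> 0) (tensor_map R (?G 0) M (\<phi> 0) t) =
        t \<oplus>\<^bsub>?TF 0\<^esub> tensor_map R (?F 0) M (d 0) y"
      using mod_homD(1)[OF th[OF h] t] by blast
  next
    fix n t assume t: "t \<in> carrier (?TF (Suc n))" and dt: "tensor_map R (?F n) M (d n) t = \<zero>\<^bsub>?TF n\<^esub>"
    interpret TS: module R "?TF (Suc n)" by (rule tF)
    interpret FS: module R "?F (Suc n)" by (rule mF)
    have "tensor_map R (?F (Suc n)) M (\<psi> (Suc n)) (tensor_map R (?G (Suc n)) M (\<phi> (Suc n)) t) =
      t \<oplus>\<^bsub>?TF (Suc n)\<^esub> (tensor_map R (?F (Suc n)) M (d (Suc n)) (tensor_map R (?F (Suc (Suc n))) M (h (Suc n)) t)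
        \<oplus>\<^bsub>?TF (Suc n)\<^esub> tensor_map R (?F (Suc n)) M (h n) (tensor_map R (?F n) M (d n) t))"
    proof (rule tensor_pair.tensor_hom_ext[OF TF tF mod_hom_comp[OF th[OF \<phi>(1)] th[OF \<psi>(1)]]
          mod_hom_sum[OF tF tF idT mod_hom_sum[OF tF tF mod_hom_comp[OF th[OF h] th[OF f(3)]] mod_hom_comp[OF th[OF f(3)] th[OF h]]]] _ t])
      fix p m assume p: "p \<in> carrier (?F (Suc n))" and m: "m \<in> carrier M"
      show "tensor_map R (?F (Suc n)) M (\<psi> (Suc n)) (tensor_map R (?G (Suc n)) M (\<phi> (Suc n)) (tens R (?F (Suc n)) M p m)) =
        tens R (?F (Suc n)) M p m \<oplus>\<^bsub>?TF (Suc n)\<^esub>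
        (tensor_map R (?F (Suc n)) M (d (Suc n)) (tensor_map R (?F (Suc (Suc n))) M (h (Suc n)) (tens R (?F (Suc n)) M p m))
        \<oplus>\<^bsub>?TF (Suc n)\<^esub> tensor_map R (?F (Suc n)) M (h n) (tensor_map R (?F n) M (d n) (tens R (?F (Suc n)) M p m)))"
        using p m by (simp only: tt[OF \<phi>(1)] tt[OF \<psi>(1)] tt[OF h] tt[OF f(3)] mod_homD(1)[OF \<phi>(1)]
            mod_homD(1)[OF h] mod_homD(1)[OF f(3)] hS bil FS.a_closed)
    qed
    \<comment> \<open>On a cycle the second summand of the homotopy vanishes, and only a boundary is
      left.\<close>
    also have "tensor_map R (?F (Suc n)) M (h n) (tensor_map R (?F n) M (d n) t) = \<zero>\<^bsub>?TF (Suc n)\<^esub>"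
      unfolding dt by (rule mod_hom_zero[OF tF tF th[OF h]])
    finally show "\<exists>y\<in>carrier (?TF (Suc (Suc n))). tensor_map R (?F (Suc n)) M (\<psi> (Suc n)) (tensor_map R (?G (Suc n)) M (\<phi> (Suc n)) t) =
        t \<oplus>\<^bsub>?TF (Suc n)\<^esub> tensor_map R (?F (Suc n)) M (d (Suc n)) y"
      using mod_homD(1)[OF th[OF h] t] mod_homD(1)[OF th[OF f(3)] mod_homD(1)[OF th[OF h] t]] TS.r_zero by metis
  qed
qed

lemma hom_cohomology_independent:
  assumes N: "module R N" and M: "module R M"
    and F: "is_free_resolution R N B d \<epsilon>" and G: "is_free_resolution R N B' d' \<epsilon>'"
    and S: "belongs_to R (hom_cohomology R (\<lambda>n. free_mod R (B' n)) d' M i) S"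
  shows "belongs_to R (hom_cohomology R (\<lambda>n. free_mod R (B n)) d M i) S"
proof -
  let ?F = "\<lambda>n. free_mod R (B n)" and ?G = "\<lambda>n. free_mod R (B' n)"
  interpret M: module R M by fact
  note mF = free_module and f = resolutionD[OF F] and g = resolutionD[OF G]
  obtain \<phi> \<psi> h where \<phi>: "\<And>n. \<phi> n \<in> mod_hom R (?F n) (?G n)"
    "\<And>n u. u \<in> carrier (?F (Suc n)) \<Longrightarrow> d' n (\<phi> (Suc n) u) = \<phi> n (d n u)"
    and \<psi>: "\<And>n. \<psi> n \<in> mod_hom R (?G n) (?F n)"
    "\<And>n u. u \<in> carrier (?G (Suc n)) \<Longrightarrow> d n (\<psi> (Suc n) u) = \<psi> n (d' n u)"
    and h: "\<And>n. h n \<in> mod_hom R (?F n) (?F (Suc n))"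
    and h0: "\<And>u. u \<in> carrier (?F 0) \<Longrightarrow> \<psi> 0 (\<phi> 0 u) = u \<oplus>\<^bsub>?F 0\<^esub> d 0 (h 0 u)"
    and hS: "\<And>n u. u \<in> carrier (?F (Suc n)) \<Longrightarrow> \<psi> (Suc n) (\<phi> (Suc n) u) =
      u \<oplus>\<^bsub>?F (Suc n)\<^esub> (d (Suc n) (h (Suc n) u) \<oplus>\<^bsub>?F (Suc n)\<^esub> h n (d n u))"
    by (rule resolution_homotopy_equivalence[OF is_cring N F G]) (rule that; assumption)
  let ?HF = "\<lambda>n. hom_mod R (?F n) M" and ?HG = "\<lambda>n. hom_mod R (?G n) M"
  note hm = hom_module[OF mF M] and pre = precomp_hom[OF mF M]
  note fc = mod_homD(1)[OF f(3)] and gc = mod_homD(1)[OF g(3)] and hc = mod_homD(1)[OF h]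
    and \<phi>c = mod_homD(1)[OF \<phi>(1)] and \<psi>c = mod_homD(1)[OF \<psi>(1)]
  have hz: "x \<zero>\<^bsub>P\<^esub> = \<zero>\<^bsub>M\<^esub>" if "module R P" "x \<in> carrier (hom_mod R P M)" for P x
    using mod_hom_zero[OF that(1) M] that(2) by simp
  \<comment> \<open>Hom reverses arrows: composition with \<open>\<psi>\<close> leads to the Hom
    modules of the other resolution and composition with \<open>\<phi>\<close> back, so the round
    trip is composition with \<open>\<psi> \<phi>\<close>, the composite for which \<open>h\<close>
    is available.\<close>
  show ?thesis
    unfolding hom_cohomology_def
  proof (rule cochain_cohomology_retract[where D = ?HG and e = "\<lambda>n f. \<lambda>x\<in>carrier (?G (Suc n)). f (d' n x)"
        and f = "\<lambda>n f. \<lambda>x\<in>carrier (?G n). f (\<psi> n x)" and g = "\<lambda>n f. \<lambda>x\<in>carrier (?F n). f (\<phi> n x)",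
        OF hm pre[OF f(3)] _ hm pre[OF g(3)] _ pre[OF \<psi>(1)] _ pre[OF \<phi>(1)] _ _ _ S[unfolded hom_cohomology_def]])
    fix n x assume x: "x \<in> carrier (?HF n)"
    show "(\<lambda>y\<in>carrier (?F (Suc (Suc n))). (\<lambda>y\<in>carrier (?F (Suc n)). x (d n y)) (d (Suc n) y)) = \<zero>\<^bsub>?HF (Suc (Suc n))\<^esub>"
      by (simp add: fc f(6) hz[OF mF x] fun_eq_iff del: free_mod_simps)
    show "(\<lambda>y\<in>carrier (?G (Suc n)). (\<lambda>y\<in>carrier (?G n). x (\<psi> n y)) (d' n y)) =
      (\<lambda>y\<in>carrier (?G (Suc n)). (\<lambda>y\<in>carrier (?F (Suc n)). x (d n y)) (\<psi> (Suc n) y))"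
      using gc \<psi>c \<psi>(2) by (intro restrict_ext) simp
  next
    fix n x assume x: "x \<in> carrier (?HG n)"
    show "(\<lambda>y\<in>carrier (?G (Suc (Suc n))). (\<lambda>y\<in>carrier (?G (Suc n)). x (d' n y)) (d' (Suc n) y)) = \<zero>\<^bsub>?HG (Suc (Suc n))\<^esub>"
      by (simp add: gc g(6) hz[OF mF x] fun_eq_iff del: free_mod_simps)
    show "(\<lambda>y\<in>carrier (?F (Suc n)). (\<lambda>y\<in>carrier (?F n). x (\<phi> n y)) (d n y)) =
      (\<lambda>y\<in>carrier (?F (Suc n)). (\<lambda>y\<in>carrier (?G (Suc n)). x (d' n y)) (\<phi> (Suc n) y))"
      using fc \<phi>c \<phi>(2) by (intro restrict_ext) simp
  next
    fix x assume x: "x \<in> carrier (?HF 0)" and dx: "(\<lambda>y\<in>carrier (?F (Suc 0)). x (d 0 y)) = \<zero>\<^bsub>?HF (Suc 0)\<^esub>"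
    then have xh: "x \<in> mod_hom R (?F 0) M" and xe: "x \<in> extensional (carrier (?F 0))" by simp_all
    have dx': "x (d 0 y) = \<zero>\<^bsub>M\<^esub>" if "y \<in> carrier (?F (Suc 0))" for y using fun_cong[OF dx, of y] that by simp
    have "x (\<psi> 0 (\<phi> 0 y)) = x y" if y: "y \<in> carrier (?F 0)" for y
      unfolding h0[OF y] mod_homD(2)[OF xh y fc[OF hc[OF y]]] dx'[OF hc[OF y]]
      by (rule M.r_zero[OF mod_homD(1)[OF xh y]])
    then show "(\<lambda>y\<in>carrier (?F 0). (\<lambda>y\<in>carrier (?G 0). x (\<psi> 0 y)) (\<phi> 0 y)) = x"
      using xe \<phi>c by (auto simp: fun_eq_iff extensional_def)
  next
    fix n x assume x: "x \<in> carrier (?HF (Suc n))"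
      and dx: "(\<lambda>y\<in>carrier (?F (Suc (Suc n))). x (d (Suc n) y)) = \<zero>\<^bsub>?HF (Suc (Suc n))\<^esub>"
    then have xh: "x \<in> mod_hom R (?F (Suc n)) M" and xe: "x \<in> extensional (carrier (?F (Suc n)))" by simp_all
    have dx': "x (d (Suc n) y) = \<zero>\<^bsub>M\<^esub>" if "y \<in> carrier (?F (Suc (Suc n)))" for y using fun_cong[OF dx, of y] that by simp
    interpret FS: module R "?F (Suc n)" by (rule mF)
    have eq: "x (\<psi> (Suc n) (\<phi> (Suc n) y)) = x y \<oplus>\<^bsub>M\<^esub> x (h n (d n y))" if y: "y \<in> carrier (?F (Suc n))" for y
    proof -
      note c1 = fc[OF hc[OF y]] and c2 = hc[OF fc[OF y]]
      show ?thesis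
        unfolding hS[OF y] mod_homD(2)[OF xh y FS.a_closed[OF c1 c2]] mod_homD(2)[OF xh c1 c2] dx'[OF hc[OF y]]
        using M.l_zero[OF mod_homD(1)[OF xh c2]] by simp
    qed
    \<comment> \<open>The cochain whose coboundary is added is \<open>x\<close> composed with
      \<open>h n\<close>; the other summand of the homotopy disappears because \<open>x\<close> is a
      cocycle.\<close>
    show "\<exists>z\<in>carrier (?HF n). (\<lambda>y\<in>carrier (?F (Suc n)). (\<lambda>y\<in>carrier (?G (Suc n)). x (\<psi> (Suc n) y)) (\<phi> (Suc n) y)) =
      x \<oplus>\<^bsub>?HF (Suc n)\<^esub> (\<lambda>y\<in>carrier (?F (Suc n)). z (d n y))"
    proof (rule bexI[OF _ mod_homD(1)[OF pre[OF h] x]])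
      show "(\<lambda>y\<in>carrier (?F (Suc n)). (\<lambda>y\<in>carrier (?G (Suc n)). x (\<psi> (Suc n) y)) (\<phi> (Suc n) y)) =
        x \<oplus>\<^bsub>?HF (Suc n)\<^esub> (\<lambda>y\<in>carrier (?F (Suc n)). (\<lambda>y\<in>carrier (?F n). x (h n y)) (d n y))"
        using eq \<phi>c fc by (simp add: fun_eq_iff)
    qed
  qed
qed

end

lemma quot_ideal_kill:
  assumes R: "cring R" and I: "ideal I R" and x: "x \<in> I"
    and z: "z \<in> carrier (quot_mod (self_mod R) I)"
  shows "x \<odot>\<^bsub>quot_mod (self_mod R) I\<^esub> z = \<zero>\<^bsub>quot_mod (self_mod R) I\<^esub>"
proof -
  interpret ideal I R by fact
  interpret cring R by fact
  note S = self_module[OF R] and sI = submodule_self_ideal[OF R I]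
  interpret S: module R "self_mod R" by (rule S)
  obtain r where r: "r \<in> carrier R" "z = I +>\<^bsub>self_mod R\<^esub> r" using z quot_carrier[OF S sI] by auto
  have xc: "x \<in> carrier R" using x a_subset by blast
  have "x \<odot>\<^bsub>quot_mod (self_mod R) I\<^esub> z = I +>\<^bsub>self_mod R\<^esub> (x \<otimes>\<^bsub>R\<^esub> r)"
    using mod_homD(3)[OF coset_hom[OF S sI] xc, of r] r by simp
  also have "\<dots> = I +>\<^bsub>self_mod R\<^esub> \<zero>\<^bsub>R\<^esub>"
    using coset_eq_iff[OF S sI, of "x \<otimes>\<^bsub>R\<^esub> r" "\<zero>\<^bsub>R\<^esub>"] S.minus_r_zero[of "x \<otimes>\<^bsub>R\<^esub> r"] r(1) xc I_r_closed[OF x r(1)] by simp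
  also have "\<dots> = I" using coset_zero[OF S sI] by simp
  finally show ?thesis by (simp add: quot_mod_simps)
qed

theorem theorem1p3:
  fixes R :: "('a, 'r) ring_scheme"
    and S :: "('a, 'u) module set"
    and xs :: "'a list"
    and M :: "('a, 'u) module"
  assumes "cring R" and "noetherian_ring R" and "\<one>\<^bsub>R\<^esub> \<noteq> \<zero>\<^bsub>R\<^esub>"
    and "infinite (UNIV :: 'u set)"
    and "serre_subcategory R S"
    and "set xs \<subseteq> carrier R"
    and "\<aa> = Idl\<^bsub>R\<^esub> (set xs)"
    and "module R M"
  shows "((\<forall>i. belongs_to R (Ext_mod R i (quot_mod (self_mod R) \<aa>) M) S)
            \<longleftrightarrow> (\<forall>i. belongs_to R (Tor_mod R i (quot_mod (self_mod R) \<aa>) M) S))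
       \<and> ((\<forall>i. belongs_to R (Tor_mod R i (quot_mod (self_mod R) \<aa>) M) S)
            \<longleftrightarrow> (\<forall>i. belongs_to R (koszul_cohomology R i xs M) S))
       \<and> ((\<forall>i. belongs_to R (koszul_cohomology R i xs M) S)
            \<longleftrightarrow> (\<forall>i. belongs_to R (koszul_homology R i xs M) S))"
proof -
  note R = assms(1,2) and M = assms(8)
  interpret serre_class R S
    by (rule serre_class.intro[OF assms(1)]) (simp add: serre_class_axioms_def assms)
  interpret koszul R xs
    by (rule koszul.intro[OF assms(1)]) (simp add: koszul_axioms_def assms)
  interpret KS: serre_free_complex R S KB KD
    by (rule serre_free_complex.intro[OF serre_class_axioms K.finite_free_complex_axioms])
  let ?N = "quot_mod (self_mod R) \<aa>"
  have I: "ideal \<aa> R" unfolding assms(7) by (rule genideal_ideal[OF assms(6)])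
  have N: "module R ?N" by (rule quot_module[OF self_module[OF R(1)] submodule_self_ideal[OF R(1) I]])
  \<comment> \<open>This is the type of bases that \<open>free_resolution\<close> prescribes for a
    module whose elements are cosets. A finite resolution in the same type can serve as a witness
    for the choice.\<close>
  have inf: "infinite (UNIV :: ('a + 'a set) list set)" by (rule infinite_UNIV_listI)
  obtain E :: "nat \<Rightarrow> ('a + 'a set) list set" and e \<eta> b0 where G: "is_free_resolution R ?N E e \<eta>"
    and E: "\<And>n. finite (E n)" "E 0 = {b0}" and e0: "\<And>c. c \<in> E 1 \<Longrightarrow> e 0 (basis_vec R c) b0 \<in> \<aa>"
    using finite_resolution_quotient[OF R inf I] by (elim exE conjE) (rule that, assumption, erule spec, assumption, erule (1) bspec)
  note g = resolutionD[OF G]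
  have gcx: "finite_free_complex R E e"
    by (intro finite_free_complex.intro finite_free_complex_axioms.intro R(1) E(1) g(3) g(6)) assumption+
  interpret GS: serre_free_complex R S E e
    by (rule serre_free_complex.intro[OF serre_class_axioms gcx])
  obtain B d where Bd: "free_resolution R ?N = (B, d)" by (cases "free_resolution R ?N")
  \<comment> \<open>The finite resolution shows that the choice is not void, so the chosen
    resolution, possibly of infinite rank, is a genuine one.\<close>
  have "\<exists>\<epsilon>. is_free_resolution R ?N B d \<epsilon>"
  proof -
    have "case (SOME (B :: nat \<Rightarrow> ('a + 'a set) list set, d). \<exists>\<epsilon>. is_free_resolution R ?N B d \<epsilon>) of (B, d) \<Rightarrow> \<exists>\<epsilon>. is_free_resolution R ?N B d \<epsilon>"
      by (rule someI[of _ "(E, e)"]) (use G in auto)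
    then show ?thesis using Bd unfolding free_resolution_def by simp
  qed
  then obtain \<epsilon> where F: "is_free_resolution R ?N B d \<epsilon>" by blast
  \<comment> \<open>Independence, used in both directions, replaces the chosen resolution by the
    finite one, for which matrices are available.\<close>
  have Tor: "belongs_to R (Tor_mod R i ?N M) S \<longleftrightarrow> mhc M (shift_basis E) (shift_matrix R e) i" for i
    using tensor_homology_independent[OF N M F G, of i] tensor_homology_independent[OF N M G F, of i]
      GS.tensor_link[OF M, of i] by (auto simp: Tor_mod_def Bd GS.mat.hc_def mhc_def)
  have Ext: "belongs_to R (Ext_mod R i ?N M) S \<longleftrightarrow> mhk M (shift_basis E) (shift_matrix R e) i" for i
    using hom_cohomology_independent[OF N M F G, of i] hom_cohomology_independent[OF N M G F, of i]
      GS.hom_link[OF M, of i] by (auto simp: Ext_mod_def Bd GS.mat.hk_def mhk_def)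
  have km: "koszul_mod R xs = (\<lambda>n. free_mod R (KB n))" by (simp add: koszul_mod_def fun_eq_iff)
  have Kh: "belongs_to R (koszul_homology R i xs M) S \<longleftrightarrow> mhc M (shift_basis KB) (shift_matrix R KD) i" for i
    using KS.tensor_link[OF M, of i] by (simp add: koszul_homology_def km KS.mat.hc_def mhc_def)
  have Kc: "belongs_to R (koszul_cohomology R i xs M) S \<longleftrightarrow> mhk M (shift_basis KB) (shift_matrix R KD) i" for i
    using KS.hom_link[OF M, of i] by (simp add: koszul_cohomology_def km KS.mat.hk_def mhk_def)
  note Kmat = K.mat_complex and Gmat = GS.mat_complex
  have Gaug: "mat_aug R (Idl\<^bsub>R\<^esub> (set xs)) (shift_basis E) (shift_matrix R e)"
    using GS.free_aug[OF E(2) I e0] by (simp add: assms(7))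
  have Gnull: "mat_null R x (shift_basis E) (shift_matrix R e)" if "x \<in> set xs" for x
  proof (rule resolution_mat_null[OF R(1) N G gcx])
    show "x \<in> carrier R" using that assms(6) by blast
    have "x \<in> \<aa>" using that genideal_self[OF assms(6)] by (auto simp: assms(7))
    then show "x \<odot>\<^bsub>?N\<^esub> z = \<zero>\<^bsub>?N\<^esub>" if "z \<in> carrier ?N" for z by (rule quot_ideal_kill[OF R(1) I _ that])
  qed
  \<comment> \<open>From this index on all shifted Koszul bases are empty, so reversing the degrees
    loses no homology.\<close>
  let ?n = "length xs + 2"
  let ?RB = "\<lambda>n. shift_basis KB (?n - n)" and ?RA = "rev_matrix ?n (shift_matrix R KD)"
  have Rmat: "mat_complex R ?RB ?RA"
    by (rule mat_complex.rev_complex[OF Kmat]) (rule koszul_bound, simp)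
  have Rnull: "mat_null R x ?RB ?RA" if "x \<in> set xs" for x
    by (rule mat_complex.rev_null[OF Kmat koszul_null[OF that]])
  note KG = matrix_comparison[OF Kmat koszul_aug Gmat assms(6) Gnull M]
  note GK = matrix_comparison[OF Gmat Gaug Kmat assms(6) koszul_null M]
  note KR = matrix_comparison[OF Kmat koszul_aug Rmat assms(6) Rnull M]
  note rev = rev_homology[OF M koszul_bound, of ?n]
  \<comment> \<open>\<open>KR\<close> passes from the Koszul complex to its reversed dual, and
    \<open>rev\<close> reads the homology of the latter as Koszul cohomology, or its cohomology as
    Koszul homology. This gives one implication each.\<close>
  have "(\<forall>i. mhc M (shift_basis KB) (shift_matrix R KD) i) \<longleftrightarrow> (\<forall>i. mhk M (shift_basis KB) (shift_matrix R KD) i)"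
    using rev(1)[OF _ KR(1)] rev(2)[OF _ KR(2)] by blast
  moreover have "(\<forall>i. mhc M (shift_basis KB) (shift_matrix R KD) i) \<longleftrightarrow> (\<forall>i. mhc M (shift_basis E) (shift_matrix R e) i)"
    using KG(1) GK(1) by blast
  moreover have "(\<forall>i. mhk M (shift_basis KB) (shift_matrix R KD) i) \<longleftrightarrow> (\<forall>i. mhk M (shift_basis E) (shift_matrix R e) i)"
    using KG(2) GK(2) by blast
  ultimately show ?thesis unfolding Tor Ext Kh Kc by blast
qed

end
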